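(* Let $k$ be a non-archimedean local field of characteristic zero, $\eta$ a character of $k^\times$, and $\tau_1,\tau_2,\tau_3$ irreducible admissible smooth representations of $\mathrm{GL}_2(k)$. The representation $\tau=\tau_1\otimes\tau_2\otimes\tau_3$ of $M=\mathrm{GL}_2(k)^3$ is good if and only if the following three conditions hold, where for each $i\in\{1,2,3\}$ we write $\{j,l\}=\{1,2,3\}\setminus\{i\}$ with $j<l$: (G1) For each $i$, if $\tau_i=\chi_i\circ\det$ for some character $\chi_i$ of $k^\times$, then $\chi_i\otimes\chi_i\ne(\eta\circ\det)\otimes(\omega_{\tau_j}^{-1}\otimes\omega_{\tau_l}^{-1})$. (G2) For each $i$, if $\tau_i=\mathrm{St}(\chi_i)$ for some character $\chi_i$ of $k^\times$, then $\chi_i\otimes\chi_i\ne(\eta\circ\det)\otimes(\omega_{\tau_j}^{-1}\otimes\omega_{\tau_l}^{-1})\otimes\delta_{B_2}^{-1}$. (G3) For each $i$, if $\tau_i=\mathrm{Ind}_{B_2}^{\mathrm{GL}_2(k)}(\chi_{ij}\otimes\chi_{il})$ for some characters $\chi_{ij},\chi_{il}$ of $k^\times$, then $$\chi_{ij}\otimes\chi_{il}\ne(\eta\circ\det)\otimes(\omega_{\tau_j}^{-1}\otimes\omega_{\tau_l}^{-1})\otimes\delta_{B_2}^{-1/2}$$ and $$\chi_{ij}\otimes\chi_{il}\ne(\eta\circ\det)\otimes(\omega_{\tau_l}^{-1}\otimes\omega_{\tau_j}^{-1})\otimes\delta_{B_2}^{1/2}.$$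
   Context: $B_2\subset\mathrm{GL}_2(k)$ is the upper triangular Borel subgroup, $T_2$ the diagonal torus, $N_2$ the upper triangular unipotent subgroup. For characters $\chi_1,\chi_2$ of $k^\times$, $\chi_1\otimes\chi_2$ denotes the character $\mathrm{diag}(x_1,x_2)\mapsto\chi_1(x_1)\chi_2(x_2)$ of $T_2$; $\eta\circ\det$ is restricted to $T_2$. $|\cdot|$ is the normalized absolute value of $k$ and $\delta_{B_2}=|\cdot|\otimes|\cdot|^{-1}$. $\mathrm{Ind}$ is normalized smooth induction. $\mathrm{St}(\chi)$ is the unique irreducible quotient of $\mathrm{Ind}_{B_2}^{\mathrm{GL}_2(k)}(\chi|\cdot|^{-1/2}\otimes\chi|\cdot|^{1/2})$. All (in)equalities in (G1)-(G3) are between characters of $T_2$. $\omega_{\tau_i}$ is the central character of $\tau_i$. For a smooth representation $V$ of $\mathrm{GL}_2(k)$, $J(V)=V/\mathrm{Span}\{n\cdot v-v:n\in N_2,v\in V\}$ is its (unnormalized) Jacquet module, a $T_2$-representation, and $(\cdot)_{\mathrm{ss}}$ denotes semisimplification. The representation $\tau$ is called good if for each $i\in\{1,2,3\}$, with $\{j,l\}=\{1,2,3\}\setminus\{i\}$ and $j<l$, $$\mathrm{Hom}_{T_2}\left(J(\tau_i)_{\mathrm{ss}},(\eta\circ\det)\otimes(\omega_{\tau_j}^{-1}\otimes\omega_{\tau_l}^{-1})\right)=0.$$ *)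

theory Defs
  imports "HOL-Analysis.Analysis" "HOL-Algebra.Module" "HOL-Algebra.AbelCoset"
begin

section \<open>The base field\<close>

text \<open>A non-archimedean local field of characteristic zero, with its normalized absolute value:
  a uniformizer has absolute value \<open>1 / q\<close>, where \<open>q\<close> is the cardinality of the residue field.
  The metric is the one of the absolute value; compactness of the ring of integers expresses local
  compactness.\<close>

class nonarch_local_field = field_char_0 + metric_space +
  fixes nabs :: "'a \<Rightarrow> real"
  assumes dist_nabs: "dist x y = nabs (x - y)"
    and nabs_mult: "nabs (x * y) = nabs x * nabs y"
    and nabs_ultrametric: "nabs (x + y) \<le> max (nabs x) (nabs y)"
    and nabs_nontrivial: "\<exists>x. 0 < nabs x \<and> nabs x < 1"
    and compact_integers: "compact {x. nabs x \<le> 1}"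
    and nabs_normalized:
      "nabs p < 1 \<Longrightarrow> (\<And>x. nabs x < 1 \<Longrightarrow> nabs x \<le> nabs p) \<Longrightarrow>
        nabs p * real (card ({x. nabs x \<le> 1} // {(x, y). nabs x \<le> 1 \<and> nabs y \<le> 1 \<and> nabs (x - y) < 1})) = 1"

text \<open>Continuous homomorphisms from the multiplicative group of \<open>k\<close> to that of the complex numbers
  (not necessarily unitary). The value at \<open>0\<close> is irrelevant and left unconstrained.\<close>

definition is_character :: "('k::nonarch_local_field \<Rightarrow> complex) \<Rightarrow> bool" where
  "is_character \<xi> \<longleftrightarrow> continuous_on (- {0}) \<xi> \<and> (\<forall>x. x \<noteq> 0 \<longrightarrow> \<xi> x \<noteq> 0) \<and>
     (\<forall>x y. x \<noteq> 0 \<longrightarrow> y \<noteq> 0 \<longrightarrow> \<xi> (x * y) = \<xi> x * \<xi> y)"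


section \<open>\<open>GL\<^sub>2\<close> and its subgroups\<close>

type_synonym 'k mat2 = "'k ^ 2 ^ 2"

definition GL2 :: "'k::nonarch_local_field mat2 monoid" where
  "GL2 = \<lparr>carrier = {A. invertible A}, mult = (**), one = mat 1\<rparr>"

definition B2 :: "'k::nonarch_local_field mat2 set" where
  "B2 = {A. invertible A \<and> A $ 2 $ 1 = 0}"

definition T2 :: "'k::nonarch_local_field mat2 monoid" where
  "T2 = GL2\<lparr>carrier := {A. invertible A \<and> A $ 1 $ 2 = 0 \<and> A $ 2 $ 1 = 0}\<rparr>"

definition N2 :: "'k::nonarch_local_field mat2 set" where
  "N2 = {A. A $ 1 $ 1 = 1 \<and> A $ 2 $ 2 = 1 \<and> A $ 2 $ 1 = 0}"

definition torus_part :: "'k::nonarch_local_field mat2 \<Rightarrow> 'k mat2" where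
  "torus_part b = (\<chi> i j. if i = j then b $ i $ j else 0)"

text \<open>Characters of \<open>T\<^sub>2\<close> are functions on matrices of which only the values on \<open>T\<^sub>2\<close> matter;
  accordingly they are compared by \<open>T2_eq\<close>.\<close>

definition tensor_char :: "('k::nonarch_local_field \<Rightarrow> complex) \<Rightarrow> ('k \<Rightarrow> complex) \<Rightarrow> 'k mat2 \<Rightarrow> complex" where
  "tensor_char \<xi>\<^sub>1 \<xi>\<^sub>2 = (\<lambda>t. \<xi>\<^sub>1 (t $ 1 $ 1) * \<xi>\<^sub>2 (t $ 2 $ 2))"

definition T2_eq :: "('k::nonarch_local_field mat2 \<Rightarrow> complex) \<Rightarrow> ('k mat2 \<Rightarrow> complex) \<Rightarrow> bool" where
  "T2_eq \<mu> \<nu> \<longleftrightarrow> (\<forall>t\<in>carrier T2. \<mu> t = \<nu> t)"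

definition nabs_pow :: "real \<Rightarrow> 'k::nonarch_local_field \<Rightarrow> complex" where
  "nabs_pow s = (\<lambda>x. of_real (nabs x powr s))"

definition delta_B2_pow :: "real \<Rightarrow> 'k::nonarch_local_field mat2 \<Rightarrow> complex" where
  "delta_B2_pow s = tensor_char (nabs_pow s) (nabs_pow (- s))"


section \<open>Representations\<close>

definition complex_ring :: "complex ring" where
  "complex_ring = \<lparr>carrier = UNIV, mult = (*), one = 1, zero = 0, add = (+)\<rparr>"

text \<open>The fields \<open>mult\<close> and \<open>one\<close>, inherited from the library's module record, play no role.\<close>

record ('g, 'v) rep = "(complex, 'v) module" +
  act :: "'g \<Rightarrow> 'v \<Rightarrow> 'v"

definition linear_maps ::
  "(complex, 'v, 'm) module_scheme \<Rightarrow> (complex, 'w, 'n) module_scheme \<Rightarrow> ('v \<Rightarrow> 'w) set" where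
  "linear_maps V W = {f. f \<in> carrier V \<rightarrow> carrier W \<and>
     (\<forall>u\<in>carrier V. \<forall>v\<in>carrier V. f (u \<oplus>\<^bsub>V\<^esub> v) = f u \<oplus>\<^bsub>W\<^esub> f v) \<and>
     (\<forall>c. \<forall>v\<in>carrier V. f (c \<odot>\<^bsub>V\<^esub> v) = c \<odot>\<^bsub>W\<^esub> f v)}"

definition representation :: "'g monoid \<Rightarrow> ('g, 'v) rep \<Rightarrow> bool" where
  "representation G V \<longleftrightarrow> group G \<and> Module.module complex_ring V \<and>
     (\<forall>g\<in>carrier G. act V g \<in> linear_maps V V) \<and>
     (\<forall>v\<in>carrier V. act V \<one>\<^bsub>G\<^esub> v = v) \<and>
     (\<forall>g\<in>carrier G. \<forall>h\<in>carrier G. \<forall>v\<in>carrier V. act V (g \<otimes>\<^bsub>G\<^esub> h) v = act V g (act V h v))"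

definition subrep :: "'g monoid \<Rightarrow> ('g, 'v) rep \<Rightarrow> 'v set \<Rightarrow> bool" where
  "subrep G V W \<longleftrightarrow> submodule W complex_ring V \<and> (\<forall>g\<in>carrier G. \<forall>w\<in>W. act V g w \<in> W)"

definition irreducible_rep :: "'g monoid \<Rightarrow> ('g, 'v) rep \<Rightarrow> bool" where
  "irreducible_rep G V \<longleftrightarrow> representation G V \<and> carrier V \<noteq> {\<zero>\<^bsub>V\<^esub>} \<and>
     (\<forall>W. subrep G V W \<longrightarrow> W = {\<zero>\<^bsub>V\<^esub>} \<or> W = carrier V)"

definition smooth_rep :: "'g::topological_space monoid \<Rightarrow> ('g, 'v) rep \<Rightarrow> bool" where
  "smooth_rep G V \<longleftrightarrow> representation G V \<and>
     (\<forall>v\<in>carrier V. openin (top_of_set (carrier G)) {g \<in> carrier G. act V g v = v})"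

definition fixed_vectors :: "('g, 'v) rep \<Rightarrow> 'g set \<Rightarrow> 'v set" where
  "fixed_vectors V K = {v \<in> carrier V. \<forall>g\<in>K. act V g v = v}"

definition finite_dimensional :: "(complex, 'v, 'm) module_scheme \<Rightarrow> 'v set \<Rightarrow> bool" where
  "finite_dimensional V W \<longleftrightarrow>
     (\<exists>B. finite B \<and> B \<subseteq> W \<and> (\<forall>w\<in>W. \<exists>c. w = (\<Oplus>\<^bsub>V\<^esub>b\<in>B. c b \<odot>\<^bsub>V\<^esub> b)))"

definition admissible_rep :: "'g::topological_space monoid \<Rightarrow> ('g, 'v) rep \<Rightarrow> bool" where
  "admissible_rep G V \<longleftrightarrow> smooth_rep G V \<and>
     (\<forall>K. subgroup K G \<and> openin (top_of_set (carrier G)) K \<and> compact K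
        \<longrightarrow> finite_dimensional V (fixed_vectors V K))"

text \<open>Intertwining maps, made extensional so that the Hom space vanishes iff it is the
  singleton of the zero map.\<close>

definition rep_hom :: "'g monoid \<Rightarrow> ('g, 'v) rep \<Rightarrow> ('g, 'w) rep \<Rightarrow> ('v \<Rightarrow> 'w) set" where
  "rep_hom G V W = {f \<in> linear_maps V W \<inter> extensional (carrier V).
     \<forall>g\<in>carrier G. \<forall>v\<in>carrier V. f (act V g v) = act W g (f v)}"

definition rep_hom_zero :: "'g monoid \<Rightarrow> ('g, 'v) rep \<Rightarrow> ('g, 'w) rep \<Rightarrow> bool" where
  "rep_hom_zero G V W \<longleftrightarrow> rep_hom G V W = {\<lambda>v\<in>carrier V. \<zero>\<^bsub>W\<^esub>}"

definition rep_iso :: "'g monoid \<Rightarrow> ('g, 'v) rep \<Rightarrow> ('g, 'w) rep \<Rightarrow> bool" where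
  "rep_iso G V W \<longleftrightarrow> (\<exists>f\<in>rep_hom G V W. bij_betw f (carrier V) (carrier W))"

definition char_rep :: "('g \<Rightarrow> complex) \<Rightarrow> ('g, complex) rep" where
  "char_rep \<mu> = \<lparr>carrier = UNIV, mult = (*), one = 1, zero = 0, add = (+), smult = (*),
     act = (\<lambda>g z. \<mu> g * z)\<rparr>"

text \<open>The quotient of \<open>V\<close> by \<open>W\<close>, on the set of cosets of \<open>W\<close>; the operations on cosets follow the
  pattern of the library's \<open>FactRing\<close>.\<close>

definition quot_rep :: "('g, 'v) rep \<Rightarrow> 'v set \<Rightarrow> ('g, 'v set) rep" where
  "quot_rep V W = \<lparr>carrier = a_rcosets\<^bsub>V\<^esub> W, mult = undefined, one = undefined,
     zero = W, add = set_add V,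
     smult = (\<lambda>c X. \<Union>x\<in>X. W +>\<^bsub>V\<^esub> (c \<odot>\<^bsub>V\<^esub> x)),
     act = (\<lambda>g X. \<Union>x\<in>X. W +>\<^bsub>V\<^esub> (act V g x))\<rparr>"

definition direct_sum_rep :: "nat \<Rightarrow> (nat \<Rightarrow> ('g, 'v) rep) \<Rightarrow> ('g, nat \<Rightarrow> 'v) rep" where
  "direct_sum_rep n U = \<lparr>carrier = (\<Pi>\<^sub>E i\<in>{..<n}. carrier (U i)), mult = undefined, one = undefined,
     zero = (\<lambda>i\<in>{..<n}. \<zero>\<^bsub>U i\<^esub>),
     add = (\<lambda>x y. \<lambda>i\<in>{..<n}. x i \<oplus>\<^bsub>U i\<^esub> y i),
     smult = (\<lambda>c x. \<lambda>i\<in>{..<n}. c \<odot>\<^bsub>U i\<^esub> x i),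
     act = (\<lambda>g x. \<lambda>i\<in>{..<n}. act (U i) g (x i))\<rparr>"


subsection \<open>Semisimplification\<close>

definition subquot_rep :: "('g, 'v) rep \<Rightarrow> 'v set \<Rightarrow> 'v set \<Rightarrow> ('g, 'v set) rep" where
  "subquot_rep V U W = quot_rep (V\<lparr>carrier := U\<rparr>) W"

definition composition_series :: "'g monoid \<Rightarrow> ('g, 'v) rep \<Rightarrow> nat \<Rightarrow> (nat \<Rightarrow> 'v set) \<Rightarrow> bool" where
  "composition_series G V n F \<longleftrightarrow> F 0 = {\<zero>\<^bsub>V\<^esub>} \<and> F n = carrier V \<and>
     (\<forall>i\<le>n. subrep G V (F i)) \<and>
     (\<forall>i<n. F i \<subseteq> F (Suc i) \<and> irreducible_rep G (subquot_rep V (F (Suc i)) (F i)))"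

text \<open>For \<open>V\<close> of finite length: the direct sum of the composition factors, read off from an arbitrarily
  chosen composition series. By Jordan--Hoelder the choice does not affect the isomorphism class.\<close>

definition semisimplification :: "'g monoid \<Rightarrow> ('g, 'v) rep \<Rightarrow> ('g, nat \<Rightarrow> 'v set) rep" where
  "semisimplification G V =
     (let (n, F) = (SOME (n, F). composition_series G V n F)
      in direct_sum_rep n (\<lambda>i. subquot_rep V (F (Suc i)) (F i)))"


section \<open>Representations of \<open>GL\<^sub>2\<close>\<close>

text \<open>For irreducible admissible \<open>V\<close> the scalar exists and is unique by Schur's lemma.\<close>

definition central_char :: "('k::nonarch_local_field mat2, 'v) rep \<Rightarrow> 'k \<Rightarrow> complex" where
  "central_char V z = (THE c. \<forall>v\<in>carrier V. act V (mat z) v = c \<odot>\<^bsub>V\<^esub> v)"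

text \<open>Normalized smooth induction of a character of \<open>T\<^sub>2\<close>, with the action by right translation.
  Functions on \<open>GL\<^sub>2\<close> are extended by zero to all matrices.\<close>

definition induced_space :: "('k::nonarch_local_field mat2 \<Rightarrow> complex) \<Rightarrow> ('k mat2 \<Rightarrow> complex) set" where
  "induced_space \<mu> = {f.
     (\<forall>g. \<not> invertible g \<longrightarrow> f g = 0) \<and>
     (\<forall>b\<in>B2. \<forall>g\<in>carrier GL2.
        f (b ** g) = delta_B2_pow (1/2) (torus_part b) * \<mu> (torus_part b) * f g) \<and>
     (\<exists>K. subgroup K GL2 \<and> openin (top_of_set (carrier GL2)) K \<and>
        (\<forall>g\<in>carrier GL2. \<forall>h\<in>K. f (g ** h) = f g))}"

definition Ind_B2 ::
  "('k::nonarch_local_field mat2 \<Rightarrow> complex) \<Rightarrow> ('k mat2, 'k mat2 \<Rightarrow> complex) rep" where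
  "Ind_B2 \<mu> = \<lparr>carrier = induced_space \<mu>, mult = undefined, one = undefined,
     zero = (\<lambda>x. 0), add = (\<lambda>f f' x. f x + f' x), smult = (\<lambda>c f x. c * f x),
     act = (\<lambda>g f x. f (x ** g))\<rparr>"

definition Steinberg ::
  "('k::nonarch_local_field \<Rightarrow> complex) \<Rightarrow> ('k mat2, ('k mat2 \<Rightarrow> complex) set) rep" where
  "Steinberg \<xi> =
     (let I = Ind_B2 (tensor_char (\<lambda>x. \<xi> x * nabs_pow (-1/2) x) (\<lambda>x. \<xi> x * nabs_pow (1/2) x))
      in quot_rep I (THE W. subrep GL2 I W \<and> irreducible_rep GL2 (quot_rep I W)))"

text \<open>The span in the definition of the Jacquet module is the submodule generated by the given
  vectors. The quotient is regarded as a representation of \<open>T\<^sub>2\<close>.\<close>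

definition jacquet_module ::
  "('k::nonarch_local_field mat2, 'v) rep \<Rightarrow> ('k mat2, 'v set) rep" where
  "jacquet_module V = quot_rep V
     ((\<lambda>W. submodule W complex_ring V) hull {act V n v \<ominus>\<^bsub>V\<^esub> v | n v. n \<in> N2 \<and> v \<in> carrier V})"

text \<open>The character \<open>(\<eta> \<circ> det) \<otimes> (\<alpha>\<^sup>-\<^sup>1 \<otimes> \<beta>\<^sup>-\<^sup>1)\<close> of \<open>T\<^sub>2\<close>.\<close>

definition dual_twist ::
  "('k::nonarch_local_field \<Rightarrow> complex) \<Rightarrow> ('k \<Rightarrow> complex) \<Rightarrow> ('k \<Rightarrow> complex) \<Rightarrow> 'k mat2 \<Rightarrow> complex" where
  "dual_twist \<eta> \<alpha> \<beta> =
     (\<lambda>t. \<eta> (det t) * tensor_char (\<lambda>x. inverse (\<alpha> x)) (\<lambda>x. inverse (\<beta> x)) t)"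

text \<open>The external tensor product \<open>\<tau>\<^sub>1 \<otimes> \<tau>\<^sub>2 \<otimes> \<tau>\<^sub>3\<close> enters only through its factors, so the definition is
  given for the family \<open>\<tau>\<close> (indexed by \<open>1, 2, 3\<close>).\<close>

definition good ::
  "('k::nonarch_local_field \<Rightarrow> complex) \<Rightarrow> (nat \<Rightarrow> ('k mat2, 'v) rep) \<Rightarrow> bool" where
  "good \<eta> \<tau> \<longleftrightarrow> (\<forall>i\<in>{1,2,3}. \<forall>j l. {j, l} = {1,2,3} - {i} \<and> j < l \<longrightarrow>
     rep_hom_zero T2 (semisimplification T2 (jacquet_module (\<tau> i)))
       (char_rep (dual_twist \<eta> (central_char (\<tau> j)) (central_char (\<tau> l)))))"

end

theory Submission
  imports Defs "HOL-Computational_Algebra.Fundamental_Theorem_Algebra"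
begin

text \<open>Fix \<open>i\<close> and write \<open>V\<close> for \<open>\<tau> i\<close>, \<open>N\<^sub>2\<close> and \<open>B\<^sub>2\<close> for the unipotent and Borel subgroups, and \<open>D\<close> for the character
  \<open>(\<eta> \<circ> det) \<otimes> (\<omega>\<^sub>j\<^sup>-\<^sup>1 \<otimes> \<omega>\<^sub>l\<^sup>-\<^sup>1)\<close> of the torus. Everything is translated into a statement about
  eigenfunctionals: nonzero linear forms on \<open>V\<close> that are \<open>N\<^sub>2\<close>-invariant and transform under the torus by \<open>D\<close>.
  The two halves of the proof are

  \<^item> \<open>D\<close> occurs in the semisimplified Jacquet module of \<open>V\<close> iff \<open>V\<close> has such an eigenfunctional
    (\<open>jacquet_hom_iff\<close>);
  \<^item> \<open>V\<close> has such an eigenfunctional iff one of (G1), (G2), (G3) fails (\<open>eigenfunctional_iff\<close>).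

  By Frobenius reciprocity an eigenfunctional embeds \<open>V\<close> into the space \<open>ps a c\<close> of smooth functions with
  \<open>f (b g) = a (b\<^sub>1\<^sub>1) c (b\<^sub>2\<^sub>2) f g\<close>, where \<open>D = a \<otimes> c\<close>; this is the principal series with
  \<open>\<delta>\<^sup>1\<^sup>/\<^sup>2\<close> absorbed into the characters. So the subrepresentations of \<open>ps a c\<close> are to be understood.
  Restriction of functions to the big Bruhat cell gives the filtration \<open>ps00 \<subseteq> {f. f 1 = 0} \<subseteq> ps a c\<close>: functions
  vanishing at \<open>1\<close> become locally constant functions of compact support on the line, and \<open>ps00\<close> consists of
  those whose integral is zero. The torus acts on the two upper steps, which are lines, by \<open>a \<otimes> c\<close> and by
  \<open>(x, y) \<mapsto> (\<bar>x\<bar> / \<bar>y\<bar>) c x a y\<close>. The crucial fact is that \<open>ps00\<close> is irreducible already under \<open>B\<^sub>2\<close>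
  (\<open>integral_zero_irreducible\<close>, \<open>ps00_irreducible\<close>): averaging a function over the units makes it radial, and
  comparing a radial function with its translates produces the difference of two normalized indicator
  functions of balls. Hence a subrepresentation either meets \<open>ps00\<close> trivially, and then \<open>SL\<^sub>2\<close> acts trivially
  on it, so that it is a line \<open>\<xi> \<circ> det\<close> with \<open>a = c = \<xi>\<close> (\<open>sub_is_line\<close>); or it contains \<open>ps00\<close>, and then
  it is everything or \<open>a = \<bar>\<cdot>\<bar>\<^sup>2 c\<close> (\<open>proper_sub_exponent\<close>). These three outcomes are (G1), (G3) and (G2); in the
  last case the subrepresentation is identified with \<open>St(\<xi>)\<close> by an explicit intertwining map out of
  \<open>Ind(\<xi>\<bar>\<cdot>\<bar>\<^sup>-\<^sup>1\<^sup>/\<^sup>2 \<otimes> \<xi>\<bar>\<cdot>\<bar>\<^sup>1\<^sup>/\<^sup>2)\<close>, whose kernel is the line spanned by \<open>\<xi> \<circ> det\<close>.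

  The same picture computes Jacquet modules: inside \<open>ps a c\<close> the kernel of \<open>V \<rightarrow> J(V)\<close> is the intersection with
  \<open>ps00\<close> (\<open>jacquet_kernel_frob\<close>), so \<open>J(V)\<close> has a composition series of length at most two with the two
  characters above. If \<open>J(V) \<noteq> 0\<close>, an eigenfunctional for some character exists: \<open>V\<close> is finitely
  generated under \<open>B\<^sub>2\<close> because \<open>GL\<^sub>2 = B\<^sub>2 K\<close>, so Zorn's lemma gives a simple quotient of \<open>J(V)\<close>, on which
  the torus acts by scalars by Schur's lemma in countable dimension (\<open>schur_countable\<close>,
  \<open>exists_eigenfunctional\<close>).\<close>

section \<open>Valuation theory of the base field\<close>

lemma nabs_0 [simp]: "nabs (0::'k::nonarch_local_field) = 0"
  using dist_nabs[of "0::'k" 0] by simp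

lemma nabs_ge_0 [simp]: "0 \<le> nabs (x::'k::nonarch_local_field)"
  using dist_nabs[of x 0] zero_le_dist[of x 0] by simp

lemma nabs_eq_0 [simp]: "nabs (x::'k::nonarch_local_field) = 0 \<longleftrightarrow> x = 0"
  using dist_nabs[of x 0] by (metis diff_zero dist_eq_0_iff)

lemma nabs_pos [simp]: "0 < nabs (x::'k::nonarch_local_field) \<longleftrightarrow> x \<noteq> 0"
  using nabs_ge_0[of x] nabs_eq_0[of x] by linarith

lemma nabs_1 [simp]: "nabs (1::'k::nonarch_local_field) = 1"
  using nabs_mult[of "1::'k" 1] by simp

lemma nabs_uminus [simp]: "nabs (- x) = nabs (x::'k::nonarch_local_field)"
  using dist_nabs[of x 0] dist_nabs[of 0 x] by (simp add: dist_commute)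

lemma nabs_minus_commute: "nabs (x - y) = nabs (y - (x::'k::nonarch_local_field))"
  by (metis nabs_uminus minus_diff_eq)

lemma nabs_diff_le: "nabs (x - y) \<le> max (nabs x) (nabs (y::'k::nonarch_local_field))"
  using nabs_ultrametric[of x "- y"] by simp

lemma nabs_inverse: "nabs (inverse x) = inverse (nabs (x::'k::nonarch_local_field))"
proof (cases "x = 0")
  case False
  then have "nabs x * nabs (inverse x) = 1"
    by (metis nabs_mult nabs_1 right_inverse)
  then show ?thesis by (metis inverse_unique)
qed simp

lemma nabs_divide: "nabs (x / y) = nabs x / nabs (y::'k::nonarch_local_field)"
  by (simp add: divide_inverse nabs_mult nabs_inverse)

lemma nabs_power: "nabs (x ^ n) = nabs (x::'k::nonarch_local_field) ^ n"
  by (induction n) (auto simp: nabs_mult)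

lemma nabs_add_le: "nabs (x::'k::nonarch_local_field) \<le> r \<Longrightarrow> nabs y \<le> r \<Longrightarrow> nabs (x + y) \<le> r"
  using nabs_ultrametric[of x y] by linarith

lemma nabs_sub_le: "nabs (x::'k::nonarch_local_field) \<le> r \<Longrightarrow> nabs y \<le> r \<Longrightarrow> nabs (x - y) \<le> r"
  using nabs_diff_le[of x y] by linarith

lemma nabs_add_dominant:
  assumes "nabs y < nabs (x::'k::nonarch_local_field)" shows "nabs (x + y) = nabs x"
proof -
  have "nabs (x + y) \<le> nabs x" using assms nabs_ultrametric[of x y] by simp
  moreover have "nabs x \<le> max (nabs (x + y)) (nabs y)"
    using nabs_diff_le[of "x + y" y] by simp
  ultimately show ?thesis using assms by linarith
qed

lemma continuous_on_nabs: "continuous_on A (nabs :: 'k::nonarch_local_field \<Rightarrow> real)"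
proof -
  have "continuous_on A (\<lambda>x::'k. dist x 0)" by (intro continuous_intros)
  then show ?thesis by (simp add: dist_nabs)
qed

lemma closed_nabs_le: "closed {x::'k::nonarch_local_field. nabs x \<le> r}"
  by (rule closed_Collect_le) (auto intro: continuous_on_nabs)

lemma nabs_unbounded: "\<exists>a::'k::nonarch_local_field. a \<noteq> 0 \<and> r \<le> nabs a"
proof -
  obtain x :: 'k where x: "0 < nabs x" "nabs x < 1" using nabs_nontrivial by blast
  have "1 < inverse (nabs x)" using x by (simp add: one_less_inverse)
  then obtain n where "r < inverse (nabs x) ^ n" using real_arch_pow by blast
  then have "r < nabs (inverse x ^ n)" by (simp add: nabs_power nabs_inverse)
  moreover have "inverse x ^ n \<noteq> 0" using x by auto
  ultimately show ?thesis by (intro exI[of _ "inverse x ^ n"]) auto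
qed

lemma continuous_on_mult_const: "continuous_on A (\<lambda>x. a * (x::'k::nonarch_local_field))"
proof (cases "a = 0")
  case False
  show ?thesis unfolding continuous_on_iff
  proof (intro ballI allI impI)
    fix x e assume "0 < (e::real)"
    then show "\<exists>d>0. \<forall>x'\<in>A. dist x' x < d \<longrightarrow> dist (a * x') (a * x) < e"
      using False
      by (intro exI[of _ "e / nabs a"])
        (simp_all add: dist_nabs nabs_mult right_diff_distrib[symmetric] pos_less_divide_eq mult.commute[of "nabs a"])
  qed
qed simp

lemma compact_nabs_le: "compact {x::'k::nonarch_local_field. nabs x \<le> r}"
proof -
  obtain a :: 'k where a: "a \<noteq> 0" "r \<le> nabs a" using nabs_unbounded by blast
  have "compact ((\<lambda>x. a * x) ` {x. nabs x \<le> 1})"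
    by (intro compact_continuous_image continuous_on_mult_const compact_integers)
  moreover have "{x. nabs x \<le> r} \<subseteq> (\<lambda>x. a * x) ` {x. nabs x \<le> 1}"
  proof
    fix x :: 'k assume "x \<in> {x. nabs x \<le> r}"
    then have "x = a * (x / a)" "nabs (x / a) \<le> 1" using a by (auto simp: nabs_divide)
    then show "x \<in> (\<lambda>x. a * x) ` {x. nabs x \<le> 1}" by blast
  qed
  ultimately show ?thesis
    using compact_Int_closed[OF _ closed_nabs_le[of r], of "(\<lambda>x. a * x) ` {x. nabs x \<le> 1}"]
    by (simp add: Int_absorb1)
qed

text \<open>The form in which compactness is used throughout: orbits of vectors and of functions under compact sets of
  group elements are finite.\<close>

lemma finite_image_locally_constant:
  fixes f :: "'a::metric_space \<Rightarrow> 'b"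
  assumes "compact K" and "\<And>x. x \<in> K \<Longrightarrow> \<exists>e>0. \<forall>y\<in>K. dist x y < e \<longrightarrow> f y = f x"
  shows "finite (f ` K)"
proof -
  obtain e where e: "\<And>x. x \<in> K \<Longrightarrow> e x > (0::real) \<and> (\<forall>y\<in>K. dist x y < e x \<longrightarrow> f y = f x)"
    using assms(2) by metis
  have "K \<subseteq> (\<Union>x\<in>K. ball x (e x))" using e by force
  then obtain C where C: "C \<subseteq> K" "finite C" "K \<subseteq> (\<Union>x\<in>C. ball x (e x))"
    using compactE_image[OF assms(1), of K "\<lambda>x. ball x (e x)"] by auto
  have "f ` K \<subseteq> f ` C"
  proof
    fix z assume "z \<in> f ` K"
    then obtain y where y: "y \<in> K" "z = f y" by blast
    then obtain x where "x \<in> C" "y \<in> ball x (e x)" using C by blast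
    then show "z \<in> f ` C" using e[of x] C(1) y by force
  qed
  then show ?thesis using C(2) finite_surj by blast
qed

text \<open>The open unit ball is closed, hence compact, so the absolute value attains its supremum on it.\<close>

lemma exists_uniformizer:
  "\<exists>p::'k::nonarch_local_field. p \<noteq> 0 \<and> nabs p < 1 \<and> (\<forall>x::'k. nabs x < 1 \<longrightarrow> nabs x \<le> nabs p)"
proof -
  let ?M = "{x::'k. nabs x < 1}"
  have cl: "closed ?M"
    unfolding closed_limpt islimpt_approachable
  proof (intro allI impI, rule ccontr)
    fix x assume h: "\<forall>e>0. \<exists>x'\<in>?M. x' \<noteq> x \<and> dist x' x < e" and n: "x \<notin> ?M"
    \<comment> \<open>a limit point is at distance less than 1 from the ball, hence in it\<close>
    from h[rule_format, of 1] obtain y where y: "nabs y < 1" "nabs (y - x) < 1"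
      by (auto simp: dist_nabs)
    then have "nabs (y - (y - x)) < 1" using nabs_diff_le[of y "y - x"] by linarith
    then show False using n by simp
  qed
  have eq: "?M = {x. nabs x \<le> 1} \<inter> ?M" by auto
  have c: "compact ?M"
    by (subst eq, rule compact_Int_closed[OF compact_integers cl])
  obtain y :: 'k where y: "0 < nabs y" "nabs y < 1" using nabs_nontrivial by blast
  obtain p where p: "p \<in> ?M" "\<forall>x\<in>?M. nabs x \<le> nabs p"
    using continuous_attains_sup[OF c _ continuous_on_nabs] y by blast
  have "0 < nabs p" using p(2)[rule_format, of y] y(2) order_less_le_trans[OF y(1)] by blast
  then have "p \<noteq> 0" by simp
  then show ?thesis using p by blast
qed

definition unif :: "'k::nonarch_local_field" where
  "unif = (SOME p. p \<noteq> 0 \<and> nabs p < 1 \<and> (\<forall>x::'k. nabs x < 1 \<longrightarrow> nabs x \<le> nabs p))"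

lemma unif: "unif \<noteq> (0::'k::nonarch_local_field)" "nabs (unif::'k) < 1"
    "nabs (x::'k) < 1 \<Longrightarrow> nabs x \<le> nabs (unif::'k)"
  using someI_ex[OF exists_uniformizer[where 'k='k]] unfolding unif_def[symmetric] by blast+

lemma nabs_less_iff_unif:
  assumes "a \<noteq> (0::'k::nonarch_local_field)"
  shows "nabs (x::'k) < nabs a \<longleftrightarrow> nabs x \<le> nabs (unif * a)"
proof -
  have "nabs x < nabs a \<longleftrightarrow> nabs (x / a) < 1" using assms by (simp add: nabs_divide)
  also have "\<dots> \<longleftrightarrow> nabs (x / a) \<le> nabs (unif::'k)"
    using unif(2,3) by (metis order_le_less_trans)
  also have "\<dots> \<longleftrightarrow> nabs x \<le> nabs (unif * a)" using assms by (simp add: nabs_divide nabs_mult field_simps)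
  finally show ?thesis .
qed

lemma unif_power_small: "0 < r \<Longrightarrow> \<exists>n. nabs (unif ^ n * (a::'k::nonarch_local_field)) \<le> r"
proof -
  assume r: "0 < r"
  have "0 < r / (nabs a + 1)" using r by (simp add: add_nonneg_pos)
  then obtain n where n: "nabs (unif::'k) ^ n < r / (nabs a + 1)"
    using real_arch_pow_inv[OF _ unif(2)[where 'k='k]] by blast
  have "nabs (unif::'k) ^ n * nabs a \<le> nabs (unif::'k) ^ n * (nabs a + 1)"
    by (intro mult_left_mono) auto
  also have "\<dots> \<le> r" using n by (simp add: pos_less_divide_eq add_nonneg_pos less_imp_le)
  finally show ?thesis by (auto simp: nabs_mult nabs_power)
qed

text \<open>The value group is generated by the uniformizer: take the last power of it that is not smaller than \<open>a\<close>.\<close>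

lemma nabs_value: 
  assumes "a \<noteq> (0::'k::nonarch_local_field)" "nabs a \<le> 1"
  shows "\<exists>n. nabs a = nabs (unif::'k) ^ n"
proof -
  let ?r = "nabs (unif::'k)"
  have "\<exists>n. ?r ^ n < nabs a" using real_arch_pow_inv[OF _ unif(2)[where 'k='k]] assms by simp
  then obtain n where n: "?r ^ n < nabs a" "\<And>m. m < n \<Longrightarrow> \<not> ?r ^ m < nabs a"
    using exists_least_iff[of "\<lambda>n. ?r ^ n < nabs a"] by blast
  have "n \<noteq> 0" using n(1) assms by (cases n) auto
  then obtain m where m: "n = Suc m" by (cases n) auto
  have le: "nabs a \<le> nabs (unif ^ m :: 'k)" using n(2)[of m] m by (simp add: nabs_power)
  moreover have "\<not> nabs a < nabs (unif ^ m :: 'k)"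
    using nabs_less_iff_unif[of "unif ^ m :: 'k" a] n(1) m unif(1)[where 'k='k]
    by (simp add: nabs_power nabs_mult)
  ultimately show ?thesis by (auto simp: nabs_power intro!: exI[of _ m])
qed


section \<open>The invariant integral on locally constant functions\<close>

text \<open>Balls of radius \<open>s\<close> are the cosets of an additive subgroup. Choosing one point in each of them makes
  sums over cosets into finite sums over points; equal balls get equal points because the predicate inside the
  choice depends only on the ball.\<close>

definition rep_of :: "real \<Rightarrow> 'k::nonarch_local_field \<Rightarrow> 'k" where
  "rep_of s x = (SOME y. nabs (y - x) \<le> s)"

definition reps :: "'k itself \<Rightarrow> real \<Rightarrow> real \<Rightarrow> 'k::nonarch_local_field set" where
  "reps _ R s = rep_of s ` {x. nabs x \<le> R}"

lemma rep_of_close: "0 \<le> s \<Longrightarrow> nabs (rep_of s x - x) \<le> s"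
  unfolding rep_of_def by (rule someI[of _ x]) simp

lemma rep_of_eq_iff:
  assumes "0 \<le> s" shows "rep_of s x = rep_of s y \<longleftrightarrow> nabs (x - y) \<le> s"
proof
  assume "rep_of s x = rep_of s y"
  have "nabs ((rep_of s y - y) - (rep_of s x - x)) \<le> s"
    by (intro nabs_sub_le rep_of_close assms)
  then show "nabs (x - y) \<le> s" using \<open>rep_of s x = rep_of s y\<close> by simp
next
  assume h: "nabs (x - y) \<le> s"
  have "nabs (z - x) \<le> s \<longleftrightarrow> nabs (z - y) \<le> s" for z
    using nabs_add_le[OF _ h, of "z - x"] nabs_sub_le[OF _ h, of "z - y"] by auto
  then show "rep_of s x = rep_of s y" unfolding rep_of_def by simp
qed

lemma rep_of_idem [simp]: "0 \<le> s \<Longrightarrow> rep_of s (rep_of s x) = rep_of s x"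
  by (simp add: rep_of_eq_iff rep_of_close)

lemma reps_iff:
  fixes y :: "'k::nonarch_local_field"
  assumes "0 \<le> s" "s \<le> R" shows "y \<in> reps TYPE('k) R s \<longleftrightarrow> nabs y \<le> R \<and> rep_of s y = y"
proof
  assume "y \<in> reps TYPE('k) R s"
  then obtain x where x: "nabs x \<le> R" "y = rep_of s x" by (auto simp: reps_def)
  have "nabs ((rep_of s x - x) + x) \<le> R"
    using rep_of_close[OF assms(1), of x] assms x by (intro nabs_add_le) auto
  then show "nabs y \<le> R \<and> rep_of s y = y" using x assms by simp
qed (auto simp: reps_def image_iff)

lemma finite_reps [simp]: "0 < s \<Longrightarrow> finite (reps TYPE('k::nonarch_local_field) R s)"
  unfolding reps_def
  by (rule finite_image_locally_constant[OF compact_nabs_le])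
    (auto simp: dist_nabs nabs_minus_commute rep_of_eq_iff intro!: exI[of _ s])

definition ball_inv :: "real \<Rightarrow> ('k::nonarch_local_field \<Rightarrow> complex) \<Rightarrow> bool" where
  "ball_inv s \<phi> \<longleftrightarrow> (\<forall>x y. nabs (x - y) \<le> s \<longrightarrow> \<phi> x = \<phi> y)"

definition supp_in :: "real \<Rightarrow> ('k::nonarch_local_field \<Rightarrow> complex) \<Rightarrow> bool" where
  "supp_in R \<phi> \<longleftrightarrow> (\<forall>x. R < nabs x \<longrightarrow> \<phi> x = 0)"

lemma ball_invD: "ball_inv s \<phi> \<Longrightarrow> nabs (x - y) \<le> s \<Longrightarrow> \<phi> x = \<phi> y"
  unfolding ball_inv_def by blast

lemma ball_inv_mono: "ball_inv s \<phi> \<Longrightarrow> s' \<le> s \<Longrightarrow> ball_inv s' \<phi>"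
  unfolding ball_inv_def by force

lemma supp_in_mono: "supp_in R \<phi> \<Longrightarrow> R \<le> R' \<Longrightarrow> supp_in R' \<phi>"
  unfolding supp_in_def by force

definition lsum :: "real \<Rightarrow> real \<Rightarrow> ('k::nonarch_local_field \<Rightarrow> complex) \<Rightarrow> complex" where
  "lsum R s \<phi> = (\<Sum>y\<in>reps TYPE('k) R s. \<phi> y)"

text \<open>A similarity of ratio \<open>c\<close> permutes balls, so it matches the chosen points of its source with those of its
  target after rounding. Translations and dilations are the two instances.\<close>

lemma bij_betw_reps:
  fixes T :: "'k::nonarch_local_field \<Rightarrow> 'k"
  assumes s: "0 < s" "s \<le> R" "0 < c" "c * s \<le> R'"
    and T: "\<And>x y. nabs (T x - T y) = c * nabs (x - y)" "\<And>x. nabs (T x) \<le> R' \<longleftrightarrow> nabs x \<le> R" "surj T"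
  shows "bij_betw (\<lambda>y. rep_of (c * s) (T y)) (reps TYPE('k) R s) (reps TYPE('k) R' (c * s))"
proof (rule bij_betwI')
  fix x y assume xy: "x \<in> reps TYPE('k) R s" "y \<in> reps TYPE('k) R s"
  have "rep_of (c * s) (T x) = rep_of (c * s) (T y) \<longleftrightarrow> nabs (x - y) \<le> s"
    using s by (simp add: rep_of_eq_iff T)
  also have "\<dots> \<longleftrightarrow> rep_of s x = rep_of s y" using s by (simp add: rep_of_eq_iff)
  also have "\<dots> \<longleftrightarrow> x = y" using xy s by (simp add: reps_iff)
  finally show "rep_of (c * s) (T x) = rep_of (c * s) (T y) \<longleftrightarrow> x = y" .
next
  fix x assume "x \<in> reps TYPE('k) R s"
  then show "rep_of (c * s) (T x) \<in> reps TYPE('k) R' (c * s)"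
    using s T(2) unfolding reps_def[of _ R' "c * s"] by (auto simp: reps_iff)
next
  fix z assume z: "z \<in> reps TYPE('k) R' (c * s)"
  obtain x where x: "T x = z" using T(3) by (metis surjD)
  have "nabs x \<le> R" using z x T(2)[of x] s by (simp add: reps_iff)
  then have "rep_of s x \<in> reps TYPE('k) R s" by (auto simp: reps_def)
  moreover have "rep_of (c * s) (T (rep_of s x)) = z"
  proof -
    have "rep_of (c * s) (T (rep_of s x)) = rep_of (c * s) (T x)"
      using s rep_of_close[of s x] by (simp add: rep_of_eq_iff T)
    then show ?thesis using z s by (simp add: reps_iff x)
  qed
  ultimately show "\<exists>x\<in>reps TYPE('k) R s. z = rep_of (c * s) (T x)" by blast
qed

lemma lsum_similarity:
  fixes T :: "'k::nonarch_local_field \<Rightarrow> 'k"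
  assumes s: "0 < s" "s \<le> R" "0 < c" "c * s \<le> R'"
    and T: "\<And>x y. nabs (T x - T y) = c * nabs (x - y)" "\<And>x. nabs (T x) \<le> R' \<longleftrightarrow> nabs x \<le> R" "surj T"
    and \<phi>: "ball_inv (c * s) \<phi>"
  shows "lsum R s (\<lambda>x. \<phi> (T x)) = lsum R' (c * s) \<phi>"
proof -
  have "lsum R s (\<lambda>x. \<phi> (T x)) = (\<Sum>y\<in>reps TYPE('k) R s. \<phi> (rep_of (c * s) (T y)))"
    unfolding lsum_def using s
    by (intro sum.cong refl ball_invD[OF \<phi>]) (subst nabs_minus_commute, simp add: rep_of_close)
  also have "\<dots> = lsum R' (c * s) \<phi>"
    unfolding lsum_def using sum.reindex_bij_betw[OF bij_betw_reps[OF s T]] .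
  finally show ?thesis .
qed

lemma lsum_translate:
  assumes "0 < s" "s \<le> R" "nabs h \<le> R" "ball_inv s \<phi>"
  shows "lsum R s (\<lambda>x. \<phi> (x + h)) = lsum R s \<phi>"
proof -
  have "nabs (x + h) \<le> R \<longleftrightarrow> nabs x \<le> R" for x
    using nabs_add_le[of x R h] nabs_sub_le[of "x + h" R h] assms by auto
  moreover have "surj (\<lambda>x. x + h)" by (metis surjI diff_add_cancel)
  ultimately show ?thesis
    using lsum_similarity[of s R 1 R "\<lambda>x. x + h" \<phi>] assms by simp
qed

lemma surj_mult_const: "a \<noteq> 0 \<Longrightarrow> surj (\<lambda>x. a * (x::'k::nonarch_local_field))"
  by (rule surjI[of _ "\<lambda>x. x / a"]) simp

lemma lsum_dilate:
  assumes "0 < s" "s \<le> R" "a \<noteq> 0" "ball_inv (nabs a * s) \<phi>"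
  shows "lsum R s (\<lambda>x. \<phi> (a * x)) = lsum (nabs a * R) (nabs a * s) \<phi>"
  using assms
  by (intro lsum_similarity) (auto simp: nabs_mult surj_mult_const right_diff_distrib[symmetric])

definition num_reps :: "'k::nonarch_local_field itself \<Rightarrow> real \<Rightarrow> real \<Rightarrow> nat" where
  "num_reps t R s = card (reps t R s)"

text \<open>Every ball of radius \<open>s\<close> splits into the same number of balls of radius \<open>s'\<close>, by translation.\<close>

lemma lsum_refine:
  fixes \<phi> :: "'k::nonarch_local_field \<Rightarrow> complex"
  assumes "0 < s'" "s' \<le> s" "s \<le> R" "ball_inv s \<phi>"
  shows "lsum R s' \<phi> = of_nat (num_reps TYPE('k) s s') * lsum R s \<phi>"
proof -
  have im: "rep_of s ` reps TYPE('k) R s' \<subseteq> reps TYPE('k) R s"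
    using assms unfolding reps_def[of _ R s] by (auto simp: reps_iff)
  have card: "card {y \<in> reps TYPE('k) R s'. rep_of s y = z} = num_reps TYPE('k) s s'"
    if z: "z \<in> reps TYPE('k) R s" for z
  proof -
    have z': "nabs z \<le> R" "rep_of s z = z" using z assms by (simp_all add: reps_iff)
    have "bij_betw (\<lambda>w. rep_of (1 * s') (w + z)) (reps TYPE('k) s s')
        {y \<in> reps TYPE('k) R s'. rep_of s y = z}"
    proof (rule bij_betwI')
      fix x y assume xy: "x \<in> reps TYPE('k) s s'" "y \<in> reps TYPE('k) s s'"
      have "rep_of (1 * s') (x + z) = rep_of (1 * s') (y + z) \<longleftrightarrow> rep_of s' x = rep_of s' y"
        using assms by (simp add: rep_of_eq_iff)
      then show "rep_of (1 * s') (x + z) = rep_of (1 * s') (y + z) \<longleftrightarrow> x = y"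
        using xy assms by (simp add: reps_iff)
    next
      fix x assume "x \<in> reps TYPE('k) s s'"
      then have x: "nabs x \<le> s" using assms by (simp add: reps_iff)
      have "rep_of s (rep_of s' (x + z)) = rep_of s (x + z)"
        using rep_of_close[of s' "x + z"] assms by (simp add: rep_of_eq_iff)
      also have "\<dots> = rep_of s z" using x assms by (simp add: rep_of_eq_iff)
      finally show "rep_of (1 * s') (x + z) \<in> {y \<in> reps TYPE('k) R s'. rep_of s y = z}"
        using z' x assms nabs_add_le[of x R z] by (auto simp: reps_def)
    next
      fix y assume y: "y \<in> {y \<in> reps TYPE('k) R s'. rep_of s y = z}"
      then have y': "rep_of s' y = y" "rep_of s y = rep_of s z" using assms z' by (auto simp: reps_iff)
      then have "nabs (y - z) \<le> s" using assms by (simp add: rep_of_eq_iff)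
      then have "rep_of s' (y - z) \<in> reps TYPE('k) s s'" by (auto simp: reps_def)
      moreover have "rep_of s' (rep_of s' (y - z) + z) = rep_of s' y"
        using rep_of_close[of s' "y - z"] assms by (simp add: rep_of_eq_iff algebra_simps)
      ultimately show "\<exists>x\<in>reps TYPE('k) s s'. y = rep_of (1 * s') (x + z)" using y' by force
    qed
    then show ?thesis unfolding num_reps_def using bij_betw_same_card by fastforce
  qed
  have "lsum R s' \<phi> = (\<Sum>z\<in>reps TYPE('k) R s. \<Sum>y | y \<in> reps TYPE('k) R s' \<and> rep_of s y = z. \<phi> y)"
    unfolding lsum_def using assms im by (intro sum.group[symmetric]) auto
  also have "\<dots> = (\<Sum>z\<in>reps TYPE('k) R s. of_nat (num_reps TYPE('k) s s') * \<phi> z)"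
  proof (intro sum.cong refl)
    fix z assume z: "z \<in> reps TYPE('k) R s"
    have "(\<Sum>y | y \<in> reps TYPE('k) R s' \<and> rep_of s y = z. \<phi> y) =
        (\<Sum>y | y \<in> reps TYPE('k) R s' \<and> rep_of s y = z. \<phi> z)"
      using assms rep_of_close[of s] by (intro sum.cong refl ball_invD[OF assms(4)]) (auto simp: nabs_minus_commute)
    also have "\<dots> = of_nat (num_reps TYPE('k) s s') * \<phi> z" using card[OF z] by simp
    finally show "(\<Sum>y | y \<in> reps TYPE('k) R s' \<and> rep_of s y = z. \<phi> y) = of_nat (num_reps TYPE('k) s s') * \<phi> z" .
  qed
  also have "\<dots> = of_nat (num_reps TYPE('k) s s') * lsum R s \<phi>"
    by (simp add: lsum_def sum_distrib_left)
  finally show ?thesis .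
qed

lemma lsum_enlarge:
  fixes \<phi> :: "'k::nonarch_local_field \<Rightarrow> complex"
  assumes "0 < s" "s \<le> R" "R \<le> R'" "supp_in R \<phi>"
  shows "lsum R' s \<phi> = lsum R s \<phi>"
  unfolding lsum_def
proof (rule sum.mono_neutral_right)
  show "\<forall>i\<in>reps TYPE('k) R' s - reps TYPE('k) R s. \<phi> i = 0"
    using assms by (auto simp: reps_iff supp_in_def)
qed (use assms in \<open>auto simp: reps_iff\<close>)

lemma lsum_1: "lsum R s (\<lambda>_::'k::nonarch_local_field. 1) = of_nat (num_reps TYPE('k) R s)"
  by (simp add: lsum_def num_reps_def)

lemma num_reps_mult:
  assumes "0 < s'" "s' \<le> s" "s \<le> R"
  shows "num_reps TYPE('k::nonarch_local_field) R s' = num_reps TYPE('k) s s' * num_reps TYPE('k) R s"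
proof -
  have "ball_inv s (\<lambda>_::'k. 1)" by (simp add: ball_inv_def)
  from lsum_refine[OF assms this] show ?thesis
    unfolding lsum_1 by (metis of_nat_eq_iff of_nat_mult)
qed

lemma num_reps_dilate:
  assumes "0 < s" "s \<le> R" "a \<noteq> (0::'k::nonarch_local_field)"
  shows "num_reps TYPE('k) (nabs a * R) (nabs a * s) = num_reps TYPE('k) R s"
proof -
  have "ball_inv (nabs a * s) (\<lambda>_::'k. 1)" by (simp add: ball_inv_def)
  from lsum_dilate[OF assms this] show ?thesis unfolding lsum_1 by (metis of_nat_eq_iff)
qed

lemma num_reps_self: "0 < R \<Longrightarrow> num_reps TYPE('k::nonarch_local_field) R R = 1"
proof -
  assume R: "0 < R"
  have "reps TYPE('k) R R = {rep_of R 0}"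
    using R by (auto simp: reps_def image_iff rep_of_eq_iff intro!: exI[of _ 0])
  then show ?thesis by (simp add: num_reps_def)
qed

lemma num_reps_unif: "nabs (unif::'k::nonarch_local_field) * real (num_reps TYPE('k) 1 (nabs (unif::'k))) = 1"
proof -
  let ?r = "nabs (unif::'k)" and ?E = "{(x, y::'k). nabs x \<le> 1 \<and> nabs y \<le> 1 \<and> nabs (x - y) < 1}"
  let ?A = "{x::'k. nabs x \<le> 1}"
  have less: "nabs x < 1 \<longleftrightarrow> nabs x \<le> ?r" for x :: 'k
    using unif(2,3) order_le_less_trans by blast
  have fE: "(\<lambda>x::'k. {y\<in>?A. rep_of ?r y = x}) ` reps TYPE('k) 1 ?r = ?A // ?E"
  proof (rule Set.set_eqI)
    fix X :: "'k set"
    have "X \<in> ?A // ?E \<longleftrightarrow> (\<exists>x\<in>?A. X = ?E `` {x})" by (auto simp: quotient_def)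
    also have "\<dots> \<longleftrightarrow> (\<exists>x\<in>?A. X = {y\<in>?A. rep_of ?r y = rep_of ?r x})"
      by (intro bex_cong refl arg_cong[where f="\<lambda>Y. X = Y"])
        (auto simp: rep_of_eq_iff less nabs_minus_commute)
    also have "\<dots> \<longleftrightarrow> X \<in> (\<lambda>x. {y\<in>?A. rep_of ?r y = x}) ` reps TYPE('k) 1 ?r"
      by (auto simp: reps_def image_iff)
    finally show "X \<in> (\<lambda>x. {y\<in>?A. rep_of ?r y = x}) ` reps TYPE('k) 1 ?r \<longleftrightarrow> X \<in> ?A // ?E" by simp
  qed
  have "inj_on (\<lambda>x. {y\<in>?A. rep_of ?r y = x}) (reps TYPE('k) 1 ?r)"
  proof (rule inj_onI)
    fix x y assume "x \<in> reps TYPE('k) 1 ?r" "y \<in> reps TYPE('k) 1 ?r"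
      "{z\<in>?A. rep_of ?r z = x} = {z\<in>?A. rep_of ?r z = y}"
    then show "x = y" unfolding reps_def by fastforce
  qed
  then have "card (?A // ?E) = num_reps TYPE('k) 1 ?r"
    unfolding num_reps_def fE[symmetric] by (rule card_image)
  moreover have "?r * real (card (?A // ?E)) = 1"
    using nabs_normalized[of "unif::'k"] unif(2,3) by blast
  ultimately show ?thesis by simp
qed

lemma num_reps_nabs_aux: "nabs (unif::'k::nonarch_local_field) ^ n * real (num_reps TYPE('k) 1 (nabs (unif::'k) ^ n)) = 1"
proof (induction n)
  case (Suc n)
  let ?r = "nabs (unif::'k)"
  have r: "0 < ?r" "?r < 1" using unif(1,2)[where 'k='k] by auto
  have "num_reps TYPE('k) 1 (?r ^ Suc n) = num_reps TYPE('k) (?r ^ n) (?r ^ Suc n) * num_reps TYPE('k) 1 (?r ^ n)"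
    using r by (intro num_reps_mult) (auto simp: mult_left_le_one_le power_le_one less_imp_le)
  also have "num_reps TYPE('k) (?r ^ n) (?r ^ Suc n) = num_reps TYPE('k) 1 ?r"
    using num_reps_dilate[of ?r 1 "unif ^ n :: 'k"] r by (simp add: nabs_power mult.commute)
  finally have "?r ^ Suc n * real (num_reps TYPE('k) 1 (?r ^ Suc n)) =
      (?r * num_reps TYPE('k) 1 ?r) * (?r ^ n * num_reps TYPE('k) 1 (?r ^ n))" by simp
  then show ?case using Suc num_reps_unif[where 'k='k] by simp
qed (simp add: num_reps_self)

text \<open>The normalization of the absolute value enters here: it says that the index of \<open>p O\<close> in \<open>O\<close> is
  \<open>1 / \<bar>p\<bar>\<close> for a uniformizer \<open>p\<close>, and indices are multiplicative in towers.\<close>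

lemma num_reps_nabs:
  assumes "a \<noteq> (0::'k::nonarch_local_field)" "b \<noteq> (0::'k)" "nabs b \<le> nabs a"
  shows "nabs b * real (num_reps TYPE('k) (nabs a) (nabs b)) = nabs a"
proof -
  have "nabs (b / a) \<le> 1" using assms by (simp add: nabs_divide)
  then obtain n where n: "nabs (b / a) = nabs (unif::'k) ^ n" using nabs_value[of "b / a"] assms by auto
  have "num_reps TYPE('k) (nabs a) (nabs b) = num_reps TYPE('k) 1 (nabs (b / a))"
    using num_reps_dilate[of "nabs (b / a)" 1 a] assms by (simp add: nabs_divide)
  moreover have "nabs b / nabs a * num_reps TYPE('k) 1 (nabs (b / a)) = 1"
    using num_reps_nabs_aux[of n, where 'k='k] n by (simp add: nabs_divide)
  ultimately show ?thesis using assms by (simp add: field_simps)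
qed

text \<open>The Haar integral of a locally constant function of compact support: a Riemann sum over finer and finer
  balls inside larger and larger ones. For such functions the sequence is eventually constant; the limit only
  serves to make the choice of radii irrelevant.\<close>

definition haar :: "('k::nonarch_local_field \<Rightarrow> complex) \<Rightarrow> complex" where
  "haar \<phi> = lim (\<lambda>n. of_real (nabs (unif ^ n :: 'k)) * lsum (nabs (inverse (unif ^ n) :: 'k)) (nabs (unif ^ n :: 'k)) \<phi>)"

lemma haar_eq:
  fixes \<phi> :: "'k::nonarch_local_field \<Rightarrow> complex"
  assumes "b \<noteq> (0::'k)" "nabs b \<le> R" "ball_inv (nabs b) \<phi>" "supp_in R \<phi>"
  shows "haar \<phi> = of_real (nabs b) * lsum R (nabs b) \<phi>"
proof -
  obtain N where N: "nabs (unif ^ N * 1 :: 'k) \<le> min (nabs b) (inverse R)"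
    using unif_power_small[of "min (nabs b) (inverse R)" "1::'k"] assms
    by (metis inverse_positive_iff_positive min_less_iff_conj nabs_pos order_less_le_trans)
  have ev: "of_real (nabs (unif ^ n :: 'k)) * lsum (nabs (inverse (unif ^ n) :: 'k)) (nabs (unif ^ n :: 'k)) \<phi> =
      of_real (nabs b) * lsum R (nabs b) \<phi>" if n: "N \<le> n" for n
  proof -
    let ?u = "unif ^ n :: 'k"
    have u: "?u \<noteq> 0" using unif(1) by auto
    have "nabs ?u \<le> nabs (unif ^ N :: 'k)"
      unfolding nabs_power using n unif(2)[where 'k='k] by (intro power_decreasing) auto
    then have un: "nabs ?u \<le> nabs b" "nabs ?u \<le> inverse R" using N by auto
    have "0 < R" using assms(1,2) by (metis nabs_pos order_less_le_trans)
    then have R: "R \<le> nabs (inverse ?u)" using un u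
      by (metis inverse_inverse_eq inverse_le_imp_le nabs_inverse nabs_pos order_less_le_trans
          inverse_positive_iff_positive)
    have "lsum (nabs (inverse ?u)) (nabs ?u) \<phi> = lsum R (nabs ?u) \<phi>"
      using un R assms u by (intro lsum_enlarge) auto
    also have "\<dots> = of_nat (num_reps TYPE('k) (nabs b) (nabs ?u)) * lsum R (nabs b) \<phi>"
      using un R assms u by (intro lsum_refine) auto
    finally have "of_real (nabs ?u) * lsum (nabs (inverse ?u)) (nabs ?u) \<phi> =
      of_real (nabs ?u * num_reps TYPE('k) (nabs b) (nabs ?u)) * lsum R (nabs b) \<phi>" by simp
    then show ?thesis using num_reps_nabs[OF assms(1) u un(1)] by simp
  qed
  show ?thesis unfolding haar_def
    by (rule limI, rule tendsto_eventually) (use ev in \<open>auto simp: eventually_sequentially\<close>)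
qed

text \<open>The Schwartz-Bruhat functions of the line.\<close>

definition schwartz :: "('k::nonarch_local_field \<Rightarrow> complex) \<Rightarrow> bool" where
  "schwartz \<phi> \<longleftrightarrow> (\<exists>s>0. ball_inv s \<phi>) \<and> (\<exists>R. supp_in R \<phi>)"

lemma small_element: "0 < r \<Longrightarrow> \<exists>b::'k::nonarch_local_field. b \<noteq> 0 \<and> nabs b \<le> r"
  using unif_power_small[of r "1::'k"] unif(1)[where 'k='k] by (metis mult.right_neutral power_not_zero)

lemma schwartz_witness:
  assumes "schwartz (\<phi>::'k::nonarch_local_field \<Rightarrow> complex)" "0 < r"
  shows "\<exists>b::'k. b \<noteq> 0 \<and> nabs b \<le> r \<and> ball_inv (nabs b) \<phi>"
proof -
  obtain s where s: "s > 0" "ball_inv s \<phi>" using assms by (auto simp: schwartz_def)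
  obtain b :: 'k where "b \<noteq> 0" "nabs b \<le> min r s" using small_element[of "min r s"] s assms by auto
  then show ?thesis using ball_inv_mono[OF s(2), of "nabs b"] by auto
qed

lemma schwartz_witness2:
  assumes "schwartz (\<phi>::'k::nonarch_local_field \<Rightarrow> complex)" "schwartz (\<psi>::'k \<Rightarrow> complex)"
  shows "\<exists>(b::'k) R. b \<noteq> 0 \<and> nabs b \<le> R \<and> ball_inv (nabs b) \<phi> \<and> ball_inv (nabs b) \<psi> \<and> supp_in R \<phi> \<and> supp_in R \<psi>"
proof -
  obtain R1 R2 where R: "supp_in R1 \<phi>" "supp_in R2 \<psi>" using assms by (auto simp: schwartz_def)
  obtain b :: 'k where b: "b \<noteq> 0" "nabs b \<le> 1" "ball_inv (nabs b) \<phi>" using schwartz_witness[OF assms(1), of 1] by auto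
  have "0 < nabs b" using b(1) by simp
  from schwartz_witness[OF assms(2) this]
  obtain b' :: 'k where b': "b' \<noteq> 0" "nabs b' \<le> nabs b" "ball_inv (nabs b') \<psi>" by blast
  let ?R = "max 1 (max R1 R2)"
  have "supp_in ?R \<phi>" "supp_in ?R \<psi>"
    using supp_in_mono[OF R(1), of ?R] supp_in_mono[OF R(2), of ?R] by simp_all
  moreover have "ball_inv (nabs b') \<phi>" "nabs b' \<le> ?R"
    using ball_inv_mono[OF b(3) b'(2)] b(2) b'(2) by simp_all
  ultimately show ?thesis using b'(1,3) by blast
qed

lemma lsum_add: "lsum R s (\<lambda>x. \<phi> x + \<psi> x) = lsum R s \<phi> + lsum R s \<psi>"
  by (simp add: lsum_def sum.distrib)

lemma lsum_cmult: "lsum R s (\<lambda>x. c * \<phi> x) = c * lsum R s \<phi>"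
  by (simp add: lsum_def sum_distrib_left)

lemma schwartz_add: assumes "schwartz (\<phi>::'k::nonarch_local_field \<Rightarrow> complex)" "schwartz \<psi>"
  shows "schwartz (\<lambda>x. \<phi> x + \<psi> x)"
proof -
  obtain b :: 'k and R where "b \<noteq> 0" "ball_inv (nabs b) \<phi>" "ball_inv (nabs b) \<psi>" "supp_in R \<phi>" "supp_in R \<psi>"
    using schwartz_witness2[OF assms] by blast
  then have "ball_inv (nabs b) (\<lambda>x. \<phi> x + \<psi> x)" "supp_in R (\<lambda>x. \<phi> x + \<psi> x)" "0 < nabs b"
    unfolding ball_inv_def supp_in_def by (metis, simp, simp)
  then show ?thesis unfolding schwartz_def by blast
qed

lemma schwartz_cmult: "schwartz \<phi> \<Longrightarrow> schwartz (\<lambda>x. c * \<phi> x)"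
  unfolding schwartz_def ball_inv_def supp_in_def by (metis mult_zero_right)

lemma haar_add: assumes "schwartz (\<phi>::'k::nonarch_local_field \<Rightarrow> complex)" "schwartz \<psi>"
  shows "haar (\<lambda>x. \<phi> x + \<psi> x) = haar \<phi> + haar \<psi>"
proof -
  obtain b :: 'k and R where bR: "b \<noteq> 0" "nabs b \<le> R" "ball_inv (nabs b) \<phi>" "ball_inv (nabs b) \<psi>" "supp_in R \<phi>" "supp_in R \<psi>"
    using schwartz_witness2[OF assms] by blast
  have "ball_inv (nabs b) (\<lambda>x. \<phi> x + \<psi> x)" "supp_in R (\<lambda>x. \<phi> x + \<psi> x)"
    using bR unfolding ball_inv_def supp_in_def by (metis, simp)
  then show ?thesis using bR by (simp add: haar_eq[of b R] lsum_add algebra_simps)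
qed

lemma haar_cmult: assumes "schwartz (\<phi>::'k::nonarch_local_field \<Rightarrow> complex)"
  shows "haar (\<lambda>x. c * \<phi> x) = c * haar \<phi>"
proof -
  obtain b :: 'k and R where bR: "b \<noteq> 0" "nabs b \<le> R" "ball_inv (nabs b) \<phi>" "supp_in R \<phi>"
    using schwartz_witness2[OF assms assms] by blast
  have "ball_inv (nabs b) (\<lambda>x. c * \<phi> x)" "supp_in R (\<lambda>x. c * \<phi> x)"
    using bR unfolding ball_inv_def supp_in_def by (metis, simp)
  then show ?thesis using bR by (simp add: haar_eq[of b R] lsum_cmult algebra_simps)
qed

lemma schwartz_translate:
  assumes "schwartz (\<phi>::'k::nonarch_local_field \<Rightarrow> complex)" shows "schwartz (\<lambda>x. \<phi> (x + h))"
proof -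
  obtain b :: 'k and R where bR: "b \<noteq> 0" "ball_inv (nabs b) \<phi>" "supp_in R \<phi>"
    using schwartz_witness2[OF assms assms] by blast
  have "ball_inv (nabs b) (\<lambda>x. \<phi> (x + h))" using bR by (auto simp: ball_inv_def)
  moreover have "supp_in (max R (nabs h)) (\<lambda>x. \<phi> (x + h))"
    unfolding supp_in_def
  proof (intro allI impI)
    fix x :: 'k assume x: "max R (nabs h) < nabs x"
    then have "nabs (x + h) = nabs x" by (intro nabs_add_dominant) auto
    then show "\<phi> (x + h) = 0" using x bR by (auto simp: supp_in_def)
  qed
  ultimately show ?thesis unfolding schwartz_def using bR by (metis nabs_pos)
qed

lemma schwartz_dilate:
  assumes "schwartz (\<phi>::'k::nonarch_local_field \<Rightarrow> complex)" "a \<noteq> 0" shows "schwartz (\<lambda>x. \<phi> (a * x))"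
proof -
  obtain b :: 'k and R where bR: "b \<noteq> 0" "ball_inv (nabs b) \<phi>" "supp_in R \<phi>"
    using schwartz_witness2[OF assms(1,1)] by blast
  have "ball_inv (nabs (b / a)) (\<lambda>x. \<phi> (a * x))"
    unfolding ball_inv_def
  proof (intro allI impI ballI ball_invD[OF bR(2)])
    fix x y :: 'k assume "nabs (x - y) \<le> nabs (b / a)"
    then show "nabs (a * x - a * y) \<le> nabs b"
      using assms by (simp add: right_diff_distrib[symmetric] nabs_mult nabs_divide pos_le_divide_eq mult.commute[of "nabs a"])
  qed
  moreover have "supp_in (R / nabs a) (\<lambda>x. \<phi> (a * x))"
    using bR(3) assms(2) by (auto simp: supp_in_def nabs_mult field_simps)
  ultimately show ?thesis unfolding schwartz_def using bR assms by (metis divide_eq_0_iff nabs_pos)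
qed

lemma haar_dilate:
  assumes "schwartz (\<phi>::'k::nonarch_local_field \<Rightarrow> complex)" "a \<noteq> 0"
  shows "haar (\<lambda>x. \<phi> (a * x)) = haar \<phi> / of_real (nabs a)"
proof -
  obtain b :: 'k and R where bR: "b \<noteq> 0" "nabs b \<le> R" "ball_inv (nabs b) \<phi>" "supp_in R \<phi>"
    using schwartz_witness2[OF assms(1,1)] by blast
  let ?b = "b / a"
  have inv: "ball_inv (nabs ?b) (\<lambda>x. \<phi> (a * x))"
    unfolding ball_inv_def
  proof (intro allI impI ballI ball_invD[OF bR(3)])
    fix x y :: 'k assume "nabs (x - y) \<le> nabs (b / a)"
    then show "nabs (a * x - a * y) \<le> nabs b"
      using assms by (simp add: right_diff_distrib[symmetric] nabs_mult nabs_divide pos_le_divide_eq mult.commute[of "nabs a"])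
  qed
  have supp: "supp_in (R / nabs a) (\<lambda>x. \<phi> (a * x))"
    using bR(4) assms(2) by (auto simp: supp_in_def nabs_mult field_simps)
  have le: "nabs ?b \<le> R / nabs a" using bR assms by (simp add: nabs_divide divide_right_mono)
  have "haar (\<lambda>x. \<phi> (a * x)) = of_real (nabs ?b) * lsum (R / nabs a) (nabs ?b) (\<lambda>x. \<phi> (a * x))"
    using inv supp le bR assms by (intro haar_eq) auto
  also have "lsum (R / nabs a) (nabs ?b) (\<lambda>x. \<phi> (a * x)) = lsum (nabs a * (R / nabs a)) (nabs a * nabs ?b) \<phi>"
    using le bR assms by (intro lsum_dilate) (auto simp: nabs_divide)
  also have "\<dots> = lsum R (nabs b) \<phi>" using assms by (simp add: nabs_divide)
  also have "of_real (nabs ?b) * lsum R (nabs b) \<phi> = haar \<phi> / of_real (nabs a)"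
    using haar_eq[OF bR] by (simp add: nabs_divide)
  finally show ?thesis .
qed

text \<open>The function \<open>\<phi>\<close> itself may have noncompact support. This is what makes differences \<open>n f - f\<close> of functions
  in the principal series have integral zero, even when \<open>f\<close> does not vanish at \<open>1\<close>: on a large ball stable
  under the translation, the two Riemann sums coincide term by term.\<close>

lemma haar_translate_diff:
  assumes "b \<noteq> (0::'k)" "ball_inv (nabs b) \<phi>" "schwartz (\<lambda>x. \<phi> (x + h) - \<phi> (x::'k::nonarch_local_field))"
  shows "haar (\<lambda>x. \<phi> (x + h) - \<phi> x) = 0"
proof -
  let ?\<psi> = "\<lambda>x. \<phi> (x + h) - \<phi> x"
  obtain R where R: "supp_in R ?\<psi>" using assms(3) by (auto simp: schwartz_def)
  define R' where "R' = max (max R (nabs h)) (nabs b)"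
  have inv: "ball_inv (nabs b) ?\<psi>"
    unfolding ball_inv_def by (intro allI impI arg_cong2[where f="(-)"] ball_invD[OF assms(2)]) auto
  have "haar ?\<psi> = of_real (nabs b) * lsum R' (nabs b) ?\<psi>"
    using assms inv by (intro haar_eq supp_in_mono[OF R]) (auto simp: R'_def)
  also have "lsum R' (nabs b) ?\<psi> = lsum R' (nabs b) (\<lambda>x. \<phi> (x + h)) - lsum R' (nabs b) \<phi>"
    by (simp add: lsum_def sum_subtractf)
  also have "\<dots> = 0" using assms by (subst lsum_translate) (auto simp: R'_def)
  finally show ?thesis by simp
qed

lemma haar_translate:
  assumes "schwartz (\<phi>::'k::nonarch_local_field \<Rightarrow> complex)"
  shows "haar (\<lambda>x. \<phi> (x + h)) = haar \<phi>"
proof -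
  obtain b :: 'k and R where bR: "b \<noteq> 0" "nabs b \<le> R" "ball_inv (nabs b) \<phi>" "supp_in R \<phi>"
    using schwartz_witness2[OF assms(1,1)] by blast
  have s1: "schwartz (\<lambda>x. \<phi> (x + h) + (-1) * \<phi> x)"
    by (intro schwartz_add schwartz_translate schwartz_cmult assms)
  then have "haar (\<lambda>x. \<phi> (x + h) - \<phi> x) = 0" using haar_translate_diff[OF bR(1,3)] by simp
  moreover have "haar (\<lambda>x. \<phi> (x + h) + (-1) * \<phi> x) = haar (\<lambda>x. \<phi> (x + h)) + (-1) * haar \<phi>"
    by (subst haar_add) (auto intro!: schwartz_translate schwartz_cmult assms schwartz_cmult[OF assms, of "-1", simplified] simp: haar_cmult[OF assms, of "-1", simplified])
  ultimately show ?thesis by simp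
qed

definition ball_ind :: "'k::nonarch_local_field \<Rightarrow> 'k \<Rightarrow> complex" where
  "ball_ind a x = (if nabs x \<le> nabs a then 1 else 0)"

lemma schwartz_ball_ind: assumes "a \<noteq> 0" shows "schwartz (ball_ind a)"
proof -
  have "nabs x \<le> nabs a \<longleftrightarrow> nabs y \<le> nabs a" if "nabs (x - y) \<le> nabs a" for x y :: 'a
    using nabs_sub_le[OF _ that, of x] nabs_add_le[OF that, of y] by auto
  then have "ball_inv (nabs a) (ball_ind a)" by (auto simp: ball_inv_def ball_ind_def)
  moreover have "supp_in (nabs a) (ball_ind a)" by (auto simp: supp_in_def ball_ind_def)
  ultimately show ?thesis using assms unfolding schwartz_def by (metis nabs_pos)
qed

lemma haar_ball_ind: assumes "a \<noteq> (0::'k::nonarch_local_field)" shows "haar (ball_ind a) = of_real (nabs a)"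
proof -
  have "nabs x \<le> nabs a \<longleftrightarrow> nabs y \<le> nabs a" if "nabs (x - y) \<le> nabs a" for x y :: 'k
    using nabs_sub_le[OF _ that, of x] nabs_add_le[OF that, of y] by auto
  then have 1: "ball_inv (nabs a) (ball_ind a)" by (auto simp: ball_inv_def ball_ind_def)
  have 2: "supp_in (nabs a) (ball_ind a)" by (auto simp: supp_in_def ball_ind_def)
  have "lsum (nabs a) (nabs a) (ball_ind a) = lsum (nabs a) (nabs a) (\<lambda>_::'k. 1)"
    unfolding lsum_def by (intro sum.cong) (use assms in \<open>auto simp: reps_iff ball_ind_def\<close>)
  then show ?thesis using haar_eq[OF assms order_refl 1 2] assms by (simp add: lsum_1 num_reps_self)
qed

section \<open>Functions on the line of integral zero\<close>

definition lin_closed :: "('b \<Rightarrow> complex) set \<Rightarrow> bool" where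
  "lin_closed W \<longleftrightarrow> (\<lambda>_. 0) \<in> W \<and> (\<forall>f\<in>W. \<forall>g\<in>W. (\<lambda>x. f x + g x) \<in> W) \<and>
     (\<forall>c. \<forall>f\<in>W. (\<lambda>x. c * f x) \<in> W)"

lemma lin_closed_zero: "lin_closed W \<Longrightarrow> (\<lambda>_. 0) \<in> W"
  and lin_closed_add: "lin_closed W \<Longrightarrow> f \<in> W \<Longrightarrow> g \<in> W \<Longrightarrow> (\<lambda>x. f x + g x) \<in> W"
  and lin_closed_cmult: "lin_closed W \<Longrightarrow> f \<in> W \<Longrightarrow> (\<lambda>x. c * f x) \<in> W"
  by (auto simp: lin_closed_def)

lemma lin_closed_diff:
  assumes "lin_closed W" "f \<in> W" "g \<in> W" shows "(\<lambda>x. f x - g x) \<in> W"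
  using lin_closed_add[OF assms(1,2) lin_closed_cmult[OF assms(1,3), of "-1"]] by simp

lemma lin_closed_sum:
  assumes "lin_closed W" "finite A" "\<And>i. i \<in> A \<Longrightarrow> F i \<in> W"
  shows "(\<lambda>x. \<Sum>i\<in>A. F i x) \<in> W"
  using assms(2,3)
  by (induction A rule: finite_induct) (auto simp: lin_closed_zero[OF assms(1)] intro: lin_closed_add[OF assms(1)])

text \<open>The finitely many functions \<open>x \<mapsto> w (u x)\<close>, \<open>u\<close> a unit, are permuted by units, so their sum is radial. Summing
  over the set of functions avoids choosing a system of units.\<close>

lemma radial_element:
  fixes U :: "('k::nonarch_local_field \<Rightarrow> complex) set"
  assumes U: "lin_closed U" "\<And>\<phi>. \<phi> \<in> U \<Longrightarrow> schwartz \<phi>"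
    and dil: "\<And>\<phi> a. \<phi> \<in> U \<Longrightarrow> a \<noteq> 0 \<Longrightarrow> (\<lambda>x. \<phi> (a * x)) \<in> U"
    and w: "w \<in> U" "w 0 \<noteq> 0"
  obtains v where "v \<in> U" "v 0 \<noteq> 0" "\<And>x y. nabs x = nabs y \<Longrightarrow> v x = v y"
proof -
  define F where "F = (\<lambda>u x. w (u * x)) ` {u. nabs u = 1}"
  obtain b :: 'k and R where bR: "b \<noteq> 0" "nabs b \<le> R" "ball_inv (nabs b) w" "supp_in R w"
    using schwartz_witness2[OF U(2)[OF w(1)] U(2)[OF w(1)]] by blast
  have R: "0 < R" using bR(1,2) by (metis nabs_pos order_less_le_trans)
  have eq: "{u::'k. nabs u = 1} = {u. nabs u \<le> 1} \<inter> {u. 1 \<le> nabs u}" by auto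
  have cl: "closed {u::'k. 1 \<le> nabs u}"
    by (rule closed_Collect_le) (auto intro: continuous_on_nabs)
  have "compact {u::'k. nabs u = 1}"
    unfolding eq by (rule compact_Int_closed[OF compact_integers cl])
  then have fin: "finite F" unfolding F_def
  proof (rule finite_image_locally_constant)
    fix u :: 'k assume u: "u \<in> {u. nabs u = 1}"
    have "w (v * x) = w (u * x)" if v: "nabs v = 1" "nabs (u - v) < nabs b / R" for v x
    proof (cases "nabs x \<le> R")
      case True
      have "nabs (v * x - u * x) = nabs (u - v) * nabs x"
        by (metis left_diff_distrib nabs_minus_commute nabs_mult)
      also have "\<dots> \<le> nabs b / R * R" using v True R by (intro mult_mono) auto
      finally show ?thesis using R by (intro ball_invD[OF bR(3)]) simp
    next
      case False
      then show ?thesis using bR(4) u v by (simp add: supp_in_def nabs_mult)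
    qed
    then show "\<exists>e>0. \<forall>v\<in>{u. nabs u = 1}. dist u v < e \<longrightarrow> (\<lambda>x. w (v * x)) = (\<lambda>x. w (u * x))"
      using R bR(1) by (intro exI[of _ "nabs b / R"]) (auto simp: dist_nabs fun_eq_iff)
  qed
  define v where "v = (\<lambda>x. \<Sum>f\<in>F. f x)"
  have vU: "v \<in> U" unfolding v_def
    by (rule lin_closed_sum[OF U(1) fin]) (auto simp: F_def intro!: dil[OF w(1)])
  have "v 0 = (\<Sum>f\<in>F. w 0)" unfolding v_def by (intro sum.cong) (auto simp: F_def)
  then have v0: "v 0 = of_nat (card F) * w 0" by simp
  have "card F \<noteq> 0"
  proof -
    have "(\<lambda>x. w (1 * x)) \<in> F" unfolding F_def by (rule imageI) simp
    then show ?thesis using fin by auto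
  qed
  then have "v 0 \<noteq> 0" using v0 w(2) by simp
  moreover have "v x = v y" if "nabs x = nabs y" for x y
  proof (cases "y = 0")
    case True then show ?thesis using that by (metis nabs_0 nabs_eq_0)
  next
    case False
    define u where "u = x / y"
    have u: "nabs u = 1" "x = u * y" using that False by (auto simp: u_def nabs_divide)
    have bij: "bij_betw (\<lambda>f x. f (u * x)) F F"
    proof (rule bij_betw_byWitness[where f'="\<lambda>f x. f (inverse u * x)"])
      have "u \<noteq> 0" using u by auto
      then show "\<forall>a\<in>F. (\<lambda>x. a (u * (inverse u * x))) = a" "\<forall>a\<in>F. (\<lambda>x. a (inverse u * (u * x))) = a"
        by (simp_all add: mult.assoc[symmetric])
      have st: "(\<lambda>x. f (t * x)) \<in> F" if f: "f \<in> F" and t: "nabs t = 1" for f t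
      proof -
        obtain s where s: "nabs s = 1" "f = (\<lambda>x. w (s * x))" using f by (auto simp: F_def)
        have "(\<lambda>x. f (t * x)) = (\<lambda>x. w ((s * t) * x))" by (simp add: s mult.assoc)
        then show ?thesis unfolding F_def using s t by (auto simp: nabs_mult intro!: image_eqI[of _ _ "s * t"])
      qed
      show "(\<lambda>f x. f (u * x)) ` F \<subseteq> F" using st u by blast
      show "(\<lambda>f x. f (inverse u * x)) ` F \<subseteq> F" using st[of _ "inverse u"] u by (auto simp: nabs_inverse)
    qed
    have "v y = (\<Sum>f\<in>F. f y)" by (simp add: v_def)
    moreover have "v x = (\<Sum>f\<in>F. (\<lambda>x. f (u * x)) y)" by (simp add: v_def u(2))
    moreover have "\<dots> = (\<Sum>f\<in>F. f y)"
      using sum.reindex_bij_betw[OF bij, of "\<lambda>f. f y"] by simp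
    ultimately show ?thesis by simp
  qed
  ultimately show thesis using vU that by blast
qed

text \<open>A function that is locally constant, nonzero and of compact support is constant on small balls but not on
  large ones; somewhere in between the behaviour changes from one radius to the next.\<close>

lemma jump_radius:
  fixes v :: "'k::nonarch_local_field \<Rightarrow> complex"
  assumes "schwartz v" "v 0 \<noteq> 0"
  obtains e :: 'k where "e \<noteq> 0" "\<not> ball_inv (nabs e) v" "ball_inv (nabs (unif * e)) v"
proof -
  obtain b :: 'k and R where bR: "b \<noteq> 0" "nabs b \<le> R" "ball_inv (nabs b) v" "supp_in R v"
    using schwartz_witness2[OF assms(1,1)] by blast
  obtain a :: 'k where a: "a \<noteq> 0" "R + 1 \<le> nabs a" using nabs_unbounded by blast
  have 0: "\<not> ball_inv (nabs (unif ^ 0 * a)) v"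
  proof
    assume "ball_inv (nabs (unif ^ 0 * a)) v"
    then have "v 0 = v a" by (auto simp: ball_inv_def)
    moreover have "v a = 0" using bR(4) a by (auto simp: supp_in_def)
    ultimately show False using assms(2) by simp
  qed
  obtain n where n: "nabs (unif ^ n * a) \<le> nabs b" using unif_power_small[of "nabs b" a] bR(1) by auto
  have "\<exists>m. \<not> ball_inv (nabs (unif ^ m * a)) v \<and> ball_inv (nabs (unif ^ Suc m * a)) v"
  proof (rule ccontr)
    assume h: "\<not> ?thesis"
    have "\<not> ball_inv (nabs (unif ^ m * a)) v" for m
      by (induction m) (use 0 h in auto)
    then show False using ball_inv_mono[OF bR(3) n] by blast
  qed
  then obtain m where "\<not> ball_inv (nabs (unif ^ m * a)) v" "ball_inv (nabs (unif * (unif ^ m * a))) v"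
    by (auto simp: mult.assoc)
  moreover have "unif ^ m * a \<noteq> 0" using a unif(1) by auto
  ultimately show thesis using that by blast
qed

lemma sum_ball_ind_reps:
  assumes "a \<noteq> (0::'k::nonarch_local_field)" "nabs b \<le> nabs a" "b \<noteq> (0::'k)"
  shows "(\<Sum>h\<in>reps TYPE('k) (nabs a) (nabs b). ball_ind b (x + h)) = ball_ind a x"
proof (cases "nabs x \<le> nabs a")
  case True
  have "ball_ind b (x + h) = (if h = rep_of (nabs b) (- x) then 1 else 0)"
    if "h \<in> reps TYPE('k) (nabs a) (nabs b)" for h
  proof -
    have "h = rep_of (nabs b) (- x) \<longleftrightarrow> rep_of (nabs b) h = rep_of (nabs b) (- x)"
      using that assms by (simp add: reps_iff)
    also have "\<dots> \<longleftrightarrow> nabs (x + h) \<le> nabs b" by (simp add: rep_of_eq_iff add.commute)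
    finally show ?thesis by (simp add: ball_ind_def)
  qed
  then have "(\<Sum>h\<in>reps TYPE('k) (nabs a) (nabs b). ball_ind b (x + h)) =
     (\<Sum>h\<in>reps TYPE('k) (nabs a) (nabs b). if h = rep_of (nabs b) (- x) then 1 else 0)"
    by (intro sum.cong) auto
  also have "rep_of (nabs b) (- x) \<in> reps TYPE('k) (nabs a) (nabs b)" using True by (auto simp: reps_def)
  then have "(\<Sum>h\<in>reps TYPE('k) (nabs a) (nabs b). if h = rep_of (nabs b) (- x) then 1 else 0 :: complex) = 1"
    using assms by (simp add: sum.delta)
  finally show ?thesis using True by (simp add: ball_ind_def)
next
  case False
  have "ball_ind b (x + h) = 0" if "h \<in> reps TYPE('k) (nabs a) (nabs b)" for h
  proof -
    have "nabs h < nabs x" using that assms False by (simp add: reps_iff)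
    then have "nabs (x + h) = nabs x" by (rule nabs_add_dominant)
    then show ?thesis using False assms by (simp add: ball_ind_def)
  qed
  then show ?thesis using False by (simp add: ball_ind_def)
qed

text \<open>The functions of integral zero form an irreducible representation of the group of affine maps of the line.
  Starting from a radial \<open>v \<in> U\<close> and a radius \<open>\<bar>e\<bar>\<close> at which it jumps, \<open>v\<close> is a multiple of the indicator of the
  ball of radius \<open>\<bar>p e\<bar>\<close> plus a function constant on balls of radius \<open>\<bar>e\<bar>\<close>. Subtracting the sum of the
  translates of \<open>v\<close> by the points of the larger ball kills the second part and leaves
  \<open>q 1\<^bsub>B(pe)\<^esub> - 1\<^bsub>B(e)\<^esub>\<close>. Dilations and translations of this single function let one replace, modulo
  \<open>U\<close>, the indicator of any small ball by a fixed multiple of that of a large ball, so every Schwartz function is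
  congruent to a multiple of its integral.\<close>

lemma integral_zero_irreducible:
  fixes U :: "('k::nonarch_local_field \<Rightarrow> complex) set"
  assumes U: "lin_closed U" "\<And>\<phi>. \<phi> \<in> U \<Longrightarrow> schwartz \<phi>"
    and trans: "\<And>\<phi> h. \<phi> \<in> U \<Longrightarrow> (\<lambda>x. \<phi> (x + h)) \<in> U"
    and dil: "\<And>\<phi> a. \<phi> \<in> U \<Longrightarrow> a \<noteq> 0 \<Longrightarrow> (\<lambda>x. \<phi> (a * x)) \<in> U"
    and w: "w \<in> U" "w x0 \<noteq> 0"
    and \<phi>: "schwartz \<phi>" "haar \<phi> = 0"
  shows "\<phi> \<in> U"
proof -
  have "(\<lambda>x. w (x + x0)) \<in> U" using trans[OF w(1)] .
  moreover have "(\<lambda>x. w (x + x0)) 0 \<noteq> 0" using w(2) by simp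
  ultimately obtain v where v: "v \<in> U" "v 0 \<noteq> 0" "\<And>x y. nabs x = nabs y \<Longrightarrow> v x = v y"
    using radial_element[OF U dil] by blast
  obtain e :: 'k where e: "e \<noteq> 0" "\<not> ball_inv (nabs e) v" "ball_inv (nabs (unif * e)) v"
    using jump_radius[OF U(2)[OF v(1)] v(2)] by blast
  have pe: "unif * e \<noteq> 0" using e unif(1) by auto
  define \<rho> where "\<rho> = (\<lambda>x. if nabs x \<le> nabs e then v e else v x)"
  define d where "d = v 0 - v e"
  have v_eq: "v x = d * ball_ind (unif * e) x + \<rho> x" for x
  proof (cases "nabs x \<le> nabs (unif * e)")
    case True
    then have "v x = v 0" by (intro ball_invD[OF e(3)]) simp
    then show ?thesis using True nabs_less_iff_unif[OF e(1), of x] by (simp add: d_def ball_ind_def \<rho>_def)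
  next
    case False
    then have "\<not> nabs x < nabs e" using nabs_less_iff_unif[OF e(1)] by blast
    then show ?thesis using False v(3)[of x e] by (auto simp: \<rho>_def ball_ind_def)
  qed
  have \<rho>inv: "ball_inv (nabs e) \<rho>"
    unfolding ball_inv_def
  proof (intro allI impI)
    fix x y :: 'k assume xy: "nabs (x - y) \<le> nabs e"
    show "\<rho> x = \<rho> y"
    proof (cases "nabs x \<le> nabs e")
      case True
      then have "nabs y \<le> nabs e" using nabs_sub_le[OF _ xy, of x] by simp
      then show ?thesis using True by (simp add: \<rho>_def)
    next
      case False
      then have "nabs (y - x) < nabs x" using xy by (simp add: nabs_minus_commute)
      then have "nabs (x + (y - x)) = nabs x" by (rule nabs_add_dominant)
      then have "nabs y = nabs x" by simp
      then show ?thesis using False v(3)[of x y] by (simp add: \<rho>_def)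
    qed
  qed
  have d: "d \<noteq> 0"
  proof
    assume "d = 0"
    then have "v = \<rho>" using v_eq by auto
    then show False using e(2) \<rho>inv by simp
  qed
  let ?H = "reps TYPE('k) (nabs e) (nabs (unif * e))"
  let ?q = "of_nat (card ?H) :: complex"
  have le: "nabs (unif * e) \<le> nabs e" using nabs_less_iff_unif[OF e(1), of "unif * e"] by simp
  \<comment> \<open>the part \<open>\<rho>\<close> is invariant under the translations by \<open>?H\<close> and cancels\<close>
  have "(\<lambda>x. ?q * v x - (\<Sum>h\<in>?H. v (x + h))) \<in> U"
    by (intro lin_closed_diff[OF U(1)] lin_closed_cmult[OF U(1)] lin_closed_sum[OF U(1)] trans v finite_reps)
      (use pe in auto)
  also have "(\<lambda>x. ?q * v x - (\<Sum>h\<in>?H. v (x + h))) =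
      (\<lambda>x. d * (?q * ball_ind (unif * e) x - ball_ind e x))"
  proof
    fix x
    have "(\<Sum>h\<in>?H. v (x + h)) = d * (\<Sum>h\<in>?H. ball_ind (unif * e) (x + h)) + (\<Sum>h\<in>?H. \<rho> (x + h))"
      by (simp add: v_eq sum.distrib sum_distrib_left)
    also have "(\<Sum>h\<in>?H. \<rho> (x + h)) = (\<Sum>h\<in>?H. \<rho> x)"
      using le pe e(1) by (intro sum.cong refl ball_invD[OF \<rho>inv]) (auto simp: reps_iff)
    also have "(\<Sum>h\<in>?H. ball_ind (unif * e) (x + h)) = ball_ind e x"
      by (rule sum_ball_ind_reps[OF e(1) le pe])
    finally show "?q * v x - (\<Sum>h\<in>?H. v (x + h)) = d * (?q * ball_ind (unif * e) x - ball_ind e x)"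
      by (simp add: v_eq[of x] algebra_simps)
  qed
  finally have "(\<lambda>x. inverse d * (d * (?q * ball_ind (unif * e) x - ball_ind e x))) \<in> U"
    by (rule lin_closed_cmult[OF U(1)])
  then have base: "(\<lambda>x. ?q * ball_ind (unif * e) x - ball_ind e x) \<in> U"
    using d by (simp add: mult.assoc[symmetric])
  have step: "(\<lambda>x. ?q * ball_ind (unif * c) (x + h) - ball_ind c (x + h)) \<in> U" if c: "c \<noteq> 0" for c h
  proof -
    have "(\<lambda>x. ?q * ball_ind (unif * e) (e / c * (x + h)) - ball_ind e (e / c * (x + h))) \<in> U"
      using trans[OF dil[OF base, of "e / c"], of h] c e(1) by simp
    also have "(\<lambda>x. ?q * ball_ind (unif * e) (e / c * (x + h)) - ball_ind e (e / c * (x + h))) =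
        (\<lambda>x. ?q * ball_ind (unif * c) (x + h) - ball_ind c (x + h))"
      using c e(1) by (auto simp: ball_ind_def nabs_mult nabs_divide pos_divide_le_eq mult.commute mult.left_commute)
    finally show ?thesis .
  qed
  have steps: "(\<lambda>x. ?q ^ n * ball_ind (unif ^ n * c) (x + h) - ball_ind c (x + h)) \<in> U" if c: "c \<noteq> 0" for n c h
  proof (induction n)
    case 0 show ?case using lin_closed_zero[OF U(1)] by simp
  next
    case (Suc n)
    have "unif ^ n * c \<noteq> 0" using c unif(1) by auto
    from lin_closed_add[OF U(1) lin_closed_cmult[OF U(1) step[OF this, of h], of "?q ^ n"] Suc]
    show ?case by (simp add: algebra_simps)
  qed
  obtain b :: 'k and R where bR: "b \<noteq> 0" "nabs b \<le> R" "ball_inv (nabs b) \<phi>" "supp_in R \<phi>"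
    using schwartz_witness2[OF \<phi>(1,1)] by blast
  obtain c :: 'k where c: "c \<noteq> 0" "R \<le> nabs c" using nabs_unbounded by blast
  obtain n where n: "nabs (unif ^ n * c) \<le> nabs b" using unif_power_small[of "nabs b" c] bR(1) by auto
  let ?c = "unif ^ n * c"
  have c': "?c \<noteq> 0" "nabs ?c \<le> nabs c" using c n bR(2) unif(1) by auto
  have inv: "ball_inv (nabs ?c) \<phi>" and supp: "supp_in (nabs c) \<phi>"
    using ball_inv_mono[OF bR(3) n] supp_in_mono[OF bR(4) c(2)] by auto
  let ?H' = "reps TYPE('k) (nabs c) (nabs ?c)"
  have zero: "(\<Sum>h\<in>?H'. \<phi> h) = 0"
    using haar_eq[OF c'(1,2) inv supp] \<phi>(2) c'(1) c(1) unif(1)[where 'k='k] by (simp add: lsum_def)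
  have dec: "\<phi> x = (\<Sum>h\<in>?H'. \<phi> h * ball_ind ?c (x + - h))" for x
  proof -
    have "(\<Sum>h\<in>?H'. \<phi> h * ball_ind ?c (x + - h)) = (\<Sum>h\<in>?H'. if h = rep_of (nabs ?c) x then \<phi> x else 0)"
    proof (intro sum.cong refl)
      fix h assume "h \<in> ?H'"
      then have "h = rep_of (nabs ?c) x \<longleftrightarrow> rep_of (nabs ?c) h = rep_of (nabs ?c) x"
        using c' by (simp add: reps_iff)
      also have "\<dots> \<longleftrightarrow> nabs (x - h) \<le> nabs ?c" by (simp add: rep_of_eq_iff nabs_minus_commute)
      finally show "\<phi> h * ball_ind ?c (x + - h) = (if h = rep_of (nabs ?c) x then \<phi> x else 0)"
        using ball_invD[OF inv, of x h] by (simp add: ball_ind_def)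
    qed
    also have "\<dots> = \<phi> x"
    proof (cases "nabs x \<le> nabs c")
      case True
      then have "rep_of (nabs ?c) x \<in> ?H'" by (auto simp: reps_def)
      then show ?thesis using c' by (simp add: sum.delta)
    next
      case False
      then have "\<phi> x = 0" using supp by (simp add: supp_in_def)
      then show ?thesis by (simp add: sum.neutral)
    qed
    finally show ?thesis by simp
  qed
  have q0: "?q \<noteq> 0"
  proof -
    have "rep_of (nabs (unif * e)) 0 \<in> ?H" by (auto simp: reps_def)
    then have "card ?H \<noteq> 0" using pe finite_reps[of "nabs (unif * e)" "nabs e", where 'k='k] by auto
    then show ?thesis by simp
  qed
  have "(\<lambda>x. \<Sum>h\<in>?H'. \<phi> h * (?q ^ n * ball_ind ?c (x + - h) - ball_ind c (x + - h))) \<in> U"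
    by (intro lin_closed_sum[OF U(1)] lin_closed_cmult[OF U(1)] steps[OF c(1)] finite_reps) (use c' in auto)
  also have "(\<lambda>x. \<Sum>h\<in>?H'. \<phi> h * (?q ^ n * ball_ind ?c (x + - h) - ball_ind c (x + - h))) = (\<lambda>x. ?q ^ n * \<phi> x)"
  proof
    fix x
    have bc: "ball_ind c (x + - h) = ball_ind c x" if "h \<in> ?H'" for h
    proof -
      have "nabs h \<le> nabs c" using that c' by (simp add: reps_iff)
      then have "nabs (x + - h) \<le> nabs c \<longleftrightarrow> nabs x \<le> nabs c"
        using nabs_sub_le[of x "nabs c" h] nabs_add_le[of "x - h" "nabs c" h] by auto
      then show ?thesis by (simp add: ball_ind_def)
    qed
    have "(\<Sum>h\<in>?H'. \<phi> h * (?q ^ n * ball_ind ?c (x + - h) - ball_ind c (x + - h))) =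
        (\<Sum>h\<in>?H'. ?q ^ n * (\<phi> h * ball_ind ?c (x + - h)) - \<phi> h * ball_ind c x)"
      using bc by (intro sum.cong refl) (simp add: algebra_simps)
    also have "\<dots> = ?q ^ n * (\<Sum>h\<in>?H'. \<phi> h * ball_ind ?c (x + - h)) - (\<Sum>h\<in>?H'. \<phi> h) * ball_ind c x"
      by (simp only: sum_subtractf sum_distrib_left sum_distrib_right)
    also have "\<dots> = ?q ^ n * \<phi> x" using zero dec[of x] by simp
    finally show "(\<Sum>h\<in>?H'. \<phi> h * (?q ^ n * ball_ind ?c (x + - h) - ball_ind c (x + - h))) = ?q ^ n * \<phi> x" .
  qed
  finally have "(\<lambda>x. inverse (?q ^ n) * (?q ^ n * \<phi> x)) \<in> U" by (rule lin_closed_cmult[OF U(1)])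
  then show ?thesis using q0 by (simp add: mult.assoc[symmetric])
qed


section \<open>Characters\<close>

text \<open>Squaring moves a number near \<open>1\<close> away from \<open>1\<close> by a factor of at least \<open>3/2\<close>.\<close>

lemma no_small_subgroups:
  fixes z :: complex
  assumes "\<And>n::nat. cmod (z ^ n - 1) \<le> 1/2" shows "z = 1"
proof (rule ccontr)
  assume z: "z \<noteq> 1"
  have grow: "(3/2) ^ k * cmod (z - 1) \<le> cmod (z ^ (2 ^ k) - 1)" for k
  proof (induction k)
    case (Suc k)
    let ?y = "z ^ (2 ^ k)"
    have "cmod 2 \<le> cmod (?y + 1) + cmod (1 - ?y)" using norm_triangle_ineq[of "?y + 1" "1 - ?y"] by simp
    then have "3/2 \<le> cmod (?y + 1)" using assms[of "2 ^ k"] by (simp add: norm_minus_commute)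
    moreover have "z ^ (2 ^ Suc k) - 1 = (?y + 1) * (?y - 1)"
      by (simp add: power_add[symmetric] mult_2 algebra_simps flip: power_mult power_add)
    moreover from calculation have "3/2 * cmod (?y - 1) \<le> cmod (?y + 1) * cmod (?y - 1)"
      by (intro mult_right_mono) auto
    ultimately have "3/2 * cmod (?y - 1) \<le> cmod (z ^ (2 ^ Suc k) - 1)"
      by (simp only: norm_mult)
    then show ?case using Suc by simp
  qed simp
  obtain k where "1 / cmod (z - 1) < (3/2::real) ^ k" using real_arch_pow[of "3/2::real"] by auto
  then have "1 < (3/2) ^ k * cmod (z - 1)" using z by (simp add: field_simps)
  then show False using grow[of k] assms[of "2 ^ k"] by linarith
qed

lemma character_mult: "is_character \<xi> \<Longrightarrow> x \<noteq> 0 \<Longrightarrow> y \<noteq> 0 \<Longrightarrow> \<xi> (x * y) = \<xi> x * \<xi> y"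
  and character_nonzero: "is_character \<xi> \<Longrightarrow> x \<noteq> 0 \<Longrightarrow> \<xi> x \<noteq> 0"
  by (auto simp: is_character_def)

lemma character_1: assumes "is_character \<xi>" shows "\<xi> 1 = 1"
  using character_mult[OF assms, of 1 1] character_nonzero[OF assms, of 1] by simp

lemma character_inverse: assumes "is_character \<xi>" "x \<noteq> 0" shows "\<xi> (inverse x) = inverse (\<xi> x)"
proof -
  have "\<xi> x * \<xi> (inverse x) = 1"
    using character_mult[OF assms(1), of x "inverse x"] assms character_1[OF assms(1)] by simp
  then show ?thesis by (metis inverse_unique)
qed

lemma character_divide:
  assumes "is_character \<xi>" "x \<noteq> 0" "y \<noteq> 0" shows "\<xi> (x / y) = \<xi> x / \<xi> y"
  using assms by (simp add: divide_inverse character_mult character_inverse)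

lemma nabs_near_1: assumes "nabs (x - 1) < 1" shows "nabs (x::'k::nonarch_local_field) = 1" "x \<noteq> 0"
proof -
  show 1: "nabs x = 1" using nabs_add_dominant[of "x - 1" 1] assms by simp
  then show "x \<noteq> 0" by auto
qed

lemma nabs_near_1_mult:
  assumes "nabs (x - 1) \<le> s" "nabs (y - 1) \<le> s" "s < 1" shows "nabs (x * y - (1::'k::nonarch_local_field)) \<le> s"
proof -
  have "nabs (x * (y - 1)) \<le> s" using assms nabs_near_1[of x] by (simp add: nabs_mult)
  from nabs_add_le[OF this assms(1)] show ?thesis by (simp add: algebra_simps)
qed

lemma nabs_near_1_divide:
  assumes "nabs (x - 1) \<le> s" "nabs (y - 1) \<le> s" "s < 1" shows "nabs (x / y - (1::'k::nonarch_local_field)) \<le> s"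
proof -
  have y: "nabs y = 1" "y \<noteq> 0" using assms nabs_near_1[of y] by auto
  have "x / y - 1 = ((x - 1) - (y - 1)) / y" using y by (simp add: field_simps)
  then show ?thesis using nabs_sub_le[OF assms(1,2)] y by (simp add: nabs_divide)
qed

text \<open>Continuity at \<open>1\<close> maps a small subgroup \<open>1 + {x. \<bar>x\<bar> \<le> s}\<close> into a neighbourhood of \<open>1\<close> that contains no
  nontrivial subgroup of the nonzero complex numbers.\<close>

lemma character_locally_trivial:
  assumes \<xi>: "is_character (\<xi>::'k::nonarch_local_field \<Rightarrow> complex)"
  shows "\<exists>s>0. s < 1 \<and> (\<forall>x. nabs (x - 1) \<le> s \<longrightarrow> \<xi> x = 1)"
proof -
  have "continuous_on (- {0}) \<xi>" using \<xi> by (simp add: is_character_def)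
  then obtain d where d: "d > 0" "\<And>x. x \<noteq> 0 \<Longrightarrow> dist x 1 < d \<Longrightarrow> dist (\<xi> x) (\<xi> 1) < 1/2"
    unfolding continuous_on_iff by (metis ComplD ComplI singletonD half_gt_zero_iff zero_less_one singleton_iff one_neq_zero)
  define s where "s = min (d / 2) (1/2)"
  have s: "0 < s" "s < 1" "s < d" using d(1) by (auto simp: s_def)
  have "\<xi> x = 1" if x: "nabs (x - 1) \<le> s" for x
  proof (rule no_small_subgroups)
    fix n
    have "nabs (x ^ n - 1) \<le> s"
      by (induction n) (use s x in \<open>auto intro: nabs_near_1_mult\<close>)
    moreover have x0: "x \<noteq> 0" using nabs_near_1[of x] x s by auto
    ultimately have "dist (\<xi> (x ^ n)) (\<xi> 1) < 1/2" using s by (intro d(2)) (auto simp: dist_nabs)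
    moreover have "\<xi> (x ^ n) = \<xi> x ^ n"
      by (induction n) (use x0 in \<open>auto simp: character_1[OF \<xi>] character_mult[OF \<xi>]\<close>)
    ultimately show "cmod (\<xi> x ^ n - 1) \<le> 1/2" by (simp add: dist_norm character_1[OF \<xi>])
  qed
  then show ?thesis using s by blast
qed

lemma is_characterI:
  fixes \<xi> :: "'k::nonarch_local_field \<Rightarrow> complex"
  assumes "\<And>x. x \<noteq> 0 \<Longrightarrow> \<xi> x \<noteq> 0" "\<And>x y. x \<noteq> 0 \<Longrightarrow> y \<noteq> 0 \<Longrightarrow> \<xi> (x * y) = \<xi> x * \<xi> y"
    and "s > 0" "\<And>x. nabs (x - 1) \<le> s \<Longrightarrow> \<xi> x = 1"
  shows "is_character \<xi>"
proof -
  have "continuous_on (- {0}) \<xi>"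
    unfolding continuous_on_iff
  proof (intro ballI allI impI)
    fix x :: 'k and e :: real assume x: "x \<in> - {0}" and e: "0 < e"
    have "\<xi> y = \<xi> x" if y: "y \<noteq> 0" "dist y x < s * nabs x" for y
    proof -
      have "y / x - 1 = (y - x) / x" using x by (simp add: field_simps)
      then have "nabs (y / x - 1) \<le> s" using y x by (simp add: nabs_divide dist_nabs pos_divide_le_eq less_imp_le)
      then have "\<xi> (y / x) = 1" by (rule assms(4))
      moreover have "\<xi> y = \<xi> (y / x) * \<xi> x" using assms(2)[of "y / x" x] x y by simp
      ultimately show ?thesis by simp
    qed
    then have "\<forall>x'\<in>- {0}. dist x' x < s * nabs x \<longrightarrow> dist (\<xi> x') (\<xi> x) < e"
      using e by simp
    moreover have "0 < s * nabs x" using x assms(3) by simp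
    ultimately show "\<exists>d>0. \<forall>x'\<in>- {0}. dist x' x < d \<longrightarrow> dist (\<xi> x') (\<xi> x) < e" by blast
  qed
  then show ?thesis using assms by (auto simp: is_character_def)
qed

lemma is_character_mult:
  assumes "is_character (\<xi>::'k::nonarch_local_field \<Rightarrow> complex)" "is_character \<zeta>"
  shows "is_character (\<lambda>x. \<xi> x * \<zeta> x)"
  using assms unfolding is_character_def by (auto intro!: continuous_on_mult)

lemma is_character_inverse:
  assumes "is_character (\<xi>::'k::nonarch_local_field \<Rightarrow> complex)"
  shows "is_character (\<lambda>x. inverse (\<xi> x))"
  using assms unfolding is_character_def by (auto intro!: continuous_on_inverse)

lemma is_character_nabs_pow: "is_character (nabs_pow s :: 'k::nonarch_local_field \<Rightarrow> complex)"
proof (rule is_characterI[of _ "1/2"])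
  fix x y :: 'k assume "x \<noteq> 0" "y \<noteq> 0"
  then show "nabs_pow s (x * y) = nabs_pow s x * (nabs_pow s y)"
    by (simp add: nabs_pow_def nabs_mult powr_mult)
next
  fix x :: 'k assume "nabs (x - 1) \<le> 1/2"
  then show "nabs_pow s x = 1" using nabs_near_1[of x] by (simp add: nabs_pow_def)
qed (auto simp: nabs_pow_def)

lemma nabs_pow_add: "x \<noteq> 0 \<Longrightarrow> nabs_pow s x * nabs_pow t x = nabs_pow (s + t) (x::'k::nonarch_local_field)"
  by (simp add: nabs_pow_def powr_add)

lemma nabs_pow_0: "x \<noteq> 0 \<Longrightarrow> nabs_pow 0 (x::'k::nonarch_local_field) = 1"
  by (simp add: nabs_pow_def)

section \<open>Two by two matrices over the base field\<close>

definition mk :: "'a::zero \<Rightarrow> 'a \<Rightarrow> 'a \<Rightarrow> 'a \<Rightarrow> 'a ^ 2 ^ 2" where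
  "mk a b c d = vector [vector [a, b], vector [c, d]]"

lemma mk_nth [simp]: "mk a b c d $ 1 $ 1 = a" "mk a b c d $ 1 $ 2 = b"
    "mk a b c d $ 2 $ 1 = c" "mk a b c d $ 2 $ 2 = d"
  by (simp_all add: mk_def)

lemma mat2_eq_iff: "A = B \<longleftrightarrow> A $ 1 $ 1 = B $ 1 $ 1 \<and> A $ 1 $ 2 = B $ 1 $ 2 \<and> A $ 2 $ 1 = B $ 2 $ 1 \<and> A $ 2 $ 2 = B $ 2 $ 2"
  for A B :: "'a ^ 2 ^ 2"
  by (auto simp: vec_eq_iff forall_2)

lemma mk_eta: "mk (A $ 1 $ 1) (A $ 1 $ 2) (A $ 2 $ 1) (A $ 2 $ 2) = A"
  by (simp add: mat2_eq_iff)

lemma mat2_cases: obtains a b c d where "A = mk a b c d"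
  using mk_eta[of A] by metis

lemma mk_eq_iff [simp]: "mk a b c d = mk a' b' c' d' \<longleftrightarrow> a = a' \<and> b = b' \<and> c = c' \<and> d = d'"
  by (auto simp: mat2_eq_iff)

lemma mk_mult [simp]: "mk a b c d ** mk a' b' c' d' =
    mk (a * a' + b * c') (a * b' + b * d') (c * a' + d * c') (c * b' + d * (d'::'a::semiring_1))"
  by (simp add: mat2_eq_iff matrix_matrix_mult_def sum_2)

lemma mult_nth_2: "(A ** B) $ i $ j = A $ i $ 1 * B $ 1 $ j + A $ i $ 2 * B $ 2 $ j"
  for A B :: "'a::semiring_1 ^ 2 ^ 2"
  by (simp add: matrix_matrix_mult_def sum_2)

lemma mat_eq_mk: "mat z = mk z 0 0 z"
  by (simp add: mat2_eq_iff mat_def)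

lemma det_mk [simp]: "det (mk a b c d) = a * d - b * (c::'a::comm_ring_1)"
  by (simp add: det_2)

lemma invertible_iff_det: "invertible A \<longleftrightarrow> det A \<noteq> 0" for A :: "'k::nonarch_local_field mat2"
  by (rule invertible_det_nz)

lemma invertible_mk [simp]: "invertible (mk a b c d) \<longleftrightarrow> a * d - b * c \<noteq> (0::'k::nonarch_local_field)"
  by (simp add: invertible_iff_det)

lemma invertible_mult_iff: "invertible (A ** B) \<longleftrightarrow> invertible A \<and> invertible B"
  for A B :: "'k::nonarch_local_field mat2"
  by (simp add: invertible_iff_det det_mul)

lemma carrier_GL2 [simp]: "carrier GL2 = {A. invertible A}"
  and mult_GL2 [simp]: "A \<otimes>\<^bsub>GL2\<^esub> B = A ** B"
  and one_GL2 [simp]: "\<one>\<^bsub>GL2\<^esub> = mat 1"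
  by (simp_all add: GL2_def)

lemma matrix_inv_mult [simp]:
  assumes "invertible A"
  shows "A ** matrix_inv A = mat 1" "matrix_inv A ** A = mat 1" "invertible (matrix_inv A)"
  using someI_ex[OF assms[unfolded invertible_def]] unfolding matrix_inv_def invertible_def by blast+

lemma group_GL2: "group (GL2 :: 'k::nonarch_local_field mat2 monoid)"
proof (rule groupI)
  fix x :: "'k mat2" assume "x \<in> carrier GL2"
  then show "\<exists>y\<in>carrier GL2. y \<otimes>\<^bsub>GL2\<^esub> x = \<one>\<^bsub>GL2\<^esub>"
    by (intro bexI[of _ "matrix_inv x"]) auto
qed (auto simp: invertible_mult_iff matrix_mul_assoc invertible_iff_det det_mul)

lemma inv_GL2: assumes "invertible A" shows "inv\<^bsub>GL2\<^esub> A = matrix_inv A"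
  using group.inv_equality[OF group_GL2, of "matrix_inv A" A] assms by simp

lemma matrix_inv_mk:
  assumes "a * d - b * c \<noteq> (0::'k::nonarch_local_field)"
  shows "matrix_inv (mk a b c d) = mk (d / (a * d - b * c)) (- b / (a * d - b * c)) (- c / (a * d - b * c)) (a / (a * d - b * c))"
proof -
  let ?X = "mk (d / (a * d - b * c)) (- b / (a * d - b * c)) (- c / (a * d - b * c)) (a / (a * d - b * c))"
  have X: "?X ** mk a b c d = mat 1"
    using assms by (simp add: mat_eq_mk divide_simps; simp add: algebra_simps)
  then have "det ?X * det (mk a b c d) = 1" by (metis det_I det_mul)
  then have "invertible ?X" unfolding invertible_iff_det by (metis mult_zero_left zero_neq_one)
  then have "inv\<^bsub>GL2\<^esub> (mk a b c d) = ?X"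
    using X assms by (intro group.inv_equality[OF group_GL2]) (simp_all only: carrier_GL2 mult_GL2 one_GL2 mem_Collect_eq invertible_mk not_False_eq_True)
  moreover have "invertible (mk a b c d)" using assms by simp
  ultimately show ?thesis using inv_GL2 by metis
qed

lemma carrier_T2: "carrier T2 = {mk a 0 0 d |a d::'k::nonarch_local_field. a \<noteq> 0 \<and> d \<noteq> 0}"
proof (rule Set.set_eqI)
  fix A :: "'k mat2"
  obtain a b c d where A: "A = mk a b c d" by (rule mat2_cases)
  show "A \<in> carrier T2 \<longleftrightarrow> A \<in> {mk a 0 0 d |a d. a \<noteq> 0 \<and> d \<noteq> 0}"
    by (auto simp: T2_def A invertible_iff_det)
qed

lemma mult_T2 [simp]: "A \<otimes>\<^bsub>T2\<^esub> B = A ** B" and one_T2 [simp]: "\<one>\<^bsub>T2\<^esub> = mat 1"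
  by (simp_all add: T2_def)

lemma group_T2: "group (T2 :: 'k::nonarch_local_field mat2 monoid)"
proof (rule groupI)
  fix x :: "'k mat2" assume "x \<in> carrier T2"
  then obtain a d where x: "x = mk a 0 0 d" "a \<noteq> 0" "d \<noteq> 0" by (auto simp: carrier_T2)
  then show "\<exists>y\<in>carrier T2. y \<otimes>\<^bsub>T2\<^esub> x = \<one>\<^bsub>T2\<^esub>"
    by (intro bexI[of _ "mk (inverse a) 0 0 (inverse d)"]) (auto simp: carrier_T2 mat_eq_mk)
qed (auto simp: carrier_T2 matrix_mul_assoc mat_eq_mk)

lemma mem_B2: "mk a b c d \<in> B2 \<longleftrightarrow> c = 0 \<and> a \<noteq> 0 \<and> d \<noteq> (0::'k::nonarch_local_field)"
  by (auto simp: B2_def)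

lemma B2_cases:
  assumes "A \<in> B2" obtains a b d where "A = mk a b 0 d" "a \<noteq> (0::'k::nonarch_local_field)" "d \<noteq> 0"
  using assms mat2_cases[of A] mem_B2 by metis

lemma mem_N2: "mk a b c d \<in> N2 \<longleftrightarrow> a = 1 \<and> c = 0 \<and> d = (1::'k::nonarch_local_field)"
  by (auto simp: N2_def)

lemma N2_cases: assumes "A \<in> N2" obtains b where "A = mk 1 b 0 (1::'k::nonarch_local_field)"
  using assms mat2_cases[of A] mem_N2 by metis

lemma torus_part_mk [simp]: "torus_part (mk a b c d) = mk a 0 0 d"
  by (simp add: torus_part_def mat2_eq_iff)


subsection \<open>Bounds on entries, and topology\<close>

definition mbound :: "real \<Rightarrow> 'k::nonarch_local_field mat2 \<Rightarrow> bool" where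
  "mbound M A \<longleftrightarrow> (\<forall>i j. nabs (A $ i $ j) \<le> M)"

lemma mbound_mk: "mbound M (mk a b c d) \<longleftrightarrow> nabs a \<le> M \<and> nabs b \<le> M \<and> nabs c \<le> M \<and> nabs d \<le> M"
  by (auto simp: mbound_def forall_2)

lemma mbound_mult: assumes "mbound M A" "mbound N B" shows "mbound (M * N) (A ** B)"
  unfolding mbound_def
proof (intro allI)
  fix i j
  have M: "0 \<le> M" using assms(1) unfolding mbound_def by (meson nabs_ge_0 order_trans)
  have "nabs (A $ i $ l * B $ l $ j) \<le> M * N" for l
    using assms M unfolding mbound_def nabs_mult by (intro mult_mono) auto
  then show "nabs ((A ** B) $ i $ j) \<le> M * N" unfolding mult_nth_2 by (intro nabs_add_le)
qed

lemma mbound_mono: "mbound M A \<Longrightarrow> M \<le> M' \<Longrightarrow> mbound M' A"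
  unfolding mbound_def by (meson order_trans)

lemma mbound_add: "mbound M A \<Longrightarrow> mbound M B \<Longrightarrow> mbound M (A + B)"
  unfolding mbound_def by (simp add: nabs_add_le)

lemma mbound_exists: "\<exists>M>0. mbound M (A::'k::nonarch_local_field mat2)"
proof -
  obtain a b c d where A: "A = mk a b c d" by (rule mat2_cases)
  show ?thesis unfolding A mbound_mk
    by (rule exI[of _ "1 + nabs a + nabs b + nabs c + nabs d"]) (simp add: add_pos_nonneg)
qed

lemma dist_mat2_le: assumes "mbound s (B - A)" shows "dist B (A::'k::nonarch_local_field mat2) \<le> 4 * s"
proof -
  have e: "dist (B $ i $ j) (A $ i $ j) \<le> s" for i j using assms by (simp add: mbound_def dist_nabs)
  have "dist (B $ i) (A $ i) \<le> 2 * s" for i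
  proof -
    have "dist (B $ i) (A $ i) \<le> (\<Sum>j\<in>UNIV. dist (B $ i $ j) (A $ i $ j))"
      unfolding dist_vec_def by (rule L2_set_le_sum) auto
    also have "\<dots> \<le> 2 * s" using e[of i 1] e[of i 2] by (simp add: sum_2)
    finally show ?thesis .
  qed
  note r = this
  have "dist B A \<le> (\<Sum>i\<in>UNIV. dist (B $ i) (A $ i))"
    unfolding dist_vec_def[of B A] by (rule L2_set_le_sum) auto
  also have "\<dots> \<le> 4 * s" using r[of 1] r[of 2] by (simp add: sum_2)
  finally show ?thesis .
qed

lemma mbound_of_dist: assumes "dist B A \<le> s" shows "mbound s (B - (A::'k::nonarch_local_field mat2))"
  unfolding mbound_def
proof (intro allI)
  fix i j
  have "dist (B $ i $ j) (A $ i $ j) \<le> dist (B $ i) (A $ i)" by (rule dist_vec_nth_le)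
  also have "\<dots> \<le> dist B A" by (rule dist_vec_nth_le)
  finally show "nabs ((B - A) $ i $ j) \<le> s" using assms by (simp add: dist_nabs)
qed

lemma openin_GL2_iff:
  "openin (top_of_set (carrier GL2)) K \<longleftrightarrow> K \<subseteq> carrier GL2 \<and>
     (\<forall>A\<in>K. \<exists>s>0. \<forall>B::'k::nonarch_local_field mat2. invertible B \<and> mbound s (B - A) \<longrightarrow> B \<in> K)"
proof -
  have "(\<exists>e>0. \<forall>B\<in>carrier GL2. dist B A < e \<longrightarrow> B \<in> K) \<longleftrightarrow>
      (\<exists>s>0. \<forall>B::'k mat2. invertible B \<and> mbound s (B - A) \<longrightarrow> B \<in> K)" for A
  proof
    assume "\<exists>e>0. \<forall>B\<in>carrier GL2. dist B A < e \<longrightarrow> B \<in> K"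
    then obtain e where e: "e > 0" "\<And>B. invertible B \<Longrightarrow> dist B A < e \<Longrightarrow> B \<in> K" by auto
    have "B \<in> K" if "invertible B" "mbound (e / 5) (B - A)" for B
      using dist_mat2_le[OF that(2)] e that by (intro e(2)) auto
    then show "\<exists>s>0. \<forall>B. invertible B \<and> mbound s (B - A) \<longrightarrow> B \<in> K"
      using e(1) by (intro exI[of _ "e / 5"]) auto
  next
    assume "\<exists>s>0. \<forall>B. invertible B \<and> mbound s (B - A) \<longrightarrow> B \<in> K"
    then obtain s where s: "s > 0" "\<And>B. invertible B \<Longrightarrow> mbound s (B - A) \<Longrightarrow> B \<in> K" by auto
    show "\<exists>e>0. \<forall>B\<in>carrier GL2. dist B A < e \<longrightarrow> B \<in> K"
      using s(1) by (intro exI[of _ s]) (auto intro!: s(2) mbound_of_dist)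
  qed
  then show ?thesis unfolding openin_euclidean_subtopology_iff by simp
qed

lemma compact_mbound: "compact {A::'k::nonarch_local_field mat2. mbound M A}"
proof -
  let ?S = "{x::'k. nabs x \<le> M}"
  let ?f = "\<lambda>(a, b, c, d). mk a b c (d::'k)"
  have "?f = (\<lambda>x. \<chi> i j. if i = 1 then (if j = 1 then fst x else fst (snd x))
      else (if j = 1 then fst (snd (snd x)) else snd (snd (snd x))))"
    by (auto simp: fun_eq_iff mat2_eq_iff)
  moreover have "continuous_on A (\<lambda>x::'k \<times> 'k \<times> 'k \<times> 'k. \<chi> i j::2. if i = (1::2) then (if j = 1 then fst x else fst (snd x))
      else (if j = 1 then fst (snd (snd x)) else snd (snd (snd x))))" for A
  proof (intro continuous_on_vec_lambda)
    fix i j :: 2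
    show "continuous_on A (\<lambda>x::'k \<times> 'k \<times> 'k \<times> 'k. if i = (1::2) then (if j = (1::2) then fst x else fst (snd x))
      else (if j = 1 then fst (snd (snd x)) else snd (snd (snd x))))"
      by (cases "i = 1"; cases "j = 1") (auto intro!: continuous_intros)
  qed
  ultimately have "continuous_on (?S \<times> ?S \<times> ?S \<times> ?S) ?f" by simp
  then have "compact (?f ` (?S \<times> ?S \<times> ?S \<times> ?S))"
    by (intro compact_continuous_image compact_Times compact_nabs_le)
  also have "?f ` (?S \<times> ?S \<times> ?S \<times> ?S) = {A. mbound M A}"
  proof (rule Set.set_eqI)
    fix A :: "'k mat2"
    obtain a b c d where A: "A = mk a b c d" by (rule mat2_cases)
    show "A \<in> ?f ` (?S \<times> ?S \<times> ?S \<times> ?S) \<longleftrightarrow> A \<in> {A. mbound M A}"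
      by (auto simp: A mbound_mk image_iff)
  qed
  finally show ?thesis .
qed

text \<open>The principal congruence subgroups, a basis of neighbourhoods of the identity.\<close>

definition cong_subgroup :: "real \<Rightarrow> 'k::nonarch_local_field mat2 set" where
  "cong_subgroup s = {A. mbound s (A - mat 1)}"

lemma mk_minus: "mk a b c d - mk a' b' c' d' = mk (a - a') (b - b') (c - c') (d - (d'::'k::nonarch_local_field))"
  by (simp add: mat2_eq_iff)

lemma mem_cong_subgroup:
  "mk a b c d \<in> cong_subgroup s \<longleftrightarrow> nabs (a - 1) \<le> s \<and> nabs b \<le> s \<and> nabs c \<le> s \<and> nabs (d - 1) \<le> s"
  by (simp add: cong_subgroup_def mat_eq_mk mk_minus mbound_mk)

lemma cong_subgroup_det:
  assumes "A \<in> cong_subgroup s" "s < 1" shows "nabs (det A - 1) \<le> s"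
proof -
  obtain a b c d where A: "A = mk a b c d" by (rule mat2_cases)
  have h: "nabs (a - 1) \<le> s" "nabs b \<le> s" "nabs c \<le> s" "nabs (d - 1) \<le> s"
    using assms by (auto simp: A mem_cong_subgroup)
  have "nabs (b * c) \<le> s" using h assms nabs_ge_0[of c]
    by (simp add: nabs_mult) (meson less_imp_le mult_left_le nabs_ge_0 order_trans)
  from nabs_sub_le[OF nabs_near_1_mult[OF h(1,4) assms(2)] this]
  show ?thesis by (simp add: A algebra_simps)
qed

lemma cong_subgroup_invertible: "A \<in> cong_subgroup s \<Longrightarrow> s < 1 \<Longrightarrow> invertible A"
  using cong_subgroup_det[of A s] nabs_near_1[of "det A"] by (auto simp: invertible_iff_det)

lemma cong_subgroup_mono: "s \<le> s' \<Longrightarrow> cong_subgroup s \<subseteq> cong_subgroup s'"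
  by (auto simp: cong_subgroup_def intro: mbound_mono)

lemma cong_subgroup_inv:
  assumes "A \<in> cong_subgroup s" "s < 1" shows "matrix_inv A \<in> cong_subgroup s"
proof -
  obtain a b c d where A: "A = mk a b c d" by (rule mat2_cases)
  have h: "nabs (a - 1) \<le> s" "nabs b \<le> s" "nabs c \<le> s" "nabs (d - 1) \<le> s"
    using assms by (auto simp: A mem_cong_subgroup)
  let ?D = "a * d - b * c"
  have D: "nabs (?D - 1) \<le> s" using cong_subgroup_det[OF assms] by (simp add: A)
  then have D1: "nabs ?D = 1" "?D \<noteq> 0" using nabs_near_1[of ?D] assms(2) by auto
  show ?thesis
    unfolding A matrix_inv_mk[OF D1(2)] mem_cong_subgroup
    using h D D1 nabs_near_1_divide[OF h(1) D assms(2)] nabs_near_1_divide[OF h(4) D assms(2)]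
    by (simp add: nabs_divide)
qed

lemma subgroup_cong: assumes "0 < s" "s < 1" shows "subgroup (cong_subgroup s) (GL2 :: 'k::nonarch_local_field mat2 monoid)"
proof (rule group.subgroupI[OF group_GL2])
  show "cong_subgroup s \<subseteq> carrier (GL2 :: 'k mat2 monoid)" using cong_subgroup_invertible assms by auto
  have "mat 1 \<in> cong_subgroup s" using assms by (simp add: mat_eq_mk mem_cong_subgroup)
  then show "cong_subgroup s \<noteq> ({} :: 'k mat2 set)" by auto
  fix A B :: "'k mat2" assume A: "A \<in> cong_subgroup s" 
  then show "inv\<^bsub>GL2\<^esub> A \<in> cong_subgroup s"
    using cong_subgroup_inv[OF A assms(2)] inv_GL2[OF cong_subgroup_invertible[OF A assms(2)]] by simp
  assume B: "B \<in> cong_subgroup s"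
  have "A ** B - mat 1 = (A - mat 1) ** (B - mat 1) + ((A - mat 1) + (B - mat 1))"
    by (simp add: mat2_eq_iff mat_def mult_nth_2 algebra_simps)
  moreover have "mbound s ((A - mat 1) ** (B - mat 1))"
    using mbound_mult[of s "A - mat 1" s "B - mat 1"] A B assms
    by (auto simp: cong_subgroup_def mult_left_le intro: mbound_mono)
  ultimately show "A \<otimes>\<^bsub>GL2\<^esub> B \<in> cong_subgroup s"
    using A B unfolding mult_GL2 cong_subgroup_def mem_Collect_eq by (simp only: mbound_add)
qed

lemma openin_cong_subgroup:
  assumes "0 < s" "s < 1" shows "openin (top_of_set (carrier GL2)) (cong_subgroup s :: 'k::nonarch_local_field mat2 set)"
  unfolding openin_GL2_iff
proof (intro conjI ballI)
  show "cong_subgroup s \<subseteq> carrier (GL2 :: 'k mat2 monoid)" using cong_subgroup_invertible assms by auto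
  fix A :: "'k mat2" assume A: "A \<in> cong_subgroup s"
  have "B \<in> cong_subgroup s" if "mbound s (B - A)" for B
    using mbound_add[of s "B - A" "A - mat 1"] that A by (simp add: cong_subgroup_def)
  then show "\<exists>r>0. \<forall>B. invertible B \<and> mbound r (B - A) \<longrightarrow> B \<in> cong_subgroup s" using assms by blast
qed

lemma cong_subgroup_in_open:
  assumes "openin (top_of_set (carrier GL2)) K" "mat 1 \<in> K"
  shows "\<exists>s>0. s < 1 \<and> cong_subgroup s \<subseteq> (K :: 'k::nonarch_local_field mat2 set)"
proof -
  obtain s where s: "s > 0" "\<And>B. invertible B \<Longrightarrow> mbound s (B - mat 1) \<Longrightarrow> B \<in> K"
    using assms unfolding openin_GL2_iff by blast
  have "cong_subgroup (min s (1/2)) \<subseteq> K"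
  proof
    fix B :: "'k mat2" assume B: "B \<in> cong_subgroup (min s (1/2))"
    then have "mbound s (B - mat 1)" by (auto simp: cong_subgroup_def intro: mbound_mono)
    moreover have "invertible B" using cong_subgroup_invertible[OF B] by simp
    ultimately show "B \<in> K" by (rule s(2)[rotated])
  qed
  then show ?thesis using s(1) by (intro exI[of _ "min s (1/2)"]) auto
qed

lemma conj_cong_subgroup:
  fixes g :: "'k::nonarch_local_field mat2"
  assumes "invertible g" "0 < s"
  shows "\<exists>r>0. r < 1 \<and> (\<forall>h\<in>cong_subgroup r. matrix_inv g ** h ** g \<in> cong_subgroup s)"
proof -
  obtain M where M: "M > 0" "mbound M g" using mbound_exists by blast
  obtain N where N: "N > 0" "mbound N (matrix_inv g)" using mbound_exists by blast
  define r where "r = min (1/2) (s / (N * M))"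
  have r: "r > 0" "r < 1" "N * r * M \<le> s"
  proof -
    show "r > 0" "r < 1" using M N assms by (auto simp: r_def)
    have "r * (N * M) \<le> s" using M N by (simp add: r_def min_def pos_le_divide_eq[symmetric])
    then show "N * r * M \<le> s" by (simp add: mult.commute mult.left_commute)
  qed
  have "matrix_inv g ** h ** g \<in> cong_subgroup s" if h: "h \<in> cong_subgroup r" for h
  proof -
    have "matrix_inv g ** h ** g - mat 1 = matrix_inv g ** h ** g - matrix_inv g ** g" using assms by simp
    also have "\<dots> = matrix_inv g ** (h - mat 1) ** g"
      by (simp add: vec_eq_iff mult_nth_2 mat_def forall_2 algebra_simps)
    finally show ?thesis
      using mbound_mult[OF mbound_mult[OF N(2)] M(2), of r "h - mat 1"] h r(3)
      by (auto simp: cong_subgroup_def intro: mbound_mono)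
  qed
  then show ?thesis using r by blast
qed

lemma near_cong_subgroup:
  fixes A :: "'k::nonarch_local_field mat2"
  assumes "invertible A" "0 < s"
  shows "\<exists>r>0. \<forall>B. mbound r (B - A) \<longrightarrow> matrix_inv A ** B \<in> cong_subgroup s"
proof -
  obtain N where N: "N > 0" "mbound N (matrix_inv A)" using mbound_exists by blast
  have "matrix_inv A ** B \<in> cong_subgroup s" if "mbound (s / N) (B - A)" for B
  proof -
    have "mbound s (matrix_inv A ** (B - A))" using mbound_mult[OF N(2) that] N by simp
    moreover have "matrix_inv A ** (B - A) = matrix_inv A ** B - mat 1"
      unfolding matrix_inv_mult(2)[OF assms(1), symmetric] by (simp add: mat2_eq_iff mult_nth_2 algebra_simps)
    ultimately show ?thesis by (simp add: cong_subgroup_def)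
  qed
  moreover have "0 < s / N" using N assms by simp
  ultimately show ?thesis by blast
qed

section \<open>The principal series\<close>

text \<open>Upper and lower unipotent, diagonal, and the representatives \<open>w n(x)\<close> of the big Bruhat cell modulo \<open>B\<^sub>2\<close>.\<close>

definition upt :: "'k::nonarch_local_field \<Rightarrow> 'k mat2" where "upt h = mk 1 h 0 1"
definition lwt :: "'k::nonarch_local_field \<Rightarrow> 'k mat2" where "lwt h = mk 1 0 h 1"
definition dg :: "'k::nonarch_local_field \<Rightarrow> 'k \<Rightarrow> 'k mat2" where "dg x y = mk x 0 0 y"
definition uw :: "'k::nonarch_local_field \<Rightarrow> 'k mat2" where "uw x = mk 0 (-1) 1 x"

lemmas mk_defs = upt_def lwt_def dg_def uw_def

text \<open>Right translation, the action on functions.\<close>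

definition rtr :: "'k::nonarch_local_field mat2 \<Rightarrow> ('k mat2 \<Rightarrow> complex) \<Rightarrow> 'k mat2 \<Rightarrow> complex" where
  "rtr g f = (\<lambda>x. f (x ** g))"

text \<open>The restriction to the big cell, a function on the line.\<close>

definition phi :: "('k::nonarch_local_field mat2 \<Rightarrow> complex) \<Rightarrow> 'k \<Rightarrow> complex" where
  "phi f x = f (uw x)"

lemma invertible_mk_defs [simp]: "invertible (upt h)" "invertible (lwt h)" "invertible (uw h)"
    "invertible (dg x y) \<longleftrightarrow> x \<noteq> 0 \<and> y \<noteq> (0::'k::nonarch_local_field)" "invertible (mat 1 :: 'k mat2)"
  by (simp_all add: mk_defs mat_eq_mk)

lemma rtr_mult: "rtr (g ** h) f = rtr g (rtr h f)"
  by (simp add: rtr_def matrix_mul_assoc)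

lemma phi_add: "phi (\<lambda>x. f x + g x) = (\<lambda>x. phi f x + phi g x)"
  and phi_diff: "phi (\<lambda>x. f x - g x) = (\<lambda>x. phi f x - phi g x)"
  and phi_cmult: "phi (\<lambda>x. k * f x) = (\<lambda>x. k * phi f x)"
  and phi_0: "phi (\<lambda>x. 0) = (\<lambda>x. 0)"
  by (simp_all add: phi_def fun_eq_iff)

lemma phi_rtr_upt: "phi (rtr (upt h) f) = (\<lambda>x. phi f (x + h))"
  by (simp add: fun_eq_iff phi_def rtr_def mk_defs add.commute)

definition gstable :: "('k::nonarch_local_field mat2 \<Rightarrow> complex) set \<Rightarrow> bool" where
  "gstable W \<longleftrightarrow> lin_closed W \<and> (\<forall>g f. invertible g \<longrightarrow> f \<in> W \<longrightarrow> rtr g f \<in> W)"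

lemma gstableD: "gstable W \<Longrightarrow> lin_closed W" "gstable W \<Longrightarrow> invertible g \<Longrightarrow> f \<in> W \<Longrightarrow> rtr g f \<in> W"
  by (auto simp: gstable_def)

text \<open>The (unnormalized) principal series, smoothness being expressed by congruence subgroups. Absorbing
  \<open>\<delta>\<^sup>1\<^sup>/\<^sup>2\<close> into the two characters keeps square roots of absolute values out of the computations.\<close>

definition ps :: "('k::nonarch_local_field \<Rightarrow> complex) \<Rightarrow> ('k \<Rightarrow> complex) \<Rightarrow> ('k mat2 \<Rightarrow> complex) set" where
  "ps a c = {f. (\<forall>g. \<not> invertible g \<longrightarrow> f g = 0) \<and>
     (\<forall>b\<in>B2. \<forall>g. invertible g \<longrightarrow> f (b ** g) = a (b $ 1 $ 1) * c (b $ 2 $ 2) * f g) \<and>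
     (\<exists>s>0. s < 1 \<and> (\<forall>g. invertible g \<longrightarrow> (\<forall>h\<in>cong_subgroup s. f (g ** h) = f g)))}"

text \<open>It will turn out to be the kernel of the map onto the Jacquet module.\<close>

definition ps00 :: "('k::nonarch_local_field \<Rightarrow> complex) \<Rightarrow> ('k \<Rightarrow> complex) \<Rightarrow> ('k mat2 \<Rightarrow> complex) set" where
  "ps00 a c = {f \<in> ps a c. f (mat 1) = 0 \<and> haar (phi f) = 0}"

locale char_pair =
  fixes a c :: "'k::nonarch_local_field \<Rightarrow> complex"
  assumes char_a: "is_character a" and char_c: "is_character c"
begin

lemma ps_noninv: "f \<in> ps a c \<Longrightarrow> \<not> invertible g \<Longrightarrow> f g = 0"
  by (simp add: ps_def)

lemma ps_left: "f \<in> ps a c \<Longrightarrow> p \<noteq> 0 \<Longrightarrow> r \<noteq> 0 \<Longrightarrow> invertible g \<Longrightarrow> f (mk p q 0 r ** g) = a p * c r * f g"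
  using mem_B2[of p q 0 r] unfolding ps_def by fastforce

lemma ps_smooth: "f \<in> ps a c \<Longrightarrow> \<exists>s>0. s < 1 \<and> (\<forall>g. invertible g \<longrightarrow> (\<forall>h\<in>cong_subgroup s. f (g ** h) = f g))"
  by (simp add: ps_def)

lemma psI:
  assumes "\<And>g. \<not> invertible g \<Longrightarrow> f g = 0"
    "\<And>p q r g. p \<noteq> 0 \<Longrightarrow> r \<noteq> 0 \<Longrightarrow> invertible g \<Longrightarrow> f (mk p q 0 r ** g) = a p * c r * f g"
    "0 < s" "s < 1" "\<And>g h. invertible g \<Longrightarrow> h \<in> cong_subgroup s \<Longrightarrow> f (g ** h) = f g"
  shows "f \<in> ps a c"
proof -
  have "f (b ** g) = a (b $ 1 $ 1) * c (b $ 2 $ 2) * f g" if "b \<in> B2" "invertible g" for b g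
    using that(1) by (rule B2_cases) (simp add: assms(2) that(2))
  then show ?thesis using assms(1,3,4,5) unfolding ps_def by blast
qed

lemma lin_closed_ps: "lin_closed (ps a c)"
proof -
  have "(\<lambda>_. 0) \<in> ps a c" by (rule psI[of _ "1/2"]) auto
  moreover have "(\<lambda>x. f x + g x) \<in> ps a c" if f: "f \<in> ps a c" and g: "g \<in> ps a c" for f g
  proof -
    obtain s where s: "0 < s" "s < 1" "\<And>x h. invertible x \<Longrightarrow> h \<in> cong_subgroup s \<Longrightarrow> f (x ** h) = f x"
      using ps_smooth[OF f] by blast
    obtain t where t: "0 < t" "t < 1" "\<And>x h. invertible x \<Longrightarrow> h \<in> cong_subgroup t \<Longrightarrow> g (x ** h) = g x"
      using ps_smooth[OF g] by blast
    have sub: "cong_subgroup (min s t) \<subseteq> (cong_subgroup s :: 'k mat2 set)"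
      "cong_subgroup (min s t) \<subseteq> (cong_subgroup t :: 'k mat2 set)"
      by (rule cong_subgroup_mono, simp)+
    show ?thesis
    proof (rule psI[of _ "min s t"])
      fix x h :: "'k mat2" assume x: "invertible x" and h: "h \<in> cong_subgroup (min s t)"
      show "f (x ** h) + g (x ** h) = f x + g x"
        using s(3)[OF x subsetD[OF sub(1) h]] t(3)[OF x subsetD[OF sub(2) h]] by simp
    qed (use s t in \<open>auto simp: ps_noninv[OF f] ps_noninv[OF g] ps_left[OF f] ps_left[OF g] algebra_simps\<close>)
  qed
  moreover have "(\<lambda>x. k * f x) \<in> ps a c" if f: "f \<in> ps a c" for f k
  proof -
    obtain s where s: "0 < s" "s < 1" "\<And>x h. invertible x \<Longrightarrow> h \<in> cong_subgroup s \<Longrightarrow> f (x ** h) = f x"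
      using ps_smooth[OF f] by blast
    show ?thesis
      by (rule psI[OF _ _ s(1,2)]) (auto simp: ps_noninv[OF f] ps_left[OF f] s(3) algebra_simps)
  qed
  ultimately show ?thesis by (simp add: lin_closed_def)
qed

lemma rtr_ps: assumes f: "f \<in> ps a c" and g: "invertible g" shows "rtr g f \<in> ps a c"
proof -
  obtain s where s: "0 < s" "s < 1" "\<And>x h. invertible x \<Longrightarrow> h \<in> cong_subgroup s \<Longrightarrow> f (x ** h) = f x"
    using ps_smooth[OF f] by blast
  obtain r where r: "0 < r" "r < 1" "\<And>h. h \<in> cong_subgroup r \<Longrightarrow> matrix_inv g ** h ** g \<in> cong_subgroup s"
    using conj_cong_subgroup[OF g s(1)] by blast
  show ?thesis
  proof (rule psI[OF _ _ r(1,2)])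
    fix x h :: "'k mat2" assume x: "invertible x" and h: "h \<in> cong_subgroup r"
    have "g ** (matrix_inv g ** h ** g) = h ** g"
      using g by (metis matrix_inv_mult(1) matrix_mul_assoc matrix_mul_lid)
    then have "f (x ** h ** g) = f ((x ** g) ** (matrix_inv g ** h ** g))"
      by (metis matrix_mul_assoc)
    also have "\<dots> = f (x ** g)" using x g by (intro s(3) r(3) h) (simp add: invertible_mult_iff)
    finally show "rtr g f (x ** h) = rtr g f x" by (simp add: rtr_def)
  next
    fix x :: "'k mat2" assume "\<not> invertible x"
    then show "rtr g f x = 0" using ps_noninv[OF f, of "x ** g"] by (simp add: rtr_def invertible_mult_iff)
  next
    fix p q r :: 'k and x :: "'k mat2" assume "p \<noteq> 0" "r \<noteq> 0" "invertible x"
    then show "rtr g f (mk p q 0 r ** x) = a p * c r * rtr g f x"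
      using ps_left[OF f, of p r "x ** g" q] g by (simp add: rtr_def invertible_mult_iff matrix_mul_assoc)
  qed
qed

lemma ps_upper: assumes "f \<in> ps a c" "p \<noteq> 0" "r \<noteq> 0" shows "f (mk p q 0 r) = a p * c r * f (mat 1)"
  using ps_left[OF assms, of "mat 1" q] by simp

lemma ps_bruhat:
  assumes "f \<in> ps a c" "r \<noteq> 0" "p * s - q * r \<noteq> 0"
  shows "f (mk p q r s) = a ((p * s - q * r) / r) * c r * phi f (s / r)"
proof -
  have "mk p q r s = mk ((p * s - q * r) / r) p 0 r ** uw (s / r)"
    using assms(2) by (simp add: mk_defs field_simps)
  then show ?thesis using ps_left[OF assms(1), of "(p * s - q * r) / r" r "uw (s / r)" p] assms(2,3)
    by (simp add: phi_def)
qed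

text \<open>By the Bruhat decomposition, the identity and the elements \<open>w n(x)\<close> represent all orbits of \<open>B\<^sub>2\<close> acting from the left.\<close>

lemma ps_ext:
  assumes f: "f \<in> ps a c" and f': "f' \<in> ps a c" and eq: "f (mat 1) = f' (mat 1)" "phi f = phi f'"
  shows "f = f'"
proof
  fix g :: "'k mat2"
  obtain p q r s where g: "g = mk p q r s" by (rule mat2_cases)
  show "f g = f' g"
  proof (cases "invertible g")
    case False then show ?thesis using ps_noninv f f' by metis
  next
    case True
    then have d: "p * s - q * r \<noteq> 0" by (simp add: g)
    show ?thesis
    proof (cases "r = 0")
      case True
      then have "p \<noteq> 0" "s \<noteq> 0" using d by auto
      then show ?thesis using ps_upper[OF f] ps_upper[OF f'] eq(1) True by (simp add: g)
    next
      case False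
      then show ?thesis using ps_bruhat[OF f False d] ps_bruhat[OF f' False d] eq(2) by (simp add: g)
    qed
  qed
qed

lemma phi_ball_inv: assumes "f \<in> ps a c" shows "\<exists>b. b \<noteq> (0::'k) \<and> ball_inv (nabs b) (phi f)"
proof -
  obtain s where s: "0 < s" "s < 1" "\<And>x h. invertible x \<Longrightarrow> h \<in> cong_subgroup s \<Longrightarrow> f (x ** h) = f x"
    using ps_smooth[OF assms] by blast
  obtain b :: 'k where b: "b \<noteq> 0" "nabs b \<le> s" using small_element[OF s(1)] by blast
  have "phi f x = phi f y" if "nabs (x - y) \<le> nabs b" for x y
  proof -
    have "upt (x - y) \<in> cong_subgroup s" using that b s by (simp add: upt_def mem_cong_subgroup)
    then have "f (uw y ** upt (x - y)) = f (uw y)" by (intro s(3)) auto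
    then show ?thesis by (simp add: phi_def mk_defs)
  qed
  then show ?thesis using b(1) unfolding ball_inv_def by blast
qed

text \<open>Near infinity \<open>w n(x)\<close> differs from the identity by an element of \<open>B\<^sub>2\<close> on the left and a small lower unipotent
  element on the right.\<close>

lemma phi_schwartz: assumes f: "f \<in> ps a c" "f (mat 1) = 0" shows "schwartz (phi f)"
proof -
  obtain s where s: "0 < s" "s < 1" "\<And>x h. invertible x \<Longrightarrow> h \<in> cong_subgroup s \<Longrightarrow> f (x ** h) = f x"
    using ps_smooth[OF f(1)] by blast
  have "phi f x = 0" if x: "1 / s < nabs x" for x
  proof -
    have "0 < nabs x" using x s(1) by (meson divide_pos_pos order_less_trans zero_less_one)
    then have x0: "x \<noteq> 0" by auto
    then have "nabs (1 / x) \<le> s" using x s(1) by (simp add: nabs_divide field_simps less_imp_le)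
    then have "lwt (1 / x) \<in> cong_subgroup s" using s by (simp add: lwt_def mem_cong_subgroup)
    from s(3)[OF _ this, of "mat 1"] have "f (lwt (1 / x)) = 0" using f(2) by simp
    moreover have "uw x = mk (1 / x) (-1) 0 x ** lwt (1 / x)" using x0 by (simp add: mk_defs)
    ultimately show ?thesis using ps_left[OF f(1), of "1/x" x "lwt (1/x)" "-1"] x0 by (simp add: phi_def)
  qed
  then have "supp_in (1 / s) (phi f)" by (simp add: supp_in_def)
  moreover obtain b :: 'k where "b \<noteq> 0" "ball_inv (nabs b) (phi f)" using phi_ball_inv[OF f(1)] by blast
  ultimately show ?thesis unfolding schwartz_def by (metis nabs_pos)
qed

text \<open>Extend \<open>\<phi>\<close> from the big cell by zero. For smoothness let \<open>R\<close> bound the support and write points of the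
  support as \<open>x = s/r\<close> with \<open>(r, s)\<close> the bottom row. A right translation by a congruence subgroup of
  radius \<open>m / R\<^sup>2\<close> moves \<open>x\<close> by at most \<open>m\<close> and changes the arguments of \<open>a\<close> and \<open>c\<close> by factors within
  \<open>m\<close> of \<open>1\<close>. The region \<open>\<bar>x\<bar> \<le> R\<close> is preserved, and so is its complement, because the translations
  form a group.\<close>

lemma phi_surj:
  assumes \<phi>: "schwartz \<phi>"
  shows "\<exists>f\<in>ps a c. f (mat 1) = 0 \<and> phi f = \<phi>"
proof -
  obtain b :: 'k and R0 where bR: "b \<noteq> 0" "nabs b \<le> R0" "ball_inv (nabs b) \<phi>" "supp_in R0 \<phi>"
    using schwartz_witness2[OF \<phi> \<phi>] by blast
  define R where "R = max 1 R0"
  have R: "1 \<le> R" "supp_in R \<phi>" using supp_in_mono[OF bR(4), of R] by (auto simp: R_def)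
  obtain sa where sa: "0 < sa" "\<And>x. nabs (x - 1) \<le> sa \<Longrightarrow> a x = 1" using character_locally_trivial[OF char_a] by blast
  obtain sc where sc: "0 < sc" "\<And>x. nabs (x - 1) \<le> sc \<Longrightarrow> c x = 1" using character_locally_trivial[OF char_c] by blast
  define m where "m = min (min sa sc) (min (nabs b) (1/2))"
  have m: "0 < m" "m \<le> sa" "m \<le> sc" "m \<le> nabs b" "m < 1" using sa(1) sc(1) bR(1) by (auto simp: m_def)
  define s where "s = m / (R * R)"
  have s: "0 < s" "R * R * s = m" using m R by (auto simp: s_def)
  have sR: "R * s \<le> m" "s \<le> R * s" using s R
    by (metis less_eq_real_def mult.assoc mult_le_cancel_right1 mult_pos_pos not_one_le_zero order_less_le_trans zero_less_one linorder_not_le)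
       (use s R in simp)
  then have s1: "s < 1" using m by linarith
  define f :: "'k mat2 \<Rightarrow> complex" where "f g = (if invertible g \<and> g $ 2 $ 1 \<noteq> 0
     then a (det g / g $ 2 $ 1) * c (g $ 2 $ 1) * \<phi> (g $ 2 $ 2 / g $ 2 $ 1) else 0)" for g
  define big where "big g \<longleftrightarrow> g $ 2 $ 1 \<noteq> 0 \<and> nabs (g $ 2 $ 2) \<le> R * nabs (g $ 2 $ 1)" for g :: "'k mat2"
  have f0: "f g = 0" if "\<not> big g" for g
  proof (cases "g $ 2 $ 1 = 0")
    case False
    then have "R < nabs (g $ 2 $ 2 / g $ 2 $ 1)" using that by (simp add: big_def nabs_divide pos_less_divide_eq)
    then have "\<phi> (g $ 2 $ 2 / g $ 2 $ 1) = 0" using R(2) by (simp add: supp_in_def)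
    then show ?thesis by (simp add: f_def)
  qed (simp add: f_def)
  have step: "big (g ** h) \<and> f (g ** h) = f g" if g: "invertible g" "big g" and h: "h \<in> cong_subgroup s" for g h
  proof -
    obtain p q r t where gm: "g = mk p q r t" by (rule mat2_cases)
    obtain \<alpha> \<beta> \<gamma> \<delta> where hm: "h = mk \<alpha> \<beta> \<gamma> \<delta>" by (rule mat2_cases)
    have hs: "nabs (\<alpha> - 1) \<le> s" "nabs \<beta> \<le> s" "nabs \<gamma> \<le> s" "nabs (\<delta> - 1) \<le> s"
      using h by (auto simp: hm mem_cong_subgroup)
    have r: "r \<noteq> 0" using g(2) by (simp add: big_def gm)
    define x where "x = t / r"
    have x: "nabs x \<le> R" "t = x * r" using g(2) r by (auto simp: big_def gm x_def nabs_divide pos_divide_le_eq)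
    define d where "d = \<alpha> + x * \<gamma>"
    have xg: "nabs (x * \<gamma>) \<le> R * s" unfolding nabs_mult using x hs R by (intro mult_mono) auto
    have d1: "nabs (d - 1) \<le> R * s"
    proof -
      have "nabs (\<alpha> - 1) \<le> R * s" using hs sR by linarith
      from nabs_add_le[OF this xg] show ?thesis by (simp add: d_def algebra_simps)
    qed
    have dm: "nabs (d - 1) \<le> m" "nabs (d - 1) < 1" using d1 sR m by linarith+
    have dn: "nabs d = 1" "d \<noteq> 0" using nabs_near_1[OF dm(2)] by auto
    define y where "y = (\<beta> + x * \<delta>) / d"
    have gh: "(g ** h) $ 2 $ 1 = r * d" "(g ** h) $ 2 $ 2 = r * d * y"
    proof -
      show "(g ** h) $ 2 $ 1 = r * d" by (simp add: gm hm d_def x(2) algebra_simps)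
      have "d * y = \<beta> + x * \<delta>" using dn by (simp add: y_def)
      then have "r * d * y = r * (\<beta> + x * \<delta>)" by (simp only: mult.assoc)
      then show "(g ** h) $ 2 $ 2 = r * d * y" by (simp add: gm hm x(2) algebra_simps)
    qed
    have yx: "nabs (y - x) \<le> m"
    proof -
      have "y - x = ((\<beta> + x * (\<delta> - 1)) - x * (d - 1)) / d" using dn by (simp add: y_def field_simps)
      moreover have "nabs \<beta> \<le> m" using hs sR by linarith
      moreover have "nabs (x * (\<delta> - 1)) \<le> R * s" unfolding nabs_mult using x hs R by (intro mult_mono) auto
      moreover have "nabs (x * (d - 1)) \<le> R * (R * s)" unfolding nabs_mult using x d1 R by (intro mult_mono) auto
      ultimately have "nabs (\<beta> + x * (\<delta> - 1) - x * (d - 1)) \<le> m"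
        using sR(1) s(2) by (intro nabs_sub_le nabs_add_le) (simp_all add: mult.assoc)
      then show ?thesis unfolding \<open>y - x = _\<close> using dn by (simp add: nabs_divide)
    qed
    have y: "nabs y \<le> R" using nabs_add_le[of "y - x" R x] yx x m R by auto
    have big': "big (g ** h)" unfolding big_def gh using r dn y by (simp add: nabs_mult mult.commute)
    have inv': "invertible (g ** h)" using g h s1 cong_subgroup_invertible by (auto simp: invertible_mult_iff)
    have deth: "nabs (det h / d - 1) \<le> m"
    proof (rule nabs_near_1_divide[OF _ dm(1) m(5)])
      show "nabs (det h - 1) \<le> m" using cong_subgroup_det[OF h s1] sR by linarith
    qed
    have "a (det (g ** h) / (r * d)) = a (det g / r * (det h / d))" by (simp add: det_mul)
    also have "\<dots> = a (det g / r)"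
    proof -
      have "det g / r \<noteq> 0" "det h / d \<noteq> 0"
        using g r dn h s1 cong_subgroup_invertible[of h s] by (auto simp: invertible_iff_det)
      moreover have "a (det h / d) = 1" using deth m by (intro sa(2)) linarith
      ultimately show ?thesis using character_mult[OF char_a, of "det g / r" "det h / d"] by (metis mult.right_neutral)
    qed
    finally have A: "a (det (g ** h) / (r * d)) = a (det g / r)" .
    have C: "c (r * d) = c r"
      using character_mult[OF char_c r dn(2)] sc(2)[of d] dm m by simp
    have P: "\<phi> y = \<phi> x" using yx m by (intro ball_invD[OF bR(3)]) linarith
    have "f (g ** h) = a (det (g ** h) / (r * d)) * c (r * d) * \<phi> y"
      unfolding f_def gh using inv' r dn by simp
    also have "\<dots> = f g" unfolding A C P using g r by (simp add: f_def gm x_def)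
    finally show ?thesis using big' by blast
  qed
  have "f \<in> ps a c"
  proof (rule psI[OF _ _ s(1) s1])
    fix g h :: "'k mat2" assume g: "invertible g" and h: "h \<in> cong_subgroup s"
    show "f (g ** h) = f g"
    proof (cases "big g")
      case True then show ?thesis using step g h by blast
    next
      case False
      have "\<not> big (g ** h)"
      proof
        assume b: "big (g ** h)"
        have "invertible h" using cong_subgroup_invertible[OF h s1] .
        then have "big (g ** h ** matrix_inv h)"
          using step[OF _ b cong_subgroup_inv[OF h s1]] g by (simp add: invertible_mult_iff)
        moreover have "g ** h ** matrix_inv h = g"
          using \<open>invertible h\<close> by (metis matrix_inv_mult(1) matrix_mul_assoc matrix_mul_rid)
        ultimately show False using False by simp
      qed
      then show ?thesis using False f0 by simp
    qed
  next
    fix p q r :: 'k and g assume h: "p \<noteq> 0" "r \<noteq> 0" "invertible (g::'k mat2)"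
    have g21: "(mk p q 0 r ** g) $ 2 $ 1 = r * g $ 2 $ 1" "(mk p q 0 r ** g) $ 2 $ 2 = r * g $ 2 $ 2"
      by (simp_all add: mult_nth_2)
    have inv: "invertible (mk p q 0 r ** g)" using h by (simp add: invertible_mult_iff)
    show "f (mk p q 0 r ** g) = a p * c r * f g"
    proof (cases "g $ 2 $ 1 = 0")
      case True then show ?thesis by (simp add: f_def g21)
    next
      case False
      have dg0: "det g / g $ 2 $ 1 \<noteq> 0" using h False by (simp add: invertible_iff_det)
      have "a (det (mk p q 0 r ** g) / (r * g $ 2 $ 1)) = a (p * (det g / g $ 2 $ 1))"
        using h by (simp add: det_mul)
      also have "\<dots> = a p * a (det g / g $ 2 $ 1)" using character_mult[OF char_a h(1) dg0] .
      finally show ?thesis unfolding f_def g21 using h False inv character_mult[OF char_c h(2) False] by simp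
    qed
  qed (simp add: f_def)
  moreover have "f (mat 1) = 0" by (simp add: f_def mat_eq_mk)
  moreover have "phi f = \<phi>"
    using character_1[OF char_a] character_1[OF char_c] by (simp add: fun_eq_iff phi_def f_def uw_def)
  ultimately show ?thesis by blast
qed

lemma phi_rtr_dg:
  assumes "f \<in> ps a c" "x \<noteq> 0" "y \<noteq> 0"
  shows "phi (rtr (dg x y) f) = (\<lambda>z. a y * c x * phi f (y / x * z))"
proof
  fix z
  have "uw z ** dg x y = mk y 0 0 x ** uw (y / x * z)" using assms(2) by (simp add: mk_defs)
  then show "phi (rtr (dg x y) f) z = a y * c x * phi f (y / x * z)"
    using ps_left[OF assms(1) assms(3,2), of "uw (y / x * z)" 0] by (simp add: phi_def rtr_def)
qed

lemma rtr_upt_at_1: "f \<in> ps a c \<Longrightarrow> rtr (upt h) f (mat 1) = f (mat 1)"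
  using ps_upper[of f 1 1 h] character_1[OF char_a] character_1[OF char_c] by (simp add: rtr_def upt_def)

lemma rtr_dg_at_1: "f \<in> ps a c \<Longrightarrow> x \<noteq> 0 \<Longrightarrow> y \<noteq> 0 \<Longrightarrow> rtr (dg x y) f (mat 1) = a x * c y * f (mat 1)"
  using ps_upper[of f x y 0] by (simp add: rtr_def dg_def)

lemma haar_rtr_dg:
  assumes "f \<in> ps a c" "f (mat 1) = 0" "x \<noteq> 0" "y \<noteq> 0"
  shows "haar (phi (rtr (dg x y) f)) = of_real (nabs x / nabs y) * a y * c x * haar (phi f)"
proof -
  have "schwartz (\<lambda>z. phi f (y / x * z))" using assms by (intro schwartz_dilate phi_schwartz) auto
  then show ?thesis
    using assms haar_dilate[OF phi_schwartz[OF assms(1,2)], of "y / x"]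
    by (simp add: phi_rtr_dg[OF assms(1,3,4)] haar_cmult nabs_divide)
qed

lemma lin_closed_ps00: "lin_closed (ps00 a c)"
  using lin_closed_zero[OF lin_closed_ps] lin_closed_add[OF lin_closed_ps] lin_closed_cmult[OF lin_closed_ps]
    haar_cmult[OF phi_schwartz, of "\<lambda>_. 0" 0]
  unfolding lin_closed_def ps00_def
  by (auto simp: phi_add phi_cmult haar_add phi_schwartz haar_cmult phi_0)

lemma rtr_upt_ps00: assumes "f \<in> ps00 a c" shows "rtr (upt h) f \<in> ps00 a c"
  using assms rtr_ps[of f "upt h"] rtr_upt_at_1[of f h] haar_translate[OF phi_schwartz, of f h]
  by (simp add: ps00_def phi_rtr_upt)

lemma rtr_dg_ps00: assumes "f \<in> ps00 a c" "x \<noteq> 0" "y \<noteq> 0" shows "rtr (dg x y) f \<in> ps00 a c"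
  using assms rtr_ps[of f "dg x y"] rtr_dg_at_1[of f x y] haar_rtr_dg[of f x y]
  by (simp add: ps00_def)

text \<open>The unipotent group acts trivially on the quotient by \<open>ps00\<close>.\<close>

lemma unipotent_diff_ps00:
  assumes "f \<in> ps a c" shows "(\<lambda>x. rtr (upt h) f x - f x) \<in> ps00 a c"
proof -
  let ?d = "\<lambda>x. rtr (upt h) f x - f x"
  have d: "?d \<in> ps a c" by (intro lin_closed_diff[OF lin_closed_ps] rtr_ps assms) simp
  have d1: "?d (mat 1) = 0" using rtr_upt_at_1[OF assms] by simp
  obtain b :: 'k where b: "b \<noteq> 0" "ball_inv (nabs b) (phi f)" using phi_ball_inv[OF assms] by blast
  have "phi ?d = (\<lambda>x. phi f (x + h) - phi f x)" by (simp add: phi_diff phi_rtr_upt)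
  then have "haar (phi ?d) = 0"
    using haar_translate_diff[OF b, of h] phi_schwartz[OF d d1] by simp
  then show ?thesis using d d1 by (simp add: ps00_def)
qed

text \<open>Restriction to the big cell turns unipotent matrices into translations and diagonal ones, up to scalars,
  into dilations.\<close>

lemma ps00_irreducible:
  assumes U: "lin_closed U" "U \<subseteq> ps00 a c" "\<And>f h. f \<in> U \<Longrightarrow> rtr (upt h) f \<in> U"
    "\<And>f x y. f \<in> U \<Longrightarrow> x \<noteq> 0 \<Longrightarrow> y \<noteq> 0 \<Longrightarrow> rtr (dg x y) f \<in> U"
    and f: "f \<in> U" "f \<noteq> (\<lambda>_. 0)"
  shows "ps00 a c \<subseteq> U"
proof
  fix f' assume f': "f' \<in> ps00 a c"
  have lin: "lin_closed (phi ` U)"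
    unfolding lin_closed_def
  proof (intro conjI allI ballI)
    show "(\<lambda>_. 0) \<in> phi ` U" using lin_closed_zero[OF U(1)]
      by (intro image_eqI[of _ phi "\<lambda>_. 0"]) (simp_all only: phi_0)
    fix \<phi> assume "\<phi> \<in> phi ` U"
    then obtain g where g: "g \<in> U" "\<phi> = phi g" by blast
    show "(\<lambda>x. k * \<phi> x) \<in> phi ` U" for k
      using lin_closed_cmult[OF U(1) g(1), of k]
      by (intro image_eqI[of _ phi "\<lambda>x. k * g x"]) (simp_all only: g(2) phi_cmult)
    fix \<psi> assume "\<psi> \<in> phi ` U"
    then obtain g' where g': "g' \<in> U" "\<psi> = phi g'" by blast
    show "(\<lambda>x. \<phi> x + \<psi> x) \<in> phi ` U"
      using lin_closed_add[OF U(1) g(1) g'(1)]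
      by (intro image_eqI[of _ phi "\<lambda>x. g x + g' x"]) (simp_all only: g(2) g'(2) phi_add)
  qed
  have "phi f \<noteq> (\<lambda>_. 0)"
    using ps_ext[of f "\<lambda>_. 0"] f U(2) lin_closed_zero[OF lin_closed_ps] by (auto simp: ps00_def phi_0)
  then obtain x0 where x0: "phi f x0 \<noteq> 0" by auto
  have "phi f' \<in> phi ` U"
  proof (rule integral_zero_irreducible[OF lin _ _ _ imageI[OF f(1)] x0])
    fix \<phi> assume "\<phi> \<in> phi ` U"
    then obtain g where g: "g \<in> U" "\<phi> = phi g" by blast
    have gps: "g \<in> ps a c" "g (mat 1) = 0" using g U(2) by (auto simp: ps00_def)
    show "schwartz \<phi>" using phi_schwartz gps g by simp
    show "(\<lambda>x. \<phi> (x + h)) \<in> phi ` U" for h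
      using U(3)[OF g(1), of h] g(2) phi_rtr_upt[of h g] by (metis imageI)
    fix \<alpha> :: 'k assume \<alpha>: "\<alpha> \<noteq> 0"
    have "(\<lambda>x. inverse (a \<alpha>) * rtr (dg 1 \<alpha>) g x) \<in> U"
      using U(4)[OF g(1), of 1 \<alpha>] \<alpha> by (intro lin_closed_cmult[OF U(1)]) auto
    moreover have "phi (\<lambda>x. inverse (a \<alpha>) * rtr (dg 1 \<alpha>) g x) = (\<lambda>x. \<phi> (\<alpha> * x))"
      using phi_rtr_dg[OF gps(1), of 1 \<alpha>] \<alpha> character_1[OF char_c] character_nonzero[OF char_a \<alpha>] g(2)
      by (simp add: phi_cmult mult.assoc[symmetric])
    ultimately show "(\<lambda>x. \<phi> (\<alpha> * x)) \<in> phi ` U" by (metis imageI)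
  qed (use f' phi_schwartz in \<open>auto simp: ps00_def\<close>)
  then obtain g where g: "g \<in> U" "phi f' = phi g" by blast
  then have "f' = g" using ps_ext[of f' g] f' U(2) by (auto simp: ps00_def)
  then show "f' \<in> U" using g by simp
qed

lemma sub_contains_ps00:
  assumes W: "gstable W" "W \<subseteq> ps a c" and f: "f \<in> W" "f \<in> ps00 a c" "f \<noteq> (\<lambda>_. 0)"
  shows "ps00 a c \<subseteq> W"
proof -
  have "lin_closed (W \<inter> ps00 a c)"
    using gstableD(1)[OF W(1)] lin_closed_ps00 by (auto simp: lin_closed_def)
  then have "ps00 a c \<subseteq> W \<inter> ps00 a c"
    using f gstableD(2)[OF W(1)]
    by (intro ps00_irreducible[of _ f]) (auto intro: rtr_upt_ps00 rtr_dg_ps00)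
  then show ?thesis by blast
qed

text \<open>If \<open>W\<close> meets \<open>ps00\<close> trivially, then upper unipotent matrices fix every vector of \<open>W\<close>, since they move it
  by an element of \<open>ps00\<close>. Conjugating by the Weyl element, so do the lower ones, and together they generate
  \<open>SL\<^sub>2\<close>. Comparing with the equivariance under \<open>B\<^sub>2\<close> forces \<open>a = c\<close>.\<close>

lemma sub_is_line:
  assumes W: "gstable W" "W \<subseteq> ps a c" and triv: "W \<inter> ps00 a c \<subseteq> {\<lambda>_. 0}"
    and f: "f \<in> W" "f \<noteq> (\<lambda>_. 0)"
  shows "\<And>x. x \<noteq> 0 \<Longrightarrow> a x = c x" and "f (mat 1) \<noteq> 0"
    and "\<And>g. invertible g \<Longrightarrow> f g = a (det g) * f (mat 1)"
proof -
  have up: "f' (g ** upt h) = f' g" if f': "f' \<in> W" for f' g h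
  proof -
    have "(\<lambda>x. rtr (upt h) f' x - f' x) \<in> W \<inter> ps00 a c"
      using W f' by (auto intro!: lin_closed_diff unipotent_diff_ps00 gstableD)
    then have "(\<lambda>x. rtr (upt h) f' x - f' x) = (\<lambda>_. 0)" using triv by blast
    from fun_cong[OF this, of g] show ?thesis by (simp add: rtr_def)
  qed
  have lw: "f (g ** lwt h) = f g" for g h
  proof -
    have "rtr (uw 0) f \<in> W" by (rule gstableD(2)[OF W(1) _ f(1)]) simp
    from up[OF this, of "g ** mk 0 1 (-1) 0" "- h"]
    have "f (g ** (mk 0 1 (-1) 0 ** upt (- h) ** uw 0)) = f (g ** (mk 0 1 (-1) 0 ** uw 0))"
      by (simp only: rtr_def matrix_mul_assoc)
    moreover have "mk 0 1 (-1) 0 ** upt (- h) ** uw 0 = lwt h" "mk 0 1 (-1) 0 ** uw 0 = (mat 1 :: 'k mat2)"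
      by (simp_all add: mk_defs mat_eq_mk)
    ultimately show ?thesis by simp
  qed
  have fps: "f \<in> ps a c" using f W by auto
  have phi: "phi f x = f (mat 1)" for x
  proof -
    have "uw x = mat 1 ** upt (-1) ** lwt 1 ** upt (-1) ** upt x" by (simp add: mk_defs mat_eq_mk)
    then have "f (uw x) = f (mat 1)" by (simp only: up[OF f(1)] lw)
    then show ?thesis by (simp add: phi_def)
  qed
  show f1: "f (mat 1) \<noteq> 0"
  proof
    assume "f (mat 1) = 0"
    then have "f = (\<lambda>_. 0)"
      using phi by (intro ps_ext fps lin_closed_zero[OF lin_closed_ps]) (auto simp: phi_0 fun_eq_iff)
    then show False using f by simp
  qed
  show ac: "a x = c x" if x: "x \<noteq> 0" for x
  proof -
    have "f (mat 1) = f (lwt x)" using lw[of "mat 1" x] by simp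
    also have "\<dots> = a (1 / x) * c x * f (mat 1)"
      using ps_bruhat[OF fps x, of 1 1 0] phi by (simp add: lwt_def)
    finally have "a (1 / x) * c x = 1" using f1 by simp
    then show ?thesis
      using character_nonzero[OF char_a x] character_divide[OF char_a _ x, of 1] character_1[OF char_a] by simp
  qed
  fix g :: "'k mat2" assume g: "invertible g"
  obtain p q r s where gm: "g = mk p q r s" by (rule mat2_cases)
  have d: "p * s - q * r \<noteq> 0" using g by (simp add: gm)
  show "f g = a (det g) * f (mat 1)"
  proof (cases "r = 0")
    case True
    then have "p \<noteq> 0" "s \<noteq> 0" using d by auto
    then show ?thesis using ps_upper[OF fps, of p s q] ac True character_mult[OF char_a, of p s] by (simp add: gm)
  next
    case False
    have "a ((p * s - q * r) / r) * c r = a (p * s - q * r)"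
      using ac[OF False] character_mult[OF char_a, of "(p * s - q * r) / r" r] False d by simp
    then show ?thesis using ps_bruhat[OF fps False d] phi by (simp add: gm)
  qed
qed

text \<open>Unipotent matrices, hence all of \<open>SL\<^sub>2\<close>, act trivially on the quotient of \<open>ps a c\<close> by \<open>W\<close>. If \<open>W\<close> contained a
  function vanishing at \<open>1\<close> with integral one, it would also contain a translate of it not vanishing at \<open>1\<close>, and
  would be everything. So such a function survives in the quotient, where \<open>diag(t, 1/t)\<close> acts on it by
  \<open>\<kappa> = \<bar>t\<bar>\<^sup>2 a(t)\<^sup>-\<^sup>1 c(t)\<close>; therefore \<open>\<kappa> = 1\<close>.\<close>

lemma proper_sub_exponent:
  assumes W: "gstable W" "W \<subseteq> ps a c" "ps00 a c \<subseteq> W" "W \<noteq> ps a c" and t: "t \<noteq> 0"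
  shows "a t = of_real (nabs t * nabs t) * c t"
proof -
  note lin = gstableD(1)[OF W(1)] and stab = gstableD(2)[OF W(1)]
  define S where "S = {k. invertible k \<and> (\<forall>f\<in>ps a c. (\<lambda>x. rtr k f x - f x) \<in> W)}"
  have upS: "upt h \<in> S" for h using unipotent_diff_ps00 W(3) by (auto simp: S_def)
  have multS: "k ** k' \<in> S" if k: "k \<in> S" and k': "k' \<in> S" for k k'
  proof -
    have "(\<lambda>x. rtr (k ** k') f x - f x) \<in> W" if f: "f \<in> ps a c" for f
    proof -
      have "(\<lambda>x. (rtr k (rtr k' f) x - rtr k' f x) + (rtr k' f x - f x)) \<in> W"
        using k k' f rtr_ps by (intro lin_closed_add[OF lin]) (auto simp: S_def)
      then show ?thesis by (simp add: rtr_mult)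
    qed
    then show ?thesis using k k' by (auto simp: S_def invertible_mult_iff)
  qed
  have lwS: "lwt h \<in> S" for h
  proof -
    let ?v = "mk 0 1 (-1) 0 :: 'k mat2"
    have eq: "lwt h = ?v ** (upt (- h) ** uw 0)" and eq2: "?v ** uw 0 = mat 1" by (simp_all add: mk_defs mat_eq_mk)
    have "(\<lambda>x. rtr (lwt h) f x - f x) \<in> W" if f: "f \<in> ps a c" for f
    proof -
      let ?f = "rtr (uw 0) f"
      have "rtr ?v (\<lambda>x. rtr (upt (- h)) ?f x - ?f x) \<in> W"
        using upS[of "- h"] f rtr_ps by (intro stab) (auto simp: S_def)
      also have "rtr ?v (\<lambda>x. rtr (upt (- h)) ?f x - ?f x) = (\<lambda>x. rtr (lwt h) f x - rtr (?v ** uw 0) f x)"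
        by (simp only: eq rtr_mult) (simp add: rtr_def)
      also have "\<dots> = (\<lambda>x. rtr (lwt h) f x - f x)" unfolding eq2 by (simp add: rtr_def)
      finally show ?thesis .
    qed
    then show ?thesis by (simp add: S_def)
  qed
  have wS: "uw 0 \<in> S"
  proof -
    have "uw 0 = upt (-1) ** lwt 1 ** upt (-1 :: 'k)" by (simp add: mk_defs)
    then show ?thesis by (simp only: multS upS lwS)
  qed
  have dgS: "dg t (1 / t) \<in> S"
  proof -
    have "dg t (1 / t) = upt t ** lwt (- 1 / t) ** upt t ** uw 0" using t by (simp add: mk_defs)
    then show ?thesis by (simp only: multS upS lwS wS)
  qed
  obtain f0 where f0: "f0 \<in> ps a c" "f0 (mat 1) = 0" "phi f0 = ball_ind 1"
    using phi_surj[OF schwartz_ball_ind[of 1]] by auto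
  have h0: "haar (phi f0) = 1" using f0(3) haar_ball_ind[of "1::'k"] by simp
  have f0W: "f0 \<notin> W"
  proof
    assume f0W: "f0 \<in> W"
    define e where "e = rtr (uw 0) f0"
    have e: "e \<in> W" "e \<in> ps a c" using stab[OF _ f0W] rtr_ps f0 by (auto simp: e_def)
    have "phi f0 0 = 1" using f0(3) by (simp add: ball_ind_def)
    then have e1: "e (mat 1) = 1" by (simp add: e_def rtr_def phi_def)
    have "f \<in> W" if f: "f \<in> ps a c" for f
    proof -
      define f1 where "f1 = (\<lambda>x. f x - f (mat 1) * e x)"
      have f1: "f1 \<in> ps a c" "f1 (mat 1) = 0"
        unfolding f1_def using e e1 f by (auto intro: lin_closed_diff[OF lin_closed_ps] lin_closed_cmult[OF lin_closed_ps])
      define f2 where "f2 = (\<lambda>x. f1 x + (- haar (phi f1)) * f0 x)"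
      have "f2 \<in> ps a c" unfolding f2_def
        using f1 f0 by (intro lin_closed_add[OF lin_closed_ps] lin_closed_cmult[OF lin_closed_ps])
      moreover have "haar (phi f2) = 0"
        unfolding f2_def phi_add phi_cmult
        using haar_add[OF phi_schwartz[OF f1] schwartz_cmult[OF phi_schwartz[OF f0(1,2)], of "- haar (phi f1)"]]
          haar_cmult[OF phi_schwartz[OF f0(1,2)], of "- haar (phi f1)"] h0 by simp
      ultimately have "f2 \<in> W" using W(3) f0 f1 by (auto simp: ps00_def f2_def)
      from lin_closed_add[OF lin lin_closed_add[OF lin this lin_closed_cmult[OF lin f0W, of "haar (phi f1)"]]
          lin_closed_cmult[OF lin e(1), of "f (mat 1)"]]
      show ?thesis by (simp add: f2_def f1_def)
    qed
    then show False using W(2,4) by blast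
  qed
  define \<kappa> where "\<kappa> = of_real (nabs t / nabs (1 / t)) * a (1 / t) * c t"
  have t': "1 / t \<noteq> 0" using t by simp
  let ?f1 = "rtr (dg t (1 / t)) f0"
  have f1: "?f1 \<in> ps a c" "?f1 (mat 1) = 0" using f0 t rtr_ps rtr_dg_at_1[OF f0(1) t t'] by auto
  define g where "g = (\<lambda>x. ?f1 x + (- \<kappa>) * f0 x)"
  have "haar (phi g) = 0"
    unfolding g_def phi_add phi_cmult
    using haar_add[OF phi_schwartz[OF f1] schwartz_cmult[OF phi_schwartz[OF f0(1,2)], of "- \<kappa>"]]
      haar_cmult[OF phi_schwartz[OF f0(1,2)], of "- \<kappa>"] h0 haar_rtr_dg[OF f0(1,2) t t']
    by (simp add: \<kappa>_def)
  moreover have "g \<in> ps a c" unfolding g_def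
    using f1 f0 by (intro lin_closed_add[OF lin_closed_ps] lin_closed_cmult[OF lin_closed_ps])
  ultimately have gW: "g \<in> W" using W(3) f1 f0 by (auto simp: ps00_def g_def)
  have "(\<lambda>x. ?f1 x - f0 x) \<in> W" using dgS f0(1) by (simp add: S_def)
  from lin_closed_diff[OF lin this gW] have k: "(\<lambda>x. (\<kappa> - 1) * f0 x) \<in> W"
    by (simp add: g_def algebra_simps)
  have "\<kappa> = 1"
  proof (rule ccontr)
    assume "\<kappa> \<noteq> 1"
    then have "(\<lambda>x. inverse (\<kappa> - 1) * ((\<kappa> - 1) * f0 x)) = f0" by (simp add: fun_eq_iff)
    then show False using lin_closed_cmult[OF lin k, of "inverse (\<kappa> - 1)"] f0W by simp
  qed
  then show ?thesis
    using character_nonzero[OF char_a t] character_divide[OF char_a _ t, of 1] character_1[OF char_a]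
    by (simp add: \<kappa>_def nabs_divide)
qed

end

section \<open>Representations on complex vector spaces\<close>

lemma complex_ring_simps [simp]: "carrier complex_ring = UNIV" "add complex_ring = (+)"
    "monoid.mult complex_ring = (*)" "zero complex_ring = 0" "one complex_ring = 1"
  by (simp_all add: complex_ring_def)

lemma cring_complex_ring: "cring complex_ring"
proof (rule cringI)
  show "abelian_group complex_ring"
    by (rule abelian_groupI) (auto intro: exI[of _ "- x" for x] simp: add.assoc add.commute)
  show "comm_monoid complex_ring"
    by (rule comm_monoidI) (auto simp: mult.assoc mult.commute)
qed (auto simp: algebra_simps)

text \<open>The module axioms with the scalars of \<open>complex_ring\<close> replaced by plain complex numbers. Differences are written
  \<open>u \<oplus> (-1) \<odot> v\<close>, so that addition and scalar multiplication suffice.\<close>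

locale cvec =
  fixes V :: "('g, 'v) rep" (structure)
  assumes modV: "Module.module complex_ring V"
begin

sublocale M: abelian_group V
  using modV by (simp add: Module.module_def)

lemma smul_closed [simp, intro]: "v \<in> carrier V \<Longrightarrow> k \<odot> v \<in> carrier V"
  using module.smult_closed[OF modV] by simp

lemma smul_add_left: "v \<in> carrier V \<Longrightarrow> (j + k) \<odot> v = j \<odot> v \<oplus> k \<odot> v"
  using module.smult_l_distr[OF modV, of j k v] by simp

lemma smul_add_right: "u \<in> carrier V \<Longrightarrow> v \<in> carrier V \<Longrightarrow> k \<odot> (u \<oplus> v) = k \<odot> u \<oplus> k \<odot> v"
  using module.smult_r_distr[OF modV, of k u v] by simp

lemma smul_smul [simp]: "v \<in> carrier V \<Longrightarrow> j \<odot> (k \<odot> v) = (j * k) \<odot> v"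
  using module.smult_assoc1[OF modV, of j k v] by simp

lemma smul_1 [simp]: "v \<in> carrier V \<Longrightarrow> 1 \<odot> v = v"
  using module.smult_one[OF modV, of v] by simp

lemma smul_0 [simp]: "v \<in> carrier V \<Longrightarrow> 0 \<odot> v = \<zero>"
  using module.smult_l_null[OF modV, of v] by simp

lemma smul_zero [simp]: "k \<odot> \<zero> = \<zero>"
  using module.smult_r_null[OF modV, of k] by simp

lemma a_inv_eq: "v \<in> carrier V \<Longrightarrow> \<ominus> v = (-1) \<odot> v"
  using smul_add_left[of v "-1" 1] M.minus_equality[of "(-1) \<odot> v" v] by simp

lemma minus_eq': "u \<in> carrier V \<Longrightarrow> v \<in> carrier V \<Longrightarrow> u \<ominus> v = u \<oplus> (-1) \<odot> v"
  by (simp add: a_minus_def a_inv_eq)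

lemma add_neg [simp]: "v \<in> carrier V \<Longrightarrow> v \<oplus> (-1) \<odot> v = \<zero>"
  using smul_add_left[of v 1 "-1"] by simp

lemma sub_add_cancel: "u \<in> carrier V \<Longrightarrow> v \<in> carrier V \<Longrightarrow> (v \<oplus> (-1) \<odot> u) \<oplus> u = v"
  using add_neg[of u] M.a_comm[of "(-1) \<odot> u" u] by (simp only: M.a_assoc smul_closed M.r_zero)

lemma submoduleI':
  assumes "W \<subseteq> carrier V" "\<zero> \<in> W" "\<And>u v. u \<in> W \<Longrightarrow> v \<in> W \<Longrightarrow> u \<oplus> v \<in> W"
    "\<And>k v. v \<in> W \<Longrightarrow> k \<odot> v \<in> W"
  shows "submodule W complex_ring V"
  using assms a_inv_eq by (intro module.submoduleI[OF modV]) (auto simp: subset_iff)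

lemma submoduleD:
  assumes "submodule W complex_ring V"
  shows "W \<subseteq> carrier V" "\<zero> \<in> W" "u \<in> W \<Longrightarrow> v \<in> W \<Longrightarrow> u \<oplus> v \<in> W" "v \<in> W \<Longrightarrow> k \<odot> v \<in> W"
proof -
  show 1: "W \<subseteq> carrier V" "u \<in> W \<Longrightarrow> v \<in> W \<Longrightarrow> u \<oplus> v \<in> W" "v \<in> W \<Longrightarrow> k \<odot> v \<in> W" for u v k
    using module.submoduleE[OF modV assms] by auto
  obtain w where "w \<in> W" using module.submoduleE(2)[OF modV assms] by blast
  then show "\<zero> \<in> W" using 1(3)[of w 0] 1(1) smul_0[of w] by auto
qed

lemma coset_mem:
  assumes W: "submodule W complex_ring V" and v: "v \<in> carrier V"
  shows "x \<in> W +>\<^bsub>V\<^esub> v \<longleftrightarrow> x \<in> carrier V \<and> x \<oplus> (-1) \<odot> v \<in> W"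
proof
  assume "x \<in> W +>\<^bsub>V\<^esub> v"
  then obtain h where h: "h \<in> W" "x = h \<oplus> v" by (auto simp: a_r_coset_def')
  then have "h \<in> carrier V" using submoduleD(1)[OF W] by auto
  then show "x \<in> carrier V \<and> x \<oplus> (-1) \<odot> v \<in> W" using h v by (simp add: M.a_assoc)
next
  assume x: "x \<in> carrier V \<and> x \<oplus> (-1) \<odot> v \<in> W"
  have "x = (x \<oplus> (-1) \<odot> v) \<oplus> v"
    using x v add_neg[OF v] by (simp add: M.a_assoc M.a_comm[of "(-1) \<odot> v" v])
  then show "x \<in> W +>\<^bsub>V\<^esub> v" using x unfolding a_r_coset_def' by blast
qed

lemma coset_eq:
  assumes W: "submodule W complex_ring V" and u: "u \<in> carrier V" and v: "v \<in> carrier V"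
  shows "W +>\<^bsub>V\<^esub> u = W +>\<^bsub>V\<^esub> v \<longleftrightarrow> u \<oplus> (-1) \<odot> v \<in> W"
proof
  have "u \<in> W +>\<^bsub>V\<^esub> u" using coset_mem[OF W u, of u] u submoduleD(2)[OF W] by simp
  moreover assume "W +>\<^bsub>V\<^esub> u = W +>\<^bsub>V\<^esub> v"
  ultimately show "u \<oplus> (-1) \<odot> v \<in> W" using coset_mem[OF W v] by simp
next
  assume uv: "u \<oplus> (-1) \<odot> v \<in> W"
  have vu: "v \<oplus> (-1) \<odot> u \<in> W"
    using submoduleD(4)[OF W uv, of "-1"] u v by (simp add: smul_add_right M.a_comm)
  have tr: "x \<oplus> (-1) \<odot> w \<in> W" if "x \<oplus> (-1) \<odot> y \<in> W" "y \<oplus> (-1) \<odot> w \<in> W" "x \<in> carrier V" "y \<in> carrier V" "w \<in> carrier V" for x y w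
  proof -
    have "(x \<oplus> (-1) \<odot> y) \<oplus> (y \<oplus> (-1) \<odot> w) = x \<oplus> (((-1) \<odot> y \<oplus> y) \<oplus> (-1) \<odot> w)"
      using that by (simp add: M.a_assoc)
    also have "(-1) \<odot> y \<oplus> y = \<zero>" using that by (simp add: M.a_comm[of _ y])
    finally show ?thesis using submoduleD(3)[OF W that(1,2)] that by simp
  qed
  show "W +>\<^bsub>V\<^esub> u = W +>\<^bsub>V\<^esub> v"
    using tr[OF _ uv] tr[OF _ vu] u v by (auto simp: coset_mem[OF W u] coset_mem[OF W v])
qed

end

locale grep = 
  fixes G :: "'g monoid" and V :: "('g, 'v) rep" (structure)
  assumes repV: "representation G V"
begin

sublocale cvec V
  by (rule cvec.intro) (use repV in \<open>simp add: representation_def\<close>)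

sublocale G: group G
  using repV by (simp add: representation_def)

lemma act_closed [simp, intro]: "g \<in> carrier G \<Longrightarrow> v \<in> carrier V \<Longrightarrow> act V g v \<in> carrier V"
  and act_add: "g \<in> carrier G \<Longrightarrow> u \<in> carrier V \<Longrightarrow> v \<in> carrier V \<Longrightarrow> act V g (u \<oplus> v) = act V g u \<oplus> act V g v"
  and act_smul: "g \<in> carrier G \<Longrightarrow> v \<in> carrier V \<Longrightarrow> act V g (k \<odot> v) = k \<odot> act V g v"
  and act_one [simp]: "v \<in> carrier V \<Longrightarrow> act V \<one>\<^bsub>G\<^esub> v = v"
  and act_mult: "g \<in> carrier G \<Longrightarrow> h \<in> carrier G \<Longrightarrow> v \<in> carrier V \<Longrightarrow> act V (g \<otimes>\<^bsub>G\<^esub> h) v = act V g (act V h v)"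
  using repV by (auto simp: representation_def linear_maps_def Pi_def)

lemma act_zero [simp]: "g \<in> carrier G \<Longrightarrow> act V g \<zero> = \<zero>"
  using act_smul[of g \<zero> 0] by simp

lemma subrepI:
  assumes "W \<subseteq> carrier V" "\<zero> \<in> W" "\<And>u v. u \<in> W \<Longrightarrow> v \<in> W \<Longrightarrow> u \<oplus> v \<in> W"
    "\<And>k v. v \<in> W \<Longrightarrow> k \<odot> v \<in> W" "\<And>g v. g \<in> carrier G \<Longrightarrow> v \<in> W \<Longrightarrow> act V g v \<in> W"
  shows "subrep G V W"
  using assms submoduleI'[OF assms(1-4)] by (simp add: subrep_def)

lemma subrepD:
  assumes "subrep G V W"
  shows "submodule W complex_ring V" "W \<subseteq> carrier V" "\<zero> \<in> W" "u \<in> W \<Longrightarrow> v \<in> W \<Longrightarrow> u \<oplus> v \<in> W"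
    "v \<in> W \<Longrightarrow> k \<odot> v \<in> W" "g \<in> carrier G \<Longrightarrow> v \<in> W \<Longrightarrow> act V g v \<in> W"
  using assms submoduleD[of W] by (auto simp: subrep_def)

lemma subrep_carrier: "subrep G V (carrier V)"
  by (rule subrepI) auto

lemma subrep_zero: "subrep G V {\<zero>}"
  by (rule subrepI) auto

lemma subrep_restrict: assumes "subrep G V U" shows "representation G (V\<lparr>carrier := U\<rparr>)"
proof -
  have "Module.module complex_ring (V\<lparr>carrier := U\<rparr>)"
    using submodule.submodule_is_module[OF subrepD(1)[OF assms] modV] .
  then show ?thesis
    using assms repV subrepD[OF assms] unfolding representation_def linear_maps_def
    by (auto simp: Pi_def subset_iff)
qed

lemma subrep_of_restrict:
  assumes U: "subrep G V U" shows "subrep G (V\<lparr>carrier := U\<rparr>) W \<longleftrightarrow> subrep G V W \<and> W \<subseteq> U"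
proof
  interpret U: grep G "V\<lparr>carrier := U\<rparr>" by unfold_locales (rule subrep_restrict[OF U])
  assume W: "subrep G (V\<lparr>carrier := U\<rparr>) W"
  show "subrep G V W \<and> W \<subseteq> U"
    using U.subrepD(2-)[OF W] subrepD(2)[OF U] by (intro conjI subrepI) auto
next
  interpret U: grep G "V\<lparr>carrier := U\<rparr>" by unfold_locales (rule subrep_restrict[OF U])
  assume W: "subrep G V W \<and> W \<subseteq> U"
  then show "subrep G (V\<lparr>carrier := U\<rparr>) W"
    using subrepD[of W] by (intro U.subrepI) auto
qed

end


subsection \<open>Quotients\<close>

locale qrep = grep +
  fixes W assumes subW: "subrep G V W"
begin

definition proj where "proj v = W +>\<^bsub>V\<^esub> v"

abbreviation Q where "Q \<equiv> quot_rep V W"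

lemmas subWD = subrepD[OF subW]

lemma proj_eq: "u \<in> carrier V \<Longrightarrow> v \<in> carrier V \<Longrightarrow> proj u = proj v \<longleftrightarrow> u \<oplus> (-1) \<odot> v \<in> W"
  unfolding proj_def by (rule coset_eq[OF subWD(1)])

lemma mem_proj: "v \<in> carrier V \<Longrightarrow> x \<in> proj v \<longleftrightarrow> x \<in> carrier V \<and> proj x = proj v"
  using coset_mem[OF subWD(1), of v x] proj_eq[of x v] by (auto simp: proj_def)

lemma proj_self: "v \<in> carrier V \<Longrightarrow> v \<in> proj v"
  by (simp add: mem_proj)

lemma carrier_Q: "carrier Q = proj ` carrier V"
  by (auto simp: quot_rep_def A_RCOSETS_def' proj_def)

lemma proj_closed [simp, intro]: "v \<in> carrier V \<Longrightarrow> proj v \<in> carrier Q"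
  by (simp add: carrier_Q)

lemma proj_eq_zero: "v \<in> carrier V \<Longrightarrow> proj v = proj \<zero> \<longleftrightarrow> v \<in> W"
  by (simp add: proj_eq)

lemma zero_Q: "\<zero>\<^bsub>Q\<^esub> = proj \<zero>"
proof -
  have "proj \<zero> = W" using subWD(2) by (auto simp: mem_proj proj_eq_zero)
  then show ?thesis by (simp add: quot_rep_def)
qed

lemma proj_zero_iff: "v \<in> carrier V \<Longrightarrow> proj v = \<zero>\<^bsub>Q\<^esub> \<longleftrightarrow> v \<in> W"
  by (simp add: zero_Q proj_eq_zero)

lemma add_Q: assumes "u \<in> carrier V" "v \<in> carrier V" shows "proj u \<oplus>\<^bsub>Q\<^esub> proj v = proj (u \<oplus> v)"
proof -
  have "abelian_subgroup W V"
    using subWD(1) by (intro abelian_subgroupI3 additive_subgroup.intro M.abelian_group_axioms)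
      (simp_all add: submodule_def)
  then show ?thesis using abelian_subgroup.a_rcos_sum[of W V u v] assms by (simp add: quot_rep_def proj_def)
qed

lemma smul_Q: assumes v: "v \<in> carrier V" shows "k \<odot>\<^bsub>Q\<^esub> proj v = proj (k \<odot> v)"
proof -
  have "W +>\<^bsub>V\<^esub> (k \<odot> x) = proj (k \<odot> v)" if "x \<in> proj v" for x
  proof -
    have x: "x \<in> carrier V" "x \<oplus> (-1) \<odot> v \<in> W" using that v by (auto simp: mem_proj proj_eq)
    have "k \<odot> x \<oplus> (-1) \<odot> (k \<odot> v) = k \<odot> (x \<oplus> (-1) \<odot> v)" using x v by (simp add: smul_add_right)
    then have "proj (k \<odot> x) = proj (k \<odot> v)" using x v subWD(5)[OF x(2), of k] by (simp add: proj_eq)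
    then show ?thesis by (simp add: proj_def)
  qed
  then show ?thesis using proj_self[OF v] by (auto simp: quot_rep_def)
qed

lemma act_Q: assumes g: "g \<in> carrier G" and v: "v \<in> carrier V" shows "act Q g (proj v) = proj (act V g v)"
proof -
  have "W +>\<^bsub>V\<^esub> (act V g x) = proj (act V g v)" if "x \<in> proj v" for x
  proof -
    have x: "x \<in> carrier V" "x \<oplus> (-1) \<odot> v \<in> W" using that v by (auto simp: mem_proj proj_eq)
    have "act V g x \<oplus> (-1) \<odot> (act V g v) = act V g (x \<oplus> (-1) \<odot> v)" using x v g by (simp add: act_add act_smul)
    then have "proj (act V g x) = proj (act V g v)" using x v g subWD(6)[OF g x(2)] by (simp add: proj_eq)
    then show ?thesis by (simp add: proj_def)
  qed
  then show ?thesis using proj_self[OF v] by (auto simp: quot_rep_def)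
qed

lemma carrier_Q_cases: assumes "X \<in> carrier Q" obtains v where "v \<in> carrier V" "X = proj v"
  using assms by (auto simp: carrier_Q)

lemma module_Q: "Module.module complex_ring Q"
proof (rule moduleI[OF cring_complex_ring])
  show "abelian_group Q"
  proof (rule abelian_groupI)
    fix X Y Z assume X: "X \<in> carrier Q" and Y: "Y \<in> carrier Q"
    obtain x where x: "x \<in> carrier V" "X = proj x" using X by (rule carrier_Q_cases)
    obtain y where y: "y \<in> carrier V" "Y = proj y" using Y by (rule carrier_Q_cases)
    show "X \<oplus>\<^bsub>Q\<^esub> Y \<in> carrier Q" using x y by (simp add: add_Q)
    show "X \<oplus>\<^bsub>Q\<^esub> Y = Y \<oplus>\<^bsub>Q\<^esub> X" using x y by (simp add: add_Q M.a_comm)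
    show "\<zero>\<^bsub>Q\<^esub> \<oplus>\<^bsub>Q\<^esub> X = X" using x by (simp add: zero_Q add_Q)
    show "\<exists>Y\<in>carrier Q. Y \<oplus>\<^bsub>Q\<^esub> X = \<zero>\<^bsub>Q\<^esub>"
      using x by (intro bexI[of _ "proj ((-1) \<odot> x)"]) (simp_all add: zero_Q add_Q M.a_comm[of _ x])
    assume Z: "Z \<in> carrier Q"
    obtain z where z: "z \<in> carrier V" "Z = proj z" using Z by (rule carrier_Q_cases)
    show "X \<oplus>\<^bsub>Q\<^esub> Y \<oplus>\<^bsub>Q\<^esub> Z = X \<oplus>\<^bsub>Q\<^esub> (Y \<oplus>\<^bsub>Q\<^esub> Z)" using x y z by (simp add: add_Q M.a_assoc)
  next
    show "\<zero>\<^bsub>Q\<^esub> \<in> carrier Q" by (simp add: zero_Q)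
  qed
next
  fix j k X assume X: "X \<in> carrier Q"
  obtain x where x: "x \<in> carrier V" "X = proj x" using X by (rule carrier_Q_cases)
  show "j \<odot>\<^bsub>Q\<^esub> X \<in> carrier Q" using x by (simp add: smul_Q)
  show "(j \<oplus>\<^bsub>complex_ring\<^esub> k) \<odot>\<^bsub>Q\<^esub> X = j \<odot>\<^bsub>Q\<^esub> X \<oplus>\<^bsub>Q\<^esub> k \<odot>\<^bsub>Q\<^esub> X"
    using x by (simp add: smul_Q add_Q smul_add_left)
  show "(j \<otimes>\<^bsub>complex_ring\<^esub> k) \<odot>\<^bsub>Q\<^esub> X = j \<odot>\<^bsub>Q\<^esub> (k \<odot>\<^bsub>Q\<^esub> X)" using x by (simp add: smul_Q)
  show "\<one>\<^bsub>complex_ring\<^esub> \<odot>\<^bsub>Q\<^esub> X = X" using x by (simp add: smul_Q)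
  fix Y assume Y: "Y \<in> carrier Q"
  obtain y where y: "y \<in> carrier V" "Y = proj y" using Y by (rule carrier_Q_cases)
  show "j \<odot>\<^bsub>Q\<^esub> (X \<oplus>\<^bsub>Q\<^esub> Y) = j \<odot>\<^bsub>Q\<^esub> X \<oplus>\<^bsub>Q\<^esub> j \<odot>\<^bsub>Q\<^esub> Y"
    using x y by (simp add: smul_Q add_Q smul_add_right)
qed

lemma rep_Q: "representation G Q"
  unfolding representation_def linear_maps_def
proof (intro conjI ballI CollectI allI)
  show "group G" by (rule G.group_axioms)
  show "Module.module complex_ring Q" by (rule module_Q)
  show "act Q g \<in> carrier Q \<rightarrow> carrier Q" if "g \<in> carrier G" for g
    using that by (auto simp: act_Q carrier_Q)
  fix X assume X: "X \<in> carrier Q"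
  obtain x where x: "x \<in> carrier V" "X = proj x" using X by (rule carrier_Q_cases)
  show "act Q \<one>\<^bsub>G\<^esub> X = X" using x by (simp add: act_Q)
  fix g assume g: "g \<in> carrier G"
  show "act Q g (k \<odot>\<^bsub>Q\<^esub> X) = k \<odot>\<^bsub>Q\<^esub> act Q g X" for k using x g by (simp add: act_Q smul_Q act_smul)
  show "act Q (g \<otimes>\<^bsub>G\<^esub> h) X = act Q g (act Q h X)" if "h \<in> carrier G" for h
    using x g that by (simp add: act_Q act_mult)
  show "act Q g (X \<oplus>\<^bsub>Q\<^esub> Y) = act Q g X \<oplus>\<^bsub>Q\<^esub> act Q g Y" if Y: "Y \<in> carrier Q" for Y
  proof -
    obtain y where y: "y \<in> carrier V" "Y = proj y" using Y by (rule carrier_Q_cases)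
    show ?thesis using x y g by (simp add: act_Q add_Q act_add)
  qed
qed

sublocale Q: grep G Q by unfold_locales (rule rep_Q)

lemma subrep_vimage:
  assumes X: "subrep G Q X" shows "subrep G V {v \<in> carrier V. proj v \<in> X}" "W \<subseteq> {v \<in> carrier V. proj v \<in> X}"
    "X = proj ` {v \<in> carrier V. proj v \<in> X}"
proof -
  note XD = Q.subrepD[OF X]
  show "subrep G V {v \<in> carrier V. proj v \<in> X}"
    using XD(3-) by (intro subrepI) (auto simp: zero_Q simp flip: add_Q smul_Q act_Q)
  show "W \<subseteq> {v \<in> carrier V. proj v \<in> X}"
  proof
    fix w assume w: "w \<in> W"
    then have "w \<in> carrier V" using subWD(2) by auto
    then show "w \<in> {v \<in> carrier V. proj v \<in> X}" using w XD(3) proj_zero_iff[of w] by simp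
  qed
  show "X = proj ` {v \<in> carrier V. proj v \<in> X}" using XD(2) by (auto simp: carrier_Q)
qed

lemma subrep_image: assumes U: "subrep G V U" shows "subrep G Q (proj ` U)"
proof -
  note UD = subrepD[OF U]
  have c: "u \<in> U \<Longrightarrow> u \<in> carrier V" for u using UD(2) by auto
  show ?thesis
    using UD(3-) by (intro Q.subrepI) (auto simp: zero_Q add_Q smul_Q act_Q c intro!: imageI)
qed

lemma irreducible_Q_iff:
  "irreducible_rep G Q \<longleftrightarrow> W \<noteq> carrier V \<and> (\<forall>U. subrep G V U \<longrightarrow> W \<subseteq> U \<longrightarrow> U = W \<or> U = carrier V)"
proof -
  have triv: "carrier Q = {\<zero>\<^bsub>Q\<^esub>} \<longleftrightarrow> W = carrier V"
  proof
    assume h: "carrier Q = {\<zero>\<^bsub>Q\<^esub>}"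
    show "W = carrier V"
    proof
      show "carrier V \<subseteq> W"
      proof
        fix v assume v: "v \<in> carrier V"
        then have "proj v = \<zero>\<^bsub>Q\<^esub>" using h proj_closed[OF v] by auto
        then show "v \<in> W" using v by (simp add: proj_zero_iff)
      qed
    qed (rule subWD(2))
  next
    assume "W = carrier V"
    then have "proj v = \<zero>\<^bsub>Q\<^esub>" if "v \<in> carrier V" for v using that proj_zero_iff[OF that] by blast
    then have "carrier Q \<subseteq> {\<zero>\<^bsub>Q\<^esub>}" unfolding carrier_Q by blast
    moreover have "\<zero>\<^bsub>Q\<^esub> \<in> carrier Q" by (rule Q.M.zero_closed)
    ultimately show "carrier Q = {\<zero>\<^bsub>Q\<^esub>}" by blast
  qed
  have "(\<forall>X. subrep G Q X \<longrightarrow> X = {\<zero>\<^bsub>Q\<^esub>} \<or> X = carrier Q) \<longleftrightarrow>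
      (\<forall>U. subrep G V U \<longrightarrow> W \<subseteq> U \<longrightarrow> U = W \<or> U = carrier V)"
  proof (intro iffI allI impI)
    fix U assume h: "\<forall>X. subrep G Q X \<longrightarrow> X = {\<zero>\<^bsub>Q\<^esub>} \<or> X = carrier Q" and U: "subrep G V U" "W \<subseteq> U"
    note UD = subrepD[OF U(1)]
    have mem: "v \<in> U" if v: "v \<in> carrier V" "proj v \<in> proj ` U" for v
    proof -
      obtain u where u: "u \<in> U" "proj v = proj u" using v by auto
      then have "u \<in> carrier V" using UD(2) by auto
      then have "v \<oplus> (-1) \<odot> u \<in> U" "u \<in> carrier V" using u v U(2) proj_eq by auto
      moreover have "v = (v \<oplus> (-1) \<odot> u) \<oplus> u" using sub_add_cancel v \<open>u \<in> carrier V\<close> by simp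
      ultimately show ?thesis using UD(4) u(1) by metis
    qed
    from h subrep_image[OF U(1)] have "proj ` U = {\<zero>\<^bsub>Q\<^esub>} \<or> proj ` U = carrier Q" by blast
    then show "U = W \<or> U = carrier V"
    proof
      assume "proj ` U = {\<zero>\<^bsub>Q\<^esub>}"
      moreover have "v \<in> W" if "v \<in> U" "proj v = \<zero>\<^bsub>Q\<^esub>" for v
        using that UD(2) proj_zero_iff[of v] by blast
      ultimately have "U \<subseteq> W" by blast
      then show ?thesis using U(2) by auto
    next
      assume "proj ` U = carrier Q"
      then have "carrier V \<subseteq> U" using mem by auto
      then show ?thesis using UD(2) by auto
    qed
  next
    fix X assume h: "\<forall>U. subrep G V U \<longrightarrow> W \<subseteq> U \<longrightarrow> U = W \<or> U = carrier V" and X: "subrep G Q X"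
    note sv = subrep_vimage[OF X]
    from h sv(1,2) have "{v \<in> carrier V. proj v \<in> X} = W \<or> {v \<in> carrier V. proj v \<in> X} = carrier V" by blast
    then show "X = {\<zero>\<^bsub>Q\<^esub>} \<or> X = carrier Q"
    proof
      assume e: "{v \<in> carrier V. proj v \<in> X} = W"
      have "proj ` W = {\<zero>\<^bsub>Q\<^esub>}" using subWD(2,3) proj_zero_iff zero_Q by (auto intro!: image_eqI[of _ _ \<zero>])
      then show ?thesis using sv(3) e by simp
    next
      assume e: "{v \<in> carrier V. proj v \<in> X} = carrier V"
      then show ?thesis using sv(3) by (simp add: carrier_Q)
    qed
  qed
  then show ?thesis unfolding irreducible_rep_def using triv rep_Q by auto
qed

end


subsection \<open>Linear functionals and their descent to quotients\<close>

definition lfun :: "('g, 'v) rep \<Rightarrow> ('v \<Rightarrow> complex) \<Rightarrow> bool" where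
  "lfun V l \<longleftrightarrow> (\<forall>u\<in>carrier V. \<forall>v\<in>carrier V. l (u \<oplus>\<^bsub>V\<^esub> v) = l u + l v) \<and>
     (\<forall>k. \<forall>v\<in>carrier V. l (k \<odot>\<^bsub>V\<^esub> v) = k * l v)"

lemma lfun_add: "lfun V l \<Longrightarrow> u \<in> carrier V \<Longrightarrow> v \<in> carrier V \<Longrightarrow> l (u \<oplus>\<^bsub>V\<^esub> v) = l u + l v"
  and lfun_smul: "lfun V l \<Longrightarrow> v \<in> carrier V \<Longrightarrow> l (k \<odot>\<^bsub>V\<^esub> v) = k * l v"
  by (auto simp: lfun_def)

lemma (in cvec) lfun_zero: "lfun V l \<Longrightarrow> l \<zero> = 0"
  using lfun_smul[of V l \<zero> 0] by simp

text \<open>The functional induced on cosets; it is meaningful when \<open>l\<close> vanishes on the subspace.\<close>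

definition descend :: "('v \<Rightarrow> complex) \<Rightarrow> 'v set \<Rightarrow> complex" where
  "descend l X = l (SOME x. x \<in> X)"

context qrep begin

lemma descend_proj:
  assumes l: "lfun V l" "\<And>w. w \<in> W \<Longrightarrow> l w = 0" and v: "v \<in> carrier V"
  shows "descend l (proj v) = l v"
proof -
  let ?x = "SOME x. x \<in> proj v"
  have "?x \<in> proj v" using proj_self[OF v] by (rule someI)
  then have x: "?x \<in> carrier V" "?x \<oplus> (-1) \<odot> v \<in> W" using v by (auto simp: mem_proj proj_eq)
  have "l ?x + (-1) * l v = l (?x \<oplus> (-1) \<odot> v)"
    using x v by (simp only: lfun_add[OF l(1)] lfun_smul[OF l(1)] smul_closed)
  then show ?thesis using l(2)[OF x(2)] by (simp add: descend_def)
qed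

lemma lfun_descend:
  assumes l: "lfun V l" "\<And>w. w \<in> W \<Longrightarrow> l w = 0" shows "lfun Q (descend l)"
  unfolding lfun_def
  by (auto simp: carrier_Q add_Q smul_Q descend_proj[OF l] lfun_add[OF l(1)] lfun_smul[OF l(1)])

end


subsection \<open>Composition series and semisimplification\<close>

lemma composition_seriesD:
  assumes "composition_series G V n F"
  shows "F 0 = {\<zero>\<^bsub>V\<^esub>}" "F n = carrier V" "\<And>i. i \<le> n \<Longrightarrow> subrep G V (F i)" "\<And>i. i < n \<Longrightarrow> F i \<subseteq> F (Suc i)"
    "\<And>i. i < n \<Longrightarrow> irreducible_rep G (subquot_rep V (F (Suc i)) (F i))"
  using assms by (auto simp: composition_series_def)

lemma direct_sum_closed:
  assumes "\<And>i. i < n \<Longrightarrow> representation G (U i)"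
  shows "x \<in> carrier (direct_sum_rep n U) \<Longrightarrow> y \<in> carrier (direct_sum_rep n U) \<Longrightarrow>
      x \<oplus>\<^bsub>direct_sum_rep n U\<^esub> y \<in> carrier (direct_sum_rep n U)"
    and "x \<in> carrier (direct_sum_rep n U) \<Longrightarrow> k \<odot>\<^bsub>direct_sum_rep n U\<^esub> x \<in> carrier (direct_sum_rep n U)"
    and "g \<in> carrier G \<Longrightarrow> x \<in> carrier (direct_sum_rep n U) \<Longrightarrow>
      act (direct_sum_rep n U) g x \<in> carrier (direct_sum_rep n U)"
    and "\<zero>\<^bsub>direct_sum_rep n U\<^esub> \<in> carrier (direct_sum_rep n U)"
proof -
  note cv = cvec.intro[OF assms[unfolded representation_def, THEN conjunct2, THEN conjunct1]]
  note gr = grep.intro[OF assms]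
  note ab = abelian_group.axioms(1)[OF Module.module.axioms(2)[OF cvec.modV[OF cv]]]
  show "x \<oplus>\<^bsub>direct_sum_rep n U\<^esub> y \<in> carrier (direct_sum_rep n U)"
    if "x \<in> carrier (direct_sum_rep n U)" "y \<in> carrier (direct_sum_rep n U)"
    using that by (auto simp: direct_sum_rep_def PiE_iff intro!: abelian_monoid.a_closed[OF ab])
  show "k \<odot>\<^bsub>direct_sum_rep n U\<^esub> x \<in> carrier (direct_sum_rep n U)"
    if "x \<in> carrier (direct_sum_rep n U)"
    using that by (auto simp: direct_sum_rep_def PiE_iff intro!: cvec.smul_closed[OF cv])
  show "act (direct_sum_rep n U) g x \<in> carrier (direct_sum_rep n U)"
    if "g \<in> carrier G" "x \<in> carrier (direct_sum_rep n U)"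
    using that by (auto simp: direct_sum_rep_def PiE_iff intro!: grep.act_closed[OF gr])
  show "\<zero>\<^bsub>direct_sum_rep n U\<^esub> \<in> carrier (direct_sum_rep n U)"
    by (auto simp: direct_sum_rep_def PiE_iff intro!: abelian_monoid.zero_closed[OF ab])
qed

lemma direct_sum_sel:
  assumes "i < n"
  shows "(x \<oplus>\<^bsub>direct_sum_rep n U\<^esub> y) i = x i \<oplus>\<^bsub>U i\<^esub> y i" "(k \<odot>\<^bsub>direct_sum_rep n U\<^esub> x) i = k \<odot>\<^bsub>U i\<^esub> x i"
    "act (direct_sum_rep n U) g x i = act (U i) g (x i)" "\<zero>\<^bsub>direct_sum_rep n U\<^esub> i = \<zero>\<^bsub>U i\<^esub>"
    "x \<in> carrier (direct_sum_rep n U) \<Longrightarrow> x i \<in> carrier (U i)"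
  using assms by (auto simp: direct_sum_rep_def)

lemma direct_sum_eqI:
  assumes "x \<in> carrier (direct_sum_rep n U)" "y \<in> carrier (direct_sum_rep n U)" "\<And>i. i < n \<Longrightarrow> x i = y i"
  shows "x = y"
  using assms by (intro PiE_ext[of x "{..<n}" "\<lambda>i. carrier (U i)" y]) (auto simp: direct_sum_rep_def)

lemma rep_hom_zero_map:
  assumes "\<And>i. i < n \<Longrightarrow> representation G (U i)"
  shows "(\<lambda>v\<in>carrier (direct_sum_rep n U). \<zero>\<^bsub>char_rep \<mu>\<^esub>) \<in> rep_hom G (direct_sum_rep n U) (char_rep \<mu>)"
  using direct_sum_closed(1-3)[of n G U, OF assms]
  by (auto simp: rep_hom_def linear_maps_def char_rep_def)

context grep begin

lemma qrep_subquot: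
  assumes "subrep G V U'" "subrep G V U" "U \<subseteq> U'"
  shows "qrep G (V\<lparr>carrier := U'\<rparr>) U"
  using subrep_restrict[OF assms(1)] subrep_of_restrict[OF assms(1), of U] assms
  by (intro qrep.intro grep.intro qrep_axioms.intro) auto

text \<open>Relative to a subrepresentation \<open>U\<close>, so that a series can be built from below.\<close>

definition has_series where
  "has_series U \<longleftrightarrow> (\<exists>n F. F 0 = {\<zero>} \<and> F n = U \<and> (\<forall>i\<le>n. subrep G V (F i)) \<and>
     (\<forall>i<n. F i \<subseteq> F (Suc i) \<and> irreducible_rep G (subquot_rep V (F (Suc i)) (F i))))"

lemma has_series_zero: "has_series {\<zero>}"
  unfolding has_series_def
  by (rule exI[of _ 0], rule exI[of _ "\<lambda>_. {\<zero>}"]) (simp add: subrep_zero)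

text \<open>If \<open>U'\<close> is spanned by \<open>U\<close> and one more vector, then \<open>U' = U\<close> or the quotient is a line. Allowing both makes
  degenerate steps of a filtration harmless.\<close>

lemma has_series_line:
  assumes U: "has_series U" and U': "subrep G V U'" "U \<subseteq> U'"
    and y: "y \<in> U'" "\<And>x. x \<in> U' \<Longrightarrow> \<exists>k. x \<oplus> k \<odot> y \<in> U"
  shows "has_series U'"
proof (cases "U = U'")
  case False
  obtain n F where F: "F 0 = {\<zero>}" "F n = U" "\<forall>i\<le>n. subrep G V (F i)"
     "\<forall>i<n. F i \<subseteq> F (Suc i) \<and> irreducible_rep G (subquot_rep V (F (Suc i)) (F i))"
    using U unfolding has_series_def by blast
  have subU: "subrep G V U" using F(2,3) by blast
  interpret q: qrep G "V\<lparr>carrier := U'\<rparr>" U using U' subU by (intro qrep_subquot)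
  have irr: "irreducible_rep G (subquot_rep V U' U)"
    unfolding subquot_rep_def q.irreducible_Q_iff
  proof (intro conjI allI impI)
    show "U \<noteq> carrier (V\<lparr>carrier := U'\<rparr>)" using False by simp
    fix X assume "subrep G (V\<lparr>carrier := U'\<rparr>) X" "U \<subseteq> X"
    then have X: "subrep G V X" "X \<subseteq> U'" "U \<subseteq> X" by (simp_all add: subrep_of_restrict[OF U'(1)])
    note XD = subrepD[OF X(1)]
    have carr: "x \<in> carrier V" if "x \<in> U'" for x using that subrepD(2)[OF U'(1)] by auto
    show "X = U \<or> X = carrier (V\<lparr>carrier := U'\<rparr>)"
    proof (cases "X = U")
      case False
      then obtain x where x: "x \<in> X" "x \<notin> U" using X by auto
      obtain k where k: "x \<oplus> k \<odot> y \<in> U" using y(2)[of x] x X by auto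
      have xc: "x \<in> carrier V" and yc: "y \<in> carrier V" using x X y carr by auto
      have k0: "k \<noteq> 0" using k x xc yc by auto
      have "(-1) \<odot> x \<oplus> (x \<oplus> k \<odot> y) \<in> X" using x k X XD by blast
      also have "(-1) \<odot> x \<oplus> (x \<oplus> k \<odot> y) = k \<odot> y" using xc yc
        by (simp add: M.a_assoc[symmetric] M.a_comm[of _ x])
      finally have "inverse k \<odot> (k \<odot> y) \<in> X" using XD(5) by blast
      then have yX: "y \<in> X" using k0 yc by simp
      have "U' \<subseteq> X"
      proof
        fix z assume z: "z \<in> U'"
        then obtain j where j: "z \<oplus> j \<odot> y \<in> U" using y(2) by blast
        have "(z \<oplus> j \<odot> y) \<oplus> (-j) \<odot> y \<in> X" using j X XD yX by blast
        also have "(z \<oplus> j \<odot> y) \<oplus> (-j) \<odot> y = z"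
          using carr[OF z] yc smul_add_left[of y j "-j"] by (simp add: M.a_assoc)
        finally show "z \<in> X" .
      qed
      then show ?thesis using X by auto
    qed simp
  qed
  show ?thesis unfolding has_series_def
  proof (rule exI[of _ "Suc n"], rule exI[of _ "\<lambda>i. if i \<le> n then F i else U'"], intro conjI allI impI)
    fix i assume "i < Suc n"
    then consider "i < n" | "i = n" by linarith
    note i_cases = this
    show "irreducible_rep G (subquot_rep V (if Suc i \<le> n then F (Suc i) else U') (if i \<le> n then F i else U'))"
      using i_cases by cases (use F irr in auto)
    show "(if i \<le> n then F i else U') \<subseteq> (if Suc i \<le> n then F (Suc i) else U')"
      using i_cases by cases (use F U' in \<open>simp_all\<close>)
  qed (use F U' in auto)
qed (use U in simp)

lemma has_series_carrier: "has_series (carrier V) \<longleftrightarrow> (\<exists>n F. composition_series G V n F)"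
  by (auto simp: has_series_def composition_series_def)

lemma semisimplification_cases:
  assumes "has_series (carrier V)"
  obtains n F where "composition_series G V n F"
    "semisimplification G V = direct_sum_rep n (\<lambda>i. subquot_rep V (F (Suc i)) (F i))"
proof -
  let ?p = "SOME (n, F). composition_series G V n F"
  obtain n F where nF: "?p = (n, F)" by (cases ?p)
  have "\<exists>p. case p of (n, F) \<Rightarrow> composition_series G V n F" using assms has_series_carrier by auto
  from someI_ex[OF this] have "composition_series G V n F" using nF by simp
  moreover have "semisimplification G V = direct_sum_rep n (\<lambda>i. subquot_rep V (F (Suc i)) (F i))"
    unfolding semisimplification_def nF by simp
  ultimately show thesis by (rule that)
qed

text \<open>The semisimplification comes from an unknown composition series \<open>F\<close>. At the first step where \<open>l\<close> is not
  zero, it descends to a nonzero functional on that factor, which is then composed with the projection from the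
  direct sum.\<close>

lemma semisimplification_hom_nonzero:
  assumes ser: "has_series (carrier V)" and l: "lfun V l" "\<exists>v\<in>carrier V. l v \<noteq> 0"
    and eq: "\<And>g v. g \<in> carrier G \<Longrightarrow> v \<in> carrier V \<Longrightarrow> l (act V g v) = \<mu> g * l v"
  shows "\<not> rep_hom_zero G (semisimplification G V) (char_rep \<mu>)"
proof -
  obtain n F where cs: "composition_series G V n F"
    and ss: "semisimplification G V = direct_sum_rep n (\<lambda>i. subquot_rep V (F (Suc i)) (F i))"
    using semisimplification_cases[OF ser] by blast
  note csD = composition_seriesD[OF cs]
  have "\<exists>i. \<exists>v\<in>F i. l v \<noteq> 0 \<and> i \<le> n" using l(2) csD(2) by auto
  then obtain m where m: "m \<le> n" "\<exists>v\<in>F m. l v \<noteq> 0" "\<And>i. i < m \<Longrightarrow> \<forall>v\<in>F i. l v = 0"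
    using exists_least_iff[of "\<lambda>i. \<exists>v\<in>F i. l v \<noteq> 0 \<and> i \<le> n"] by (metis order.strict_trans2 less_imp_le)
  have "m \<noteq> 0" using m(2) csD(1) lfun_zero[OF l(1)] by (cases m) auto
  then obtain i where i: "m = Suc i" by (cases m) auto
  have in_: "i < n" using m i by simp
  let ?U = "\<lambda>i. subquot_rep V (F (Suc i)) (F i)"
  let ?D = "direct_sum_rep n ?U"
  have qr: "qrep G (V\<lparr>carrier := F (Suc j)\<rparr>) (F j)" if "j < n" for j
    using that csD by (intro qrep_subquot) auto
  have rp: "representation G (?U j)" if "j < n" for j
    using qrep.rep_Q[OF qr[OF that]] by (simp add: subquot_rep_def)
  interpret q: qrep G "V\<lparr>carrier := F (Suc i)\<rparr>" "F i" using qr[OF in_] .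
  have Qi: "q.Q = ?U i" by (simp add: subquot_rep_def)
  have sub: "F (Suc i) \<subseteq> carrier V" using subrepD(2)[OF csD(3)[of "Suc i"]] in_ by auto
  have lU: "lfun (V\<lparr>carrier := F (Suc i)\<rparr>) l" using l(1) sub by (auto simp: lfun_def subset_iff)
  have l0: "l w = 0" if "w \<in> F i" for w using m(3)[of i] i that by simp
  have dl: "lfun (?U i) (descend l)" using q.lfun_descend[OF lU l0] by (simp add: Qi)
  have dp: "descend l (q.proj v) = l v" if "v \<in> F (Suc i)" for v
    using q.descend_proj[OF lU l0] that by simp
  define \<psi> where "\<psi> = (\<lambda>x\<in>carrier ?D. descend l (x i))"
  have "\<psi> \<in> rep_hom G ?D (char_rep \<mu>)"
    unfolding rep_hom_def linear_maps_def
  proof (intro CollectI conjI IntI ballI allI)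
    show "\<psi> \<in> carrier ?D \<rightarrow> carrier (char_rep \<mu>)" by (auto simp: char_rep_def)
    show "\<psi> \<in> extensional (carrier ?D)" by (simp add: \<psi>_def)
    fix x assume x: "x \<in> carrier ?D"
    note xi = direct_sum_sel(5)[OF in_ x]
    show "\<psi> (k \<odot>\<^bsub>?D\<^esub> x) = k \<odot>\<^bsub>char_rep \<mu>\<^esub> \<psi> x" for k
      using x direct_sum_closed(2)[of n G ?U, OF rp x, of k] lfun_smul[OF dl xi, of k]
      by (simp add: \<psi>_def char_rep_def direct_sum_sel[OF in_])
    show "\<psi> (x \<oplus>\<^bsub>?D\<^esub> y) = \<psi> x \<oplus>\<^bsub>char_rep \<mu>\<^esub> \<psi> y" if y: "y \<in> carrier ?D" for y
      using x y direct_sum_closed(1)[of n G ?U, OF rp x y] lfun_add[OF dl xi direct_sum_sel(5)[OF in_ y]]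
      by (simp add: \<psi>_def char_rep_def direct_sum_sel[OF in_])
    show "\<psi> (act ?D g x) = act (char_rep \<mu>) g (\<psi> x)" if g: "g \<in> carrier G" for g
    proof -
      obtain v where v: "v \<in> F (Suc i)" "x i = q.proj v" using xi by (auto simp: q.carrier_Q simp flip: Qi)
      have "act (?U i) g (x i) = q.proj (act V g v)" using q.act_Q[OF g, of v] v by (simp add: Qi)
      then have "descend l (act (?U i) g (x i)) = \<mu> g * descend l (x i)"
        using dp[OF v(1)] dp[of "act V g v"] v subrepD(6)[OF csD(3)[of "Suc i"] g v(1)] in_ eq[OF g, of v] sub by auto
      then show ?thesis using x direct_sum_closed(3)[of n G ?U, OF rp g x]
        by (simp add: \<psi>_def char_rep_def direct_sum_sel[OF in_])
    qed
  qed
  moreover have "\<psi> \<noteq> (\<lambda>v\<in>carrier ?D. \<zero>\<^bsub>char_rep \<mu>\<^esub>)"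
  proof -
    obtain v where v: "v \<in> F (Suc i)" "l v \<noteq> 0" using m(2) i by auto
    define x where "x = (\<lambda>j\<in>{..<n}. if j = i then q.proj v else \<zero>\<^bsub>?U j\<^esub>)"
    have z: "\<zero>\<^bsub>?U j\<^esub> \<in> carrier (?U j)" if "j < n" for j
      using direct_sum_sel(5)[OF that direct_sum_closed(4)[of n G ?U, OF rp]] direct_sum_sel(4)[OF that, of ?U] by simp
    have "x j \<in> carrier (?U j)" if "j < n" for j
      using z[OF that] v(1) q.proj_closed[of v] that by (simp add: x_def Qi)
    then have xc: "x \<in> carrier ?D" by (simp add: direct_sum_rep_def PiE_iff) (simp add: x_def)
    have "\<psi> x = l v" using xc in_ dp[OF v(1)] by (simp add: \<psi>_def) (simp add: x_def)
    moreover have "(\<lambda>v\<in>carrier ?D. \<zero>\<^bsub>char_rep \<mu>\<^esub>) x = 0" using xc by (simp add: char_rep_def)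
    ultimately show ?thesis using v(2) by metis
  qed
  ultimately show ?thesis unfolding rep_hom_zero_def ss by auto
qed

text \<open>An identity between operators of \<open>G\<close> that holds on \<open>V\<close> holds on each composition factor, whatever the series.
  A nonzero homomorphism from the direct sum is nonzero on some summand, so its target satisfies the identity
  as well. Products of two factors are what a module of length two needs.\<close>

lemma semisimplification_hom_annihilator:
  assumes ser: "has_series (carrier V)" and g: "g \<in> carrier G" and h: "h \<in> carrier G"
    and ann: "\<And>v. v \<in> carrier V \<Longrightarrow>
      act V g (act V h v \<oplus> \<beta> \<odot> v) \<oplus> \<alpha> \<odot> (act V h v \<oplus> \<beta> \<odot> v) = \<zero>"
    and nz: "\<not> rep_hom_zero G (semisimplification G V) (char_rep \<mu>)"
  shows "(\<mu> g + \<alpha>) * (\<mu> h + \<beta>) = 0"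
proof -
  obtain n F where cs: "composition_series G V n F"
    and ss: "semisimplification G V = direct_sum_rep n (\<lambda>i. subquot_rep V (F (Suc i)) (F i))"
    using semisimplification_cases[OF ser] by blast
  note csD = composition_seriesD[OF cs]
  let ?U = "\<lambda>i. subquot_rep V (F (Suc i)) (F i)"
  let ?D = "direct_sum_rep n ?U"
  have qr: "qrep G (V\<lparr>carrier := F (Suc j)\<rparr>) (F j)" if "j < n" for j
    using that csD by (intro qrep_subquot) auto
  have rp: "representation G (?U j)" if "j < n" for j
    using qrep.rep_Q[OF qr[OF that]] by (simp add: subquot_rep_def)
  note cl = direct_sum_closed[of n G ?U]
  obtain \<phi> where \<phi>: "\<phi> \<in> rep_hom G ?D (char_rep \<mu>)" "\<phi> \<noteq> (\<lambda>v\<in>carrier ?D. \<zero>\<^bsub>char_rep \<mu>\<^esub>)"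
    using nz rep_hom_zero_map[of n G ?U \<mu>, OF rp] unfolding rep_hom_zero_def ss by blast
  have lin: "\<phi> (x \<oplus>\<^bsub>?D\<^esub> y) = \<phi> x + \<phi> y" "\<phi> (k \<odot>\<^bsub>?D\<^esub> x) = k * \<phi> x" "f \<in> carrier G \<Longrightarrow> \<phi> (act ?D f x) = \<mu> f * \<phi> x"
    if "x \<in> carrier ?D" "y \<in> carrier ?D" for x y k f
    using \<phi>(1) that by (auto simp: rep_hom_def linear_maps_def char_rep_def)
  have zeroU: "\<zero>\<^bsub>?U j\<^esub> \<in> carrier (?U j)" if "j < n" for j
    using direct_sum_sel(5)[OF that direct_sum_closed(4)[of n G ?U, OF rp]] direct_sum_sel(4)[OF that, of ?U] by simp
  have ext: "\<phi> x = undefined" if "x \<notin> carrier ?D" for x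
    using \<phi>(1) that by (auto simp: rep_hom_def extensional_def)
  obtain x where x: "x \<in> carrier ?D" "\<phi> x \<noteq> 0"
  proof -
    have "\<exists>x\<in>carrier ?D. \<phi> x \<noteq> 0"
    proof (rule ccontr)
      assume "\<not> ?thesis"
      then have "\<phi> = (\<lambda>v\<in>carrier ?D. \<zero>\<^bsub>char_rep \<mu>\<^esub>)" using ext by (auto simp: fun_eq_iff char_rep_def)
      then show False using \<phi>(2) by blast
    qed
    then show thesis using that by blast
  qed
  \<comment> \<open>cut the vector down to its first components, one at a time\<close>
  define cut where "cut m = (\<lambda>j\<in>{..<n}. if j < m then x j else \<zero>\<^bsub>?U j\<^esub>)" for m
  define single where "single m = (\<lambda>j\<in>{..<n}. if j = m then x j else \<zero>\<^bsub>?U j\<^esub>)" for m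
  have xj: "x j \<in> carrier (?U j)" if "j < n" for j using direct_sum_sel(5)[OF that x(1)] .
  have cutc: "cut m \<in> carrier ?D" and singc: "single m \<in> carrier ?D" for m
    using zeroU xj by (auto simp: cut_def single_def direct_sum_rep_def PiE_iff)
  have zD: "\<phi> z = 0" if "z \<in> carrier ?D" "\<And>j. j < n \<Longrightarrow> z j = \<zero>\<^bsub>?U j\<^esub>" for z
  proof -
    have gj: "grep G (?U j)" if "j < n" for j using rp[OF that] by (rule grep.intro)
    have "z = 0 \<odot>\<^bsub>?D\<^esub> z"
    proof (rule direct_sum_eqI[OF that(1) cl(2)[OF rp that(1)]])
      fix j assume j: "j < n"
      interpret U: grep G "?U j" using gj[OF j] .
      show "z j = (0 \<odot>\<^bsub>?D\<^esub> z) j" using that(2)[OF j] by (simp only: direct_sum_sel[OF j] U.smul_zero)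
    qed
    then show ?thesis using lin(2)[OF that(1,1), of 0] by simp
  qed
  have "\<exists>m<n. \<phi> (single m) \<noteq> 0"
  proof (rule ccontr)
    assume neg: "\<not> ?thesis"
    have "m \<le> n \<Longrightarrow> \<phi> (cut m) = 0" for m
    proof (induction m)
      case 0
      show ?case by (rule zD[OF cutc]) (simp add: cut_def)
    next
      case (Suc m)
      have "cut (Suc m) = cut m \<oplus>\<^bsub>?D\<^esub> single m"
      proof (rule direct_sum_eqI[OF cutc cl(1)[OF rp cutc singc]])
        fix j assume j: "j < n"
        interpret U: grep G "?U j" using rp[OF j] by (rule grep.intro)
        show "cut (Suc m) j = (cut m \<oplus>\<^bsub>?D\<^esub> single m) j"
          unfolding direct_sum_sel[OF j] using j U.M.l_zero[OF xj[OF j]] U.M.r_zero[OF xj[OF j]]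
            U.M.l_zero[OF U.M.zero_closed]
          by (cases j m rule: linorder_cases) (simp_all add: cut_def single_def)
      qed
      then show ?case using Suc neg lin(1)[OF cutc singc] by simp
    qed
    moreover have "cut n = x" by (rule direct_sum_eqI[OF cutc x(1)]) (simp add: cut_def)
    ultimately show False using x(2) by auto
  qed
  then obtain m where m: "m < n" "\<phi> (single m) \<noteq> 0" by blast
  interpret q: qrep G "V\<lparr>carrier := F (Suc m)\<rparr>" "F m" using qr[OF m(1)] .
  have Qm: "q.Q = ?U m" by (simp add: subquot_rep_def)
  obtain v where v: "v \<in> F (Suc m)" "x m = q.proj v" using xj[OF m(1)] by (auto simp: q.carrier_Q simp flip: Qm)
  have Fm: "subrep G V (F (Suc m))" using csD(3)[of "Suc m"] m(1) by simp
  have vV: "v \<in> carrier V" using v(1) subrepD(2)[OF Fm] by auto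
  define y where "y = single m"
  define z where "z = act ?D h y \<oplus>\<^bsub>?D\<^esub> \<beta> \<odot>\<^bsub>?D\<^esub> y"
  define z' where "z' = act ?D g z \<oplus>\<^bsub>?D\<^esub> \<alpha> \<odot>\<^bsub>?D\<^esub> z"
  have yc: "y \<in> carrier ?D" and zc: "z \<in> carrier ?D" and zc': "z' \<in> carrier ?D"
    using singc[of m] cl(1)[OF rp] cl(2)[OF rp] cl(3)[OF rp] g h by (simp_all add: y_def z_def z'_def)
  have "\<phi> z' = 0"
  proof (rule zD[OF zc'])
    fix j assume j: "j < n"
    interpret U: grep G "?U j" using rp[OF j] by (rule grep.intro)
    show "z' j = \<zero>\<^bsub>?U j\<^esub>"
    proof (cases "j = m")
      case False
      then have "y j = \<zero>\<^bsub>?U j\<^esub>" using j by (simp add: y_def single_def)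
      then show ?thesis using g h by (simp add: z'_def z_def direct_sum_sel[OF j])
    next
      case True
      let ?w = "act V h v \<oplus> \<beta> \<odot> v"
      have wF: "?w \<in> F (Suc m)" using v(1) subrepD(4-6)[OF Fm] h by blast
      have ym: "y m = q.proj v" using m(1) v(2) by (simp add: y_def single_def)
      have zm: "z m = q.proj ?w"
        unfolding z_def direct_sum_sel[OF m(1)] ym
        using q.act_Q[OF h, of v] q.smul_Q[of v \<beta>] q.add_Q[of "act V h v" "\<beta> \<odot> v"] v(1) subrepD(5,6)[OF Fm] h
        by (simp add: Qm)
      have "z' m = q.proj (act V g ?w \<oplus> \<alpha> \<odot> ?w)"
        unfolding z'_def direct_sum_sel[OF m(1)] zm
        using q.act_Q[OF g, of ?w] q.smul_Q[of ?w \<alpha>] q.add_Q[of "act V g ?w" "\<alpha> \<odot> ?w"] wF subrepD(5,6)[OF Fm] g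
        by (simp add: Qm)
      then have "z' m = q.proj \<zero>" using ann[OF vV] by simp
      then show ?thesis using q.zero_Q True by (simp add: Qm)
    qed
  qed
  moreover have "\<phi> z = (\<mu> h + \<beta>) * \<phi> y"
    unfolding z_def using yc cl(2)[OF rp yc, of \<beta>] cl(3)[OF rp h yc] h by (simp add: lin distrib_right)
  moreover have "\<phi> z' = (\<mu> g + \<alpha>) * \<phi> z"
    unfolding z'_def using zc cl(2)[OF rp zc, of \<alpha>] cl(3)[OF rp g zc] g by (simp add: lin distrib_right)
  ultimately show ?thesis using m(2) by (simp add: y_def)
qed

end

section \<open>Schur's lemma in countable dimension\<close>

text \<open>More vectors than coordinates are linearly dependent; Gaussian elimination of one coordinate at a time.\<close>

lemma linear_dependence:
  fixes \<gamma> :: "'i \<Rightarrow> 'j \<Rightarrow> complex"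
  assumes "finite J" "finite I" "card J < card I"
  shows "\<exists>a. (\<exists>i\<in>I. a i \<noteq> 0) \<and> (\<forall>j\<in>J. (\<Sum>i\<in>I. a i * \<gamma> i j) = 0)"
  using assms
proof (induction J arbitrary: I \<gamma> rule: finite_induct)
  case empty
  then have "I \<noteq> {}" by auto
  then show ?case by (intro exI[of _ "\<lambda>_. 1"]) auto
next
  case (insert j0 J)
  show ?case
  proof (cases "\<forall>i\<in>I. \<gamma> i j0 = 0")
    case True
    have "card J < card I" using insert by simp
    then obtain a where "\<exists>i\<in>I. a i \<noteq> 0" "\<forall>j\<in>J. (\<Sum>i\<in>I. a i * \<gamma> i j) = 0"
      using insert.IH[of I \<gamma>] insert.prems by blast
    then show ?thesis using True by (intro exI[of _ a]) auto
  next
    case False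
    then obtain i0 where i0: "i0 \<in> I" "\<gamma> i0 j0 \<noteq> 0" by blast
    let ?I = "I - {i0}"
    define \<gamma>' where "\<gamma>' i j = \<gamma> i j - \<gamma> i j0 / \<gamma> i0 j0 * \<gamma> i0 j" for i j
    have "card J < card ?I" using insert i0 by simp
    then obtain a where a: "\<exists>i\<in>?I. a i \<noteq> 0" "\<forall>j\<in>J. (\<Sum>i\<in>?I. a i * \<gamma>' i j) = 0"
      using insert.IH[of ?I \<gamma>'] insert.prems by auto
    define b where "b i = (if i = i0 then - (\<Sum>i\<in>?I. a i * \<gamma> i j0) / \<gamma> i0 j0 else a i)" for i
    have split: "(\<Sum>i\<in>I. b i * \<gamma> i j) = (\<Sum>i\<in>?I. a i * \<gamma>' i j)" for j
    proof -
      have "(\<Sum>i\<in>I. b i * \<gamma> i j) = b i0 * \<gamma> i0 j + (\<Sum>i\<in>?I. b i * \<gamma> i j)"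
        using insert.prems i0 by (simp add: sum.remove)
      also have "(\<Sum>i\<in>?I. b i * \<gamma> i j) = (\<Sum>i\<in>?I. a i * \<gamma> i j)"
        by (intro sum.cong) (auto simp: b_def)
      also have "b i0 * \<gamma> i0 j + (\<Sum>i\<in>?I. a i * \<gamma> i j) = (\<Sum>i\<in>?I. a i * \<gamma>' i j)"
        by (simp add: b_def \<gamma>'_def sum_distrib_right sum_distrib_left sum_divide_distrib right_diff_distrib sum_subtractf mult_ac)
      finally show ?thesis .
    qed
    have "\<gamma>' i j0 = 0" for i using i0 by (simp add: \<gamma>'_def)
    then have "\<forall>j\<in>insert j0 J. (\<Sum>i\<in>I. b i * \<gamma> i j) = 0" using a(2) by (simp add: split)
    moreover have "\<exists>i\<in>I. b i \<noteq> 0" using a(1) by (auto simp: b_def)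
    ultimately show ?thesis by blast
  qed
qed

context cvec begin

primrec lincomb :: "(nat \<Rightarrow> 'v) \<Rightarrow> (nat \<Rightarrow> complex) \<Rightarrow> nat \<Rightarrow> 'v" where
  "lincomb e k 0 = \<zero>"
| "lincomb e k (Suc n) = lincomb e k n \<oplus> k n \<odot> e n"

lemma lincomb_closed [simp]: "(\<And>i. e i \<in> carrier V) \<Longrightarrow> lincomb e k n \<in> carrier V"
  by (induction n) auto

lemma lincomb_add:
  assumes "\<And>i. e i \<in> carrier V"
  shows "lincomb e (\<lambda>i. j i + k i) n = lincomb e j n \<oplus> lincomb e k n"
proof (induction n)
  case (Suc n)
  have "(lincomb e j n \<oplus> lincomb e k n) \<oplus> (j n \<odot> e n \<oplus> k n \<odot> e n) =
      (lincomb e j n \<oplus> j n \<odot> e n) \<oplus> (lincomb e k n \<oplus> k n \<odot> e n)"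
    using assms by (simp add: M.a_ac)
  then show ?case using assms by (simp add: Suc smul_add_left)
qed simp

lemma lincomb_smul:
  assumes "\<And>i. e i \<in> carrier V"
  shows "lincomb e (\<lambda>i. m * k i) n = m \<odot> lincomb e k n"
  by (induction n) (use assms in \<open>simp_all add: smul_add_right\<close>)

lemma lincomb_zero:
  assumes "\<And>i. e i \<in> carrier V" "\<And>i. i < n \<Longrightarrow> k i = 0" shows "lincomb e k n = \<zero>"
  using assms(2) by (induction n) (use assms(1) in auto)

lemma lincomb_extend:
  assumes "\<And>i. e i \<in> carrier V" "n \<le> m"
  shows "lincomb e (\<lambda>i. if i < n then k i else 0) m = lincomb e k n"
  using assms(2)
proof (induction m)
  case (Suc m)
  show ?case
  proof (cases "n = Suc m")
    case True
    have "p \<le> Suc m \<Longrightarrow> lincomb e (\<lambda>i. if i < n then k i else 0) p = lincomb e k p" for p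
      by (induction p) (use True in auto)
    then show ?thesis using True by blast
  next
    case False
    then show ?thesis using Suc assms(1) by simp
  qed
qed simp

lemma lincomb_lincomb:
  assumes "\<And>i. e i \<in> carrier V"
  shows "lincomb (\<lambda>i. lincomb e (\<gamma> i) n) a m = lincomb e (\<lambda>j. \<Sum>i<m. a i * \<gamma> i j) n"
proof (induction m)
  case 0 show ?case using lincomb_zero[of e n "\<lambda>_. 0", OF assms] by simp
next
  case (Suc m)
  then show ?case
    using lincomb_add[of e "\<lambda>j. \<Sum>i<m. a i * \<gamma> i j" "\<lambda>j. a m * \<gamma> m j" n, OF assms]
      lincomb_smul[of e "a m" "\<gamma> m" n, OF assms] by simp
qed

lemma lincomb_mem:
  assumes "submodule W complex_ring V" "\<And>i. i < n \<Longrightarrow> e i \<in> W" shows "lincomb e k n \<in> W"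
  using assms(2) by (induction n) (auto intro: submoduleD[OF assms(1)])

definition countably_spanned where
  "countably_spanned \<longleftrightarrow> (\<exists>e. (\<forall>i. e i \<in> carrier V) \<and> (\<forall>v\<in>carrier V. \<exists>k n. v = lincomb e k n))"

lemma span_submodule:
  assumes "\<And>i. e i \<in> carrier V"
  shows "submodule {lincomb e k n |k n. True} complex_ring V"
proof (rule submoduleI')
  show "{lincomb e k n |k n. True} \<subseteq> carrier V" using assms by auto
  have "\<zero> = lincomb e (\<lambda>_. 0) 0" by simp
  then show "\<zero> \<in> {lincomb e k n |k n. True}" by blast
  fix u v assume "u \<in> {lincomb e k n |k n. True}" "v \<in> {lincomb e k n |k n. True}"
  then obtain j m k n where uv: "u = lincomb e j m" "v = lincomb e k n" by blast
  have "u = lincomb e (\<lambda>i. if i < m then j i else 0) (max m n)" "v = lincomb e (\<lambda>i. if i < n then k i else 0) (max m n)"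
    unfolding uv using lincomb_extend[of e m "max m n" j, OF assms] lincomb_extend[of e n "max m n" k, OF assms] by simp_all
  then have "u \<oplus> v = lincomb e (\<lambda>i. (if i < m then j i else 0) + (if i < n then k i else 0)) (max m n)"
    using lincomb_add[of e, OF assms] by simp
  then show "u \<oplus> v \<in> {lincomb e k n |k n. True}" by blast
next
  fix m v assume "v \<in> {lincomb e k n |k n. True}"
  then obtain k n where "v = lincomb e k n" by blast
  then have "m \<odot> v = lincomb e (\<lambda>i. m * k i) n" using lincomb_smul[of e m k n, OF assms] by simp
  then show "m \<odot> v \<in> {lincomb e k n |k n. True}" by blast
qed

end

context grep begin

text \<open>The operator \<open>p (act V z)\<close>, evaluated by Horner's scheme.\<close>

definition poly_act :: "'g \<Rightarrow> complex poly \<Rightarrow> 'v \<Rightarrow> 'v" where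
  "poly_act z p v = fold_coeffs (\<lambda>a w. a \<odot> v \<oplus> act V z w) p \<zero>"

context
  fixes z assumes z: "z \<in> carrier G"
begin

lemma poly_act_0 [simp]: "poly_act z 0 v = \<zero>"
  by (simp add: poly_act_def)

lemma poly_act_pCons [simp]: "v \<in> carrier V \<Longrightarrow> poly_act z (pCons a p) v = a \<odot> v \<oplus> act V z (poly_act z p v)"
  using z by (cases "p = 0 \<and> a = 0") (auto simp: poly_act_def)

lemma poly_act_closed [simp]: "v \<in> carrier V \<Longrightarrow> poly_act z p v \<in> carrier V"
  using z by (induction p) auto

lemma poly_act_add_poly: "v \<in> carrier V \<Longrightarrow> poly_act z (p + q) v = poly_act z p v \<oplus> poly_act z q v"
  using z by (induction p q rule: poly_induct2) (simp_all add: smul_add_left act_add M.a_ac)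

lemma poly_act_smult_poly: "v \<in> carrier V \<Longrightarrow> poly_act z (Polynomial.smult k p) v = k \<odot> poly_act z p v"
  using z by (induction p) (simp_all add: smul_add_right act_smul)

lemma poly_act_mult_poly: "v \<in> carrier V \<Longrightarrow> poly_act z (p * q) v = poly_act z p (poly_act z q v)"
  using z by (induction p) (simp_all add: mult_pCons_left poly_act_add_poly poly_act_smult_poly)

lemma poly_act_add: "u \<in> carrier V \<Longrightarrow> v \<in> carrier V \<Longrightarrow> poly_act z p (u \<oplus> v) = poly_act z p u \<oplus> poly_act z p v"
  using z by (induction p) (simp_all add: smul_add_right act_add M.a_ac)

lemma poly_act_smul: "v \<in> carrier V \<Longrightarrow> poly_act z p (k \<odot> v) = k \<odot> poly_act z p v"
  using z by (induction p) (simp_all add: smul_add_right act_smul mult.commute)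

lemma poly_act_mem: "subrep G V U \<Longrightarrow> v \<in> U \<Longrightarrow> poly_act z p v \<in> U"
proof (induction p)
  case 0 then show ?case using subrepD(3) by simp
next
  case (pCons a p)
  then have "v \<in> carrier V" using subrepD(2) by blast
  then show ?case using pCons subrepD(4-6)[OF pCons.prems(1)] z by simp
qed

lemma poly_act_linear: "v \<in> carrier V \<Longrightarrow> poly_act z [:- r, 1:] v = act V z v \<oplus> (- r) \<odot> v"
  using z by (simp add: M.a_comm)

lemma poly_act_lincomb:
  assumes "\<And>i. e i \<in> carrier V"
  shows "poly_act z p (lincomb e k n) = lincomb (\<lambda>i. poly_act z p (e i)) k n"
  using assms poly_act_smul[of \<zero> p 0] by (induction n) (simp_all add: poly_act_add poly_act_smul)

lemma poly_act_sum_poly: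
  assumes "v \<in> carrier V"
  shows "poly_act z (\<Sum>i<n. Polynomial.smult (a i) (p i)) v = lincomb (\<lambda>i. poly_act z (p i) v) a n"
  using assms by (induction n) (simp_all add: poly_act_add_poly poly_act_smult_poly)

lemma poly_act_injective_mod:
  assumes U: "subrep G V U"
    and inj: "\<And>r v. v \<in> carrier V \<Longrightarrow> act V z v \<oplus> (- r) \<odot> v \<in> U \<Longrightarrow> v \<in> U"
    and "p \<noteq> 0" "x \<in> carrier V" "poly_act z p x \<in> U"
  shows "x \<in> U"
  using assms(3-5)
proof (induction "degree p" arbitrary: p rule: less_induct)
  case less
  show ?case
  proof (cases "degree p = 0")
    case True
    then obtain a where p: "p = [:a:]" by (metis degree_eq_zeroE)
    have ax: "a \<odot> x \<in> U" using less.prems z p by simp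
    then have "inverse a \<odot> (a \<odot> x) \<in> U" by (rule subrepD(5)[OF U])
    then show ?thesis using less.prems p by simp
  next
    case False
    then obtain r where "poly p r = 0" using fundamental_theorem_of_algebra[of p] constant_degree[of p] by auto
    then obtain q where q: "p = [:- r, 1:] * q" by (auto simp: poly_eq_0_iff_dvd)
    then have q0: "q \<noteq> 0" using less.prems by auto
    then have "degree p = degree [:- r, 1:] + degree q" unfolding q by (intro degree_mult_eq) auto
    then have "degree q < degree p" by simp
    moreover have "poly_act z q x \<in> U"
      using less.prems(2,3) inj[of "poly_act z q x" r] poly_act_linear[of "poly_act z q x" r] poly_act_mult_poly[of x "[:- r, 1:]" q]
      by (simp only: q poly_act_closed)
    ultimately show ?thesis using less.hyps q0 less.prems by blast
  qed
qed

end

text \<open>Modulo \<open>U\<close> the representation is simple, so for every complex \<open>r\<close> with \<open>act V z - r\<close> nonzero, this operator is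
  bijective modulo \<open>U\<close>. Were it so for all \<open>r\<close>, a vector \<open>x\<close> outside \<open>U\<close> would have resolvent vectors
  \<open>y r = (act V z - r)\<^sup>-\<^sup>1 x\<close> for uncountably many \<open>r\<close>, and countable dimension makes finitely many of them linearly
  dependent. Clearing denominators, a nonzero polynomial in \<open>act V z\<close> would kill \<open>x\<close> modulo \<open>U\<close>; but it
  is a product of factors \<open>act V z - r\<close>, which are injective.\<close>

lemma schur_countable:
  assumes cs: "countably_spanned"
    and U: "subrep G V U" "U \<noteq> carrier V"
    and max: "\<And>U'. subrep G V U' \<Longrightarrow> U \<subseteq> U' \<Longrightarrow> U' = U \<or> U' = carrier V"
    and z: "z \<in> carrier G" "\<And>g. g \<in> carrier G \<Longrightarrow> g \<otimes>\<^bsub>G\<^esub> z = z \<otimes>\<^bsub>G\<^esub> g"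
  shows "\<exists>r. \<forall>v\<in>carrier V. act V z v \<oplus> (- r) \<odot> v \<in> U"
proof (rule ccontr)
  assume "\<not> ?thesis"
  then have no: "\<exists>v\<in>carrier V. act V z v \<oplus> (- r) \<odot> v \<notin> U" for r by blast
  note UD = subrepD[OF U(1)]
  define A where "A r v = act V z v \<oplus> (- r) \<odot> v" for r v
  have Ac: "A r v \<in> carrier V" if "v \<in> carrier V" for r v using that z by (simp add: A_def)
  have Aadd: "A r (u \<oplus> v) = A r u \<oplus> A r v" if "u \<in> carrier V" "v \<in> carrier V" for r u v
    using that z by (simp add: A_def act_add smul_add_right M.a_ac)
  have Asmul: "A r (k \<odot> v) = k \<odot> A r v" if "v \<in> carrier V" for r k v
    using that z by (simp add: A_def act_smul smul_add_right mult.commute)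
  have Aact: "A r (act V g v) = act V g (A r v)" if "v \<in> carrier V" "g \<in> carrier G" for r g v
    using that z by (simp add: A_def act_smul act_add flip: act_mult)
  have AU: "A r u \<in> U" if "u \<in> U" for r u using that UD z unfolding A_def by blast
  have inj: "v \<in> U" if v: "v \<in> carrier V" "A r v \<in> U" for r v
  proof -
    let ?K = "{v \<in> carrier V. A r v \<in> U}"
    have "A r \<zero> = \<zero>" using z by (simp add: A_def)
    then have "subrep G V ?K"
      using UD by (intro subrepI) (auto simp: Aadd Asmul Aact)
    moreover have "U \<subseteq> ?K" using UD(2) AU by auto
    moreover have "?K \<noteq> carrier V" using no[of r] by (auto simp: A_def)
    ultimately have "?K = U" using max by blast
    then show ?thesis using v by blast
  qed
  have surj: "\<exists>y\<in>carrier V. \<exists>u\<in>U. x = A r y \<oplus> u" if x: "x \<in> carrier V" for r x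
  proof -
    let ?I = "{x. \<exists>y\<in>carrier V. \<exists>u\<in>U. x = A r y \<oplus> u}"
    have uc: "u \<in> carrier V" if "u \<in> U" for u using that UD(2) by auto
    have A0: "A r \<zero> = \<zero>" using z by (simp add: A_def)
    have I: "subrep G V ?I"
    proof (rule subrepI)
      show "?I \<subseteq> carrier V" using uc Ac by auto
      show "\<zero> \<in> ?I" using A0 UD(3) by (auto intro!: bexI[of _ \<zero>])
    next
      fix a b assume "a \<in> ?I" "b \<in> ?I"
      then obtain y u y' u' where h: "y \<in> carrier V" "u \<in> U" "a = A r y \<oplus> u" "y' \<in> carrier V" "u' \<in> U" "b = A r y' \<oplus> u'" by blast
      then have "a \<oplus> b = A r (y \<oplus> y') \<oplus> (u \<oplus> u')" using uc Ac by (simp add: Aadd M.a_ac)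
      then show "a \<oplus> b \<in> ?I" using h UD(4) by blast
    next
      fix k a assume "a \<in> ?I"
      then obtain y u where h: "y \<in> carrier V" "u \<in> U" "a = A r y \<oplus> u" by blast
      then have "k \<odot> a = A r (k \<odot> y) \<oplus> k \<odot> u" using uc Ac by (simp add: Asmul smul_add_right)
      then show "k \<odot> a \<in> ?I" using h UD(5) by blast
    next
      fix g a assume g: "g \<in> carrier G" and "a \<in> ?I"
      then obtain y u where h: "y \<in> carrier V" "u \<in> U" "a = A r y \<oplus> u" by blast
      then have "act V g a = A r (act V g y) \<oplus> act V g u" using uc Ac g by (simp add: Aact act_add)
      then show "act V g a \<in> ?I" using h g UD(6) by blast
    qed
    have "U \<subseteq> ?I"
    proof
      fix u assume u: "u \<in> U"
      then have "u = A r \<zero> \<oplus> u" using uc by (simp add: A0)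
      then show "u \<in> ?I" using u by blast
    qed
    moreover have "?I \<noteq> U"
    proof
      assume eq: "?I = U"
      have "v \<in> U" if v: "v \<in> carrier V" for v
      proof -
        have "A r v = A r v \<oplus> \<zero>" using Ac v by simp
        then have "A r v \<in> ?I" using v UD(3) by blast
        then show ?thesis using inj v eq by blast
      qed
      then show False using U(2) UD(2) by blast
    qed
    ultimately have "?I = carrier V" using max[OF I] by blast
    then show ?thesis using x by blast
  qed
  obtain x where x: "x \<in> carrier V" "x \<notin> U" using U(2) UD(2) by blast
  have "\<forall>r. \<exists>y u. y \<in> carrier V \<and> u \<in> U \<and> x = A r y \<oplus> u" using surj[OF x(1)] by blast
  then obtain y u where yu: "\<And>r. y r \<in> carrier V" "\<And>r. u r \<in> U" "\<And>r. x = A r (y r) \<oplus> u r" by metis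
  obtain e where e: "\<And>i. e i \<in> carrier V" "\<And>v. v \<in> carrier V \<Longrightarrow> \<exists>k n. v = lincomb e k n"
    using cs unfolding countably_spanned_def by blast
  have "\<forall>r. \<exists>k n. y r = lincomb e k n" using e(2) yu(1) by blast
  then obtain \<gamma> N where \<gamma>: "\<And>r. y r = lincomb e (\<gamma> r) (N r)" by metis
  \<comment> \<open>uncountably many resolvent vectors lie in a countable union of finite-dimensional spaces\<close>
  have "\<exists>n. infinite {r. N r = n}"
  proof (rule ccontr)
    assume "\<not> ?thesis"
    then have "countable (\<Union>n. {r. N r = n})" by (intro countable_UN) (auto intro: countable_finite)
    moreover have "(\<Union>n. {r. N r = n}) = (UNIV :: complex set)" by auto
    ultimately show False using uncountable_UNIV_complex by simp
  qed
  then obtain n where n: "infinite {r. N r = n}" by blast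
  then obtain Z where Z: "finite Z" "card Z = Suc n" "Z \<subseteq> {r. N r = n}"
    using infinite_arbitrarily_large by blast
  obtain \<zeta> where \<zeta>: "bij_betw \<zeta> {..<Suc n} Z"
    using Z ex_bij_betw_nat_finite[OF Z(1)] by (auto simp: atLeast0LessThan)
  have N: "N (\<zeta> i) = n" if "i < Suc n" for i using \<zeta> Z(3) that by (auto simp: bij_betw_def)
  have dist: "\<zeta> i \<noteq> \<zeta> j" if "i < Suc n" "j < Suc n" "i \<noteq> j" for i j
    using \<zeta> that by (auto simp: bij_betw_def inj_on_def)
  obtain a where a: "\<exists>i\<in>{..<Suc n}. a i \<noteq> 0" "\<forall>j\<in>{..<n}. (\<Sum>i<Suc n. a i * \<gamma> (\<zeta> i) j) = 0"
    using linear_dependence[of "{..<n}" "{..<Suc n}" "\<lambda>i j. \<gamma> (\<zeta> i) j"] by auto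
  define w where "w i = lincomb e (\<gamma> (\<zeta> i)) n" for i
  have wc: "w i \<in> carrier V" for i using e(1) by (simp add: w_def)
  have wy: "w i = y (\<zeta> i)" if "i < Suc n" for i using \<gamma>[of "\<zeta> i"] N[OF that] by (simp add: w_def)
  have dep: "lincomb w a (Suc n) = \<zero>"
  proof -
    have "lincomb w a (Suc n) = lincomb e (\<lambda>j. \<Sum>i<Suc n. a i * \<gamma> (\<zeta> i) j) n"
      unfolding w_def by (rule lincomb_lincomb) (rule e(1))
    also have "\<dots> = \<zero>" using a(2) by (intro lincomb_zero e(1)) auto
    finally show ?thesis .
  qed
  define P where "P i = (\<Prod>j\<in>{..<Suc n} - {i}. [:- \<zeta> j, 1:])" for i
  define R where "R = (\<Prod>j\<in>{..<Suc n}. [:- \<zeta> j, 1:])"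
  have RP: "R = P i * [:- \<zeta> i, 1:]" if "i < Suc n" for i
    unfolding R_def P_def using that by (subst prod.remove[of _ i]) (auto simp: mult.commute)
  have modU: "\<exists>u\<in>U. poly_act z (P i) x = poly_act z R (w i) \<oplus> u" if i: "i < Suc n" for i
  proof -
    have "x = A (\<zeta> i) (w i) \<oplus> u (\<zeta> i)" using yu(3)[of "\<zeta> i"] wy[OF i] by simp
    then have "poly_act z (P i) x = poly_act z (P i) (A (\<zeta> i) (w i)) \<oplus> poly_act z (P i) (u (\<zeta> i))"
      using poly_act_add[OF z(1)] Ac[OF wc] yu(2) UD(2) by (metis subsetD)
    moreover have "poly_act z (P i) (A (\<zeta> i) (w i)) = poly_act z R (w i)"
      using RP[OF i] poly_act_mult_poly[OF z(1) wc] poly_act_linear[OF z(1) wc] by (simp only: A_def)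
    moreover have "poly_act z (P i) (u (\<zeta> i)) \<in> U" using poly_act_mem[OF z(1) U(1)] yu(2) by blast
    ultimately show ?thesis by auto
  qed
  have Rc: "poly_act z R (w i) \<in> carrier V" for i using poly_act_closed[OF z(1) wc] .
  have comb: "m \<le> Suc n \<Longrightarrow> \<exists>u\<in>U. lincomb (\<lambda>i. poly_act z (P i) x) a m = lincomb (\<lambda>i. poly_act z R (w i)) a m \<oplus> u" for m
  proof (induction m)
    case 0 show ?case using UD(3) by (auto intro!: bexI[of _ \<zero>])
  next
    case (Suc m)
    then obtain u1 where u1: "u1 \<in> U" "lincomb (\<lambda>i. poly_act z (P i) x) a m = lincomb (\<lambda>i. poly_act z R (w i)) a m \<oplus> u1" by auto
    obtain u2 where u2: "u2 \<in> U" "poly_act z (P m) x = poly_act z R (w m) \<oplus> u2" using modU[of m] Suc.prems by auto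
    have c: "u1 \<in> carrier V" "u2 \<in> carrier V" using u1 u2 UD(2) by auto
    have "lincomb (\<lambda>i. poly_act z (P i) x) a (Suc m) =
        lincomb (\<lambda>i. poly_act z R (w i)) a (Suc m) \<oplus> (u1 \<oplus> a m \<odot> u2)"
      using c Rc by (simp add: u1(2) u2(2) smul_add_right M.a_ac)
    then show ?case using u1(1) u2(1) UD(4,5) by blast
  qed
  have "lincomb (\<lambda>i. poly_act z R (w i)) a (Suc n) = \<zero>"
    using poly_act_lincomb[of z w R a "Suc n", OF z(1) wc] dep poly_act_smul[OF z(1), of \<zero> R 0] z poly_act_closed[OF z(1), of \<zero> R] by simp
  then have "lincomb (\<lambda>i. poly_act z (P i) x) a (Suc n) \<in> U" using comb[of "Suc n"] UD(2) by auto
  then have PU: "poly_act z (\<Sum>i<Suc n. Polynomial.smult (a i) (P i)) x \<in> U"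
    using poly_act_sum_poly[OF z(1) x(1), of a P "Suc n"] by simp
  have "(\<Sum>i<Suc n. Polynomial.smult (a i) (P i)) \<noteq> 0"
  proof
    assume zero: "(\<Sum>i<Suc n. Polynomial.smult (a i) (P i)) = 0"
    obtain k where k: "k < Suc n" "a k \<noteq> 0" using a(1) by auto
    have "poly (P i) (\<zeta> k) = 0" if "i < Suc n" "i \<noteq> k" for i
      using that k unfolding P_def poly_prod by (intro prod_zero) auto
    then have "poly (\<Sum>i<Suc n. Polynomial.smult (a i) (P i)) (\<zeta> k) = (\<Sum>i<Suc n. if i = k then a k * poly (P k) (\<zeta> k) else 0)"
      unfolding poly_sum by (intro sum.cong) auto
    also have "\<dots> = a k * poly (P k) (\<zeta> k)" using k by (simp add: sum.delta)
    finally have "poly 0 (\<zeta> k) = a k * poly (P k) (\<zeta> k)" by (simp only: zero)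
    then have "poly (P k) (\<zeta> k) = 0" using k by simp
    moreover have "poly (P k) (\<zeta> k) \<noteq> 0"
      using k dist[of k] unfolding P_def poly_prod by (auto simp: prod_zero_iff)
    ultimately show False by simp
  qed
  from poly_act_injective_mod[OF z(1) U(1) _ this x(1) PU] inj show False using x(2) by (auto simp: A_def)
qed

end

section \<open>Irreducible smooth representations and their Jacquet modules\<close>

lemma det_near:
  fixes A B :: "'k::nonarch_local_field mat2"
  assumes "mbound M A" "mbound s (B - A)" "s \<le> M"
  shows "nabs (det B - det A) \<le> M * s"
proof -
  obtain a b c d where A: "A = mk a b c d" by (rule mat2_cases)
  obtain a' b' c' d' where B: "B = mk a' b' c' d'" by (rule mat2_cases)
  have h: "nabs a \<le> M" "nabs b \<le> M" "nabs c \<le> M" "nabs d \<le> M"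
    "nabs (a' - a) \<le> s" "nabs (b' - b) \<le> s" "nabs (c' - c) \<le> s" "nabs (d' - d) \<le> s"
    using assms by (auto simp: A B mbound_mk mk_minus)
  have h': "nabs a' \<le> M" "nabs b' \<le> M"
    using nabs_add_le[of "a' - a" M a] nabs_add_le[of "b' - b" M b] h assms(3) by auto
  have s0: "0 \<le> s" "0 \<le> M" using h(5) h(1) nabs_ge_0 order_trans by blast+
  have p: "nabs (x * y) \<le> M * s" if "nabs x \<le> M" "nabs y \<le> s" for x y :: 'k
    unfolding nabs_mult using that s0 by (intro mult_mono) auto
  have "det B - det A = (a' * (d' - d) + d * (a' - a)) - (b' * (c' - c) + c * (b' - b))"
    by (simp add: A B algebra_simps)
  also have "nabs \<dots> \<le> M * s"
    by (intro nabs_sub_le nabs_add_le p h h')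
  finally show ?thesis .
qed

lemma representation_T2:
  assumes "representation GL2 V" shows "representation (T2 :: 'k::nonarch_local_field mat2 monoid) V"
  using assms group_T2 unfolding representation_def by (auto simp: T2_def)

locale smooth_gl2 = grep GL2 V for V :: "('k::nonarch_local_field mat2, 'v) rep" (structure) +
  assumes smoothV: "smooth_rep GL2 V"
begin

lemma act_closed' [simp, intro]: "invertible g \<Longrightarrow> v \<in> carrier V \<Longrightarrow> act V g v \<in> carrier V"
  and act_add': "invertible g \<Longrightarrow> u \<in> carrier V \<Longrightarrow> v \<in> carrier V \<Longrightarrow> act V g (u \<oplus> v) = act V g u \<oplus> act V g v"
  and act_smul': "invertible g \<Longrightarrow> v \<in> carrier V \<Longrightarrow> act V g (k \<odot> v) = k \<odot> act V g v"
  and act_one' [simp]: "v \<in> carrier V \<Longrightarrow> act V (mat 1) v = v"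
  and act_mult': "invertible g \<Longrightarrow> invertible h \<Longrightarrow> v \<in> carrier V \<Longrightarrow> act V (g ** h) v = act V g (act V h v)"
  using act_closed[of g v] act_add[of g u v] act_smul[of g v k] act_one[of v] act_mult[of g h v] by simp_all

lemma stabilizer:
  assumes v: "v \<in> carrier V"
  shows "\<exists>s>0. s < 1 \<and> (\<forall>h\<in>cong_subgroup s. act V h v = v)"
proof -
  have "openin (top_of_set (carrier GL2)) {g \<in> carrier GL2. act V g v = v}"
    using smoothV v by (simp add: smooth_rep_def)
  from cong_subgroup_in_open[OF this] obtain s where "s > 0" "s < 1" "cong_subgroup s \<subseteq> {g \<in> carrier GL2. act V g v = v}"
    using v by auto
  then show ?thesis by blast
qed

text \<open>\<open>GL\<^sub>2\<close> is the union of the sets where the entries are bounded by \<open>n\<close> and \<open>\<bar>det\<bar> \<ge> 1 / (n + 1)\<close>. The orbit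
  map is locally constant, so each of them contributes finitely many vectors. To work on a set that is evidently
  compact, the orbit map is extended to all bounded matrices by the value \<open>None\<close>, which is again locally constant.\<close>

lemma countable_orbit:
  assumes v: "v \<in> carrier V"
  shows "countable {act V g v |g. invertible g}"
proof -
  obtain s where s: "0 < s" "s < 1" "\<And>h. h \<in> cong_subgroup s \<Longrightarrow> act V h v = v" using stabilizer[OF v] by blast
  define F where "F n A = (if 1 / real (Suc n) \<le> nabs (det A) then Some (act V A v) else None)" for n A
  have fin: "finite (F n ` {A. mbound (real n) A})" for n
  proof (rule finite_image_locally_constant[OF compact_mbound])
    fix A :: "'k mat2" assume A: "A \<in> {A. mbound (real n) A}"
    show "\<exists>e>0. \<forall>B\<in>{A. mbound (real n) A}. dist A B < e \<longrightarrow> F n B = F n A"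
    proof (cases "1 / real (Suc n) \<le> nabs (det A)")
      case True
      have "0 < 1 / real (Suc n)" by simp
      then have inv: "invertible A" using True by (auto simp: invertible_iff_det)
      obtain t where t: "t > 0" "\<And>B. mbound t (B - A) \<Longrightarrow> matrix_inv A ** B \<in> cong_subgroup s"
        using near_cong_subgroup[OF inv s(1)] by blast
      have "F n B = F n A" if B: "dist A B < t" for B
      proof -
        have h: "matrix_inv A ** B \<in> cong_subgroup s"
          using B by (intro t(2) mbound_of_dist) (simp add: dist_commute)
        have eq: "A ** (matrix_inv A ** B) = B" using inv by (simp add: matrix_mul_assoc)
        have "act V B v = act V A (act V (matrix_inv A ** B) v)"
          using act_mult'[OF inv cong_subgroup_invertible[OF h s(2)] v] by (simp add: eq)
        moreover have "nabs (det B) = nabs (det A)"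
        proof -
          have "nabs (det (matrix_inv A ** B)) = 1"
            using nabs_near_1[of "det (matrix_inv A ** B)"] cong_subgroup_det[OF h s(2)] s(2) by simp
          then have "nabs (det (A ** (matrix_inv A ** B))) = nabs (det A)"
            unfolding det_mul[of A] nabs_mult by simp
          then show ?thesis by (simp add: eq)
        qed
        ultimately show ?thesis using s(3)[OF h] by (simp add: F_def)
      qed
      then show ?thesis using t(1) by blast
    next
      case False
      define M where "M = real n + 1"
      have M: "M > 0" "1 \<le> M" "mbound M A" using A by (auto simp: M_def intro: mbound_mono)
      define t where "t = 1 / (2 * real (Suc n) * M)"
      have t: "t > 0" "M * t < 1 / real (Suc n)" "t \<le> M"
      proof -
        show t0: "t > 0" using M by (simp add: t_def)
        have Mt: "M * t = 1 / (2 * real (Suc n))" using M by (simp add: t_def)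
        also have "\<dots> < 1 / real (Suc n)" by (simp add: field_simps)
        finally show "M * t < 1 / real (Suc n)" .
        have "1 * t \<le> M * t" using M t0 by (intro mult_right_mono) auto
        also have "M * t \<le> 1" unfolding Mt by (simp add: field_simps)
        finally have "t \<le> 1" by simp
        then show "t \<le> M" using M by linarith
      qed
      have "F n B = F n A" if B: "dist A B < t" for B
      proof -
        have "mbound t (B - A)" using B by (intro mbound_of_dist) (simp add: dist_commute)
        from det_near[OF M(3) this t(3)] have "nabs (det B - det A) < 1 / real (Suc n)" using t by linarith
        then have "nabs (det B - det A + det A) < 1 / real (Suc n)"
          using nabs_ultrametric[of "det B - det A" "det A"] False by linarith
        then show ?thesis using False by (simp add: F_def)
      qed
      then show ?thesis using t(1) by blast
    qed
  qed
  have "{act V g v |g. invertible g} \<subseteq> (\<Union>n. the ` (F n ` {A. mbound (real n) A}))"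
  proof
    fix w assume "w \<in> {act V g v |g. invertible g}"
    then obtain g where g: "invertible g" "w = act V g v" by blast
    obtain M where M: "M > 0" "mbound M g" using mbound_exists by blast
    obtain n1 where n1: "M \<le> real n1" using real_arch_simple by blast
    have "0 < nabs (det g)" using g(1) by (simp add: invertible_iff_det)
    then obtain n2 where n2: "inverse (real (Suc n2)) < nabs (det g)" using reals_Archimedean by blast
    let ?n = "max n1 n2"
    have "mbound (real ?n) g" using n1 by (intro mbound_mono[OF M(2)]) auto
    moreover have "1 / real (Suc ?n) \<le> inverse (real (Suc n2))" by (simp add: field_simps)
    then have "F ?n g = Some w" using n2 g by (simp add: F_def)
    ultimately show "w \<in> (\<Union>n. the ` (F n ` {A. mbound (real n) A}))" by force
  qed
  moreover have "countable (\<Union>n. the ` (F n ` {A. mbound (real n) A}))"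
    using fin by (intro countable_UN) (auto intro: countable_finite)
  ultimately show ?thesis by (rule countable_subset)
qed

end

text \<open>A nonzero functional on which \<open>B\<^sub>2\<close> acts by \<open>a \<otimes> c\<close>; equivalently, a nonzero \<open>T\<^sub>2\<close>-map from the Jacquet
  module to that character.\<close>

definition eigenfunctional ::
  "('k::nonarch_local_field mat2, 'v) rep \<Rightarrow> ('k \<Rightarrow> complex) \<Rightarrow> ('k \<Rightarrow> complex) \<Rightarrow> ('v \<Rightarrow> complex) \<Rightarrow> bool" where
  "eigenfunctional V a c l \<longleftrightarrow> lfun V l \<and> (\<exists>v\<in>carrier V. l v \<noteq> 0) \<and>
     (\<forall>p q r. \<forall>v\<in>carrier V. p \<noteq> 0 \<longrightarrow> r \<noteq> 0 \<longrightarrow> l (act V (mk p q 0 r) v) = a p * c r * l v)"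

locale irred_gl2 = smooth_gl2 V for V :: "('k::nonarch_local_field mat2, 'v) rep" (structure) +
  assumes irrV: "irreducible_rep GL2 V"
begin

lemma nontrivial: obtains v where "v \<in> carrier V" "v \<noteq> \<zero>"
proof -
  have "carrier V \<noteq> {\<zero>}" using irrV by (simp add: irreducible_rep_def)
  then show thesis using that M.zero_closed by blast
qed

lemma subrep_trivial: "subrep GL2 V W \<Longrightarrow> W = {\<zero>} \<or> W = carrier V"
  using irrV by (simp add: irreducible_rep_def)

lemma countably_spannedV: "countably_spanned"
proof -
  obtain v0 where v0: "v0 \<in> carrier V" "v0 \<noteq> \<zero>" by (rule nontrivial)
  let ?O = "{act V g v0 |g. invertible g}"
  have ne: "?O \<noteq> {}" using invertible_mk_defs(5)[where 'k='k] by blast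
  define e where "e = from_nat_into ?O"
  have rng: "range e = ?O" unfolding e_def using range_from_nat_into[OF ne countable_orbit[OF v0(1)]] .
  have ec: "e i \<in> carrier V" for i
  proof -
    have "e i \<in> ?O" using rng by blast
    then show ?thesis using v0 by auto
  qed
  let ?S = "{lincomb e k n |k n. True}"
  note S = span_submodule[of e, OF ec]
  have eS: "w \<in> ?S" if "w \<in> ?O" for w
  proof -
    have "w \<in> range e" unfolding rng by (rule that)
    then obtain i where i: "w = e i" by (rule rangeE)
    have "e i = lincomb e (\<lambda>j. if j = i then 1 else 0) (Suc i)"
      using lincomb_zero[of e i "\<lambda>j. if j = i then 1 else 0", OF ec] ec by simp
    moreover have "lincomb e (\<lambda>j. if j = i then 1 else 0) (Suc i) \<in> ?S" by blast
    ultimately show ?thesis unfolding i by (rule ssubst)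
  qed
  have "subrep GL2 V ?S"
    unfolding subrep_def
  proof (intro conjI ballI S)
    fix g w assume g: "g \<in> carrier (GL2 :: 'k mat2 monoid)" and w: "w \<in> ?S"
    then obtain k n where w: "w = lincomb e k n" by blast
    have ge: "act V g (e i) \<in> ?S" for i
    proof -
      have "e i \<in> ?O" using rng by blast
      then obtain h where h: "invertible h" "e i = act V h v0" by blast
      then have "act V g (e i) = act V (g ** h) v0" using g v0 by (simp add: act_mult')
      then show ?thesis using g h by (intro eS) (auto simp: invertible_mult_iff)
    qed
    have "act V g (lincomb e k n) = lincomb (\<lambda>i. act V g (e i)) k n"
      using g ec by (induction n) (simp_all add: act_add act_smul)
    also have "\<dots> \<in> ?S" by (rule lincomb_mem[OF S ge])
    finally show "act V g w \<in> ?S" using w by simp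
  qed
  moreover have "?S \<noteq> {\<zero>}"
  proof -
    have "act V (mat 1) v0 \<in> ?S" by (rule eS) (use invertible_mk_defs(5)[where 'k='k] in blast)
    then show ?thesis using v0 by auto
  qed
  ultimately have "?S = carrier V" using subrep_trivial by blast
  then show ?thesis unfolding countably_spanned_def using ec by blast
qed

lemma central_scalar:
  assumes x: "x \<noteq> 0"
  shows "\<exists>r. \<forall>v\<in>carrier V. act V (mat x) v = r \<odot> v"
proof -
  have comm: "g ** mat x = mat x ** g" for g :: "'k mat2"
    by (rule mat2_cases[of g]) (simp add: mat_eq_mk mult.commute)
  have "\<exists>r. \<forall>v\<in>carrier V. act V (mat x) v \<oplus> (- r) \<odot> v \<in> {\<zero>}"
  proof (rule schur_countable[OF countably_spannedV subrep_zero])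
    show "{\<zero>} \<noteq> carrier V" using irrV by (auto simp: irreducible_rep_def)
  qed (use x comm subrep_trivial in \<open>auto simp: mat_eq_mk\<close>)
  then obtain r where r: "\<And>v. v \<in> carrier V \<Longrightarrow> act V (mat x) v \<oplus> (- r) \<odot> v = \<zero>" by blast
  have "act V (mat x) v = r \<odot> v" if v: "v \<in> carrier V" for v
  proof -
    have m: "act V (mat x) v \<in> carrier V" using v x by (simp add: mat_eq_mk)
    have "act V (mat x) v = (act V (mat x) v \<oplus> (-1) \<odot> (r \<odot> v)) \<oplus> r \<odot> v"
      using sub_add_cancel[of "r \<odot> v" "act V (mat x) v"] v m by simp
    also have "\<dots> = r \<odot> v" using r[OF v] v by simp
    finally show ?thesis .
  qed
  then show ?thesis by blast
qed

lemma smul_cancel: "v \<in> carrier V \<Longrightarrow> v \<noteq> \<zero> \<Longrightarrow> j \<odot> v = k \<odot> v \<Longrightarrow> j = k"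
proof (rule ccontr)
  assume v: "v \<in> carrier V" "v \<noteq> \<zero>" "j \<odot> v = k \<odot> v" and ne: "j \<noteq> k"
  then have "(j + - k) \<odot> v = \<zero>" using smul_add_left[of v j "- k"] smul_add_left[of v k "- k"] by simp
  then have "inverse (j - k) \<odot> ((j - k) \<odot> v) = \<zero>" by simp
  then show False using ne v by (simp del: minus_diff_eq)
qed

lemma central_char_act:
  assumes x: "x \<noteq> 0" and v: "v \<in> carrier V"
  shows "act V (mat x) v = central_char V x \<odot> v"
proof -
  obtain r where r: "\<forall>v\<in>carrier V. act V (mat x) v = r \<odot> v" using central_scalar[OF x] by blast
  obtain v0 where v0: "v0 \<in> carrier V" "v0 \<noteq> \<zero>" by (rule nontrivial)
  have "r' = r" if "\<forall>v\<in>carrier V. act V (mat x) v = r' \<odot> v" for r'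
    using smul_cancel[OF v0, of r' r] that r v0(1) by simp
  then have "central_char V x = r" unfolding central_char_def using r by (intro the_equality)
  then show ?thesis using r v by simp
qed

text \<open>Schur's lemma makes the centre act by scalars; multiplicativity is then read off from one vector, and
  continuity from its open stabilizer.\<close>

lemma is_character_central_char: "is_character (central_char V)"
proof -
  obtain v where v: "v \<in> carrier V" "v \<noteq> \<zero>" by (rule nontrivial)
  obtain s where s: "0 < s" "s < 1" "\<And>h. h \<in> cong_subgroup s \<Longrightarrow> act V h v = v" using stabilizer[OF v(1)] by blast
  have one: "central_char V x = 1" if "nabs (x - 1) \<le> s" for x
  proof -
    have "x \<noteq> 0" using that nabs_near_1[of x] s by simp
    moreover have "mat x \<in> cong_subgroup s" using that s by (simp add: mat_eq_mk mem_cong_subgroup)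
    ultimately have "central_char V x \<odot> v = 1 \<odot> v" using central_char_act[of x v] s(3) v by simp
    then show ?thesis using smul_cancel v by blast
  qed
  have mult: "central_char V (x * y) = central_char V x * central_char V y" if "x \<noteq> 0" "y \<noteq> 0" for x y
  proof -
    have i: "invertible (mat x :: 'k mat2)" "invertible (mat y :: 'k mat2)" using that by (simp_all add: mat_eq_mk)
    have "act V (mat (x * y)) v = act V (mat x ** mat y) v" by (simp add: mat_eq_mk)
    also have "\<dots> = act V (mat x) (central_char V y \<odot> v)"
      using act_mult'[OF i v(1)] central_char_act[OF that(2) v(1)] by simp
    also have "\<dots> = central_char V x \<odot> (central_char V y \<odot> v)" using central_char_act[OF that(1)] v by simp
    finally have "central_char V (x * y) \<odot> v = (central_char V x * central_char V y) \<odot> v"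
      using central_char_act[of "x * y" v] that v by simp
    then show ?thesis using smul_cancel v by blast
  qed
  have nz: "central_char V x \<noteq> 0" if "x \<noteq> 0" for x
  proof
    assume "central_char V x = 0"
    then have "central_char V (x * inverse x) = 0" using mult[of x "inverse x"] that by simp
    then show False using that one[of 1] s by simp
  qed
  show ?thesis using nz mult s(1) one by (rule is_characterI)
qed

end

subsection \<open>The kernel of the Jacquet module\<close>

definition jacquet_kernel :: "('k::nonarch_local_field mat2, 'v) rep \<Rightarrow> 'v set" where
  "jacquet_kernel V = (\<lambda>W. submodule W complex_ring V) hull {act V n v \<ominus>\<^bsub>V\<^esub> v | n v. n \<in> N2 \<and> v \<in> carrier V}"

lemma jacquet_module_eq: "jacquet_module V = quot_rep V (jacquet_kernel V)"
  by (simp add: jacquet_module_def jacquet_kernel_def)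

lemma borel_unipotent: "r \<noteq> 0 \<Longrightarrow> mk p q 0 r ** upt h = upt (p * h / r) ** mk p q 0 (r::'k::nonarch_local_field)"
  by (simp add: mk_defs)

lemma borel_decomp: "r \<noteq> 0 \<Longrightarrow> mk p q 0 r = upt (q / r) ** dg p (r::'k::nonarch_local_field)"
  by (simp add: mk_defs)

text \<open>With bottom row \<open>(c, d)\<close>, divide by the entry of larger absolute value.\<close>

lemma iwasawa:
  fixes g :: "'k::nonarch_local_field mat2"
  assumes "invertible g"
  shows "\<exists>p q r x k. p \<noteq> 0 \<and> r \<noteq> 0 \<and> nabs x \<le> 1 \<and> (k = lwt x \<or> k = mk 0 1 1 x) \<and> g = mk p q 0 r ** k"
proof -
  obtain a b c d where g: "g = mk a b c d" by (rule mat2_cases)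
  have det: "a * d - b * c \<noteq> 0" using assms by (simp add: g)
  show ?thesis
  proof (cases "nabs c \<le> nabs d")
    case True
    then have d: "d \<noteq> 0" using det by (metis diff_0_right mult_zero_right nabs_0 nabs_eq_0 nabs_ge_0 order_antisym)
    have "a - b * c / d \<noteq> 0" using det d by (simp add: field_simps)
    moreover have "nabs (c / d) \<le> 1" using True d by (simp add: nabs_divide)
    moreover have "g = mk (a - b * c / d) b 0 d ** lwt (c / d)" using d by (simp add: g mk_defs)
    ultimately show ?thesis using d by blast
  next
    case False
    then have c: "c \<noteq> 0" by auto
    have "b - a * d / c \<noteq> 0" using det c by (simp add: field_simps)
    moreover have "nabs (d / c) \<le> 1" using False c by (simp add: nabs_divide)
    moreover have "g = mk (b - a * d / c) a 0 c ** mk 0 1 1 (d / c)" using c by (simp add: g)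
    ultimately show ?thesis using c by blast
  qed
qed

context smooth_gl2
begin

sublocale T: grep T2 V
  by (rule grep.intro) (rule representation_T2[OF repV])

lemma jacquet_kernel_minimal:
  assumes "submodule W complex_ring V" "\<And>h v. v \<in> carrier V \<Longrightarrow> act V (upt h) v \<oplus> (-1) \<odot> v \<in> W"
  shows "jacquet_kernel V \<subseteq> W"
  unfolding jacquet_kernel_def
proof (rule hull_minimal)
  show "{act V n v \<ominus> v |n v. n \<in> N2 \<and> v \<in> carrier V} \<subseteq> W"
  proof clarify
    fix n v assume n: "n \<in> (N2 :: 'k mat2 set)" and v: "v \<in> carrier V"
    obtain b where b: "n = mk 1 b 0 1" using n by (rule N2_cases)
    show "act V n v \<ominus> v \<in> W"
      using assms(2)[OF v, of b] v minus_eq'[of "act V n v" v] act_closed'[OF invertible_mk_defs(1) v, of b]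
      by (simp add: b upt_def)
  qed
qed (rule assms(1))

lemma jacquet_kernel_submodule: "submodule (jacquet_kernel V) complex_ring V"
  and jacquet_kernel_diff: "v \<in> carrier V \<Longrightarrow> act V (upt h) v \<oplus> (-1) \<odot> v \<in> jacquet_kernel V"
proof -
  let ?S = "{act V n v \<ominus> v | n v. n \<in> N2 \<and> v \<in> carrier V}"
  have S: "?S \<subseteq> carrier V"
    by (auto elim!: N2_cases intro!: M.minus_closed)
  have c: "submodule (carrier V) complex_ring V" by (rule submoduleI') auto
  have eq: "jacquet_kernel V = \<Inter>{t. submodule t complex_ring V \<and> ?S \<subseteq> t}"
    by (simp add: jacquet_kernel_def hull_def)
  show "submodule (jacquet_kernel V) complex_ring V"
    unfolding eq
  proof (rule submoduleI')
    show "\<Inter>{t. submodule t complex_ring V \<and> ?S \<subseteq> t} \<subseteq> carrier V" using c S by blast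
    show "\<zero> \<in> \<Inter>{t. submodule t complex_ring V \<and> ?S \<subseteq> t}"
      by (auto dest: submoduleD(2))
    show "u \<oplus> w \<in> \<Inter>{t. submodule t complex_ring V \<and> ?S \<subseteq> t}"
      if "u \<in> \<Inter>{t. submodule t complex_ring V \<and> ?S \<subseteq> t}" "w \<in> \<Inter>{t. submodule t complex_ring V \<and> ?S \<subseteq> t}" for u w
    proof (intro InterI)
      fix t assume t: "t \<in> {t. submodule t complex_ring V \<and> ?S \<subseteq> t}"
      then have "u \<in> t" "w \<in> t" using that by blast+
      then show "u \<oplus> w \<in> t" using submoduleD(3)[of t] t by simp
    qed
    show "k \<odot> w \<in> \<Inter>{t. submodule t complex_ring V \<and> ?S \<subseteq> t}"
      if "w \<in> \<Inter>{t. submodule t complex_ring V \<and> ?S \<subseteq> t}" for k w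
    proof (intro InterI)
      fix t assume t: "t \<in> {t. submodule t complex_ring V \<and> ?S \<subseteq> t}"
      then have "w \<in> t" using that by blast
      then show "k \<odot> w \<in> t" using submoduleD(4)[of t] t by simp
    qed
  qed
  assume v: "v \<in> carrier V"
  have "act V (upt h) v \<ominus> v \<in> ?S" using v by (auto simp: upt_def mem_N2 intro!: exI[of _ "mk 1 h 0 1"])
  then have "act V (upt h) v \<ominus> v \<in> jacquet_kernel V" unfolding eq by blast
  then show "act V (upt h) v \<oplus> (-1) \<odot> v \<in> jacquet_kernel V" using minus_eq'[of "act V (upt h) v" v] v by simp
qed

lemma jacquet_kernel_borel:
  assumes pr: "p \<noteq> 0" "r \<noteq> 0" and u: "u \<in> jacquet_kernel V"
  shows "act V (mk p q 0 r) u \<in> jacquet_kernel V"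
proof -
  let ?b = "mk p q 0 r" and ?K = "jacquet_kernel V"
  have b: "invertible ?b" using pr by simp
  note KD = submoduleD[OF jacquet_kernel_submodule]
  have "?K \<subseteq> {v \<in> carrier V. act V ?b v \<in> ?K}"
  proof (rule jacquet_kernel_minimal)
    show "submodule {v \<in> carrier V. act V ?b v \<in> ?K} complex_ring V"
      using KD(2-4) act_zero[of ?b] b by (intro submoduleI') (auto simp: act_add' act_smul')
    fix h v assume v: "v \<in> carrier V"
    have "act V ?b (act V (upt h) v) = act V (?b ** upt h) v" using act_mult'[OF b _ v, of "upt h"] by simp
    also have "\<dots> = act V (upt (p * h / r)) (act V ?b v)"
      unfolding borel_unipotent[OF pr(2)] using act_mult'[OF _ b v, of "upt (p * h / r)"] by simp
    finally have "act V ?b (act V (upt h) v \<oplus> (-1) \<odot> v) = act V (upt (p * h / r)) (act V ?b v) \<oplus> (-1) \<odot> act V ?b v"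
      using b v by (simp add: act_add' act_smul')
    then show "act V (upt h) v \<oplus> (-1) \<odot> v \<in> {v \<in> carrier V. act V ?b v \<in> ?K}"
      using jacquet_kernel_diff[of "act V ?b v" "p * h / r"] b v by simp
  qed
  then show ?thesis using u by blast
qed

lemma jacquet_kernel_subrep: "subrep T2 V (jacquet_kernel V)"
  unfolding subrep_def using jacquet_kernel_submodule jacquet_kernel_borel[where q=0]
  by (auto simp: carrier_T2)

lemma borel_stable:
  assumes U: "subrep T2 V U" "jacquet_kernel V \<subseteq> U" and pr: "p \<noteq> 0" "r \<noteq> 0" and u: "u \<in> U"
  shows "act V (mk p q 0 r) u \<in> U"
proof -
  note UD = T.subrepD[OF U(1)]
  have uV: "u \<in> carrier V" using UD(2) u by auto
  let ?w = "act V (dg p r) u"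
  have w: "?w \<in> U" using UD(6)[of "dg p r"] u pr by (auto simp: carrier_T2 dg_def)
  have wV: "?w \<in> carrier V" using UD(2) w by auto
  have "act V (mk p q 0 r) u = act V (upt (q / r)) ?w"
    using act_mult'[of "upt (q / r)" "dg p r" u] pr uV borel_decomp[OF pr(2), of p q] by simp
  also have "\<dots> = (act V (upt (q / r)) ?w \<oplus> (-1) \<odot> ?w) \<oplus> ?w"
    using sub_add_cancel[of ?w "act V (upt (q / r)) ?w"] wV by simp
  also have "\<dots> \<in> U" using jacquet_kernel_diff[OF wV, of "q / r"] U(2) w UD(4) by blast
  finally show ?thesis .
qed

lemma finite_compact_orbit:
  assumes v: "v \<in> carrier V" and M: "\<And>x h. M (x + h) = M x ** upt h \<or> M (x + h) = M x ** lwt h"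
    and inv: "\<And>x. invertible (M x)"
  shows "finite ((\<lambda>x. act V (M x) v) ` {x::'k. nabs x \<le> 1})"
proof (rule finite_image_locally_constant[OF compact_nabs_le])
  obtain s where s: "0 < s" "s < 1" "\<And>h. h \<in> cong_subgroup s \<Longrightarrow> act V h v = v" using stabilizer[OF v] by blast
  fix x :: 'k
  have "act V (M y) v = act V (M x) v" if y: "dist x y < s" for y
  proof -
    have h: "nabs (y - x) \<le> s" using y by (simp add: dist_nabs nabs_minus_commute)
    then have "upt (y - x) \<in> cong_subgroup s" "lwt (y - x) \<in> cong_subgroup s"
      using s by (simp_all add: mk_defs mem_cong_subgroup)
    then have "act V (M x ** upt (y - x)) v = act V (M x) v" "act V (M x ** lwt (y - x)) v = act V (M x) v"
      using s(3) inv v by (simp_all add: act_mult')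
    then show ?thesis using M[of x "y - x"] by auto
  qed
  then show "\<exists>e>0. \<forall>y\<in>{x. nabs x \<le> 1}. dist x y < e \<longrightarrow> act V (M y) v = act V (M x) v"
    using s(1) by blast
qed

end

context irred_gl2
begin

text \<open>Zorn's lemma needs that a union of proper subspaces is proper. By the Iwasawa decomposition, a subspace that is
  stable under \<open>B\<^sub>2\<close> and contains the finite set \<open>F\<close>, the orbit of \<open>v0\<close> under a compact set, contains the whole
  orbit of \<open>v0\<close>, hence all of \<open>V\<close>; and a finite subset of a union of a chain lies in one member.\<close>

lemma maximal_borel_stable:
  assumes ne: "jacquet_kernel V \<noteq> carrier V"
  obtains U where "subrep T2 V U" "jacquet_kernel V \<subseteq> U" "U \<noteq> carrier V"
    "\<And>U'. subrep T2 V U' \<Longrightarrow> U \<subseteq> U' \<Longrightarrow> U' = U \<or> U' = carrier V"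
proof -
  obtain v0 where v0: "v0 \<in> carrier V" "v0 \<noteq> \<zero>" by (rule nontrivial)
  define F where "F = (\<lambda>x. act V (lwt x) v0) ` {x. nabs x \<le> 1} \<union> (\<lambda>x. act V (mk 0 1 1 x) v0) ` {x. nabs x \<le> 1}"
  have finF: "finite F" unfolding F_def
    by (intro finite_UnI finite_compact_orbit v0) (auto simp: mk_defs)
  have full: "U = carrier V" if U: "subrep T2 V U" "jacquet_kernel V \<subseteq> U" and F: "F \<subseteq> U" for U
  proof -
    note UD = T.subrepD[OF U(1)]
    have orb: "act V g v0 \<in> U" if g: "invertible g" for g
    proof -
      obtain p q r x k where h: "p \<noteq> 0" "r \<noteq> 0" "nabs x \<le> 1" "k = lwt x \<or> k = mk 0 1 1 x" "g = mk p q 0 r ** k"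
        using iwasawa[OF g] by blast
      have "act V k v0 \<in> U" using h(3,4) F by (auto simp: F_def)
      moreover have "act V g v0 = act V (mk p q 0 r) (act V k v0)"
        using h v0 act_mult'[of "mk p q 0 r" k v0] by auto
      ultimately show ?thesis using borel_stable[OF U h(1,2)] by simp
    qed
    \<comment> \<open>the largest subrepresentation inside \<open>U\<close>; it contains \<open>v0\<close>\<close>
    let ?X = "{v \<in> carrier V. \<forall>g. invertible g \<longrightarrow> act V g v \<in> U}"
    have "subrep GL2 V ?X"
    proof (rule subrepI)
      fix g v assume g: "g \<in> carrier (GL2 :: 'k mat2 monoid)" and v: "v \<in> ?X"
      have "act V h (act V g v) \<in> U" if h: "invertible h" for h
      proof -
        have "invertible (h ** g)" using g h by (simp add: invertible_mult_iff)
        then have "act V (h ** g) v \<in> U" using v by blast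
        then show ?thesis using act_mult'[of h g v] g h v by simp
      qed
      then show "act V g v \<in> ?X" using g v by simp
    qed (use UD(3-5) in \<open>auto simp: act_add' act_smul'\<close>)
    moreover have "v0 \<in> ?X" using orb v0 by simp
    ultimately have X: "?X = carrier V" using subrep_trivial v0 by blast
    have "v \<in> U" if "v \<in> carrier V" for v
    proof -
      have "v \<in> ?X" using that X by blast
      then have "act V (mat 1) v \<in> U" using invertible_mk_defs(5) by blast
      then show ?thesis using that by simp
    qed
    then show ?thesis using UD(2) by blast
  qed
  let ?A = "{U. subrep T2 V U \<and> jacquet_kernel V \<subseteq> U \<and> U \<noteq> carrier V}"
  have "\<exists>M\<in>?A. \<forall>X\<in>?A. M \<subseteq> X \<longrightarrow> X = M"
  proof (rule subset_Zorn_nonempty)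
    show "?A \<noteq> {}" using jacquet_kernel_subrep ne by blast
  next
    fix C assume C: "C \<noteq> {}" "subset.chain ?A C"
    have CA: "subrep T2 V U" "jacquet_kernel V \<subseteq> U" "U \<noteq> carrier V" if "U \<in> C" for U
      using that C(2) by (auto simp: subset.chain_def)
    have comp: "U \<subseteq> U' \<or> U' \<subseteq> U" if "U \<in> C" "U' \<in> C" for U U'
      using that C(2) by (auto simp: subset.chain_def)
    have sub: "subrep T2 V (\<Union>C)"
    proof (rule T.subrepI)
      show "\<Union>C \<subseteq> carrier V" using CA(1) T.subrepD(2) by blast
      show "\<zero> \<in> \<Union>C" using C(1) CA(1) T.subrepD(3) by blast
      show "k \<odot> v \<in> \<Union>C" if "v \<in> \<Union>C" for k v using that CA(1) T.subrepD(5) by blast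
      show "act V g v \<in> \<Union>C" if "g \<in> carrier T2" "v \<in> \<Union>C" for g v using that CA(1) T.subrepD(6) by blast
      fix u v assume "u \<in> \<Union>C" "v \<in> \<Union>C"
      then obtain U U' where h: "U \<in> C" "u \<in> U" "U' \<in> C" "v \<in> U'" by blast
      from comp[OF h(1,3)] show "u \<oplus> v \<in> \<Union>C"
      proof
        assume "U \<subseteq> U'"
        then have "u \<oplus> v \<in> U'" using h T.subrepD(4)[OF CA(1)[OF h(3)]] by blast
        then show ?thesis using h by blast
      next
        assume "U' \<subseteq> U"
        then have "u \<oplus> v \<in> U" using h T.subrepD(4)[OF CA(1)[OF h(1)]] by blast
        then show ?thesis using h by blast
      qed
    qed
    have jk: "jacquet_kernel V \<subseteq> \<Union>C" using C(1) CA(2) by blast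
    have "\<Union>C \<noteq> carrier V"
    proof
      assume eq: "\<Union>C = carrier V"
      have "F \<subseteq> \<Union>C" unfolding eq using v0 by (auto simp: F_def)
      obtain U where U: "U \<in> C" "F \<subseteq> U"
        by (rule finite_subset_Union_chain[OF finF \<open>F \<subseteq> \<Union>C\<close> C(1) C(2)])
      then show False using full[OF CA(1,2)[OF U(1)] U(2)] CA(3)[OF U(1)] by simp
    qed
    then show "\<Union>C \<in> ?A" using sub jk by blast
  qed
  then obtain U where U: "U \<in> ?A" and max: "\<forall>X\<in>?A. U \<subseteq> X \<longrightarrow> X = U" by (rule bexE)
  from U have U': "subrep T2 V U" "jacquet_kernel V \<subseteq> U" "U \<noteq> carrier V" by simp_all
  have "X = U \<or> X = carrier V" if X: "subrep T2 V X" "U \<subseteq> X" for X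
  proof (cases "X = carrier V")
    case False
    then have "X \<in> ?A" using X U'(2) by auto
    then show ?thesis using max X(2) by blast
  qed simp
  then show thesis using that[OF U'] by blast
qed

text \<open>On the simple quotient of \<open>V\<close> by a maximal \<open>B\<^sub>2\<close>-stable subspace \<open>U\<close> the torus acts by scalars \<open>D t\<close>, so this
  quotient is a line, spanned by \<open>v1\<close>; \<open>l\<close> is the coordinate along \<open>v1\<close>. The stabilizer of \<open>v1\<close> shows
  that \<open>D\<close> is trivial near the identity.\<close>

lemma exists_eigenfunctional:
  assumes ne: "jacquet_kernel V \<noteq> carrier V"
  shows "\<exists>a c l. is_character a \<and> is_character c \<and> eigenfunctional V a c l"
proof -
  obtain U where U: "subrep T2 V U" "jacquet_kernel V \<subseteq> U" "U \<noteq> carrier V"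
    and max: "\<And>U'. subrep T2 V U' \<Longrightarrow> U \<subseteq> U' \<Longrightarrow> U' = U \<or> U' = carrier V"
    using maximal_borel_stable[OF ne] by blast
  note UD = T.subrepD[OF U(1)]
  have "\<exists>r. \<forall>v\<in>carrier V. act V t v \<oplus> (- r) \<odot> v \<in> U" if t: "t \<in> carrier T2" for t
  proof (rule T.schur_countable[OF countably_spannedV U(1,3) max t])
    fix g assume "g \<in> carrier (T2 :: 'k mat2 monoid)"
    then show "g \<otimes>\<^bsub>T2\<^esub> t = t \<otimes>\<^bsub>T2\<^esub> g" using t by (auto simp: carrier_T2 mult.commute)
  qed
  then obtain D where D: "\<And>t v. t \<in> carrier T2 \<Longrightarrow> v \<in> carrier V \<Longrightarrow> act V t v \<oplus> (- D t) \<odot> v \<in> U" by metis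
  obtain v1 where v1: "v1 \<in> carrier V" "v1 \<notin> U" using U(3) UD(2) by blast
  have uniq: "j = k" if v: "v \<in> carrier V" "v \<oplus> (- j) \<odot> v1 \<in> U" "v \<oplus> (- k) \<odot> v1 \<in> U" for v j k
  proof (rule ccontr)
    assume jk: "j \<noteq> k"
    have "(v \<oplus> (- j) \<odot> v1) \<oplus> (-1) \<odot> (v \<oplus> (- k) \<odot> v1) \<in> U" using v UD(4,5) by blast
    also have "(v \<oplus> (- j) \<odot> v1) \<oplus> (-1) \<odot> (v \<oplus> (- k) \<odot> v1) = (v \<oplus> (-1) \<odot> v) \<oplus> ((- j) \<odot> v1 \<oplus> k \<odot> v1)"
      using v v1 by (simp add: smul_add_right M.a_ac del: add_neg)
    also have "\<dots> = (k - j) \<odot> v1" using v v1 smul_add_left[of v1 "- j" k] by simp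
    finally have "inverse (k - j) \<odot> ((k - j) \<odot> v1) \<in> U" by (rule UD(5))
    then show False using v1 jk by simp
  qed
  have ex: "\<exists>k. v \<oplus> (- k) \<odot> v1 \<in> U" if v: "v \<in> carrier V" for v
  proof -
    let ?I = "{v \<in> carrier V. \<exists>k. v \<oplus> (- k) \<odot> v1 \<in> U}"
    have "subrep T2 V ?I"
    proof (rule T.subrepI)
      show "\<zero> \<in> ?I" using UD(3) v1 by (auto intro!: exI[of _ 0])
    next
      fix u v assume "u \<in> ?I" "v \<in> ?I"
      then obtain j k where h: "u \<in> carrier V" "v \<in> carrier V" "u \<oplus> (- j) \<odot> v1 \<in> U" "v \<oplus> (- k) \<odot> v1 \<in> U" by blast
      have "(u \<oplus> v) \<oplus> (- (j + k)) \<odot> v1 = (u \<oplus> (- j) \<odot> v1) \<oplus> (v \<oplus> (- k) \<odot> v1)"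
        using h v1 smul_add_left[of v1 "- j" "- k"] by (simp add: M.a_ac)
      then have "(u \<oplus> v) \<oplus> (- (j + k)) \<odot> v1 \<in> U" using h UD(4) by simp
      then show "u \<oplus> v \<in> ?I" using h by blast
    next
      fix m v assume "v \<in> ?I"
      then obtain k where h: "v \<in> carrier V" "v \<oplus> (- k) \<odot> v1 \<in> U" by blast
      have "m \<odot> v \<oplus> (- (m * k)) \<odot> v1 = m \<odot> (v \<oplus> (- k) \<odot> v1)"
        using h v1 by (simp add: smul_add_right)
      then have "m \<odot> v \<oplus> (- (m * k)) \<odot> v1 \<in> U" using UD(5)[OF h(2), of m] by simp
      then show "m \<odot> v \<in> ?I" using h by blast
    next
      fix t v assume t: "t \<in> carrier (T2 :: 'k mat2 monoid)" and "v \<in> ?I"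
      then obtain k where h: "v \<in> carrier V" "v \<oplus> (- k) \<odot> v1 \<in> U" by blast
      have tv: "act V t v \<in> carrier V" using T.act_closed[OF t h(1)] .
      have "(act V t v \<oplus> (- D t) \<odot> v) \<oplus> D t \<odot> (v \<oplus> (- k) \<odot> v1) \<in> U"
        using D[OF t h(1)] h(2) UD(4,5) by blast
      also have "(act V t v \<oplus> (- D t) \<odot> v) \<oplus> D t \<odot> (v \<oplus> (- k) \<odot> v1) =
          act V t v \<oplus> (((- D t) \<odot> v \<oplus> D t \<odot> v) \<oplus> (- (D t * k)) \<odot> v1)"
        using h v1 tv by (simp add: smul_add_right M.a_assoc)
      also have "(- D t) \<odot> v \<oplus> D t \<odot> v = \<zero>" using h smul_add_left[of v "- D t" "D t"] by simp
      finally have "act V t v \<oplus> (- (D t * k)) \<odot> v1 \<in> U" using v1 by simp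
      then show "act V t v \<in> ?I" using tv by blast
    qed auto
    moreover have "U \<subseteq> ?I"
    proof
      fix u assume u: "u \<in> U"
      then have uV: "u \<in> carrier V" using UD(2) by auto
      then have "u \<oplus> (- 0) \<odot> v1 = u" using v1 by simp
      then have "u \<oplus> (- 0) \<odot> v1 \<in> U" using u by simp
      then show "u \<in> ?I" using uV by blast
    qed
    moreover have "v1 \<in> ?I"
    proof -
      have "v1 \<oplus> (- 1) \<odot> v1 \<in> U" using v1 UD(3) by simp
      then show ?thesis using v1 by blast
    qed
    ultimately have "?I = carrier V" using max[of ?I] v1 by blast
    then show ?thesis using v by blast
  qed
  define l where "l v = (THE k. v \<oplus> (- k) \<odot> v1 \<in> U)" for v
  have l_eq: "l v = k" if "v \<in> carrier V" "v \<oplus> (- k) \<odot> v1 \<in> U" for v k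
    unfolding l_def using that uniq by (intro the_equality) auto
  have l_U: "v \<oplus> (- l v) \<odot> v1 \<in> U" if v: "v \<in> carrier V" for v
    using ex[OF v] l_eq[OF v] by metis
  have l_0: "l u = 0" if "u \<in> U" for u
    using that UD(2) v1 by (intro l_eq) (auto simp: subset_iff)
  have l_1: "l v1 = 1" using v1 UD(3) by (intro l_eq) auto
  have l_add: "l (u \<oplus> v) = l u + l v" if h: "u \<in> carrier V" "v \<in> carrier V" for u v
  proof (rule l_eq)
    have "(u \<oplus> v) \<oplus> (- (l u + l v)) \<odot> v1 = (u \<oplus> (- l u) \<odot> v1) \<oplus> (v \<oplus> (- l v) \<odot> v1)"
      using h v1 smul_add_left[of v1 "- l u" "- l v"] by (simp add: M.a_ac)
    then show "(u \<oplus> v) \<oplus> (- (l u + l v)) \<odot> v1 \<in> U" using l_U h UD(4) by simp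
  qed (use h in simp)
  have l_smul: "l (k \<odot> v) = k * l v" if h: "v \<in> carrier V" for k v
  proof (rule l_eq)
    have "k \<odot> v \<oplus> (- (k * l v)) \<odot> v1 = k \<odot> (v \<oplus> (- l v) \<odot> v1)"
      using h v1 by (simp add: smul_add_right)
    then show "k \<odot> v \<oplus> (- (k * l v)) \<odot> v1 \<in> U" using l_U[OF h] UD(5) by simp
  qed (use h in simp)
  have lf: "lfun V l" using l_add l_smul by (simp add: lfun_def)
  have l_T: "l (act V t v) = D t * l v" if t: "t \<in> carrier T2" and v: "v \<in> carrier V" for t v
  proof -
    have "l (act V t v \<oplus> (- D t) \<odot> v) = 0" using D[OF t v] l_0 by blast
    then show ?thesis using l_add[of "act V t v" "(- D t) \<odot> v"] l_smul[OF v, of "- D t"] T.act_closed[OF t v] v by simp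
  qed
  have l_N: "l (act V (upt h) v) = l v" if v: "v \<in> carrier V" for h v
  proof -
    have "l (act V (upt h) v \<oplus> (-1) \<odot> v) = 0" using jacquet_kernel_diff[OF v, of h] U(2) l_0 by blast
    then show ?thesis using l_add[of "act V (upt h) v" "(-1) \<odot> v"] l_smul[OF v, of "-1"] v by simp
  qed
  have dgT: "dg x y \<in> carrier T2" if "x \<noteq> 0" "y \<noteq> 0" for x y :: 'k
    using that by (auto simp: carrier_T2 dg_def)
  have D1: "D t = l (act V t v1)" if "t \<in> carrier T2" for t using l_T[OF that v1(1)] l_1 by simp
  have Dmult: "D (t ** t') = D t * D t'" if t: "t \<in> carrier T2" "t' \<in> carrier T2" for t t'
  proof -
    have "D (t ** t') = l (act V (t ** t') v1)" using D1 T.G.m_closed[OF t] by simp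
    also have "\<dots> = l (act V t (act V t' v1))" using T.act_mult[OF t v1(1)] by simp
    also have "\<dots> = D t * D t'" using l_T[OF t(1) T.act_closed[OF t(2) v1(1)]] D1[OF t(2)] by simp
    finally show ?thesis .
  qed
  obtain s where s: "0 < s" "s < 1" "\<And>h. h \<in> cong_subgroup s \<Longrightarrow> act V h v1 = v1" using stabilizer[OF v1(1)] by blast
  have Done: "D t = 1" if "t \<in> carrier T2" "t \<in> cong_subgroup s" for t using D1 s(3) that l_1 by simp
  define a where "a x = D (dg x 1)" for x
  define c where "c y = D (dg 1 y)" for y
  have mult: "dg x y ** dg x' y' = dg (x * x') (y * y')" for x y x' y' :: 'k by (simp add: dg_def)
  have am: "a (x * y) = a x * a y" and cm: "c (x * y) = c x * c y" if "x \<noteq> 0" "y \<noteq> 0" for x y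
    using Dmult[OF dgT dgT, of x 1 y 1] Dmult[OF dgT dgT, of 1 x 1 y] that by (simp_all add: a_def c_def mult)
  have a1: "a x = 1" and c1: "c x = 1" if "nabs (x - 1) \<le> s" for x
  proof -
    have "x \<noteq> 0" using nabs_near_1[of x] that s by simp
    then show "a x = 1" "c x = 1"
      using Done[OF dgT, of x 1] Done[OF dgT, of 1 x] that s by (simp_all add: a_def c_def dg_def mem_cong_subgroup)
  qed
  have "a x \<noteq> 0" "c x \<noteq> 0" if x: "x \<noteq> 0" for x
  proof -
    have "a x * a (inverse x) = 1" "c x * c (inverse x) = 1"
      using am[of x "inverse x"] cm[of x "inverse x"] x a1[of 1] c1[of 1] s by simp_all
    then show "a x \<noteq> 0" "c x \<noteq> 0" by auto
  qed
  then have "is_character a" "is_character c"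
    using am cm a1 c1 s(1) by (auto intro!: is_characterI[of _ s])
  moreover have "l (act V (mk p q 0 r) v) = a p * c r * l v" if "v \<in> carrier V" "p \<noteq> 0" "r \<noteq> 0" for p q r v
  proof -
    have "act V (mk p q 0 r) v = act V (upt (q / r)) (act V (dg p r) v)"
      using act_mult'[of "upt (q / r)" "dg p r" v] that borel_decomp[OF that(3), of p q] by simp
    moreover have "D (dg p r) = a p * c r"
      using Dmult[OF dgT dgT, of p 1 1 r] that by (simp add: a_def c_def mult)
    ultimately show ?thesis using l_N l_T[OF dgT, of p r v] that by simp
  qed
  ultimately show ?thesis
    unfolding eigenfunctional_def using lf v1(1) l_1 by (metis zero_neq_one)
qed

end


subsection \<open>Frobenius reciprocity\<close>

definition frob :: "('k::nonarch_local_field mat2, 'v) rep \<Rightarrow> ('v \<Rightarrow> complex) \<Rightarrow> 'v \<Rightarrow> 'k mat2 \<Rightarrow> complex" where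
  "frob V l v = (\<lambda>g. if invertible g then l (act V g v) else 0)"

locale frobenius = smooth_gl2 V + char_pair a c
  for V :: "('k::nonarch_local_field mat2, 'v) rep" (structure) and a c :: "'k \<Rightarrow> complex" +
  fixes l :: "'v \<Rightarrow> complex"
  assumes eig: "eigenfunctional V a c l"
begin

lemma lfun_l: "lfun V l"
  and l_borel: "p \<noteq> 0 \<Longrightarrow> r \<noteq> 0 \<Longrightarrow> v \<in> carrier V \<Longrightarrow> l (act V (mk p q 0 r) v) = a p * c r * l v"
  and l_nonzero: "\<exists>v\<in>carrier V. l v \<noteq> 0"
  using eig by (auto simp: eigenfunctional_def)

abbreviation \<Phi> where "\<Phi> \<equiv> frob V l"

lemma frob_at_1: "v \<in> carrier V \<Longrightarrow> \<Phi> v (mat 1) = l v"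
  by (simp add: frob_def)

lemma frob_ps: assumes v: "v \<in> carrier V" shows "\<Phi> v \<in> ps a c"
proof -
  obtain s where s: "0 < s" "s < 1" "\<And>h. h \<in> cong_subgroup s \<Longrightarrow> act V h v = v" using stabilizer[OF v] by blast
  show ?thesis
  proof (rule psI[OF _ _ s(1,2)])
    fix g h :: "'k mat2" assume g: "invertible g" and h: "h \<in> cong_subgroup s"
    have hi: "invertible h" using cong_subgroup_invertible[OF h s(2)] .
    then show "\<Phi> v (g ** h) = \<Phi> v g"
      using g s(3)[OF h] act_mult'[OF g hi v] by (simp add: frob_def invertible_mult_iff)
  next
    fix p q r :: 'k and g :: "'k mat2" assume h: "p \<noteq> 0" "r \<noteq> 0" "invertible g"
    then show "\<Phi> v (mk p q 0 r ** g) = a p * c r * \<Phi> v g"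
      using act_mult'[of "mk p q 0 r" g v] l_borel[of p r "act V g v" q] v by (simp add: frob_def invertible_mult_iff)
  qed (simp add: frob_def)
qed

lemma frob_add: "u \<in> carrier V \<Longrightarrow> v \<in> carrier V \<Longrightarrow> \<Phi> (u \<oplus> v) = (\<lambda>g. \<Phi> u g + \<Phi> v g)"
  by (auto simp: frob_def fun_eq_iff act_add' lfun_add[OF lfun_l])

lemma frob_smul: "v \<in> carrier V \<Longrightarrow> \<Phi> (k \<odot> v) = (\<lambda>g. k * \<Phi> v g)"
  by (auto simp: frob_def fun_eq_iff act_smul' lfun_smul[OF lfun_l])

lemma frob_act: "invertible g \<Longrightarrow> v \<in> carrier V \<Longrightarrow> \<Phi> (act V g v) = rtr g (\<Phi> v)"
  by (auto simp: frob_def fun_eq_iff rtr_def invertible_mult_iff act_mult')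

lemma frob_zero: "\<Phi> \<zero> = (\<lambda>_. 0)"
  using frob_smul[of \<zero> 0] by simp

lemma gstable_frob_image:
  assumes X: "subrep GL2 V X" shows "gstable (\<Phi> ` X)"
proof -
  note XD = subrepD[OF X]
  have c: "v \<in> carrier V" if "v \<in> X" for v using that XD(2) by auto
  have "(\<lambda>_. 0) \<in> \<Phi> ` X" using XD(3) frob_zero by (intro image_eqI[of _ _ \<zero>]) simp_all
  moreover have "(\<lambda>x. f x + g x) \<in> \<Phi> ` X" if h: "f \<in> \<Phi> ` X" "g \<in> \<Phi> ` X" for f g
  proof -
    obtain u v where "u \<in> X" "v \<in> X" "f = \<Phi> u" "g = \<Phi> v" using h by blast
    then show ?thesis using XD(4) frob_add[of u v] c by (intro image_eqI[of _ _ "u \<oplus> v"]) auto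
  qed
  moreover have "(\<lambda>x. k * f x) \<in> \<Phi> ` X" if h: "f \<in> \<Phi> ` X" for f k
  proof -
    obtain u where "u \<in> X" "f = \<Phi> u" using h by blast
    then show ?thesis using XD(5) frob_smul[of u k] c by (intro image_eqI[of _ _ "k \<odot> u"]) auto
  qed
  moreover have "rtr g f \<in> \<Phi> ` X" if h: "invertible g" "f \<in> \<Phi> ` X" for f g
  proof -
    obtain u where "u \<in> X" "f = \<Phi> u" using h by blast
    then show ?thesis using XD(6)[of g] frob_act[of g u] c h by (intro image_eqI[of _ _ "act V g u"]) auto
  qed
  ultimately show ?thesis unfolding gstable_def lin_closed_def by blast
qed

lemma subrep_frob_vimage:
  assumes W: "gstable W" shows "subrep GL2 V {v \<in> carrier V. \<Phi> v \<in> W}"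
  using gstableD[OF W] lin_closed_zero[of W] lin_closed_add[of W] lin_closed_cmult[of W]
  by (intro subrepI) (auto simp: frob_zero frob_add frob_smul frob_act)

lemma frob_image_ps: "\<Phi> ` carrier V \<subseteq> ps a c"
  using frob_ps by auto

lemma gstable_frob: "gstable (\<Phi> ` carrier V)"
  by (rule gstable_frob_image[OF subrep_carrier])

end

locale frobenius_irred = frobenius V a c l + irred_gl2 V
  for V :: "('k::nonarch_local_field mat2, 'v) rep" (structure) and a c :: "'k \<Rightarrow> complex" and l
begin

lemma frob_eq_zero: assumes v: "v \<in> carrier V" shows "\<Phi> v = (\<lambda>_. 0) \<longleftrightarrow> v = \<zero>"
proof -
  have "gstable {\<lambda>_. 0}" by (simp add: gstable_def lin_closed_def rtr_def)
  then have "{v \<in> carrier V. \<Phi> v \<in> {\<lambda>_. 0}} = {\<zero>} \<or> {v \<in> carrier V. \<Phi> v \<in> {\<lambda>_. 0}} = carrier V"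
    by (intro subrep_trivial subrep_frob_vimage)
  moreover have "{v \<in> carrier V. \<Phi> v \<in> {\<lambda>_. 0}} \<noteq> carrier V"
  proof
    assume h: "{v \<in> carrier V. \<Phi> v \<in> {\<lambda>_. 0}} = carrier V"
    obtain v where v: "v \<in> carrier V" "l v \<noteq> 0" using l_nonzero by blast
    then have "\<Phi> v = (\<lambda>_. 0)" using h by blast
    then show False using frob_at_1[OF v(1)] v(2) by simp
  qed
  ultimately have "{v \<in> carrier V. \<Phi> v \<in> {\<lambda>_. 0}} = {\<zero>}" by blast
  then show ?thesis using v by blast
qed

lemma frob_inj: assumes "u \<in> carrier V" "v \<in> carrier V" "\<Phi> u = \<Phi> v" shows "u = v"
proof -
  have "\<Phi> (u \<oplus> (-1) \<odot> v) = (\<lambda>_. 0)" using assms by (simp add: frob_add frob_smul)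
  then have "u \<oplus> (-1) \<odot> v = \<zero>" using frob_eq_zero[of "u \<oplus> (-1) \<odot> v"] assms by simp
  then show ?thesis using sub_add_cancel[of v u] assms by simp
qed

lemma frob_sub_trivial:
  assumes W: "gstable W" "W \<subseteq> \<Phi> ` carrier V" shows "W = {\<lambda>_. 0} \<or> W = \<Phi> ` carrier V"
proof -
  have eq: "W = \<Phi> ` {v \<in> carrier V. \<Phi> v \<in> W}" using W(2) by blast
  from subrep_trivial[OF subrep_frob_vimage[OF W(1)]] show ?thesis
  proof
    assume "{v \<in> carrier V. \<Phi> v \<in> W} = {\<zero>}"
    then have "W = \<Phi> ` {\<zero>}" using eq by simp
    then show ?thesis by (simp add: frob_zero)
  next
    assume "{v \<in> carrier V. \<Phi> v \<in> W} = carrier V"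
    then show ?thesis using eq by simp
  qed
qed

text \<open>The kernel is contained in \<open>ps00\<close> because unipotent differences are. Conversely, if \<open>V\<close> contains a nonzero element
  of \<open>ps00\<close>, it contains all of \<open>ps00\<close>; the kernel is then a nonzero \<open>B\<^sub>2\<close>-stable subspace of the irreducible \<open>ps00\<close>.\<close>

lemma jacquet_kernel_frob: "jacquet_kernel V = {v \<in> carrier V. \<Phi> v \<in> ps00 a c}"
proof
  show le: "jacquet_kernel V \<subseteq> {v \<in> carrier V. \<Phi> v \<in> ps00 a c}"
  proof (rule jacquet_kernel_minimal)
    show "submodule {v \<in> carrier V. \<Phi> v \<in> ps00 a c} complex_ring V"
      using lin_closed_zero[OF lin_closed_ps00] lin_closed_add[OF lin_closed_ps00] lin_closed_cmult[OF lin_closed_ps00]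
      by (intro submoduleI') (auto simp: frob_zero frob_add frob_smul)
    show "act V (upt h) v \<oplus> (-1) \<odot> v \<in> {v \<in> carrier V. \<Phi> v \<in> ps00 a c}" if v: "v \<in> carrier V" for h v
      using unipotent_diff_ps00[OF frob_ps[OF v], of h] v by (simp add: frob_add frob_smul frob_act)
  qed
  note KD = submoduleD[OF jacquet_kernel_submodule]
  have Kc: "v \<in> carrier V" if "v \<in> jacquet_kernel V" for v using KD(1) that by auto
  show "{v \<in> carrier V. \<Phi> v \<in> ps00 a c} \<subseteq> jacquet_kernel V"
  proof (cases "\<exists>f\<in>\<Phi> ` carrier V \<inter> ps00 a c. f \<noteq> (\<lambda>_. 0)")
    case False
    then show ?thesis using frob_eq_zero KD(2) by blast
  next
    case True
    then obtain f where f: "f \<in> \<Phi> ` carrier V" "f \<in> ps00 a c" "f \<noteq> (\<lambda>_. 0)" by blast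
    then have sub: "ps00 a c \<subseteq> \<Phi> ` carrier V" using sub_contains_ps00[OF gstable_frob frob_image_ps] by blast
    let ?U = "\<Phi> ` jacquet_kernel V"
    have U00: "?U \<subseteq> ps00 a c" using le by blast
    have lin: "lin_closed ?U"
      unfolding lin_closed_def
    proof (intro conjI allI ballI)
      show "(\<lambda>_. 0) \<in> ?U" using KD(2) frob_zero by (intro image_eqI[of _ _ \<zero>]) simp_all
      fix f assume "f \<in> ?U"
      then obtain u where u: "u \<in> jacquet_kernel V" "f = \<Phi> u" by blast
      show "(\<lambda>x. k * f x) \<in> ?U" for k
        using u KD(4) frob_smul[OF Kc[OF u(1)], of k] by (intro image_eqI[of _ _ "k \<odot> u"]) auto
      fix g assume "g \<in> ?U"
      then obtain v where v: "v \<in> jacquet_kernel V" "g = \<Phi> v" by blast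
      show "(\<lambda>x. f x + g x) \<in> ?U"
        using u v KD(3) frob_add[OF Kc[OF u(1)] Kc[OF v(1)]] by (intro image_eqI[of _ _ "u \<oplus> v"]) auto
    qed
    have borel: "rtr (mk p q 0 r) f \<in> ?U" if f: "f \<in> ?U" and pr: "p \<noteq> 0" "r \<noteq> 0" for f p q r
    proof -
      obtain u where u: "u \<in> jacquet_kernel V" "f = \<Phi> u" using f by blast
      then show ?thesis
        using jacquet_kernel_borel[OF pr u(1), of q] frob_act[OF _ Kc[OF u(1)], of "mk p q 0 r"] pr
        by (intro image_eqI[of _ _ "act V (mk p q 0 r) u"]) auto
    qed
    obtain v where v: "v \<in> carrier V" "f = \<Phi> v" using f(1) by blast
    \<comment> \<open>a nonzero function of compact support is not invariant under all translations\<close>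
    obtain h where h: "rtr (upt h) f \<noteq> f"
    proof (rule ccontr)
      assume "\<not> thesis"
      then have inv: "rtr (upt h) f = f" for h using that by blast
      have fps: "f \<in> ps a c" "f (mat 1) = 0" using f(2) by (auto simp: ps00_def)
      obtain R where R: "supp_in R (phi f)" using phi_schwartz[OF fps] by (auto simp: schwartz_def)
      obtain y :: 'k where y: "R + 1 \<le> nabs y" using nabs_unbounded by blast
      have "phi f x = 0" for x
      proof -
        have "phi f x = phi f (x + (y - x))" using inv[of "y - x"] phi_rtr_upt[of "y - x" f] by (metis fun_cong)
        also have "\<dots> = 0" using R y by (simp add: supp_in_def)
        finally show ?thesis .
      qed
      then have "f = (\<lambda>_. 0)"
        using fps by (intro ps_ext lin_closed_zero[OF lin_closed_ps]) (auto simp: phi_0 fun_eq_iff)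
      then show False using f(3) by blast
    qed
    have "act V (upt h) v \<oplus> (-1) \<odot> v \<in> jacquet_kernel V" by (rule jacquet_kernel_diff[OF v(1)])
    then have "(\<lambda>x. rtr (upt h) f x - f x) \<in> ?U"
      using v by (intro image_eqI[of _ _ "act V (upt h) v \<oplus> (-1) \<odot> v"]) (auto simp: frob_add frob_smul frob_act)
    moreover have "(\<lambda>x. rtr (upt h) f x - f x) \<noteq> (\<lambda>_. 0)" using h by (auto simp: fun_eq_iff)
    ultimately have "ps00 a c \<subseteq> ?U"
      using borel[of _ 1 1] borel[of _ _ _ 0]
      by (intro ps00_irreducible[OF lin U00]) (auto simp: upt_def dg_def)
    then show ?thesis using frob_inj Kc by blast
  qed
qed

end

section \<open>Semisimplified Jacquet modules\<close>

context char_pair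
begin

lemma haar_phi_add:
  assumes "f \<in> ps a c" "f (mat 1) = 0" "g \<in> ps a c" "g (mat 1) = 0"
  shows "haar (phi (\<lambda>x. f x + g x)) = haar (phi f) + haar (phi g)"
  unfolding phi_add using assms by (intro haar_add phi_schwartz)

lemma haar_phi_cmult:
  assumes "f \<in> ps a c" "f (mat 1) = 0"
  shows "haar (phi (\<lambda>x. k * f x)) = k * haar (phi f)"
  unfolding phi_cmult using assms by (intro haar_cmult phi_schwartz)

lemma haar_phi_borel:
  assumes f: "f \<in> ps a c" "f (mat 1) = 0" and pr: "p \<noteq> 0" "r \<noteq> 0"
  shows "haar (phi (rtr (mk p q 0 r) f)) = of_real (nabs p / nabs r) * a r * c p * haar (phi f)"
proof -
  have g: "rtr (dg p r) f \<in> ps a c" "rtr (dg p r) f (mat 1) = 0"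
    using rtr_ps[OF f(1)] rtr_dg_at_1[OF f(1) pr] f pr by auto
  have "phi (rtr (mk p q 0 r) f) = (\<lambda>x. phi (rtr (dg p r) f) (x + q / r))"
    unfolding borel_decomp[OF pr(2), of p q] rtr_mult by (rule phi_rtr_upt)
  then show ?thesis using haar_translate[OF phi_schwartz[OF g]] haar_rtr_dg[OF f pr] by simp
qed

lemma normalized_element: "\<exists>f\<in>ps a c. f (mat 1) = 0 \<and> haar (phi f) = 1"
  using phi_surj[OF schwartz_ball_ind[of 1]] haar_ball_ind[of "1::'k"] by auto

text \<open>The element \<open>(x0, y0) - a x0 c y0\<close> of the group algebra of the torus kills the first character of the Jacquet module of
  \<open>ps a c\<close>, that is, it maps \<open>ps a c\<close> to functions vanishing at \<open>1\<close>. Followed by the integral it is a functional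
  that transforms by the second character.\<close>

definition twisted :: "'k \<Rightarrow> 'k \<Rightarrow> ('k mat2 \<Rightarrow> complex) \<Rightarrow> 'k mat2 \<Rightarrow> complex" where
  "twisted x0 y0 f = (\<lambda>x. rtr (dg x0 y0) f x + (- (a x0 * c y0)) * f x)"

lemma twisted_ps:
  assumes "f \<in> ps a c" "x0 \<noteq> 0" "y0 \<noteq> 0"
  shows "twisted x0 y0 f \<in> ps a c" "twisted x0 y0 f (mat 1) = 0"
proof -
  show "twisted x0 y0 f \<in> ps a c"
    unfolding twisted_def using assms
    by (intro lin_closed_add[OF lin_closed_ps] lin_closed_cmult[OF lin_closed_ps] rtr_ps) auto
  show "twisted x0 y0 f (mat 1) = 0" using rtr_dg_at_1[OF assms] by (simp add: twisted_def)
qed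

lemma haar_twisted_borel:
  assumes f: "f \<in> ps a c" and xy: "x0 \<noteq> 0" "y0 \<noteq> 0" and pr: "p \<noteq> 0" "r \<noteq> 0"
  shows "haar (phi (twisted x0 y0 (rtr (mk p q 0 r) f))) =
     of_real (nabs p / nabs r) * a r * c p * haar (phi (twisted x0 y0 f))"
proof -
  have up: "haar (phi (twisted x0 y0 (rtr (upt h) g))) = haar (phi (twisted x0 y0 g))" if g: "g \<in> ps a c" for g h
  proof -
    have gd: "rtr (dg x0 y0) g \<in> ps a c" using rtr_ps g xy by simp
    have "dg x0 y0 ** upt h = upt (x0 * h / y0) ** dg x0 y0" using xy by (simp add: mk_defs)
    then have sw: "rtr (dg x0 y0) (rtr (upt h) g) = rtr (upt (x0 * h / y0)) (rtr (dg x0 y0) g)"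
      by (simp flip: rtr_mult)
    let ?d1 = "\<lambda>x. rtr (upt (x0 * h / y0)) (rtr (dg x0 y0) g) x - rtr (dg x0 y0) g x"
    let ?d2 = "\<lambda>x. rtr (upt h) g x - g x"
    have d: "?d1 \<in> ps00 a c" "?d2 \<in> ps00 a c" by (rule unipotent_diff_ps00[OF gd], rule unipotent_diff_ps00[OF g])
    let ?e = "\<lambda>x. ?d1 x + (- (a x0 * c y0)) * ?d2 x"
    have e: "?e \<in> ps00 a c" by (intro lin_closed_add[OF lin_closed_ps00] lin_closed_cmult[OF lin_closed_ps00] d)
    have "twisted x0 y0 (rtr (upt h) g) = (\<lambda>x. twisted x0 y0 g x + ?e x)"
      unfolding twisted_def sw by (simp add: fun_eq_iff algebra_simps)
    then show ?thesis
      using haar_phi_add[OF twisted_ps[OF g xy], of ?e] e by (simp add: ps00_def)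
  qed
  have g: "rtr (dg p r) f \<in> ps a c" using rtr_ps f pr by simp
  have "dg x0 y0 ** dg p r = dg p r ** dg x0 y0" by (simp add: dg_def mult.commute)
  then have "rtr (dg x0 y0) (rtr (dg p r) f) = rtr (dg p r) (rtr (dg x0 y0) f)" by (metis rtr_mult)
  from fun_cong[OF this] have "twisted x0 y0 (rtr (dg p r) f) = rtr (dg p r) (twisted x0 y0 f)"
    unfolding twisted_def by (simp add: fun_eq_iff rtr_def[of "dg p r"])
  moreover have "rtr (mk p q 0 r) f = rtr (upt (q / r)) (rtr (dg p r) f)"
    unfolding borel_decomp[OF pr(2), of p q] rtr_mult ..
  ultimately show ?thesis
    using up[OF g, of "q / r"] haar_rtr_dg[OF twisted_ps[OF f xy] pr] by simp
qed

lemma twisted_add: "twisted x0 y0 (\<lambda>x. f x + g x) = (\<lambda>x. twisted x0 y0 f x + twisted x0 y0 g x)"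
  and twisted_cmult: "twisted x0 y0 (\<lambda>x. k * f x) = (\<lambda>x. k * twisted x0 y0 f x)"
  by (simp_all add: twisted_def rtr_def fun_eq_iff algebra_simps)

end

lemma eigenfunctional_cong:
  assumes "eigenfunctional V a c l" "\<And>x. x \<noteq> 0 \<Longrightarrow> a x = a' x" "\<And>x. x \<noteq> 0 \<Longrightarrow> c x = c' x"
  shows "eigenfunctional V a' c' l"
  using assms unfolding eigenfunctional_def by auto

context smooth_gl2
begin

lemma qrep_jacquet: "qrep T2 V (jacquet_kernel V)"
  by (intro qrep.intro qrep_axioms.intro jacquet_kernel_subrep T.grep_axioms)

lemma jacquet_hom_annihilator:
  assumes ser: "grep.has_series T2 (jacquet_module V) (carrier (jacquet_module V))"
    and t: "t \<in> carrier T2" "t' \<in> carrier T2"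
    and ann: "\<And>v. v \<in> carrier V \<Longrightarrow>
      act V t (act V t' v \<oplus> \<beta> \<odot> v) \<oplus> \<alpha> \<odot> (act V t' v \<oplus> \<beta> \<odot> v) \<in> jacquet_kernel V"
    and nz: "\<not> rep_hom_zero T2 (semisimplification T2 (jacquet_module V)) (char_rep \<mu>)"
  shows "(\<mu> t + \<alpha>) * (\<mu> t' + \<beta>) = 0"
proof -
  interpret q: qrep T2 V "jacquet_kernel V" by (rule qrep_jacquet)
  have J: "q.Q = jacquet_module V" by (simp add: jacquet_module_eq)
  show ?thesis
  proof (rule q.Q.semisimplification_hom_annihilator[OF _ t])
    show "q.Q.has_series (carrier q.Q)" using ser by (simp add: J)
    show "\<not> rep_hom_zero T2 (semisimplification T2 q.Q) (char_rep \<mu>)" using nz by (simp add: J)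
    fix X assume "X \<in> carrier q.Q"
    then obtain v where v: "v \<in> carrier V" "X = q.proj v" by (rule q.carrier_Q_cases)
    have c: "act V t' v \<in> carrier V" using T.act_closed[OF t(2) v(1)] .
    have c2: "act V t (act V t' v \<oplus> \<beta> \<odot> v) \<in> carrier V" using T.act_closed[OF t(1)] c v by simp
    have "q.proj (act V t (act V t' v \<oplus> \<beta> \<odot> v) \<oplus> \<alpha> \<odot> (act V t' v \<oplus> \<beta> \<odot> v)) = \<zero>\<^bsub>q.Q\<^esub>"
      using ann[OF v(1)] c c2 v by (subst q.proj_zero_iff) auto
    then show "act q.Q t (act q.Q t' X \<oplus>\<^bsub>q.Q\<^esub> \<beta> \<odot>\<^bsub>q.Q\<^esub> X) \<oplus>\<^bsub>q.Q\<^esub> \<alpha> \<odot>\<^bsub>q.Q\<^esub> (act q.Q t' X \<oplus>\<^bsub>q.Q\<^esub> \<beta> \<odot>\<^bsub>q.Q\<^esub> X) = \<zero>\<^bsub>q.Q\<^esub>"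
      using v c c2 by (simp add: q.act_Q[OF t(1)] q.act_Q[OF t(2)] q.smul_Q q.add_Q)
  qed
qed

end

context frobenius_irred
begin

lemma haar_frob_add:
  assumes "u \<in> carrier V" "l u = 0" "v \<in> carrier V" "l v = 0"
  shows "haar (phi (\<Phi> (u \<oplus> v))) = haar (phi (\<Phi> u)) + haar (phi (\<Phi> v))"
  using assms by (simp add: frob_add haar_phi_add frob_ps frob_at_1)

lemma haar_frob_smul:
  assumes "v \<in> carrier V" "l v = 0"
  shows "haar (phi (\<Phi> (k \<odot> v))) = k * haar (phi (\<Phi> v))"
  using assms by (simp add: frob_smul haar_phi_cmult frob_ps frob_at_1)

lemma mem_jacquet_kernel: "v \<in> jacquet_kernel V \<longleftrightarrow> v \<in> carrier V \<and> l v = 0 \<and> haar (phi (\<Phi> v)) = 0"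
  unfolding jacquet_kernel_frob by (auto simp: ps00_def frob_ps frob_at_1)

text \<open>Evaluation at \<open>1\<close> and the integral over the big cell exhibit the two steps of the filtration as spanned by at
  most one vector each.\<close>

lemma jacquet_series_frob: "grep.has_series T2 (jacquet_module V) (carrier (jacquet_module V))"
proof -
  interpret q: qrep T2 V "jacquet_kernel V" by (rule qrep_jacquet)
  have J: "q.Q = jacquet_module V" by (simp add: jacquet_module_eq)
  define V0 where "V0 = {v \<in> carrier V. l v = 0}"
  have V0: "subrep T2 V V0"
    unfolding V0_def
    using l_borel[where q=0]
    by (intro T.subrepI) (auto simp: lfun_add[OF lfun_l] lfun_smul[OF lfun_l] lfun_zero[OF lfun_l] carrier_T2)
  have 0: "q.Q.has_series {\<zero>\<^bsub>q.Q\<^esub>}" by (rule q.Q.has_series_zero)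
  have sub0: "subrep T2 q.Q (q.proj ` V0)" by (rule q.subrep_image[OF V0])
  have 1: "q.Q.has_series (q.proj ` V0)"
  proof -
    obtain y where y: "y \<in> V0" "\<And>x. x \<in> V0 \<Longrightarrow> \<exists>k. x \<oplus> k \<odot> y \<in> jacquet_kernel V"
    proof (cases "\<exists>v\<in>V0. haar (phi (\<Phi> v)) \<noteq> 0")
      case True
      then obtain y where y: "y \<in> V0" "haar (phi (\<Phi> y)) \<noteq> 0" by blast
      show thesis
      proof (rule that[OF y(1)])
        fix x assume x: "x \<in> V0"
        let ?k = "- (haar (phi (\<Phi> x)) / haar (phi (\<Phi> y)))"
        have "x \<oplus> ?k \<odot> y \<in> jacquet_kernel V"
          using x y unfolding mem_jacquet_kernel V0_def
          by (simp add: haar_frob_add haar_frob_smul lfun_add[OF lfun_l] lfun_smul[OF lfun_l])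
        then show "\<exists>k. x \<oplus> k \<odot> y \<in> jacquet_kernel V" by blast
      qed
    next
      case False
      show thesis
      proof (rule that[of \<zero>])
        show "\<zero> \<in> V0" by (simp add: V0_def lfun_zero[OF lfun_l])
        fix x assume x: "x \<in> V0"
        then have "x \<oplus> 0 \<odot> \<zero> \<in> jacquet_kernel V" using False by (simp add: mem_jacquet_kernel V0_def)
        then show "\<exists>k. x \<oplus> k \<odot> \<zero> \<in> jacquet_kernel V" by blast
      qed
    qed
    have yV: "y \<in> carrier V" using y(1) by (simp add: V0_def)
    show ?thesis
    proof (rule q.Q.has_series_line[OF 0 sub0])
      show "{\<zero>\<^bsub>q.Q\<^esub>} \<subseteq> q.proj ` V0" using q.Q.subrepD(3)[OF sub0] by simp
      show "q.proj y \<in> q.proj ` V0" using y(1) by simp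
      fix X assume "X \<in> q.proj ` V0"
      then obtain x where x: "x \<in> V0" "X = q.proj x" by blast
      then have xV: "x \<in> carrier V" by (simp add: V0_def)
      obtain k where k: "x \<oplus> k \<odot> y \<in> jacquet_kernel V" using y(2)[OF x(1)] by blast
      have "X \<oplus>\<^bsub>q.Q\<^esub> k \<odot>\<^bsub>q.Q\<^esub> q.proj y = q.proj (x \<oplus> k \<odot> y)"
        using x xV yV by (simp add: q.smul_Q q.add_Q)
      then show "\<exists>k. X \<oplus>\<^bsub>q.Q\<^esub> k \<odot>\<^bsub>q.Q\<^esub> q.proj y \<in> {\<zero>\<^bsub>q.Q\<^esub>}"
        using k q.proj_zero_iff[of "x \<oplus> k \<odot> y"] xV yV by auto
    qed
  qed
  obtain v1 where v1: "v1 \<in> carrier V" "l v1 \<noteq> 0" using l_nonzero by blast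
  have "q.Q.has_series (carrier q.Q)"
  proof (rule q.Q.has_series_line[OF 1 q.Q.subrep_carrier])
    show "q.proj ` V0 \<subseteq> carrier q.Q" using q.Q.subrepD(2)[OF sub0] .
    show "q.proj v1 \<in> carrier q.Q" using v1 by simp
    fix X assume "X \<in> carrier q.Q"
    then obtain x where x: "x \<in> carrier V" "X = q.proj x" by (rule q.carrier_Q_cases)
    let ?k = "- (l x / l v1)"
    have "x \<oplus> ?k \<odot> v1 \<in> V0"
      using x v1 by (simp add: V0_def lfun_add[OF lfun_l] lfun_smul[OF lfun_l])
    moreover have "X \<oplus>\<^bsub>q.Q\<^esub> ?k \<odot>\<^bsub>q.Q\<^esub> q.proj v1 = q.proj (x \<oplus> ?k \<odot> v1)"
      using x v1 by (simp add: q.smul_Q q.add_Q)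
    ultimately show "\<exists>k. X \<oplus>\<^bsub>q.Q\<^esub> k \<odot>\<^bsub>q.Q\<^esub> q.proj v1 \<in> q.proj ` V0" by (metis imageI)
  qed
  then show ?thesis by (simp add: J)
qed

lemma frob_twisted:
  assumes v: "v \<in> carrier V" and xy: "x \<noteq> 0" "y \<noteq> 0"
  shows "\<Phi> (act V (dg x y) v \<oplus> (- (a x * c y)) \<odot> v) = twisted x y (\<Phi> v)"
  using v xy by (simp add: frob_add frob_smul frob_act twisted_def)

text \<open>The two characters of \<open>ps a c\<close> give an identity that kills the Jacquet module, so \<open>\<mu>\<close> is one of them. If it is
  the first, \<open>l\<close> is the required functional. Otherwise some \<open>(x0, y0)\<close> separates \<open>\<mu>\<close> from the first character, and
  the twisted integral \<open>m\<close> transforms by \<open>\<mu>\<close>; it is nonzero, since otherwise \<open>(x0, y0)\<close> would act on the whole Jacquet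
  module by the first character, and \<open>\<mu>\<close> would not be separated from it.\<close>

lemma jacquet_hom_eigenfunctional:
  assumes \<mu>: "\<And>x y. x \<noteq> 0 \<Longrightarrow> y \<noteq> 0 \<Longrightarrow> \<mu> (mk x 0 0 y) = d1 x * d2 y"
    and d: "is_character d1" "is_character d2"
    and nz: "\<not> rep_hom_zero T2 (semisimplification T2 (jacquet_module V)) (char_rep \<mu>)"
  shows "\<exists>l. eigenfunctional V d1 d2 l"
proof -
  note ann = jacquet_hom_annihilator[OF jacquet_series_frob _ _ _ nz]
  have dgT: "dg x y \<in> carrier T2" if "x \<noteq> 0" "y \<noteq> 0" for x y :: 'k
    using that by (auto simp: carrier_T2 dg_def)
  have tw: "act V (dg x y) v \<oplus> (- (a x * c y)) \<odot> v \<in> carrier V"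
    "l (act V (dg x y) v \<oplus> (- (a x * c y)) \<odot> v) = 0"
    if "v \<in> carrier V" "x \<noteq> 0" "y \<noteq> 0" for v x y
  proof -
    show w: "act V (dg x y) v \<oplus> (- (a x * c y)) \<odot> v \<in> carrier V" using that by simp
    show "l (act V (dg x y) v \<oplus> (- (a x * c y)) \<odot> v) = 0"
      using frob_at_1[OF w] frob_twisted[OF that] twisted_ps(2)[OF frob_ps] that by simp
  qed
  have \<mu>1: "\<mu> (mat 1) = 1" using \<mu>[of 1 1] character_1[OF d(1)] character_1[OF d(2)] by (simp add: mat_eq_mk)
  show ?thesis
  proof (cases "\<forall>x y. x \<noteq> 0 \<longrightarrow> y \<noteq> 0 \<longrightarrow> \<mu> (mk x 0 0 y) = a x * c y")
    case True
    have "a x = d1 x" "c x = d2 x" if x: "x \<noteq> 0" for x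
    proof -
      have "d1 x * d2 1 = a x * c 1" "d1 1 * d2 x = a 1 * c x" using True \<mu> x by (metis one_neq_zero)+
      then show "a x = d1 x" "c x = d2 x"
        using character_1[OF d(1)] character_1[OF d(2)] character_1[OF char_a] character_1[OF char_c] by simp_all
    qed
    then show ?thesis using eigenfunctional_cong[OF eig] by blast
  next
    case False
    then obtain x0 y0 where xy0: "x0 \<noteq> 0" "y0 \<noteq> 0" "\<mu> (mk x0 0 0 y0) \<noteq> a x0 * c y0" by blast
    let ?w = "\<lambda>v. act V (dg x0 y0) v \<oplus> (- (a x0 * c y0)) \<odot> v"
    have second: "d1 x * d2 y = of_real (nabs x / nabs y) * a y * c x" if xy: "x \<noteq> 0" "y \<noteq> 0" for x y
    proof -
      let ?k = "of_real (nabs x / nabs y) * a y * c x"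
      have "(\<mu> (dg x y) + (- ?k)) * (\<mu> (dg x0 y0) + (- (a x0 * c y0))) = 0"
      proof (rule ann[OF dgT[OF xy] dgT[OF xy0(1,2)]])
        fix v assume v: "v \<in> carrier V"
        have w: "?w v \<in> carrier V" "l (?w v) = 0" using tw[OF v xy0(1,2)] by auto
        have lw: "l (act V (dg x y) (?w v)) = 0" using l_borel[OF xy w(1), of 0] w(2) by (simp add: dg_def)
        have cw: "act V (dg x y) (?w v) \<in> carrier V" using w(1) xy by simp
        have "haar (phi (\<Phi> (act V (dg x y) (?w v)))) = ?k * haar (phi (\<Phi> (?w v)))"
          using haar_rtr_dg[OF frob_ps[OF w(1)] _ xy] frob_act[OF _ w(1), of "dg x y"] xy frob_at_1[OF w(1)] w(2) by simp
        then show "act V (dg x y) (?w v) \<oplus> (- ?k) \<odot> ?w v \<in> jacquet_kernel V"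
          unfolding mem_jacquet_kernel
          using w lw cw haar_frob_add[OF cw lw, of "(- ?k) \<odot> ?w v"] haar_frob_smul[OF w, of "- ?k"]
            lfun_add[OF lfun_l cw, of "(- ?k) \<odot> ?w v"] lfun_smul[OF lfun_l w(1), of "- ?k"]
          by (simp del: of_real_divide)
      qed
      then have "\<mu> (dg x y) = ?k" using xy0(3) by (simp add: dg_def)
      then show ?thesis using \<mu>[OF xy] by (simp add: dg_def)
    qed
    define m where "m v = haar (phi (twisted x0 y0 (\<Phi> v)))" for v
    have "\<exists>v\<in>carrier V. m v \<noteq> 0"
    proof (rule ccontr)
      assume neg: "\<not> ?thesis"
      \<comment> \<open>the factor for the identity matrix is the invertible scalar 2\<close>
      have "(\<mu> (mat 1) + 1) * (\<mu> (dg x0 y0) + (- (a x0 * c y0))) = 0"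
      proof (rule ann[OF _ dgT[OF xy0(1,2)]])
        show "mat 1 \<in> carrier (T2 :: 'k mat2 monoid)" by (auto simp: carrier_T2 mat_eq_mk)
        fix v assume v: "v \<in> carrier V"
        have w: "?w v \<in> carrier V" "l (?w v) = 0" using tw[OF v xy0(1,2)] by auto
        have "?w v \<in> jacquet_kernel V"
          unfolding mem_jacquet_kernel using w neg v frob_twisted[OF v xy0(1,2)] by (simp add: m_def)
        then have "?w v \<oplus> 1 \<odot> ?w v \<in> jacquet_kernel V"
          using submoduleD(3,4)[OF jacquet_kernel_submodule] by blast
        then show "act V (mat 1) (?w v) \<oplus> 1 \<odot> ?w v \<in> jacquet_kernel V" using w by simp
      qed
      then show False using \<mu>1 xy0(3) by (simp add: dg_def)
    qed
    moreover have "lfun V m"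
      unfolding lfun_def m_def using xy0
      by (auto simp: frob_add frob_smul twisted_add twisted_cmult haar_phi_add haar_phi_cmult twisted_ps frob_ps)
    moreover have "m (act V (mk p q 0 r) v) = d1 p * d2 r * m v" if "v \<in> carrier V" "p \<noteq> 0" "r \<noteq> 0" for p q r v
      unfolding m_def using that haar_twisted_borel[OF frob_ps xy0(1,2), of v p r q] second[of p r] frob_act[of "mk p q 0 r" v]
      by simp
    ultimately show ?thesis unfolding eigenfunctional_def by blast
  qed
qed

end

context irred_gl2
begin

lemma frobenius_irredI:
  assumes "is_character a" "is_character c" "eigenfunctional V a c l"
  shows "frobenius_irred V a c l"
  by (intro frobenius_irred.intro frobenius.intro smooth_gl2_axioms irred_gl2_axioms
      char_pair.intro frobenius_axioms.intro assms)

text \<open>If the Jacquet module is zero, both sides fail; otherwise \<open>V\<close> embeds into a principal series.\<close>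

theorem jacquet_hom_iff:
  assumes \<mu>: "\<And>x y. x \<noteq> 0 \<Longrightarrow> y \<noteq> 0 \<Longrightarrow> \<mu> (mk x 0 0 y) = d1 x * d2 y"
    and d: "is_character d1" "is_character d2"
  shows "\<not> rep_hom_zero T2 (semisimplification T2 (jacquet_module V)) (char_rep \<mu>) \<longleftrightarrow>
    (\<exists>l. eigenfunctional V d1 d2 l)"
proof
  assume nz: "\<not> rep_hom_zero T2 (semisimplification T2 (jacquet_module V)) (char_rep \<mu>)"
  show "\<exists>l. eigenfunctional V d1 d2 l"
  proof (cases "jacquet_kernel V = carrier V")
    case False
    then obtain a c l where h: "is_character a" "is_character c" "eigenfunctional V a c l"
      using exists_eigenfunctional by blast
    interpret frobenius_irred V a c l by (rule frobenius_irredI[OF h])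
    show ?thesis using jacquet_hom_eigenfunctional[OF \<mu> d nz] by blast
  next
    case True
    interpret q: qrep T2 V "jacquet_kernel V" by (rule qrep_jacquet)
    have J: "q.Q = jacquet_module V" by (simp add: jacquet_module_eq)
    have "carrier q.Q = {\<zero>\<^bsub>q.Q\<^esub>}"
    proof
      show "carrier q.Q \<subseteq> {\<zero>\<^bsub>q.Q\<^esub>}"
      proof
        fix X assume "X \<in> carrier q.Q"
        then obtain v where "v \<in> carrier V" "X = q.proj v" by (rule q.carrier_Q_cases)
        then show "X \<in> {\<zero>\<^bsub>q.Q\<^esub>}" using q.proj_zero_iff[of v] True by simp
      qed
    qed (use q.Q.M.zero_closed in simp)
    then have ser: "grep.has_series T2 (jacquet_module V) (carrier (jacquet_module V))"
      using q.Q.has_series_zero by (simp add: J)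
    have one: "mat 1 \<in> carrier (T2 :: 'k mat2 monoid)" by (auto simp: carrier_T2 mat_eq_mk)
    \<comment> \<open>on the zero module every operator vanishes, even the scalar 4\<close>
    have "(\<mu> (mat 1) + 1) * (\<mu> (mat 1) + 1) = 0"
      by (rule jacquet_hom_annihilator[OF ser one one _ nz]) (simp add: True)
    moreover have "\<mu> (mat 1) = 1" using \<mu>[of 1 1] character_1[OF d(1)] character_1[OF d(2)] by (simp add: mat_eq_mk)
    ultimately show ?thesis by simp
  qed
next
  assume "\<exists>l. eigenfunctional V d1 d2 l"
  then obtain l where l: "eigenfunctional V d1 d2 l" by blast
  interpret frobenius_irred V d1 d2 l by (rule frobenius_irredI[OF d l])
  interpret q: qrep T2 V "jacquet_kernel V" by (rule qrep_jacquet)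
  have J: "q.Q = jacquet_module V" by (simp add: jacquet_module_eq)
  have kill: "l u = 0" if "u \<in> jacquet_kernel V" for u using that by (simp add: mem_jacquet_kernel)
  have dp: "descend l (q.proj v) = l v" if "v \<in> carrier V" for v
    using q.descend_proj[OF lfun_l kill that] by simp
  have "\<not> rep_hom_zero T2 (semisimplification T2 q.Q) (char_rep \<mu>)"
  proof (rule q.Q.semisimplification_hom_nonzero)
    show "q.Q.has_series (carrier q.Q)" using jacquet_series_frob by (simp add: J)
    show "lfun q.Q (descend l)" by (rule q.lfun_descend[OF lfun_l kill])
    show "\<exists>X\<in>carrier q.Q. descend l X \<noteq> 0" using l_nonzero dp by (auto simp: q.carrier_Q)
    fix t X assume t: "t \<in> carrier (T2 :: 'k mat2 monoid)" and "X \<in> carrier q.Q"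
    then obtain v where v: "v \<in> carrier V" "X = q.proj v" using q.carrier_Q_cases by blast
    obtain x y where xy: "t = mk x 0 0 y" "x \<noteq> 0" "y \<noteq> 0" using t by (auto simp: carrier_T2)
    have "act q.Q t X = q.proj (act V t v)" using q.act_Q[OF t v(1)] v(2) by simp
    then show "descend l (act q.Q t X) = \<mu> t * descend l X"
      using dp[OF v(1)] dp[OF T.act_closed[OF t v(1)]] l_borel[OF xy(2,3) v(1), of 0] \<mu>[OF xy(2,3)] v(2)
      by (simp add: xy(1))
  qed
  then show "\<not> rep_hom_zero T2 (semisimplification T2 (jacquet_module V)) (char_rep \<mu>)" by (simp add: J)
qed

end

section \<open>Induced and Steinberg representations\<close>

lemma ps_cong:
  assumes "\<And>x. x \<noteq> 0 \<Longrightarrow> a x = a' x" "\<And>x. x \<noteq> 0 \<Longrightarrow> c x = c' x"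
  shows "ps a c = ps a' (c' :: 'k::nonarch_local_field \<Rightarrow> complex)"
proof -
  have "a (b $ 1 $ 1) * c (b $ 2 $ 2) = a' (b $ 1 $ 1) * c' (b $ 2 $ 2)" if "b \<in> B2" for b
    using that by (rule B2_cases) (simp add: assms)
  then show ?thesis unfolding ps_def by (intro Collect_cong conj_cong refl ball_cong) auto
qed

lemma haar_zero: "haar (\<lambda>_::'k::nonarch_local_field. 0) = 0"
  using haar_cmult[OF schwartz_ball_ind[of "1::'k"], of 0] by simp

lemma Ind_carrier:
  assumes "\<And>x. x \<noteq> 0 \<Longrightarrow> a x = nabs_pow (1/2) x * \<xi> x" "\<And>x. x \<noteq> 0 \<Longrightarrow> c x = nabs_pow (- (1/2)) x * \<zeta> x"
  shows "carrier (Ind_B2 (tensor_char \<xi> \<zeta>)) = ps a (c :: 'k::nonarch_local_field \<Rightarrow> complex)"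
proof -
  have tp: "delta_B2_pow (1/2) (torus_part b) * tensor_char \<xi> \<zeta> (torus_part b) = a (b $ 1 $ 1) * c (b $ 2 $ 2)"
    if "b \<in> B2" for b
    using that by (rule B2_cases) (simp add: delta_B2_pow_def tensor_char_def assms)
  have sm: "(\<exists>K. subgroup K GL2 \<and> openin (top_of_set (carrier GL2)) K \<and> (\<forall>g\<in>carrier GL2. \<forall>h\<in>K. f (g ** h) = f g)) \<longleftrightarrow>
      (\<exists>s>0. s < 1 \<and> (\<forall>g. invertible g \<longrightarrow> (\<forall>h\<in>cong_subgroup s. f (g ** h) = f g)))" for f :: "'k mat2 \<Rightarrow> complex"
  proof
    assume "\<exists>K. subgroup K GL2 \<and> openin (top_of_set (carrier GL2)) K \<and> (\<forall>g\<in>carrier GL2. \<forall>h\<in>K. f (g ** h) = f g)"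
    then obtain K where K: "subgroup K GL2" "openin (top_of_set (carrier GL2)) K" "\<forall>g\<in>carrier GL2. \<forall>h\<in>K. f (g ** h) = f g" by blast
    have "mat 1 \<in> K" using subgroup.one_closed[OF K(1)] by simp
    from cong_subgroup_in_open[OF K(2) this] obtain s where s: "s > 0" "s < 1" "cong_subgroup s \<subseteq> K" by blast
    have "\<forall>g. invertible g \<longrightarrow> (\<forall>h\<in>cong_subgroup s. f (g ** h) = f g)"
      using K(3) s(3) unfolding carrier_GL2 by blast
    then show "\<exists>s>0. s < 1 \<and> (\<forall>g. invertible g \<longrightarrow> (\<forall>h\<in>cong_subgroup s. f (g ** h) = f g))"
      using s(1,2) by blast
  next
    assume "\<exists>s>0. s < 1 \<and> (\<forall>g. invertible g \<longrightarrow> (\<forall>h\<in>cong_subgroup s. f (g ** h) = f g))"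
    then obtain s where s: "s > 0" "s < 1" "\<forall>g. invertible g \<longrightarrow> (\<forall>h\<in>cong_subgroup s. f (g ** h) = f g)" by blast
    then show "\<exists>K. subgroup K GL2 \<and> openin (top_of_set (carrier GL2)) K \<and> (\<forall>g\<in>carrier GL2. \<forall>h\<in>K. f (g ** h) = f g)"
      using subgroup_cong[OF s(1,2)] openin_cong_subgroup[OF s(1,2)] by (intro exI[of _ "cong_subgroup s"]) auto
  qed
  show ?thesis
    unfolding Ind_B2_def ps_def induced_space_def sm
    by (auto simp: tp)
qed

lemma Ind_sel [simp]: "\<zero>\<^bsub>Ind_B2 \<mu>\<^esub> = (\<lambda>_. 0)" "f \<oplus>\<^bsub>Ind_B2 \<mu>\<^esub> g = (\<lambda>x. f x + g x)"
    "k \<odot>\<^bsub>Ind_B2 \<mu>\<^esub> f = (\<lambda>x. k * f x)" "act (Ind_B2 \<mu>) h f = rtr h f"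
  by (simp_all add: Ind_B2_def rtr_def)

lemma (in char_pair) smooth_gl2_Ind:
  assumes carr: "carrier (Ind_B2 \<mu>) = ps a c"
  shows "smooth_gl2 (Ind_B2 \<mu>)"
proof -
  let ?I = "Ind_B2 \<mu>"
  note lz = lin_closed_zero[OF lin_closed_ps] and la = lin_closed_add[OF lin_closed_ps]
    and lc = lin_closed_cmult[OF lin_closed_ps]
  have "Module.module complex_ring ?I"
  proof (rule moduleI[OF cring_complex_ring])
    show "abelian_group ?I"
    proof (rule abelian_groupI)
      fix f assume "f \<in> carrier ?I"
      then show "\<exists>g\<in>carrier ?I. g \<oplus>\<^bsub>?I\<^esub> f = \<zero>\<^bsub>?I\<^esub>"
        using lc[of f "-1"] by (intro bexI[of _ "\<lambda>x. (-1) * f x"]) (auto simp: carr)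
    qed (auto simp: carr lz la add.assoc add.commute)
  qed (auto simp: carr lc algebra_simps)
  then have rep: "representation GL2 ?I"
    unfolding representation_def linear_maps_def
    by (auto simp: carr group_GL2 rtr_ps rtr_mult) (auto simp: rtr_def)
  have "smooth_rep GL2 ?I"
    unfolding smooth_rep_def
  proof (intro conjI ballI rep)
    fix f assume "f \<in> carrier ?I"
    then have f: "f \<in> ps a c" by (simp add: carr)
    obtain s where s: "0 < s" "s < 1" "\<And>x h. invertible x \<Longrightarrow> h \<in> cong_subgroup s \<Longrightarrow> f (x ** h) = f x"
      using ps_smooth[OF f] by blast
    have fix_h: "rtr h f = f" if h: "h \<in> cong_subgroup s" for h
    proof
      fix x show "rtr h f x = f x"
        using s(3)[OF _ h, of x] ps_noninv[OF f] by (cases "invertible x") (auto simp: rtr_def invertible_mult_iff)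
    qed
    show "openin (top_of_set (carrier GL2)) {g \<in> carrier GL2. act ?I g f = f}"
      unfolding openin_GL2_iff
    proof (intro conjI ballI)
      fix A assume "A \<in> {g \<in> carrier (GL2 :: 'k mat2 monoid). act ?I g f = f}"
      then have A: "invertible A" "rtr A f = f" by auto
      obtain r where r: "r > 0" "\<And>B. mbound r (B - A) \<Longrightarrow> matrix_inv A ** B \<in> cong_subgroup s"
        using near_cong_subgroup[OF A(1) s(1)] by blast
      have "rtr B f = f" if "mbound r (B - A)" for B
      proof -
        have "A ** (matrix_inv A ** B) = B" using A by (simp add: matrix_mul_assoc)
        then have "rtr B f = rtr A (rtr (matrix_inv A ** B) f)" by (simp flip: rtr_mult)
        then show ?thesis using fix_h[OF r(2)[OF that]] A(2) by simp
      qed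
      then show "\<exists>s>0. \<forall>B. invertible B \<and> mbound s (B - A) \<longrightarrow> B \<in> {g \<in> carrier GL2. act ?I g f = f}"
        using r(1) by auto
    qed auto
  qed
  then show ?thesis using rep by (intro smooth_gl2.intro grep.intro smooth_gl2_axioms.intro)
qed

lemma (in char_pair) subrep_Ind_iff:
  assumes carr: "carrier (Ind_B2 \<mu>) = ps a c"
  shows "subrep GL2 (Ind_B2 \<mu>) W \<longleftrightarrow> gstable W \<and> W \<subseteq> ps a c"
proof -
  interpret I: smooth_gl2 "Ind_B2 \<mu>" by (rule smooth_gl2_Ind[OF carr])
  show ?thesis
  proof
    assume W: "subrep GL2 (Ind_B2 \<mu>) W"
    show "gstable W \<and> W \<subseteq> ps a c"
      using I.subrepD(2-)[OF W] by (auto simp: carr gstable_def lin_closed_def)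
  next
    assume W: "gstable W \<and> W \<subseteq> ps a c"
    then show "subrep GL2 (Ind_B2 \<mu>) W"
      by (intro I.subrepI) (auto simp: carr gstable_def lin_closed_def)
  qed
qed

lemma (in smooth_gl2) eigenfunctional_pullback:
  assumes iso: "rep_iso GL2 V V'" and l: "eigenfunctional V' a c l"
  shows "\<exists>l'. eigenfunctional V a c l'"
proof -
  obtain f where f: "f \<in> rep_hom GL2 V V'" "bij_betw f (carrier V) (carrier V')" using iso by (auto simp: rep_iso_def)
  have fc: "f v \<in> carrier V'" if "v \<in> carrier V" for v using f(2) that by (auto simp: bij_betw_def)
  have fa: "f (u \<oplus> v) = f u \<oplus>\<^bsub>V'\<^esub> f v" "f (k \<odot> v) = k \<odot>\<^bsub>V'\<^esub> f v" "invertible g \<Longrightarrow> f (act V g v) = act V' g (f v)"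
    if "u \<in> carrier V" "v \<in> carrier V" for u v k g
    using f(1) that by (auto simp: rep_hom_def linear_maps_def)
  have "eigenfunctional V a c (\<lambda>v. l (f v))"
    unfolding eigenfunctional_def
  proof (intro conjI allI ballI impI)
    show "lfun V (\<lambda>v. l (f v))" using l fa fc by (auto simp: lfun_def eigenfunctional_def)
    obtain w where w: "w \<in> carrier V'" "l w \<noteq> 0" using l by (auto simp: eigenfunctional_def)
    then have "w \<in> f ` carrier V" using f(2) by (simp add: bij_betw_def)
    then show "\<exists>v\<in>carrier V. l (f v) \<noteq> 0" using w(2) by blast
    fix p q r :: 'k and v assume "v \<in> carrier V" "p \<noteq> 0" "r \<noteq> 0"
    then show "l (f (act V (mk p q 0 r) v)) = a p * c r * l (f v)"
      using l fa(3)[of v v "mk p q 0 r"] fc by (simp add: eigenfunctional_def)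
  qed
  then show ?thesis by blast
qed

lemma eigenfunctional_char_rep:
  assumes "is_character (\<xi>::'k::nonarch_local_field \<Rightarrow> complex)"
  shows "eigenfunctional (char_rep (\<lambda>g. \<xi> (det g))) \<xi> \<xi> (\<lambda>z. z)"
  using character_mult[OF assms] by (auto simp: eigenfunctional_def lfun_def char_rep_def intro: exI[of _ 1])

lemma (in char_pair) eigenfunctional_Ind_1:
  assumes carr: "carrier (Ind_B2 \<mu>) = ps a c"
  shows "eigenfunctional (Ind_B2 \<mu>) a c (\<lambda>f. f (mat 1))"
proof -
  obtain f where f: "f \<in> ps a c" "haar (phi f) = 1" using normalized_element by blast
  have "phi f \<noteq> (\<lambda>_. 0)" using f(2) haar_zero[where 'k='k] by auto
  then obtain x where "phi f x \<noteq> 0" by blast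
  then have "f (uw x) \<noteq> 0" by (simp add: phi_def)
  then have "rtr (uw x) f \<in> ps a c" "rtr (uw x) f (mat 1) \<noteq> 0" using rtr_ps[OF f(1), of "uw x"] by (simp_all add: rtr_def)
  then have "\<exists>f\<in>carrier (Ind_B2 \<mu>). f (mat 1) \<noteq> 0" unfolding carr by blast
  then show ?thesis
    using ps_upper by (auto simp: eigenfunctional_def lfun_def carr rtr_def)
qed

text \<open>The second character of the Jacquet module of \<open>ps a c\<close>. If it differs from the first, the twisted integral realizes
  it; if not, evaluation at \<open>1\<close> does.\<close>

lemma (in char_pair) eigenfunctional_Ind_2:
  assumes carr: "carrier (Ind_B2 \<mu>) = ps a c"
    and d: "\<And>x. x \<noteq> 0 \<Longrightarrow> d1 x = nabs_pow 1 x * c x" "\<And>x. x \<noteq> 0 \<Longrightarrow> d2 x = nabs_pow (-1) x * a x"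
  shows "\<exists>l. eigenfunctional (Ind_B2 \<mu>) d1 d2 l"
proof (cases "\<forall>x y. x \<noteq> 0 \<longrightarrow> y \<noteq> 0 \<longrightarrow> a x * c y = d1 x * d2 y")
  case True
  have one: "a 1 = 1" "c 1 = 1" "d1 1 = 1" "d2 1 = 1"
    using character_1[OF char_a] character_1[OF char_c] d[of 1] by (simp_all add: nabs_pow_def)
  have "a x = d1 x" "c x = d2 x" if "x \<noteq> 0" for x
    using True[rule_format, of x 1] True[rule_format, of 1 x] that by (simp_all add: one)
  then show ?thesis using eigenfunctional_cong[OF eigenfunctional_Ind_1[OF carr]] by blast
next
  case False
  then obtain x0 y0 where xy: "x0 \<noteq> 0" "y0 \<noteq> 0" "a x0 * c y0 \<noteq> d1 x0 * d2 y0" by blast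
  have dd: "d1 x * d2 y = of_real (nabs x / nabs y) * a y * c x" if "x \<noteq> 0" "y \<noteq> 0" for x y
    using that by (simp add: d nabs_pow_def powr_minus_divide)
  let ?l = "\<lambda>f. haar (phi (twisted x0 y0 f))"
  obtain f where f: "f \<in> ps a c" "f (mat 1) = 0" "haar (phi f) = 1" using normalized_element by blast
  have rf: "rtr (dg x0 y0) f \<in> ps a c" "rtr (dg x0 y0) f (mat 1) = 0"
    using rtr_ps[OF f(1)] rtr_dg_at_1[OF f(1) xy(1,2)] f(2) xy by simp_all
  have "?l f = of_real (nabs x0 / nabs y0) * a y0 * c x0 * haar (phi f) + (- (a x0 * c y0)) * haar (phi f)"
    unfolding twisted_def
    using haar_phi_add[OF rf lin_closed_cmult[OF lin_closed_ps f(1)], of "- (a x0 * c y0)"]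
      haar_phi_cmult[OF f(1,2), of "- (a x0 * c y0)"] haar_rtr_dg[OF f(1,2) xy(1,2)] f(2) by simp
  then have "?l f \<noteq> 0" using f(3) dd[OF xy(1,2)] xy(3) by simp
  then have "\<exists>f\<in>carrier (Ind_B2 \<mu>). ?l f \<noteq> 0" using f(1) carr by blast
  moreover have "lfun (Ind_B2 \<mu>) ?l"
    unfolding lfun_def using xy(1,2)
    by (auto simp: carr twisted_add twisted_cmult haar_phi_add haar_phi_cmult twisted_ps)
  moreover have "?l (rtr (mk p q 0 r) f) = d1 p * d2 r * ?l f" if "f \<in> ps a c" "p \<noteq> 0" "r \<noteq> 0" for f p q r
    using haar_twisted_borel[OF that(1) xy(1,2) that(2,3)] dd[OF that(2,3)] by simp
  ultimately have "eigenfunctional (Ind_B2 \<mu>) d1 d2 ?l" by (simp add: eigenfunctional_def carr)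
  then show ?thesis by blast
qed


text \<open>Here \<open>I\<close> is the representation whose quotient is \<open>St(\<xi>)\<close>. It is \<open>ps \<xi> \<xi>\<close> and contains the line spanned by
  \<open>\<kappa> = \<xi> \<circ> det\<close>. The characters \<open>a1\<close> and \<open>c1\<close> are those of the Jacquet module of \<open>St(\<xi>)\<close>.\<close>

locale steinberg =
  fixes \<xi> :: "'k::nonarch_local_field \<Rightarrow> complex"
  assumes char: "is_character \<xi>"
begin

definition a1 where "a1 x = nabs_pow 1 x * \<xi> x"
definition c1 where "c1 x = nabs_pow (-1) x * \<xi> x"

sublocale Y: char_pair \<xi> \<xi> by unfold_locales (rule char)+
sublocale X: char_pair a1 c1
  unfolding a1_def[abs_def] c1_def[abs_def]
  by unfold_locales (intro is_character_mult is_character_nabs_pow char)+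

definition I where
  "I = Ind_B2 (tensor_char (\<lambda>x. \<xi> x * nabs_pow (-1/2) x) (\<lambda>x. \<xi> x * nabs_pow (1/2) x))"

lemma carrier_I: "carrier I = ps \<xi> \<xi>"
  unfolding I_def
proof (rule Ind_carrier)
  fix x :: 'k assume x: "x \<noteq> 0"
  have "nabs_pow (1/2) x * nabs_pow (-1/2) x = 1" "nabs_pow (- (1/2)) x * nabs_pow (1/2) x = 1"
    using nabs_pow_add[OF x] nabs_pow_0[OF x] by simp_all
  then show "\<xi> x = nabs_pow (1/2) x * (\<xi> x * nabs_pow (-1/2) x)"
    "\<xi> x = nabs_pow (- (1/2)) x * (\<xi> x * nabs_pow (1/2) x)" by (simp_all add: mult.left_commute)
qed

lemma I_sel [simp]: "\<zero>\<^bsub>I\<^esub> = (\<lambda>_. 0)" "f \<oplus>\<^bsub>I\<^esub> g = (\<lambda>x. f x + g x)"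
    "k \<odot>\<^bsub>I\<^esub> f = (\<lambda>x. k * f x)" "act I h f = rtr h f"
  by (simp_all only: I_def Ind_sel)

sublocale I: smooth_gl2 I
  unfolding I_def by (rule Y.smooth_gl2_Ind[OF carrier_I[unfolded I_def]])

lemma subrep_I_iff: "subrep GL2 I W \<longleftrightarrow> gstable W \<and> W \<subseteq> ps \<xi> \<xi>"
  unfolding I_def by (rule Y.subrep_Ind_iff[OF carrier_I[unfolded I_def]])

definition \<kappa> :: "'k mat2 \<Rightarrow> complex" where "\<kappa> g = (if invertible g then \<xi> (det g) else 0)"
definition line where "line = {f. \<exists>k. f = (\<lambda>g. k * \<kappa> g)}"

lemma \<kappa>_1: "\<kappa> (mat 1) = 1"
  using character_1[OF char] by (simp add: \<kappa>_def)

lemma rtr_\<kappa>: "invertible g \<Longrightarrow> rtr g \<kappa> = (\<lambda>x. \<xi> (det g) * \<kappa> x)"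
  using character_mult[OF char] by (auto simp: fun_eq_iff rtr_def \<kappa>_def invertible_iff_det det_mul)

lemma \<kappa>_ps: "\<kappa> \<in> ps \<xi> \<xi>"
proof -
  obtain s where s: "s > 0" "s < 1" "\<And>x. nabs (x - 1) \<le> s \<Longrightarrow> \<xi> x = 1" using character_locally_trivial[OF char] by blast
  show ?thesis
  proof (rule Y.psI[OF _ _ s(1,2)])
    fix g h :: "'k mat2" assume g: "invertible g" and h: "h \<in> cong_subgroup s"
    have "\<xi> (det h) = 1" using s(3) cong_subgroup_det[OF h s(2)] by blast
    moreover have "invertible h" using cong_subgroup_invertible[OF h s(2)] .
    ultimately show "\<kappa> (g ** h) = \<kappa> g" using fun_cong[OF rtr_\<kappa>[of h], of g] by (simp add: rtr_def)
  next
    fix p q r :: 'k and g :: "'k mat2" assume "p \<noteq> 0" "r \<noteq> 0" "invertible g"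
    then show "\<kappa> (mk p q 0 r ** g) = \<xi> p * \<xi> r * \<kappa> g"
      using character_mult[OF char] by (simp add: \<kappa>_def invertible_iff_det det_mul)
  qed (simp add: \<kappa>_def)
qed

lemma gstable_line: "gstable line" "line \<subseteq> ps \<xi> \<xi>"
proof -
  have "rtr g (\<lambda>x. k * \<kappa> x) = (\<lambda>x. (k * \<xi> (det g)) * \<kappa> x)" if "invertible g" for g k
    using fun_cong[OF rtr_\<kappa>[OF that]] by (auto simp: rtr_def fun_eq_iff)
  moreover have "lin_closed line"
    unfolding lin_closed_def line_def
  proof (intro conjI ballI allI)
    show "(\<lambda>_. 0) \<in> {f. \<exists>k. f = (\<lambda>g. k * \<kappa> g)}" by (auto intro: exI[of _ 0])
    fix f assume "f \<in> {f. \<exists>k. f = (\<lambda>g. k * \<kappa> g)}"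
    then obtain k where k: "f = (\<lambda>g. k * \<kappa> g)" by blast
    show "(\<lambda>x. j * f x) \<in> {f. \<exists>k. f = (\<lambda>g. k * \<kappa> g)}" for j
      by (auto simp: k mult.assoc[symmetric])
    fix g assume "g \<in> {f. \<exists>k. f = (\<lambda>g. k * \<kappa> g)}"
    then obtain j where j: "g = (\<lambda>g. j * \<kappa> g)" by blast
    have "(\<lambda>x. f x + g x) = (\<lambda>x. (k + j) * \<kappa> x)" by (simp add: k j distrib_right)
    then show "(\<lambda>x. f x + g x) \<in> {f. \<exists>k. f = (\<lambda>g. k * \<kappa> g)}" by blast
  qed
  ultimately show "gstable line" by (auto simp: gstable_def line_def)
  show "line \<subseteq> ps \<xi> \<xi>" using lin_closed_cmult[OF Y.lin_closed_ps \<kappa>_ps] by (auto simp: line_def)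
qed

lemma line_proper: "line \<noteq> ps \<xi> \<xi>"
proof
  assume eq: "line = ps \<xi> \<xi>"
  obtain f where f: "f \<in> ps \<xi> \<xi>" "f (mat 1) = 0" "haar (phi f) = 1" using Y.normalized_element by blast
  obtain k where k: "f = (\<lambda>g. k * \<kappa> g)" using f(1) unfolding eq[symmetric] by (auto simp: line_def)
  have "k = 0" using f(2) \<kappa>_1 by (simp add: k)
  then have "phi f = (\<lambda>x. 0)" by (simp add: k phi_def fun_eq_iff)
  then have "haar (phi f) = 0" using haar_zero[where 'k='k] by simp
  then show False using f(3) by simp
qed

text \<open>A proper subrepresentation containing \<open>ps00\<close> would require \<open>\<xi> = \<bar>\<cdot>\<bar>\<^sup>2 \<xi>\<close>.\<close>

lemma sub_dichotomy:
  assumes W: "gstable W" "W \<subseteq> ps \<xi> \<xi>"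
  shows "W \<subseteq> line \<or> W = ps \<xi> \<xi>"
proof (cases "W \<inter> ps00 \<xi> \<xi> \<subseteq> {\<lambda>_. 0}")
  case True
  have "f \<in> line" if f: "f \<in> W" for f
  proof (cases "f = (\<lambda>_. 0)")
    case True then show ?thesis using lin_closed_zero[OF gstableD(1)[OF gstable_line(1)]] by simp
  next
    case False
    have "f g = f (mat 1) * \<kappa> g" for g
    proof (cases "invertible g")
      case True
      then show ?thesis using Y.sub_is_line(3)[OF W \<open>W \<inter> ps00 \<xi> \<xi> \<subseteq> {\<lambda>_. 0}\<close> f False True] by (simp add: \<kappa>_def)
    next
      case False
      then show ?thesis using Y.ps_noninv[of f g] f W(2) by (auto simp: \<kappa>_def)
    qed
    then have "f = (\<lambda>g. f (mat 1) * \<kappa> g)" by (rule ext)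
    then show ?thesis unfolding line_def by blast
  qed
  then show ?thesis by blast
next
  case False
  then obtain f where f: "f \<in> W" "f \<in> ps00 \<xi> \<xi>" "f \<noteq> (\<lambda>_. 0)" by blast
  have sub: "ps00 \<xi> \<xi> \<subseteq> W" by (rule Y.sub_contains_ps00[OF W f])
  have "W = ps \<xi> \<xi>"
  proof (rule ccontr)
    assume "W \<noteq> ps \<xi> \<xi>"
    from Y.proper_sub_exponent[OF W sub this, of unif] unif(1)
    have "of_real (nabs (unif::'k) * nabs (unif::'k)) = (1::complex)"
      using character_nonzero[OF char unif(1)] by simp
    then have "nabs (unif::'k) * nabs (unif::'k) = 1" by (metis of_real_1 of_real_eq_iff)
    moreover have "nabs (unif::'k) * nabs (unif::'k) < 1 * 1"
      using unif(2)[where 'k='k] by (intro mult_strict_mono) auto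
    ultimately show False by simp
  qed
  then show ?thesis by blast
qed

lemma line_irreducible_quotient:
  "(THE W. subrep GL2 I W \<and> irreducible_rep GL2 (quot_rep I W)) = line"
proof (rule the_equality)
  have sub: "subrep GL2 I line" using subrep_I_iff gstable_line by blast
  interpret q: qrep GL2 I line
    by (intro qrep.intro qrep_axioms.intro sub I.grep_axioms)
  have "irreducible_rep GL2 (quot_rep I line)"
    unfolding q.irreducible_Q_iff carrier_I subrep_I_iff
    using line_proper sub_dichotomy by blast
  then show "subrep GL2 I line \<and> irreducible_rep GL2 (quot_rep I line)" using sub by blast
next
  fix W assume W: "subrep GL2 I W \<and> irreducible_rep GL2 (quot_rep I W)"
  then have W': "gstable W" "W \<subseteq> ps \<xi> \<xi>" using subrep_I_iff by blast+
  interpret q: qrep GL2 I W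
    using W by (intro qrep.intro qrep_axioms.intro I.grep_axioms) blast
  have irr: "W \<noteq> ps \<xi> \<xi>" "\<And>U. gstable U \<Longrightarrow> U \<subseteq> ps \<xi> \<xi> \<Longrightarrow> W \<subseteq> U \<Longrightarrow> U = W \<or> U = ps \<xi> \<xi>"
    using W unfolding q.irreducible_Q_iff carrier_I subrep_I_iff by blast+
  have "W \<subseteq> line" using sub_dichotomy[OF W'] irr(1) by blast
  then show "W = line" using irr(2)[OF gstable_line] line_proper by blast
qed

lemma Steinberg_eq: "Steinberg \<xi> = quot_rep I line"
  unfolding Steinberg_def Let_def I_def[symmetric] line_irreducible_quotient ..

lemma subrep_line: "subrep GL2 I line"
  using subrep_I_iff gstable_line by blast

sublocale q: qrep GL2 I line
  by (intro qrep.intro qrep_axioms.intro subrep_line I.grep_axioms)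

text \<open>Subtracting a multiple of \<open>\<kappa>\<close> makes a function vanish at \<open>1\<close>, so that it can be integrated over the big
  cell. This commutes with \<open>B\<^sub>2\<close> because \<open>\<kappa>\<close> spans a subrepresentation on which \<open>B\<^sub>2\<close> acts as on values at \<open>1\<close>.\<close>

definition corr where "corr f = (\<lambda>x. f x + (- f (mat 1)) * \<kappa> x)"
definition lam where "lam f = haar (phi (corr f))"

lemma corr_ps: assumes "f \<in> ps \<xi> \<xi>" shows "corr f \<in> ps \<xi> \<xi>" "corr f (mat 1) = 0"
  using lin_closed_add[OF Y.lin_closed_ps assms lin_closed_cmult[OF Y.lin_closed_ps \<kappa>_ps, of "- f (mat 1)"]] \<kappa>_1
  by (simp_all add: corr_def)

lemma eigenfunctional_lam: "eigenfunctional I a1 c1 lam"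
  unfolding eigenfunctional_def
proof (intro conjI allI ballI impI)
  have "corr (\<lambda>x. f x + g x) = (\<lambda>x. corr f x + corr g x)" "corr (\<lambda>x. k * f x) = (\<lambda>x. k * corr f x)" for f g k
    by (simp_all add: corr_def algebra_simps)
  then show "lfun I lam"
    unfolding lfun_def carrier_I lam_def I_sel
    using Y.haar_phi_add[OF corr_ps corr_ps] Y.haar_phi_cmult[OF corr_ps] by simp
  obtain f where f: "f \<in> ps \<xi> \<xi>" "f (mat 1) = 0" "haar (phi f) = 1" using Y.normalized_element by blast
  then have "lam f = 1" by (simp add: lam_def corr_def)
  then show "\<exists>f\<in>carrier I. lam f \<noteq> 0" using f(1) carrier_I by (metis zero_neq_one)
  fix p q r :: 'k and f assume f: "f \<in> carrier I" and pr: "p \<noteq> 0" "r \<noteq> 0"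
  then have f: "f \<in> ps \<xi> \<xi>" unfolding carrier_I by blast
  have 1: "rtr (mk p q 0 r) f (mat 1) = \<xi> p * \<xi> r * f (mat 1)"
    using Y.ps_upper[OF f pr] by (simp add: rtr_def)
  have 2: "rtr (mk p q 0 r) \<kappa> = (\<lambda>x. \<xi> p * \<xi> r * \<kappa> x)"
    using rtr_\<kappa>[of "mk p q 0 r"] pr character_mult[OF char pr] by simp
  have "corr (rtr (mk p q 0 r) f) = rtr (mk p q 0 r) (corr f)"
  proof
    fix x
    show "corr (rtr (mk p q 0 r) f) x = rtr (mk p q 0 r) (corr f) x"
      using fun_cong[OF 2, of x] unfolding corr_def 1 by (simp add: rtr_def)
  qed
  then show "lam (act I (mk p q 0 r) f) = a1 p * c1 r * lam f"
    using Y.haar_phi_borel[OF corr_ps[OF f] pr] pr by (simp add: lam_def a1_def c1_def nabs_pow_def powr_minus_divide)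
qed

lemma lam_line: "f \<in> line \<Longrightarrow> lam f = 0"
proof -
  assume "f \<in> line"
  then obtain k where "f = (\<lambda>g. k * \<kappa> g)" by (auto simp: line_def)
  then have "corr f = (\<lambda>x. 0)" using \<kappa>_1 by (simp add: corr_def)
  then have "phi (corr f) = (\<lambda>x. 0)" by (simp add: phi_def fun_eq_iff)
  then show ?thesis using haar_zero[where 'k='k] by (simp add: lam_def)
qed

lemma eigenfunctional_Steinberg: "\<exists>l. eigenfunctional (Steinberg \<xi>) a1 c1 l"
proof -
  have lf: "lfun I lam" using eigenfunctional_lam by (simp add: eigenfunctional_def)
  have dp: "descend lam (q.proj f) = lam f" if "f \<in> carrier I" for f
    using q.descend_proj[OF lf lam_line that] .
  have "eigenfunctional q.Q a1 c1 (descend lam)"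
    unfolding eigenfunctional_def
  proof (intro conjI allI ballI impI)
    show "lfun q.Q (descend lam)" by (rule q.lfun_descend[OF lf lam_line])
    obtain f where f: "f \<in> carrier I" "lam f \<noteq> 0" using eigenfunctional_lam by (auto simp: eigenfunctional_def)
    then have "descend lam (q.proj f) \<noteq> 0" using dp[OF f(1)] by simp
    then show "\<exists>X\<in>carrier q.Q. descend lam X \<noteq> 0" using q.proj_closed[OF f(1)] by blast
    fix p q' r :: 'k and X assume X: "X \<in> carrier q.Q" and pr: "p \<noteq> 0" "r \<noteq> 0"
    obtain f where f: "f \<in> carrier I" "X = q.proj f" using X by (rule q.carrier_Q_cases)
    have g: "mk p q' 0 r \<in> carrier (GL2 :: 'k mat2 monoid)" using pr by simp
    show "descend lam (act q.Q (mk p q' 0 r) X) = a1 p * c1 r * descend lam X"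
      using eigenfunctional_lam f pr dp[OF f(1)] dp[OF I.act_closed[OF g f(1)]] q.act_Q[OF g f(1)]
      by (simp add: eigenfunctional_def)
  qed
  then show ?thesis unfolding Steinberg_eq by blast
qed

sublocale F: frobenius I a1 c1 lam
  by (intro frobenius.intro frobenius_axioms.intro I.smooth_gl2_axioms X.char_pair_axioms eigenfunctional_lam)

lemma frob_kernel: "f \<in> carrier I \<Longrightarrow> F.\<Phi> f = (\<lambda>_. 0) \<longleftrightarrow> f \<in> line"
proof -
  assume f: "f \<in> carrier I"
  have "gstable {\<lambda>_. 0 :: complex}" by (simp add: gstable_def lin_closed_def rtr_def)
  from F.subrep_frob_vimage[OF this] have K: "gstable {f \<in> carrier I. F.\<Phi> f \<in> {\<lambda>_. 0}}" "{f \<in> carrier I. F.\<Phi> f \<in> {\<lambda>_. 0}} \<subseteq> ps \<xi> \<xi>"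
    unfolding subrep_I_iff by blast+
  have "{f \<in> carrier I. F.\<Phi> f \<in> {\<lambda>_. 0}} \<noteq> ps \<xi> \<xi>"
  proof
    assume h: "{f \<in> carrier I. F.\<Phi> f \<in> {\<lambda>_. 0}} = ps \<xi> \<xi>"
    obtain g where g: "g \<in> carrier I" "lam g \<noteq> 0" using eigenfunctional_lam by (auto simp: eigenfunctional_def)
    then have "F.\<Phi> g = (\<lambda>_. 0)" using h carrier_I by blast
    then show False using F.frob_at_1[OF g(1)] g(2) by simp
  qed
  then have "{f \<in> carrier I. F.\<Phi> f \<in> {\<lambda>_. 0}} \<subseteq> line" using sub_dichotomy[OF K] by blast
  moreover have "F.\<Phi> f = (\<lambda>_. 0)" if "f \<in> line"
  proof -
    have "lam (rtr g f) = 0" if "invertible g" for g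
      using lam_line gstableD(2)[OF gstable_line(1) that \<open>f \<in> line\<close>] by blast
    then show ?thesis by (auto simp: frob_def)
  qed
  ultimately show ?thesis using f by blast
qed

lemma exponents_differ: "\<exists>x. x \<noteq> 0 \<and> a1 x \<noteq> c1 x"
proof -
  have "nabs_pow 1 (unif::'k) \<noteq> nabs_pow (-1) (unif::'k)"
  proof
    assume "nabs_pow 1 (unif::'k) = nabs_pow (-1) (unif::'k)"
    then have "nabs (unif::'k) = 1 / nabs (unif::'k)" by (simp add: nabs_pow_def powr_minus_divide del: of_real_divide)
    then have "nabs (unif::'k) * nabs (unif::'k) = 1" using unif(1)[where 'k='k] by (simp add: field_simps)
    moreover have "nabs (unif::'k) * nabs (unif::'k) < 1 * 1"
      using unif(2)[where 'k='k] by (intro mult_strict_mono) auto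
    ultimately show False by simp
  qed
  then have "a1 (unif::'k) \<noteq> c1 unif" using character_nonzero[OF char unif(1)] by (simp add: a1_def c1_def)
  then show ?thesis using unif(1) by blast
qed

lemma sub_contains_X00:
  assumes "gstable W" "W \<subseteq> ps a1 c1" "f \<in> W" "f \<noteq> (\<lambda>_. 0)"
  shows "ps00 a1 c1 \<subseteq> W" "\<exists>g\<in>ps00 a1 c1. g \<noteq> (\<lambda>_. 0)"
proof -
  have "\<not> W \<inter> ps00 a1 c1 \<subseteq> {\<lambda>_. 0}" using X.sub_is_line(1)[OF assms(1,2) _ assms(3,4)] exponents_differ by blast
  then obtain g where "g \<in> W" "g \<in> ps00 a1 c1" "g \<noteq> (\<lambda>_. 0)" by blast
  then show "ps00 a1 c1 \<subseteq> W" "\<exists>g\<in>ps00 a1 c1. g \<noteq> (\<lambda>_. 0)"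
    using X.sub_contains_ps00[OF assms(1,2)] by blast+
qed

text \<open>The functional \<open>lam\<close> defines an intertwining map from \<open>I\<close> to \<open>ps a1 c1\<close> with kernel the line. Any nonzero
  subrepresentation \<open>W\<close> of the target contains \<open>ps00\<close>, for \<open>a1 \<noteq> c1\<close> excludes lines, and so does the image. The
  preimage of \<open>W\<close> is thus larger than the line, hence everything.\<close>

lemma frob_image_minimal:
  assumes W: "gstable W" "W \<subseteq> ps a1 c1" "f \<in> W" "f \<noteq> (\<lambda>_. 0)"
  shows "F.\<Phi> ` carrier I \<subseteq> W"
proof -
  obtain h where h: "h \<in> carrier I" "lam h \<noteq> 0" using eigenfunctional_lam by (auto simp: eigenfunctional_def)
  then have "F.\<Phi> h \<noteq> (\<lambda>_. 0)" using F.frob_at_1[OF h(1)] by auto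
  then have "ps00 a1 c1 \<subseteq> F.\<Phi> ` carrier I" using sub_contains_X00(1)[OF F.gstable_frob F.frob_image_ps imageI[OF h(1)]] by blast
  moreover obtain g where g: "g \<in> ps00 a1 c1" "g \<noteq> (\<lambda>_. 0)" using sub_contains_X00(2)[OF W] by blast
  ultimately obtain y where y: "y \<in> carrier I" "F.\<Phi> y = g" by blast
  have gW: "g \<in> W" using sub_contains_X00(1)[OF W] g by blast
  have "\<not> {f \<in> carrier I. F.\<Phi> f \<in> W} \<subseteq> line" using y gW g(2) frob_kernel[OF y(1)] by blast
  moreover have "gstable {f \<in> carrier I. F.\<Phi> f \<in> W}" "{f \<in> carrier I. F.\<Phi> f \<in> W} \<subseteq> ps \<xi> \<xi>"
    using F.subrep_frob_vimage[OF W(1)] unfolding subrep_I_iff by blast+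
  ultimately have "{f \<in> carrier I. F.\<Phi> f \<in> W} = ps \<xi> \<xi>" using sub_dichotomy by blast
  then show ?thesis using carrier_I by blast
qed

end

section \<open>Irreducible representations with a Borel eigenfunctional\<close>

context frobenius_irred
begin

lemma rep_iso_char:
  assumes triv: "\<Phi> ` carrier V \<inter> ps00 a c \<subseteq> {\<lambda>_. 0}"
  shows "\<And>x. x \<noteq> 0 \<Longrightarrow> a x = c x" "rep_iso GL2 V (char_rep (\<lambda>g. a (det g)))"
proof -
  obtain w where w: "w \<in> carrier V" "l w \<noteq> 0" using l_nonzero by blast
  have nz: "\<Phi> v \<noteq> (\<lambda>_. 0)" if "v \<in> carrier V" "v \<noteq> \<zero>" for v using frob_eq_zero that by blast
  note line = sub_is_line[OF gstable_frob frob_image_ps triv imageI]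
  have w0: "w \<noteq> \<zero>" using w lfun_zero[OF lfun_l] by auto
  show "a x = c x" if "x \<noteq> 0" for x using line(1)[OF w(1) nz[OF w(1) w0] that] .
  have lact: "l (act V g v) = a (det g) * l v" if g: "invertible g" and v: "v \<in> carrier V" for g v
  proof (cases "v = \<zero>")
    case True
    then show ?thesis using lfun_zero[OF lfun_l] act_zero[of g] g by simp
  next
    case False
    have "\<Phi> v g = a (det g) * \<Phi> v (mat 1)" using line(3)[OF v nz[OF v False] g] .
    then show ?thesis using frob_at_1[OF v] g by (simp add: frob_def)
  qed
  define f where "f = (\<lambda>v\<in>carrier V. l v)"
  have "f \<in> rep_hom GL2 V (char_rep (\<lambda>g. a (det g)))"
    unfolding rep_hom_def linear_maps_def
    by (auto simp: f_def char_rep_def lfun_add[OF lfun_l] lfun_smul[OF lfun_l] lact)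
  moreover have "bij_betw f (carrier V) (carrier (char_rep (\<lambda>g. a (det g))))"
  proof (rule bij_betw_imageI)
    show "inj_on f (carrier V)"
    proof (rule inj_onI)
      fix u v assume uv: "u \<in> carrier V" "v \<in> carrier V" "f u = f v"
      let ?d = "u \<oplus> (-1) \<odot> v"
      have d: "?d \<in> carrier V" "l ?d = 0" using uv by (simp_all add: f_def lfun_add[OF lfun_l] lfun_smul[OF lfun_l])
      have "?d = \<zero>"
      proof (rule ccontr)
        assume "?d \<noteq> \<zero>"
        then have "\<Phi> ?d (mat 1) \<noteq> 0" using line(2)[OF d(1) nz[OF d(1)]] by blast
        then show False using frob_at_1[OF d(1)] d(2) by simp
      qed
      then show "u = v" using sub_add_cancel[of v u] uv by simp
    qed
    have "z \<in> f ` carrier V" for z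
    proof -
      have "f ((z / l w) \<odot> w) = z" using w by (simp add: f_def lfun_smul[OF lfun_l])
      then show ?thesis using w by (metis imageI smul_closed)
    qed
    then show "f ` carrier V = carrier (char_rep (\<lambda>g. a (det g)))" by (auto simp: char_rep_def)
  qed
  ultimately show "rep_iso GL2 V (char_rep (\<lambda>g. a (det g)))" unfolding rep_iso_def by blast
qed

lemma rep_iso_Ind:
  assumes full: "\<Phi> ` carrier V = ps a c" and carr: "carrier (Ind_B2 \<mu>) = ps a c"
  shows "rep_iso GL2 V (Ind_B2 \<mu>)"
proof -
  define f where "f = (\<lambda>v\<in>carrier V. \<Phi> v)"
  have "f \<in> rep_hom GL2 V (Ind_B2 \<mu>)"
    unfolding rep_hom_def linear_maps_def
    by (auto simp: f_def carr frob_ps frob_add frob_smul frob_act)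
  moreover have "bij_betw f (carrier V) (carrier (Ind_B2 \<mu>))"
    unfolding carr full[symmetric]
    by (rule bij_betw_imageI) (auto simp: f_def inj_on_def frob_inj)
  ultimately show ?thesis unfolding rep_iso_def by blast
qed

text \<open>Both \<open>V\<close> and \<open>Ind(\<xi>\<bar>\<cdot>\<bar>\<^sup>-\<^sup>1\<^sup>/\<^sup>2 \<otimes> \<xi>\<bar>\<cdot>\<bar>\<^sup>1\<^sup>/\<^sup>2)\<close> map to \<open>ps a c\<close>, with the same image by minimality. The isomorphism
  sends \<open>v\<close> to the coset of any \<open>y v\<close> with the same image.\<close>

lemma rep_iso_Steinberg:
  assumes \<xi>: "is_character \<xi>" and ac: "\<And>x. x \<noteq> 0 \<Longrightarrow> a x = nabs_pow 1 x * \<xi> x" "\<And>x. x \<noteq> 0 \<Longrightarrow> c x = nabs_pow (-1) x * \<xi> x"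
  shows "rep_iso GL2 V (Steinberg \<xi>)"
proof -
  interpret S: steinberg \<xi> by (rule steinberg.intro[OF \<xi>])
  have ps_eq: "ps a c = ps S.a1 S.c1"
    by (rule ps_cong) (simp_all add: ac S.a1_def S.c1_def)
  let ?M = "S.F.\<Phi>"
  obtain w where w: "w \<in> carrier V" "l w \<noteq> 0" using l_nonzero by blast
  have w0: "\<Phi> w \<noteq> (\<lambda>_. 0)" using frob_at_1[OF w(1)] w(2) by auto
  have sub: "?M ` carrier S.I \<subseteq> \<Phi> ` carrier V"
    using S.frob_image_minimal[OF gstable_frob _ imageI[OF w(1)] w0] frob_image_ps ps_eq by blast
  have "?M ` carrier S.I \<noteq> {\<lambda>_. 0}"
  proof
    assume h: "?M ` carrier S.I = {\<lambda>_. 0}"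
    obtain y where y: "y \<in> carrier S.I" "S.lam y \<noteq> 0" using S.F.l_nonzero by blast
    then have "?M y = (\<lambda>_. 0)" using h by blast
    then show False using S.F.frob_at_1[OF y(1)] y(2) by simp
  qed
  then have eq: "?M ` carrier S.I = \<Phi> ` carrier V"
    using frob_sub_trivial[OF S.F.gstable_frob sub] by blast
  have proj_M: "S.q.proj y = S.q.proj y' \<longleftrightarrow> ?M y = ?M y'" if y: "y \<in> carrier S.I" "y' \<in> carrier S.I" for y y'
  proof -
    have c: "(-1) \<odot>\<^bsub>S.I\<^esub> y' \<in> carrier S.I" "y \<oplus>\<^bsub>S.I\<^esub> (-1) \<odot>\<^bsub>S.I\<^esub> y' \<in> carrier S.I"
      using S.I.smul_closed[OF y(2)] S.I.M.a_closed[OF y(1) S.I.smul_closed[OF y(2)]] by blast+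
    have "?M (y \<oplus>\<^bsub>S.I\<^esub> (-1) \<odot>\<^bsub>S.I\<^esub> y') = (\<lambda>g. ?M y g - ?M y' g)"
      using S.F.frob_add[OF y(1) c(1)] S.F.frob_smul[OF y(2), of "-1"] by simp
    then have "?M (y \<oplus>\<^bsub>S.I\<^esub> (-1) \<odot>\<^bsub>S.I\<^esub> y') = (\<lambda>_. 0) \<longleftrightarrow> ?M y = ?M y'" by (auto simp: fun_eq_iff)
    then show ?thesis using S.frob_kernel[OF c(2)] S.q.proj_eq[OF y] by blast
  qed
  have "\<forall>v. \<exists>y. v \<in> carrier V \<longrightarrow> y \<in> carrier S.I \<and> ?M y = \<Phi> v"
  proof
    fix v show "\<exists>y. v \<in> carrier V \<longrightarrow> y \<in> carrier S.I \<and> ?M y = \<Phi> v"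
    proof (cases "v \<in> carrier V")
      case True
      then have "\<Phi> v \<in> ?M ` carrier S.I" unfolding eq by (rule imageI)
      then show ?thesis by (auto simp: image_iff)
    qed blast
  qed
  from choice[OF this] obtain y where
    y: "\<And>v. v \<in> carrier V \<Longrightarrow> y v \<in> carrier S.I" "\<And>v. v \<in> carrier V \<Longrightarrow> ?M (y v) = \<Phi> v" by blast
  have proj_y: "S.q.proj (y v) = S.q.proj x \<longleftrightarrow> \<Phi> v = ?M x" if "v \<in> carrier V" "x \<in> carrier S.I" for v x
    using proj_M[OF y(1)[OF that(1)] that(2)] y(2)[OF that(1)] by simp
  define f where "f = (\<lambda>v\<in>carrier V. S.q.proj (y v))"
  have fQ: "f \<in> rep_hom GL2 V S.q.Q"
    unfolding rep_hom_def linear_maps_def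
  proof (intro CollectI IntI conjI ballI allI)
    show "f \<in> carrier V \<rightarrow> carrier S.q.Q" using y(1) by (auto simp: f_def intro: S.q.proj_closed)
    show "f \<in> extensional (carrier V)" by (simp add: f_def)
    fix v assume v: "v \<in> carrier V"
    show "f (k \<odot> v) = k \<odot>\<^bsub>S.q.Q\<^esub> f v" for k
    proof -
      have "S.q.proj (y (k \<odot> v)) = S.q.proj (k \<odot>\<^bsub>S.I\<^esub> y v)"
        using proj_y[OF smul_closed[OF v] S.I.smul_closed[OF y(1)[OF v]], of k k]
          frob_smul[OF v, of k] S.F.frob_smul[OF y(1)[OF v], of k] y(2)[OF v] by simp
      then show ?thesis using v S.q.smul_Q[OF y(1)[OF v], of k] by (simp add: f_def)
    qed
    show "f (u \<oplus> v) = f u \<oplus>\<^bsub>S.q.Q\<^esub> f v" if u: "u \<in> carrier V" for u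
    proof -
      have "S.q.proj (y (u \<oplus> v)) = S.q.proj (y u \<oplus>\<^bsub>S.I\<^esub> y v)"
        using proj_y[OF M.a_closed[OF u v] S.I.M.a_closed[OF y(1)[OF u] y(1)[OF v]]]
          frob_add[OF u v] S.F.frob_add[OF y(1)[OF u] y(1)[OF v]] y(2)[OF u] y(2)[OF v] by simp
      then show ?thesis using u v S.q.add_Q[OF y(1)[OF u] y(1)[OF v]] by (simp add: f_def)
    qed
    show "f (act V g v) = act S.q.Q g (f v)" if g: "g \<in> carrier GL2" for g
    proof -
      have gi: "invertible g" using g by simp
      have "S.q.proj (y (act V g v)) = S.q.proj (act S.I g (y v))"
        using proj_y[OF act_closed[OF g v] S.I.act_closed[OF g y(1)[OF v]]]
          frob_act[OF gi v] S.F.frob_act[OF gi y(1)[OF v]] y(2)[OF v] by simp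
      then show ?thesis using v g S.q.act_Q[OF g y(1)[OF v]] by (simp add: f_def)
    qed
  qed
  have "bij_betw f (carrier V) (carrier S.q.Q)"
  proof (rule bij_betw_imageI)
    show "inj_on f (carrier V)"
    proof (rule inj_onI)
      fix u v assume uv: "u \<in> carrier V" "v \<in> carrier V" "f u = f v"
      then have "\<Phi> u = \<Phi> v" using proj_y[OF uv(1) y(1)[OF uv(2)]] y(2)[OF uv(2)] by (simp add: f_def)
      then show "u = v" using frob_inj uv by blast
    qed
    show "f ` carrier V = carrier S.q.Q"
    proof
      show "f ` carrier V \<subseteq> carrier S.q.Q" using y(1) by (auto simp: f_def intro: S.q.proj_closed)
      show "carrier S.q.Q \<subseteq> f ` carrier V"
      proof
        fix X assume "X \<in> carrier S.q.Q"
        then obtain x where x: "x \<in> carrier S.I" "X = S.q.proj x" by (rule S.q.carrier_Q_cases)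
        have "?M x \<in> \<Phi> ` carrier V" using eq x(1) by blast
        then obtain v where v: "v \<in> carrier V" "?M x = \<Phi> v" by blast
        then have "f v = X" using proj_y[OF v(1) x(1)] x(2) by (simp add: f_def)
        then show "X \<in> f ` carrier V" using v(1) by blast
      qed
    qed
  qed
  then show ?thesis using fQ unfolding rep_iso_def S.Steinberg_eq by blast
qed

end

section \<open>Characters of the torus and the criterion for goodness\<close>

lemma T2_eq_iff: "T2_eq \<mu> \<nu> \<longleftrightarrow> (\<forall>x y. x \<noteq> 0 \<longrightarrow> y \<noteq> 0 \<longrightarrow> \<mu> (mk x 0 0 y) = \<nu> (mk x 0 0 (y::'k::nonarch_local_field)))"
  by (auto simp: T2_eq_def carrier_T2)

lemma T2_eq_tensor_char:
  assumes \<xi>: "is_character \<xi>" "is_character \<zeta>" and d: "is_character d1" "is_character d2"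
    and \<mu>: "\<And>x y. x \<noteq> 0 \<Longrightarrow> y \<noteq> 0 \<Longrightarrow> \<mu> (mk x 0 0 y) = d1 x * d2 (y::'k::nonarch_local_field)"
  shows "T2_eq (tensor_char \<xi> \<zeta>) \<mu> \<longleftrightarrow> (\<forall>x. x \<noteq> 0 \<longrightarrow> \<xi> x = d1 x \<and> \<zeta> x = d2 x)"
proof
  assume h: "T2_eq (tensor_char \<xi> \<zeta>) \<mu>"
  have e: "\<xi> x * \<zeta> y = d1 x * d2 y" if "x \<noteq> 0" "y \<noteq> 0" for x y
    using h that \<mu> unfolding T2_eq_iff tensor_char_def by auto
  show "\<forall>x. x \<noteq> 0 \<longrightarrow> \<xi> x = d1 x \<and> \<zeta> x = d2 x"
    using e[of _ 1] e[of 1] character_1[OF \<xi>(1)] character_1[OF \<xi>(2)] character_1[OF d(1)] character_1[OF d(2)] by auto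
qed (auto simp: T2_eq_iff tensor_char_def \<mu>)

text \<open>Left to right, \<open>V\<close> is a subrepresentation of \<open>ps d1 d2\<close>, and the three cases are those of its intersection with
  \<open>ps00\<close> and of being proper. The second alternative for an induced representation comes
  from the second character of its Jacquet module, and is used from right to left.\<close>

theorem (in irred_gl2) eigenfunctional_iff:
  assumes d: "is_character d1" "is_character d2"
    and \<mu>: "\<And>x y. x \<noteq> 0 \<Longrightarrow> y \<noteq> 0 \<Longrightarrow> \<mu> (mk x 0 0 y) = d1 x * d2 y"
    and \<mu>': "\<And>x y. x \<noteq> 0 \<Longrightarrow> y \<noteq> 0 \<Longrightarrow> \<mu>' (mk x 0 0 y) = d2 x * d1 y"
  shows "(\<exists>l. eigenfunctional V d1 d2 l) \<longleftrightarrow>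
    (\<exists>\<xi>. is_character \<xi> \<and> rep_iso GL2 V (char_rep (\<lambda>g. \<xi> (det g))) \<and> T2_eq (tensor_char \<xi> \<xi>) \<mu>) \<or>
    (\<exists>\<xi>. is_character \<xi> \<and> rep_iso GL2 V (Steinberg \<xi>) \<and> T2_eq (tensor_char \<xi> \<xi>) (\<lambda>t. \<mu> t * delta_B2_pow (-1) t)) \<or>
    (\<exists>\<xi>\<^sub>1 \<xi>\<^sub>2. is_character \<xi>\<^sub>1 \<and> is_character \<xi>\<^sub>2 \<and> rep_iso GL2 V (Ind_B2 (tensor_char \<xi>\<^sub>1 \<xi>\<^sub>2)) \<and>
       (T2_eq (tensor_char \<xi>\<^sub>1 \<xi>\<^sub>2) (\<lambda>t. \<mu> t * delta_B2_pow (-1/2) t) \<or>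
        T2_eq (tensor_char \<xi>\<^sub>1 \<xi>\<^sub>2) (\<lambda>t. \<mu>' t * delta_B2_pow (1/2) t)))"
    (is "?L \<longleftrightarrow> ?A \<or> ?B \<or> ?C")
proof -
  note nc = is_character_nabs_pow[where 'k='k]
  have tw: "is_character (\<lambda>x. d x * nabs_pow s x)" if "is_character d" for d :: "'k \<Rightarrow> complex" and s
    using is_character_mult[OF that nc] .
  have \<mu>s: "\<mu> (mk x 0 0 y) * delta_B2_pow s (mk x 0 0 y) = (d1 x * nabs_pow s x) * (d2 y * nabs_pow (- s) y)"
    "\<mu>' (mk x 0 0 y) * delta_B2_pow s (mk x 0 0 y) = (d2 x * nabs_pow s x) * (d1 y * nabs_pow (- s) y)"
    if "x \<noteq> 0" "y \<noteq> 0" for x y s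
    using that by (simp_all add: \<mu> \<mu>' delta_B2_pow_def tensor_char_def)
  have TA: "T2_eq (tensor_char \<xi> \<xi>) \<mu> \<longleftrightarrow> (\<forall>x. x \<noteq> 0 \<longrightarrow> \<xi> x = d1 x \<and> \<xi> x = d2 x)" if "is_character \<xi>" for \<xi>
    by (rule T2_eq_tensor_char[OF that that d \<mu>])
  have TB: "T2_eq (tensor_char \<xi>\<^sub>1 \<xi>\<^sub>2) (\<lambda>t. \<mu> t * delta_B2_pow s t) \<longleftrightarrow>
      (\<forall>x. x \<noteq> 0 \<longrightarrow> \<xi>\<^sub>1 x = d1 x * nabs_pow s x \<and> \<xi>\<^sub>2 x = d2 x * nabs_pow (- s) x)"
    "T2_eq (tensor_char \<xi>\<^sub>1 \<xi>\<^sub>2) (\<lambda>t. \<mu>' t * delta_B2_pow s t) \<longleftrightarrow>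
      (\<forall>x. x \<noteq> 0 \<longrightarrow> \<xi>\<^sub>1 x = d2 x * nabs_pow s x \<and> \<xi>\<^sub>2 x = d1 x * nabs_pow (- s) x)"
    if "is_character \<xi>\<^sub>1" "is_character \<xi>\<^sub>2" for \<xi>\<^sub>1 \<xi>\<^sub>2 s
    using T2_eq_tensor_char[OF that tw[OF d(1)] tw[OF d(2)], of "\<lambda>t. \<mu> t * delta_B2_pow s t" s "- s"]
      T2_eq_tensor_char[OF that tw[OF d(2)] tw[OF d(1)], of "\<lambda>t. \<mu>' t * delta_B2_pow s t" s "- s"] \<mu>s by blast+
  have pw: "nabs_pow s x * (nabs_pow t x * z) = nabs_pow (s + t) x * z" if "x \<noteq> 0" for s t x and z :: complex
    using nabs_pow_add[OF that, of s t] by (simp add: mult.assoc[symmetric])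
  have pc: "nabs_pow s x * (z * nabs_pow t x) = z" if "x \<noteq> 0" "s + t = 0" for s t x and z :: complex
    using pw[OF that(1), of s t z] nabs_pow_0[OF that(1)] that(2) by (simp add: mult.commute)
  show ?thesis
  proof
    assume ?L
    then obtain l where l: "eigenfunctional V d1 d2 l" by blast
    interpret frobenius_irred V d1 d2 l by (rule frobenius_irredI[OF d l])
    show "?A \<or> ?B \<or> ?C"
    proof (cases "\<Phi> ` carrier V \<inter> ps00 d1 d2 \<subseteq> {\<lambda>_. 0}")
      case True
      have "T2_eq (tensor_char d1 d1) \<mu>"
        unfolding TA[OF d(1)] using rep_iso_char(1)[OF True] by simp
      then have ?A using rep_iso_char(2)[OF True] d(1) by (intro exI[of _ d1] conjI)
      then show ?thesis by (rule disjI1)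
    next
      case False
      then obtain f where f: "f \<in> \<Phi> ` carrier V" "f \<in> ps00 d1 d2" "f \<noteq> (\<lambda>_. 0)" by blast
      have sub: "ps00 d1 d2 \<subseteq> \<Phi> ` carrier V" by (rule sub_contains_ps00[OF gstable_frob frob_image_ps f])
      show ?thesis
      proof (cases "\<Phi> ` carrier V = ps d1 d2")
        case True
        \<comment> \<open>undo the normalization by \<open>\<delta>\<^sup>1\<^sup>/\<^sup>2\<close>\<close>
        let ?\<xi> = "\<lambda>x. d1 x * nabs_pow (-1/2) x" and ?\<zeta> = "\<lambda>x. d2 x * nabs_pow (1/2) x"
        have "carrier (Ind_B2 (tensor_char ?\<xi> ?\<zeta>)) = ps d1 d2"
          by (rule Ind_carrier) (rule pc[symmetric]; simp)+
        from rep_iso_Ind[OF True this] have ?C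
          using TB(1)[OF tw[OF d(1)] tw[OF d(2)], of "-1/2" "1/2" "-1/2"] tw[OF d(1), of "-1/2"] tw[OF d(2), of "1/2"] by auto
        then show ?thesis by blast
      next
        case False
        note ex = proper_sub_exponent[OF gstable_frob frob_image_ps sub False]
        let ?\<xi> = "\<lambda>x. d1 x * nabs_pow (-1) x"
        have e1: "d1 x = nabs_pow 1 x * ?\<xi> x" if "x \<noteq> 0" for x
          using pw[OF that, of 1 "-1" "d1 x"] nabs_pow_0[OF that] by (simp add: mult.commute)
        have e2: "d2 x = nabs_pow (-1) x * ?\<xi> x" if "x \<noteq> 0" for x
          using ex[OF that] that by (simp add: nabs_pow_def powr_minus_divide)
        have e3: "?\<xi> x = d2 x * nabs_pow 1 x" if "x \<noteq> 0" for x
          using ex[OF that] that by (simp add: nabs_pow_def powr_minus_divide)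
        have "rep_iso GL2 V (Steinberg ?\<xi>)" by (rule rep_iso_Steinberg[OF tw[OF d(1)] e1 e2])
        then have ?B using TB(1)[OF tw[OF d(1)] tw[OF d(1)], of "-1" "-1" "-1"] tw[OF d(1), of "-1"] e3
          by (intro exI[of _ ?\<xi>]) auto
        then show ?thesis by blast
      qed
    qed
  next
    assume "?A \<or> ?B \<or> ?C"
    then consider (A) ?A | (B) ?B | (C) ?C by blast
    then show ?L
    proof cases
      case A
      then obtain \<xi> where \<xi>: "is_character \<xi>" "rep_iso GL2 V (char_rep (\<lambda>g. \<xi> (det g)))" "T2_eq (tensor_char \<xi> \<xi>) \<mu>" by blast
      obtain l where "eigenfunctional V \<xi> \<xi> l"
        using eigenfunctional_pullback[OF \<xi>(2) eigenfunctional_char_rep[OF \<xi>(1)]] by blast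
      moreover have "\<forall>x. x \<noteq> 0 \<longrightarrow> \<xi> x = d1 x \<and> \<xi> x = d2 x" using \<xi>(3) unfolding TA[OF \<xi>(1)] .
      ultimately have "eigenfunctional V d1 d2 l" using eigenfunctional_cong[of V \<xi> \<xi> l d1 d2] by blast
      then show ?L by blast
    next
      case B
      then obtain \<xi> where \<xi>: "is_character \<xi>" "rep_iso GL2 V (Steinberg \<xi>)" "T2_eq (tensor_char \<xi> \<xi>) (\<lambda>t. \<mu> t * delta_B2_pow (-1) t)" by blast
      interpret S: steinberg \<xi> by (rule steinberg.intro[OF \<xi>(1)])
      obtain l' where "eigenfunctional (Steinberg \<xi>) S.a1 S.c1 l'" using S.eigenfunctional_Steinberg by blast
      then obtain l where l: "eigenfunctional V S.a1 S.c1 l" using eigenfunctional_pullback[OF \<xi>(2)] by blast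
      have e: "\<xi> x = d1 x * nabs_pow (-1) x" "\<xi> x = d2 x * nabs_pow 1 x" if "x \<noteq> 0" for x
        using TB(1)[OF \<xi>(1,1), of "-1"] \<xi>(3) that by auto
      have "S.a1 x = d1 x" "S.c1 x = d2 x" if x: "x \<noteq> 0" for x
      proof -
        show "S.a1 x = d1 x" unfolding S.a1_def e(1)[OF x] by (rule pc[OF x]) simp
        show "S.c1 x = d2 x" unfolding S.c1_def e(2)[OF x] by (rule pc[OF x]) simp
      qed
      then show ?L using eigenfunctional_cong[OF l] by blast
    next
      case C
      then obtain \<xi>\<^sub>1 \<xi>\<^sub>2 where \<xi>: "is_character \<xi>\<^sub>1" "is_character \<xi>\<^sub>2" "rep_iso GL2 V (Ind_B2 (tensor_char \<xi>\<^sub>1 \<xi>\<^sub>2))"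
        "T2_eq (tensor_char \<xi>\<^sub>1 \<xi>\<^sub>2) (\<lambda>t. \<mu> t * delta_B2_pow (-1/2) t) \<or>
         T2_eq (tensor_char \<xi>\<^sub>1 \<xi>\<^sub>2) (\<lambda>t. \<mu>' t * delta_B2_pow (1/2) t)" by blast
      define a where "a x = nabs_pow (1/2) x * \<xi>\<^sub>1 x" for x
      define c where "c x = nabs_pow (- (1/2)) x * \<xi>\<^sub>2 x" for x
      interpret P: char_pair a c
        unfolding a_def[abs_def] c_def[abs_def] by unfold_locales (intro is_character_mult nc \<xi>)+
      have carr: "carrier (Ind_B2 (tensor_char \<xi>\<^sub>1 \<xi>\<^sub>2)) = ps a c" by (rule Ind_carrier) (simp_all add: a_def c_def)
      from \<xi>(4) show ?L
      proof
        assume "T2_eq (tensor_char \<xi>\<^sub>1 \<xi>\<^sub>2) (\<lambda>t. \<mu> t * delta_B2_pow (-1/2) t)"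
        then have e: "\<xi>\<^sub>1 x = d1 x * nabs_pow (-1/2) x" "\<xi>\<^sub>2 x = d2 x * nabs_pow (1/2) x" if "x \<noteq> 0" for x
          using TB(1)[OF \<xi>(1,2), of "-1/2"] that by auto
        obtain l where l: "eigenfunctional V a c l"
          using eigenfunctional_pullback[OF \<xi>(3) P.eigenfunctional_Ind_1[OF carr]] by blast
        have "a x = d1 x" "c x = d2 x" if x: "x \<noteq> 0" for x
          using pw[OF x, of "1/2" "-1/2" "d1 x"] pw[OF x, of "-(1/2)" "1/2" "d2 x"] e[OF x] nabs_pow_0[OF x]
          by (simp_all add: a_def c_def mult.commute)
        then show ?L using eigenfunctional_cong[OF l] by blast
      next
        assume "T2_eq (tensor_char \<xi>\<^sub>1 \<xi>\<^sub>2) (\<lambda>t. \<mu>' t * delta_B2_pow (1/2) t)"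
        then have e: "\<xi>\<^sub>1 x = d2 x * nabs_pow (1/2) x" "\<xi>\<^sub>2 x = d1 x * nabs_pow (-(1/2)) x" if "x \<noteq> 0" for x
          using TB(2)[OF \<xi>(1,2), of "1/2"] that by auto
        have "d1 x = nabs_pow 1 x * c x" "d2 x = nabs_pow (-1) x * a x" if x: "x \<noteq> 0" for x
        proof -
          have "nabs_pow 1 x * c x = nabs_pow (1 + - (1/2)) x * (d1 x * nabs_pow (- (1/2)) x)"
            unfolding c_def e(2)[OF x] by (rule pw[OF x])
          also have "\<dots> = d1 x" by (rule pc[OF x]) simp
          finally show "d1 x = nabs_pow 1 x * c x" ..
          have "nabs_pow (-1) x * a x = nabs_pow (-1 + 1/2) x * (d2 x * nabs_pow (1/2) x)"
            unfolding a_def e(1)[OF x] by (rule pw[OF x])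
          also have "\<dots> = d2 x" by (rule pc[OF x]) simp
          finally show "d2 x = nabs_pow (-1) x * a x" ..
        qed
        then obtain l' where "eigenfunctional (Ind_B2 (tensor_char \<xi>\<^sub>1 \<xi>\<^sub>2)) d1 d2 l'"
          using P.eigenfunctional_Ind_2[OF carr, of d1 d2] by blast
        then show ?L using eigenfunctional_pullback[OF \<xi>(3)] by blast
      qed
    qed
  qed
qed

text \<open>The three conditions are quantified separately in the theorem; this regroups them for each \<open>i\<close>.\<close>

lemma distribute_conditions:
  assumes "\<And>i j l. i \<in> S \<Longrightarrow> R i j l \<Longrightarrow> P i j l \<longleftrightarrow>
      \<not> ((\<exists>x. X x \<and> U i x \<and> A i j l x) \<or> (\<exists>x. X x \<and> W i x \<and> B i j l x) \<or>
         (\<exists>x y. X x \<and> X y \<and> Y i x y \<and> (C i j l x y \<or> D i j l x y)))"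
  shows "(\<forall>i\<in>S. \<forall>j l. R i j l \<longrightarrow> P i j l) \<longleftrightarrow>
      (\<forall>i\<in>S. \<forall>j l. R i j l \<longrightarrow> (\<forall>x. X x \<and> U i x \<longrightarrow> \<not> A i j l x)) \<and>
      (\<forall>i\<in>S. \<forall>j l. R i j l \<longrightarrow> (\<forall>x. X x \<and> W i x \<longrightarrow> \<not> B i j l x)) \<and>
      (\<forall>i\<in>S. \<forall>j l. R i j l \<longrightarrow> (\<forall>x y. X x \<and> X y \<and> Y i x y \<longrightarrow> \<not> C i j l x y \<and> \<not> D i j l x y))"
proof -
  have "(\<forall>i\<in>S. \<forall>j l. R i j l \<longrightarrow> P i j l) \<longleftrightarrow> (\<forall>i\<in>S. \<forall>j l. R i j l \<longrightarrow>
      \<not> ((\<exists>x. X x \<and> U i x \<and> A i j l x) \<or> (\<exists>x. X x \<and> W i x \<and> B i j l x) \<or>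
         (\<exists>x y. X x \<and> X y \<and> Y i x y \<and> (C i j l x y \<or> D i j l x y))))"
    by (intro ball_cong refl all_cong1 imp_cong assms)
  also have "\<dots> \<longleftrightarrow>
      (\<forall>i\<in>S. \<forall>j l. R i j l \<longrightarrow> (\<forall>x. X x \<and> U i x \<longrightarrow> \<not> A i j l x)) \<and>
      (\<forall>i\<in>S. \<forall>j l. R i j l \<longrightarrow> (\<forall>x. X x \<and> W i x \<longrightarrow> \<not> B i j l x)) \<and>
      (\<forall>i\<in>S. \<forall>j l. R i j l \<longrightarrow> (\<forall>x y. X x \<and> X y \<and> Y i x y \<longrightarrow> \<not> C i j l x y \<and> \<not> D i j l x y))"
    by (simp only: de_Morgan_disj not_ex de_Morgan_conj imp_conjR all_conj_distrib ball_conj_distrib) blast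
  finally show ?thesis .
qed

theorem proposition1p4:
  fixes \<eta> :: "'k::nonarch_local_field \<Rightarrow> complex"
    and \<tau> :: "nat \<Rightarrow> ('k mat2, 'v) rep"
  assumes "is_character \<eta>"
    and "\<And>i. i \<in> {1,2,3} \<Longrightarrow> irreducible_rep GL2 (\<tau> i)"
    and "\<And>i. i \<in> {1,2,3} \<Longrightarrow> smooth_rep GL2 (\<tau> i)"
    and "\<And>i. i \<in> {1,2,3} \<Longrightarrow> admissible_rep GL2 (\<tau> i)"
  shows "good \<eta> \<tau> \<longleftrightarrow>
    (\<comment> \<open>(G1)\<close>
     \<forall>i\<in>{1,2,3}. \<forall>j l. {j, l} = {1,2,3} - {i} \<and> j < l \<longrightarrow>
       (\<forall>\<xi>. is_character \<xi> \<and> rep_iso GL2 (\<tau> i) (char_rep (\<lambda>g. \<xi> (det g))) \<longrightarrow>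
          \<not> T2_eq (tensor_char \<xi> \<xi>)
                  (dual_twist \<eta> (central_char (\<tau> j)) (central_char (\<tau> l))))) \<and>
    (\<comment> \<open>(G2)\<close>
     \<forall>i\<in>{1,2,3}. \<forall>j l. {j, l} = {1,2,3} - {i} \<and> j < l \<longrightarrow>
       (\<forall>\<xi>. is_character \<xi> \<and> rep_iso GL2 (\<tau> i) (Steinberg \<xi>) \<longrightarrow>
          \<not> T2_eq (tensor_char \<xi> \<xi>)
                  (\<lambda>t. dual_twist \<eta> (central_char (\<tau> j)) (central_char (\<tau> l)) t * delta_B2_pow (-1) t))) \<and>
    (\<comment> \<open>(G3)\<close>
     \<forall>i\<in>{1,2,3}. \<forall>j l. {j, l} = {1,2,3} - {i} \<and> j < l \<longrightarrow>
       (\<forall>\<xi>\<^sub>1 \<xi>\<^sub>2. is_character \<xi>\<^sub>1 \<and> is_character \<xi>\<^sub>2 \<and>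
            rep_iso GL2 (\<tau> i) (Ind_B2 (tensor_char \<xi>\<^sub>1 \<xi>\<^sub>2)) \<longrightarrow>
          \<not> T2_eq (tensor_char \<xi>\<^sub>1 \<xi>\<^sub>2)
                  (\<lambda>t. dual_twist \<eta> (central_char (\<tau> j)) (central_char (\<tau> l)) t * delta_B2_pow (-1/2) t) \<and>
          \<not> T2_eq (tensor_char \<xi>\<^sub>1 \<xi>\<^sub>2)
                  (\<lambda>t. dual_twist \<eta> (central_char (\<tau> l)) (central_char (\<tau> j)) t * delta_B2_pow (1/2) t)))"
proof -
  have irr: "irred_gl2 (\<tau> i)" if "i \<in> {1,2,3}" for i
    using assms(2,3)[OF that]
    by (intro irred_gl2.intro smooth_gl2.intro grep.intro smooth_gl2_axioms.intro irred_gl2_axioms.intro)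
      (simp_all add: irreducible_rep_def)
  have key: "rep_hom_zero T2 (semisimplification T2 (jacquet_module (\<tau> i)))
        (char_rep (dual_twist \<eta> (central_char (\<tau> j)) (central_char (\<tau> l)))) \<longleftrightarrow>
      \<not> ((\<exists>\<xi>. is_character \<xi> \<and> rep_iso GL2 (\<tau> i) (char_rep (\<lambda>g. \<xi> (det g))) \<and>
            T2_eq (tensor_char \<xi> \<xi>) (dual_twist \<eta> (central_char (\<tau> j)) (central_char (\<tau> l)))) \<or>
         (\<exists>\<xi>. is_character \<xi> \<and> rep_iso GL2 (\<tau> i) (Steinberg \<xi>) \<and>
            T2_eq (tensor_char \<xi> \<xi>)
                  (\<lambda>t. dual_twist \<eta> (central_char (\<tau> j)) (central_char (\<tau> l)) t * delta_B2_pow (-1) t)) \<or>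
         (\<exists>\<xi>\<^sub>1 \<xi>\<^sub>2. is_character \<xi>\<^sub>1 \<and> is_character \<xi>\<^sub>2 \<and> rep_iso GL2 (\<tau> i) (Ind_B2 (tensor_char \<xi>\<^sub>1 \<xi>\<^sub>2)) \<and>
            (T2_eq (tensor_char \<xi>\<^sub>1 \<xi>\<^sub>2)
                  (\<lambda>t. dual_twist \<eta> (central_char (\<tau> j)) (central_char (\<tau> l)) t * delta_B2_pow (-1/2) t) \<or>
             T2_eq (tensor_char \<xi>\<^sub>1 \<xi>\<^sub>2)
                  (\<lambda>t. dual_twist \<eta> (central_char (\<tau> l)) (central_char (\<tau> j)) t * delta_B2_pow (1/2) t))))"
    if h: "i \<in> {1,2,3}" "{j, l} = {1,2,3} - {i} \<and> j < l" for i j l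
  proof -
    have jl: "j \<in> {1,2,3}" "l \<in> {1,2,3}" using h by blast+
    interpret irred_gl2 "\<tau> i" by (rule irr[OF h(1)])
    define d where "d m x = \<eta> x * inverse (central_char (\<tau> m) x)" for m x
    have d: "is_character (d m)" if "m \<in> {1,2,3}" for m
      unfolding d_def[abs_def]
      by (intro is_character_mult assms(1) is_character_inverse irred_gl2.is_character_central_char irr that)
    have \<mu>: "dual_twist \<eta> (central_char (\<tau> m)) (central_char (\<tau> n)) (mk x 0 0 y) = d m x * d n y"
      if "x \<noteq> 0" "y \<noteq> 0" for m n x y
      using character_mult[OF assms(1) that] by (simp add: dual_twist_def tensor_char_def d_def)
    from jacquet_hom_iff[OF \<mu> d[OF jl(1)] d[OF jl(2)]] eigenfunctional_iff[OF d[OF jl(1)] d[OF jl(2)] \<mu> \<mu>]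
    show ?thesis by blast
  qed
  show ?thesis unfolding good_def by (rule distribute_conditions) (rule key)
qed

end
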